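(* Let $L$ be a finite group, $w\in\mathbb Z_{\ge0}$, and let $\mathcal X$ be a rationally closed subgroup of $\mathcal C(L)$. Suppose that $\xi\in\mathcal C(L\wr S_w)$ satisfies $\omega_\lambda(\xi)\in\mathcal X^{\otimes l(\lambda)}$ for every partition $\lambda$ of $w$. Then $\xi\in\mathcal X\wr S_w$.
   Context: $\mathcal C(X)=\mathbb Z[\operatorname{Irr}(X)]$ is the group of virtual characters; a subgroup $B$ of an abelian group $A$ is rationally closed if $na\in B$ with $a\in A$, $n\in\mathbb Z\setminus\{0\}$ implies $a\in B$. Elements of $L\wr S_w$ are $(x_1,\dots,x_w;\sigma)$ with multiplication $(x;\sigma)(y;\tau)=(x_1y_{\sigma^{-1}(1)},\dots,x_wy_{\sigma^{-1}(w)};\sigma\tau)$. A marked cycle in $S_w$ is a non-identity cycle or a singleton $j\in[1,w]$ (acting trivially), with order = size of its support; for a marked cycle $\sigma$ with least support point $i$, $y_\sigma(x)=(1,\dots,x,\dots,1;\sigma)$ with $x$ in position $i$. For a partition (or composition) $\lambda=(\lambda_1,\dots,\lambda_r)$ of $w$, $l(\lambda)=r$, and $\omega_\lambda(\xi)$ is the class function on $L^{\times r}$ given by $(x_1,\dots,x_r)\mapsto\xi(y_{\sigma_1}(x_1)\cdots y_{\sigma_r}(x_r))$ where $\sigma_1,\dots,\sigma_r$ are disjoint marked cycles of orders $\lambda_1,\dots,\lambda_r$; class functions on $L^{\times r}$ are identified with $\operatorname{CF}(L)^{\otimes r}$, so $\mathcal X^{\otimes r}\subseteq\mathcal C(L^{\times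 r})$. For a class function $\phi$ on $L$, $\phi^{\tilde\times m}$ is the class function on $L\wr S_m$ with value $\phi(x_1)\cdots\phi(x_r)$ on $y_{\sigma_1}(x_1)\cdots y_{\sigma_r}(x_r)$ whenever the supports of the $\sigma_j$ partition $[1,m]$ (every element is conjugate to such a product). For a tuple $\Theta=((\phi_1,\chi_1),\dots,(\phi_s,\chi_s))$ with $\phi_i$ class functions on $L$ and $\chi_i\in\mathcal C(S_{w_i})$, $\sum w_i=w$, set $\zeta_\Theta=\operatorname{Ind}^{L\wr S_w}_{\prod_i L\wr S_{w_i}}\prod_i(\phi_i^{\tilde\times w_i}\operatorname{Inf}^{L\wr S_{w_i}}_{S_{w_i}}\chi_i)$, with $\prod S_{w_i}$ a Young subgroup. $\mathcal X\wr S_w$ is the $\mathbb Z$-span of all $\zeta_\Theta$ with all $\phi_i\in\mathcal X$. *)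

theory Defs
  imports "HOL-Algebra.Group" "HOL-Algebra.Sym_Groups" "HOL-Combinatorics.Cycles"
    "Jordan_Normal_Form.Matrix"
begin

definition is_rep :: "('g, 'b) monoid_scheme \<Rightarrow> nat \<Rightarrow> ('g \<Rightarrow> complex mat) \<Rightarrow> bool" where
  "is_rep G n \<rho> \<longleftrightarrow>
     (\<forall>g\<in>carrier G. \<rho> g \<in> carrier_mat n n) \<and> \<rho> \<one>\<^bsub>G\<^esub> = 1\<^sub>m n \<and>
     (\<forall>g\<in>carrier G. \<forall>h\<in>carrier G. \<rho> (g \<otimes>\<^bsub>G\<^esub> h) = \<rho> g * \<rho> h)"

definition is_subspace :: "nat \<Rightarrow> complex vec set \<Rightarrow> bool" where
  "is_subspace n W \<longleftrightarrow> W \<subseteq> carrier_vec n \<and> 0\<^sub>v n \<in> W \<and>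
     (\<forall>u\<in>W. \<forall>v\<in>W. u + v \<in> W) \<and> (\<forall>c::complex. \<forall>v\<in>W. c \<cdot>\<^sub>v v \<in> W)"

definition is_irr_rep :: "('g, 'b) monoid_scheme \<Rightarrow> nat \<Rightarrow> ('g \<Rightarrow> complex mat) \<Rightarrow> bool" where
  "is_irr_rep G n \<rho> \<longleftrightarrow> is_rep G n \<rho> \<and> n > 0 \<and>
     \<not> (\<exists>W. is_subspace n W \<and> W \<noteq> {0\<^sub>v n} \<and> W \<noteq> carrier_vec n \<and>
            (\<forall>g\<in>carrier G. \<forall>v\<in>W. \<rho> g *\<^sub>v v \<in> W))"

definition char_of :: "('g, 'b) monoid_scheme \<Rightarrow> nat \<Rightarrow> ('g \<Rightarrow> complex mat) \<Rightarrow> 'g \<Rightarrow> complex" where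
  "char_of G n \<rho> = (\<lambda>g. if g \<in> carrier G then (\<Sum>i<n. \<rho> g $$ (i, i)) else 0)"

definition irr_chars :: "('g, 'b) monoid_scheme \<Rightarrow> ('g \<Rightarrow> complex) set" where
  "irr_chars G = {char_of G n \<rho> | n \<rho>. is_irr_rep G n \<rho>}"

definition int_span :: "('x \<Rightarrow> complex) set \<Rightarrow> ('x \<Rightarrow> complex) set" where
  "int_span S = {f. \<exists>F c. finite F \<and> F \<subseteq> S \<and>
                      f = (\<lambda>x. \<Sum>\<chi>\<in>F. of_int (c \<chi>) * \<chi> x)}"

definition vchars :: "('g, 'b) monoid_scheme \<Rightarrow> ('g \<Rightarrow> complex) set" where
  "vchars G = int_span (irr_chars G)"

definition rat_closed_subgroup :: "('x \<Rightarrow> complex) set \<Rightarrow> ('x \<Rightarrow> complex) set \<Rightarrow> bool" where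
  "rat_closed_subgroup A B \<longleftrightarrow> B \<subseteq> A \<and> (\<lambda>_. 0) \<in> B \<and>
     (\<forall>a\<in>B. \<forall>b\<in>B. (\<lambda>x. a x + b x) \<in> B) \<and> (\<forall>a\<in>B. (\<lambda>x. - a x) \<in> B) \<and>
     (\<forall>a\<in>A. \<forall>n::int. n \<noteq> 0 \<and> (\<lambda>x. of_int n * a x) \<in> B \<longrightarrow> a \<in> B)"

definition induce :: "('g, 'b) monoid_scheme \<Rightarrow> 'g set \<Rightarrow> ('g \<Rightarrow> complex) \<Rightarrow> 'g \<Rightarrow> complex" where
  "induce G H \<psi> = (\<lambda>g. if g \<in> carrier G then
      (1 / of_nat (card H)) * (\<Sum>x\<in>carrier G.
          if x \<otimes>\<^bsub>G\<^esub> g \<otimes>\<^bsub>G\<^esub> inv\<^bsub>G\<^esub> x \<in> H then \<psi> (x \<otimes>\<^bsub>G\<^esub> g \<otimes>\<^bsub>G\<^esub> inv\<^bsub>G\<^esub> x) else 0)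
      else 0)"

text \<open>Elements (x_1,...,x_w; sigma) of L wr S_w are pairs (x, sigma) with x a function on
  [1,w] (equal to 1 outside) and sigma a permutation of [1,w].\<close>
type_synonym 'a wr = "(nat \<Rightarrow> 'a) \<times> (nat \<Rightarrow> nat)"

definition wreath :: "('a, 'b) monoid_scheme \<Rightarrow> nat \<Rightarrow> 'a wr monoid" where
  "wreath L w = \<lparr> carrier = {(x, \<sigma>). (\<forall>i\<in>{1..w}. x i \<in> carrier L) \<and>
                                     (\<forall>i. i \<notin> {1..w} \<longrightarrow> x i = \<one>\<^bsub>L\<^esub>) \<and> \<sigma> permutes {1..w}},
     mult = (\<lambda>(x, \<sigma>) (y, \<tau>). (\<lambda>i. x i \<otimes>\<^bsub>L\<^esub> y (Hilbert_Choice.inv \<sigma> i), \<sigma> \<circ> \<tau>)),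
     one = (\<lambda>_. \<one>\<^bsub>L\<^esub>, id) \<rparr>"

text \<open>Marked cycles are given by lists of distinct elements of [1,w] in cycle notation
  (a singleton list is a marked fixed point). Its support is the set of the list, its order
  the length.  y_sigma(x) has x in the position of the least support point.\<close>
definition ycyc :: "('a, 'b) monoid_scheme \<Rightarrow> nat list \<Rightarrow> 'a \<Rightarrow> 'a wr" where
  "ycyc L cs x = ((\<lambda>i. if i = Min (set cs) then x else \<one>\<^bsub>L\<^esub>), cycle_of_list cs)"

definition wr_prod :: "('a, 'b) monoid_scheme \<Rightarrow> nat \<Rightarrow> 'a wr list \<Rightarrow> 'a wr" where
  "wr_prod L w gs = foldr (\<lambda>g h. g \<otimes>\<^bsub>wreath L w\<^esub> h) gs \<one>\<^bsub>wreath L w\<^esub>"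

definition marked_decomp :: "nat \<Rightarrow> nat list list \<Rightarrow> bool" where
  "marked_decomp m cs \<longleftrightarrow> (\<forall>c\<in>set cs. c \<noteq> [] \<and> distinct c) \<and>
     (\<forall>i<length cs. \<forall>j<length cs. i \<noteq> j \<longrightarrow> set (cs ! i) \<inter> set (cs ! j) = {}) \<and>
     (\<Union>c\<in>set cs. set c) = {1..m}"

text \<open>phi^{~x m}: the class function on L wr S_m with value phi(x_1)...phi(x_r) on
  y_{sigma_1}(x_1)...y_{sigma_r}(x_r) (supports of the sigma_j partitioning [1,m]),
  extended to all elements by conjugation.\<close>
definition tilde_pow :: "('a, 'b) monoid_scheme \<Rightarrow> ('a \<Rightarrow> complex) \<Rightarrow> nat \<Rightarrow> 'a wr \<Rightarrow> complex" where
  "tilde_pow L \<phi> m = (\<lambda>g. if g \<in> carrier (wreath L m) then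
      (SOME v. \<exists>cs xs h. marked_decomp m cs \<and> length xs = length cs \<and> set xs \<subseteq> carrier L \<and>
         h \<in> carrier (wreath L m) \<and>
         g = h \<otimes>\<^bsub>wreath L m\<^esub> wr_prod L m (map2 (ycyc L) cs xs) \<otimes>\<^bsub>wreath L m\<^esub> inv\<^bsub>wreath L m\<^esub> h \<and>
         v = (\<Prod>j<length xs. \<phi> (xs ! j)))
      else 0)"

definition inflate :: "((nat \<Rightarrow> nat) \<Rightarrow> complex) \<Rightarrow> 'a wr \<Rightarrow> complex" where
  "inflate \<chi> = (\<lambda>(x, \<sigma>). \<chi> \<sigma>)"

definition offs :: "nat list \<Rightarrow> nat \<Rightarrow> nat" where
  "offs ws i = sum_list (take i ws)"

definition block :: "nat list \<Rightarrow> nat \<Rightarrow> nat set" where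
  "block ws i = {offs ws i + 1 .. offs ws i + ws ! i}"

text \<open>The subgroup prod_i L wr S_{w_i} of L wr S_w.\<close>
definition young_wr :: "('a, 'b) monoid_scheme \<Rightarrow> nat list \<Rightarrow> 'a wr set" where
  "young_wr L ws = {(x, \<sigma>) \<in> carrier (wreath L (sum_list ws)).
                     \<forall>i<length ws. \<sigma> ` block ws i = block ws i}"

definition young_comp :: "('a, 'b) monoid_scheme \<Rightarrow> nat list \<Rightarrow> nat \<Rightarrow> 'a wr \<Rightarrow> 'a wr" where
  "young_comp L ws i = (\<lambda>(x, \<sigma>).
     ((\<lambda>j. if j \<in> {1..ws ! i} then x (offs ws i + j) else \<one>\<^bsub>L\<^esub>),
      (\<lambda>j. if j \<in> {1..ws ! i} then \<sigma> (offs ws i + j) - offs ws i else j)))"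

text \<open>zeta_Theta for Theta = ((phi_1,chi_1),...,(phi_s,chi_s)) with w_i given explicitly:
  Theta is a list of triples (phi_i, w_i, chi_i).\<close>
definition zeta :: "('a, 'b) monoid_scheme
     \<Rightarrow> (('a \<Rightarrow> complex) \<times> nat \<times> ((nat \<Rightarrow> nat) \<Rightarrow> complex)) list \<Rightarrow> 'a wr \<Rightarrow> complex" where
  "zeta L \<Theta> = (let ws = map (\<lambda>(\<phi>, m, \<chi>). m) \<Theta> in
     induce (wreath L (sum_list ws)) (young_wr L ws)
       (\<lambda>g. \<Prod>i<length \<Theta>. (case \<Theta> ! i of (\<phi>, m, \<chi>) \<Rightarrow>
            tilde_pow L \<phi> m (young_comp L ws i g) * inflate \<chi> (young_comp L ws i g))))"

definition wr_span :: "('a, 'b) monoid_scheme \<Rightarrow> ('a \<Rightarrow> complex) set \<Rightarrow> nat \<Rightarrow> ('a wr \<Rightarrow> complex) set" where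
  "wr_span L X w = int_span {zeta L \<Theta> | \<Theta>.
      sum_list (map (\<lambda>(\<phi>, m, \<chi>). m) \<Theta>) = w \<and>
      (\<forall>(\<phi>, m, \<chi>) \<in> set \<Theta>. \<phi> \<in> X \<and> \<chi> \<in> vchars (sym_group m))}"

definition canon_cycles :: "nat list \<Rightarrow> nat list list" where
  "canon_cycles lam = map (\<lambda>j. [offs lam j + 1 ..< offs lam j + lam ! j + 1]) [0..<length lam]"

definition omega :: "('a, 'b) monoid_scheme \<Rightarrow> nat list \<Rightarrow> ('a wr \<Rightarrow> complex) \<Rightarrow> 'a list \<Rightarrow> complex" where
  "omega L lam \<xi> = (\<lambda>xs. \<xi> (wr_prod L (sum_list lam) (map2 (ycyc L) (canon_cycles lam) xs)))"

text \<open>f lies in X^{(x) r} (viewed inside the class functions on L^{x r}): f agrees on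
  L^{x r} with a Z-linear combination of functions (x_1..x_r) |-> phi_1(x_1)...phi_r(x_r),
  phi_j in X.\<close>
definition in_tensor_pow :: "('a, 'b) monoid_scheme \<Rightarrow> ('a \<Rightarrow> complex) set \<Rightarrow> nat \<Rightarrow> ('a list \<Rightarrow> complex) \<Rightarrow> bool" where
  "in_tensor_pow L X r f \<longleftrightarrow> (\<exists>F c. finite F \<and>
      (\<forall>\<phi>s\<in>F. length \<phi>s = r \<and> set \<phi>s \<subseteq> X) \<and>
      (\<forall>xs. length xs = r \<and> set xs \<subseteq> carrier L \<longrightarrow>
         f xs = (\<Sum>\<phi>s\<in>F. of_int (c \<phi>s) * (\<Prod>j<r. (\<phi>s ! j) (xs ! j)))))"

definition is_partition :: "nat \<Rightarrow> nat list \<Rightarrow> bool" where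
  "is_partition w lam \<longleftrightarrow> (\<forall>k\<in>set lam. k > 0) \<and> sum_list lam = w \<and> sorted_wrt (\<ge>) lam"

end

theory Submission
  imports Defs "Jordan_Normal_Form.Spectral_Radius"
begin

text \<open>
  A virtual character \<open>\<xi>\<close> of \<open>L wr S_w\<close> is recovered from its values on products of marked cycles. For the
  irreducible characters \<open>\<chi>_i\<close> of \<open>L\<close> and a colouring \<open>c\<close> of \<open>[1,w]\<close> by their indices, a product over
  the positions of primitive idempotents \<open>\<epsilon>_i\<close> of the group algebra of \<open>L\<close> cuts out of a
  representation of \<open>L wr S_w\<close> a representation of the Young subgroup of \<open>c\<close>. Its character
  \<open>\<Psi>(c,\<sigma>) = \<Sum>x. (\<Prod>p. \<epsilon>_{c p}(x_p)) \<xi>(x,\<sigma>)\<close> is a sum of products of characters of symmetric groups.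
  Since \<open>\<epsilon>_i\<close> is idempotent under convolution, \<open>\<Psi>(c,\<sigma>)\<close> is also the coefficient of the tensor product of
  the \<open>\<chi>_{c(j)}\<close>, \<open>j\<close> running over the cycles of \<open>\<sigma>\<close>, in \<open>\<omega>_\<lambda>(\<xi>)\<close>. A rationally closed
  subgroup \<open>X\<close> has a retraction \<open>\<pi>\<close> from the virtual characters of \<open>L\<close> onto \<open>X\<close>, and applying
  \<open>\<pi>\<close> in every tensor factor fixes \<open>\<omega>_\<lambda>(\<xi>)\<close>. Hence \<open>\<xi>\<close> is the sum over the compositions of \<open>w\<close> of the
  characters induced from the functions \<open>\<Prod>i. \<pi>(\<chi>_i)^~ \<Psi>\<close> on Young subgroups.
\<close>

section \<open>Idempotent matrices and composition series\<close>

text \<open>Passing from \<open>\<phi>\<close> to \<open>tilde_pow L \<phi> m\<close> is not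
  additive, so \<open>\<xi>\<close> cannot be rewritten by expanding characters inside tilde powers.
  The sum over colourings takes the place of such an expansion: an induced function becomes a sum
  over the colourings fixed by \<sigma>, in which each cycle carries one value of some
  \<pi>(\<chi>_i), and the distributive law applies cycle by cycle.

  Integrality is the delicate point. The \<epsilon>_i are primitive idempotents, matrix units at (0,
  0), and not the central ones: the pairing with \<chi>_i is then 1 and not the degree.
  \<open>Psi\<close> is a character because the product of the \<epsilon>'s commutes with all
  permutations preserving the colours, so that its image is an honest representation of a product of
  symmetric groups.

  Rational closure enters only through the retraction: it makes \<open>X\<close> a pure sublattice
  of a free abelian group of finite rank, and such a sublattice is a direct summand. The
  \<pi>(\<chi>_i) lie in \<open>X\<close>, while the \<chi>_i themselves may not.\<close>

definition mtrace :: "complex mat \<Rightarrow> complex" where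
  "mtrace A = (\<Sum>i<dim_row A. A $$ (i, i))"

lemma mtrace_comm:
  assumes "A \<in> carrier_mat n m" "B \<in> carrier_mat m n"
  shows "mtrace (A * B) = mtrace (B * A)"
proof -
  have "mtrace (A * B) = (\<Sum>i<n. \<Sum>j<m. A $$ (i, j) * B $$ (j, i))"
    using assms by (auto simp: mtrace_def scalar_prod_def lessThan_atLeast0 intro!: sum.cong)
  also have "\<dots> = (\<Sum>j<m. \<Sum>i<n. B $$ (j, i) * A $$ (i, j))"
    by (subst sum.swap) (simp add: mult.commute)
  also have "\<dots> = mtrace (B * A)"
    using assms by (auto simp: mtrace_def scalar_prod_def lessThan_atLeast0 intro!: sum.cong)
  finally show ?thesis .
qed

lemma mtrace_diff:
  assumes "A \<in> carrier_mat n n" "B \<in> carrier_mat n n"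
  shows "mtrace (A - B) = mtrace A - mtrace B"
  using assms by (simp add: mtrace_def sum_subtractf)

lemma mtrace_one [simp]: "mtrace (1\<^sub>m n) = of_nat n"
  by (simp add: mtrace_def)

lemma char_of_mtrace:
  assumes "is_rep G n \<rho>" "g \<in> carrier G"
  shows "char_of G n \<rho> g = mtrace (\<rho> g)"
  using assms by (auto simp: char_of_def mtrace_def is_rep_def)

text \<open>The side conditions are equations between dimensions, which simplification can settle
  without being told the sizes of intermediate products.\<close>

lemma mult_mat_assoc_dim:
  assumes "dim_col A = dim_row B" "dim_col B = dim_row C"
  shows "A * B * C = A * (B * (C :: complex mat))"
proof -
  have "A \<in> carrier_mat (dim_row A) (dim_col A)" by auto
  moreover have "B \<in> carrier_mat (dim_col A) (dim_col B)" using assms unfolding carrier_mat_def by auto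
  moreover have "C \<in> carrier_mat (dim_col B) (dim_col C)" using assms unfolding carrier_mat_def by auto
  ultimately show ?thesis by (rule assoc_mult_mat)
qed

text \<open>The columns of \<open>C\<close> and the rows of \<open>D\<close> are dual families, so \<open>A \<mapsto> D * A * C\<close> compresses
  to the image of the idempotent \<open>C * D\<close>.\<close>

definition frame :: "nat \<Rightarrow> nat \<Rightarrow> complex mat \<Rightarrow> complex mat \<Rightarrow> bool" where
  "frame n r C D \<longleftrightarrow> C \<in> carrier_mat n r \<and> D \<in> carrier_mat r n \<and> D * C = 1\<^sub>m r"

text \<open>If \<open>n < r\<close>, padding \<open>C\<close> by zero rows and \<open>D\<close> by
  zero columns gives square matrices with \<open>D' * C' = 1\<close>. A one-sided inverse of a
  square matrix is two-sided, but the last row of \<open>C'\<close> is zero.\<close>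

lemma frame_le:
  assumes "frame n r C D"
  shows "r \<le> n"
proof (rule ccontr)
  assume "\<not> r \<le> n"
  then have rn: "n < r" by simp
  define C' where "C' = mat r r (\<lambda>(i, j). if i < n then C $$ (i, j) else 0)"
  define D' where "D' = mat r r (\<lambda>(i, j). if j < n then D $$ (i, j) else 0)"
  note f = assms[unfolded frame_def]
  have "D' * C' = 1\<^sub>m r"
  proof (rule eq_matI)
    fix i j assume ij: "i < dim_row (1\<^sub>m r :: complex mat)" "j < dim_col (1\<^sub>m r :: complex mat)"
    have "(D' * C') $$ (i, j) = (\<Sum>k<r. D' $$ (i, k) * C' $$ (k, j))"
      using ij by (simp add: C'_def D'_def scalar_prod_def lessThan_atLeast0)
    also have "\<dots> = (\<Sum>k<n. D $$ (i, k) * C $$ (k, j))"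
      using ij rn by (intro sum.mono_neutral_cong_right) (auto simp: C'_def D'_def)
    also have "\<dots> = (D * C) $$ (i, j)"
      using ij f[THEN conjunct1] f[THEN conjunct2, THEN conjunct1]
      by (auto simp: scalar_prod_def lessThan_atLeast0)
    finally show "(D' * C') $$ (i, j) = 1\<^sub>m r $$ (i, j)" using f by simp
  qed (auto simp: C'_def D'_def)
  then have "C' * D' = 1\<^sub>m r"
    by (rule mat_mult_left_right_inverse[rotated 2]) (auto simp: C'_def D'_def)
  moreover have "(C' * D') $$ (r - 1, r - 1) = 0"
    using rn by (simp add: C'_def D'_def scalar_prod_def)
  ultimately show False using rn by simp
qed

text \<open>A frame of greatest size among those with columns in \<open>W\<close> does the work of a
  basis together with its dual basis: a vector of \<open>W\<close> not fixed by \<open>C * D\<close>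
  would supply one more column.\<close>

lemma subspace_frame:
  assumes W: "is_subspace n W"
  obtains r C D where "frame n r C D" "\<And>u. u \<in> carrier_vec r \<Longrightarrow> C *\<^sub>v u \<in> W"
    "\<And>v. v \<in> W \<Longrightarrow> C *\<^sub>v (D *\<^sub>v v) = v"
proof -
  let ?P = "\<lambda>r. \<exists>C D. frame n r C D \<and> (\<forall>u\<in>carrier_vec r. C *\<^sub>v u \<in> W)"
  have P0: "?P 0"
    using W by (intro exI[of _ "0\<^sub>m n 0"] exI[of _ "0\<^sub>m 0 n"])
      (auto simp: frame_def is_subspace_def mult_mat_vec_def scalar_prod_def zero_vec_def)
  have bd: "\<forall>r. ?P r \<longrightarrow> r \<le> n" using frame_le by blast
  define r where "r = (GREATEST r. ?P r)"
  have "?P r" unfolding r_def using GreatestI_nat[of ?P, OF P0] bd by blast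
  then obtain C D where fr: "frame n r C D" and CW: "\<And>u. u \<in> carrier_vec r \<Longrightarrow> C *\<^sub>v u \<in> W"
    by blast
  have max: "\<not> ?P (r + 1)"
    using Greatest_le_nat[of ?P "r + 1" n] bd unfolding r_def by fastforce
  note f = fr[unfolded frame_def]
  have C: "C \<in> carrier_mat n r" and D: "D \<in> carrier_mat r n" and DC: "D * C = 1\<^sub>m r" using f by auto
  have "C *\<^sub>v (D *\<^sub>v v) = v" if v: "v \<in> W" for v
  proof (rule ccontr)
    assume ne: "C *\<^sub>v (D *\<^sub>v v) \<noteq> v"
    have vn: "v \<in> carrier_vec n" using v W by (auto simp: is_subspace_def)
    \<comment> \<open>The component of \<open>v\<close> missed by the columns of \<open>C\<close>.
      It stays in \<open>W\<close> and is killed by \<open>D\<close>.\<close>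
    define v' where "v' = v + (-1) \<cdot>\<^sub>v (C *\<^sub>v (D *\<^sub>v v))"
    have CDv: "C *\<^sub>v (D *\<^sub>v v) \<in> W" using CW D vn by auto
    then have v'W: "v' \<in> W" unfolding v'_def using W v by (auto simp: is_subspace_def)
    have v'n: "v' \<in> carrier_vec n" using v'W W by (auto simp: is_subspace_def)
    have Dv': "D *\<^sub>v v' = 0\<^sub>v r"
    proof -
      have "D *\<^sub>v (C *\<^sub>v (D *\<^sub>v v)) = (D * C) *\<^sub>v (D *\<^sub>v v)"
        using C D vn by (subst assoc_mult_mat_vec[of D r n C r]) auto
      also have "\<dots> = D *\<^sub>v v" using DC D vn by auto
      finally have "D *\<^sub>v (C *\<^sub>v (D *\<^sub>v v)) = D *\<^sub>v v" .
      then show ?thesis unfolding v'_def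
        using C D vn by (subst mult_add_distrib_mat_vec[of D r n]) (auto simp: mult_mat_vec[of D r n])
    qed
    have "v' \<noteq> 0\<^sub>v n"
    proof
      assume "v' = 0\<^sub>v n"
      then have "\<And>i. i < n \<Longrightarrow> v $ i = (C *\<^sub>v (D *\<^sub>v v)) $ i"
        unfolding v'_def using C vn by (auto simp: vec_eq_iff)
      then have "v = C *\<^sub>v (D *\<^sub>v v)" using vn C by (intro eq_vecI) auto
      then show False using ne by simp
    qed
    then obtain i0 where i0: "i0 < n" "v' $ i0 \<noteq> 0" using v'n by (auto simp: vec_eq_iff)
    define V where "V = mat n 1 (\<lambda>(i, j). v' $ i)"
    \<comment> \<open>\<open>F0\<close> is a coordinate functional scaled to take the value 1 at
      \<open>v'\<close>. Subtracting \<open>F0 * C * D\<close> makes it vanish on the columns of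
      \<open>C\<close> and does not change its value at \<open>v'\<close>, because \<open>D\<close>
      kills \<open>v'\<close>.\<close>
    define F0 where "F0 = mat 1 n (\<lambda>(i, j). if j = i0 then 1 / v' $ i0 else 0)"
    define F where "F = F0 - F0 * C * D"
    have V: "V \<in> carrier_mat n 1" and F0: "F0 \<in> carrier_mat 1 n" and F: "F \<in> carrier_mat 1 n"
      using C D by (auto simp: V_def F0_def F_def)
    have DV: "D * V = 0\<^sub>m r 1"
    proof (rule eq_matI)
      fix i j assume ij: "i < dim_row (0\<^sub>m r 1 :: complex mat)" "j < dim_col (0\<^sub>m r 1 :: complex mat)"
      have "(D * V) $$ (i, j) = (D *\<^sub>v v') $ i"
        using ij D v'n by (auto simp: V_def scalar_prod_def)
      then show "(D * V) $$ (i, j) = 0\<^sub>m r 1 $$ (i, j)" using Dv' ij by simp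
    qed (use D V in auto)
    have F0V: "F0 * V = 1\<^sub>m 1"
    proof (rule eq_matI)
      fix i j assume "i < dim_row (1\<^sub>m 1 :: complex mat)" "j < dim_col (1\<^sub>m 1 :: complex mat)"
      then show "(F0 * V) $$ (i, j) = 1\<^sub>m 1 $$ (i, j)"
        using i0 by (simp add: F0_def V_def scalar_prod_def if_distrib[of "\<lambda>x. x * _"] cong: if_cong)
    qed (auto simp: F0_def V_def)
    have FV: "F * V = 1\<^sub>m 1"
    proof -
      have "F0 * C * D * V = F0 * C * (D * V)" using F0 C D V by (intro assoc_mult_mat) auto
      then have "F0 * C * D * V = 0\<^sub>m 1 1" using DV F0 C by simp
      moreover have "F * V = F0 * V - F0 * C * D * V"
        unfolding F_def using F0 C D V by (intro minus_mult_distrib_mat) auto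
      ultimately show ?thesis using F0V by auto
    qed
    have FC: "F * C = 0\<^sub>m 1 r"
    proof -
      have "F0 * C * D * C = F0 * C * (D * C)" using F0 C D by (intro assoc_mult_mat) auto
      then have "F0 * C * D * C = F0 * C" using DC F0 C by simp
      moreover have "F * C = F0 * C - F0 * C * D * C"
        unfolding F_def using F0 C D by (intro minus_mult_distrib_mat) auto
      ultimately show ?thesis using F0 C by auto
    qed
    \<comment> \<open>Blocks without rows or without columns let \<open>[C V]\<close> and
      \<open>D\<close> stacked on \<open>F\<close> be treated as four-block matrices, so that their
      product is computed blockwise.\<close>
    define C' where "C' = four_block_mat C V (0\<^sub>m 0 r) (0\<^sub>m 0 1)"
    define D' where "D' = four_block_mat D (0\<^sub>m r 0) F (0\<^sub>m 1 0)"
    have C': "C' \<in> carrier_mat n (r + 1)" and D': "D' \<in> carrier_mat (r + 1) n"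
      using C D V F four_block_carrier_mat[of C n r "0\<^sub>m 0 1" 0 1 V "0\<^sub>m 0 r"]
        four_block_carrier_mat[of D r n "0\<^sub>m 1 0" 1 0 "0\<^sub>m r 0" F] by (auto simp: C'_def D'_def)
    have "D' * C' = four_block_mat (D * C + 0\<^sub>m r 0 * 0\<^sub>m 0 r) (D * V + 0\<^sub>m r 0 * 0\<^sub>m 0 1)
        (F * C + 0\<^sub>m 1 0 * 0\<^sub>m 0 r) (F * V + 0\<^sub>m 1 0 * 0\<^sub>m 0 1)"
      unfolding D'_def C'_def using C D V F by (intro mult_four_block_mat) auto
    also have "\<dots> = four_block_mat (1\<^sub>m r) (0\<^sub>m r 1) (0\<^sub>m 1 r) (1\<^sub>m 1)"
      using DC DV FC FV by simp
    finally have "D' * C' = 1\<^sub>m (r + 1)" by simp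
    then have "frame n (r + 1) C' D'" using C' D' by (simp add: frame_def)
    moreover have "C' *\<^sub>v u \<in> W" if u: "u \<in> carrier_vec (r + 1)" for u
    proof -
      define u1 where "u1 = vec_first u r"
      have u1: "u1 \<in> carrier_vec r" by (simp add: u1_def)
      have "C' *\<^sub>v u = C *\<^sub>v u1 + u $ r \<cdot>\<^sub>v v'"
      proof (rule eq_vecI)
        fix i assume "i < dim_vec (C *\<^sub>v u1 + u $ r \<cdot>\<^sub>v v')"
        then have i: "i < n" using v'n by simp
        have "(C' *\<^sub>v u) $ i = (\<Sum>k<r + 1. C' $$ (i, k) * u $ k)"
          using C' u i by (auto simp: scalar_prod_def lessThan_atLeast0)
        also have "\<dots> = (\<Sum>k<r. C $$ (i, k) * u1 $ k) + v' $ i * u $ r"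
          using C V u i by (auto simp: C'_def u1_def vec_first_def V_def intro!: sum.cong)
        also have "\<dots> = (C *\<^sub>v u1 + u $ r \<cdot>\<^sub>v v') $ i"
          using C v'n i u1 by (auto simp: scalar_prod_def lessThan_atLeast0)
        finally show "(C' *\<^sub>v u) $ i = (C *\<^sub>v u1 + u $ r \<cdot>\<^sub>v v') $ i" .
      qed (use C' v'n in auto)
      then show ?thesis using CW[OF u1] v'W W by (auto simp: is_subspace_def)
    qed
    ultimately show False using max by blast
  qed
  then show ?thesis using that fr CW by blast
qed

text \<open>The fixed space of an idempotent is its image, so a frame of this space factors
  \<open>Q\<close>. The strict bound on \<open>r\<close> drives the inductions on the
  degree.\<close>

lemma idem_frame:
  assumes Q: "Q \<in> carrier_mat n n" and QQ: "Q * Q = Q"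
  obtains r C D where "frame n r C D" "C * D = Q" "Q \<noteq> 1\<^sub>m n \<Longrightarrow> r < n"
proof -
  define W where "W = {v \<in> carrier_vec n. Q *\<^sub>v v = v}"
  have "is_subspace n W"
    using Q unfolding is_subspace_def W_def
    by (auto simp: mult_add_distrib_mat_vec[of Q n n] mult_mat_vec[of Q n n])
  from subspace_frame[OF this] obtain r C D0 where
    fr: "frame n r C D0" and CW: "\<And>u. u \<in> carrier_vec r \<Longrightarrow> C *\<^sub>v u \<in> W"
    and id: "\<And>v. v \<in> W \<Longrightarrow> C *\<^sub>v (D0 *\<^sub>v v) = v" by metis
  have C: "C \<in> carrier_mat n r" and D0: "D0 \<in> carrier_mat r n" and D0C: "D0 * C = 1\<^sub>m r"
    using fr by (auto simp: frame_def)
  have mateq: "A = B" if "A \<in> carrier_mat n k" "B \<in> carrier_mat n k"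
    "\<And>u. u \<in> carrier_vec k \<Longrightarrow> A *\<^sub>v u = B *\<^sub>v u" for A B :: "complex mat" and k
  proof (rule eq_matI)
    fix i j assume ij: "i < dim_row B" "j < dim_col B"
    then have "(A *\<^sub>v unit_vec k j) $ i = (B *\<^sub>v unit_vec k j) $ i" using that by simp
    then show "A $$ (i, j) = B $$ (i, j)" using that(1,2) ij by simp
  qed (use that in auto)
  have QC: "Q * C = C"
    using Q C CW by (intro mateq[of _ r]) (auto simp: W_def assoc_mult_mat_vec[of Q n n C r])
  \<comment> \<open>\<open>C * D0\<close> is known to be the identity only on the fixed space.
    Precomposing with \<open>Q\<close> sends every vector there first, which gives
    \<open>C * D = Q\<close>.\<close>
  define D where "D = D0 * Q"
  have D: "D \<in> carrier_mat r n" using D0 Q by (simp add: D_def)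
  have DC: "D * C = 1\<^sub>m r" unfolding D_def using D0 Q C QC D0C by simp
  have CD: "C * D = Q"
  proof (rule mateq[of _ n])
    fix u :: "complex vec" assume u: "u \<in> carrier_vec n"
    have "Q *\<^sub>v (Q *\<^sub>v u) = Q *\<^sub>v u" using Q u QQ assoc_mult_mat_vec[of Q n n Q n u] by simp
    then have "Q *\<^sub>v u \<in> W" using Q u by (auto simp: W_def)
    then have "C *\<^sub>v (D0 *\<^sub>v (Q *\<^sub>v u)) = Q *\<^sub>v u" by (rule id)
    moreover have "D *\<^sub>v u = D0 *\<^sub>v (Q *\<^sub>v u)" unfolding D_def using D0 Q u by (rule assoc_mult_mat_vec)
    moreover have "C * D *\<^sub>v u = C *\<^sub>v (D *\<^sub>v u)" using C D u by (rule assoc_mult_mat_vec)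
    ultimately show "C * D *\<^sub>v u = Q *\<^sub>v u" by simp
  qed (use C D Q in auto)
  have "r < n" if "Q \<noteq> 1\<^sub>m n"
  proof -
    have "r \<noteq> n"
    proof
      assume "r = n"
      then have "C * D = 1\<^sub>m n" using mat_mult_left_right_inverse[of D n C] C D DC by simp
      then show False using that CD by simp
    qed
    then show ?thesis using frame_le[OF fr] by simp
  qed
  then show ?thesis using that[of r C D] C D DC CD by (auto simp: frame_def)
qed

lemma idem_compl:
  assumes Q: "Q \<in> carrier_mat n n" and QQ: "Q * Q = (Q :: complex mat)"
  shows "(1\<^sub>m n - Q) * (1\<^sub>m n - Q) = 1\<^sub>m n - Q"
proof -
  have "(1\<^sub>m n - Q) * (1\<^sub>m n - Q) = (1\<^sub>m n - Q) * 1\<^sub>m n - (1\<^sub>m n - Q) * Q"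
    using Q by (intro mult_minus_distrib_mat[of _ n n]) auto
  also have "(1\<^sub>m n - Q) * Q = 1\<^sub>m n * Q - Q * Q"
    using Q by (intro minus_mult_distrib_mat[of _ n n]) auto
  finally show ?thesis using Q QQ by (intro eq_matI) auto
qed

lemma compress_mult:
  assumes "frame n r C D" "C * D = Q" and A: "A \<in> carrier_mat n n" and B: "B \<in> carrier_mat n n"
    and inv: "Q * A * Q = Q * A \<or> Q * B * Q = B * Q"
  shows "(D * A * C) * (D * B * C) = D * (A * B) * C"
proof -
  have C: "C \<in> carrier_mat n r" and D: "D \<in> carrier_mat r n" and DC: "D * C = 1\<^sub>m r"
    and Q: "Q \<in> carrier_mat n n" using assms by (auto simp: frame_def)
  have DQ: "D * Q = D" and QC: "Q * C = C"
    using C D DC assms(2)[symmetric] assoc_mult_mat[of D r n C r D n] assoc_mult_mat[of C n r D n C r] by auto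
  note as = assoc_mult_mat[symmetric]
  have e1: "(D * A * C) * (D * B * C) = D * A * Q * B * C"
  proof -
    have "(D * A * C) * (D * B * C) = (D * A) * (C * (D * (B * C)))"
      using A B C D by (simp add: mult_mat_assoc_dim del: assoc_mult_mat)
    also have "C * (D * (B * C)) = Q * (B * C)"
      unfolding assms(2)[symmetric] using B C D by (intro assoc_mult_mat[symmetric]) auto
    finally show ?thesis using A B C D Q by (simp add: mult_mat_assoc_dim del: assoc_mult_mat)
  qed
  from inv show ?thesis
  proof
    assume h: "Q * A * Q = Q * A"
    have "D * A * Q = D * Q * A * Q" using DQ by simp
    also have "\<dots> = D * (Q * A * Q)" using A D Q by (simp add: mult_mat_assoc_dim del: assoc_mult_mat)
    also have "\<dots> = D * Q * A" unfolding h using A D Q by simp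
    finally have "D * A * Q = D * A" using DQ by simp
    then show ?thesis using e1 A B C D by simp
  next
    assume h: "Q * B * Q = B * Q"
    have "Q * B * C = Q * B * (Q * C)" using QC by simp
    also have "\<dots> = (Q * B * Q) * C" using B C Q by (simp add: mult_mat_assoc_dim del: assoc_mult_mat)
    also have "\<dots> = B * (Q * C)" unfolding h using B C Q by (simp add: mult_mat_assoc_dim del: assoc_mult_mat)
    finally have "Q * B * C = B * C" using QC by simp
    moreover have "D * A * Q * B * C = D * A * (Q * B * C)" using A B C D Q by (simp add: mult_mat_assoc_dim del: assoc_mult_mat)
    ultimately show ?thesis using e1 A B C D by (simp add: mult_mat_assoc_dim del: assoc_mult_mat)
  qed
qed

lemma compress_rep:
  assumes "is_rep G n \<rho>" "group G" "frame n r C D" "C * D = Q"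
    and "(\<forall>g\<in>carrier G. Q * \<rho> g * Q = Q * \<rho> g) \<or> (\<forall>g\<in>carrier G. Q * \<rho> g * Q = \<rho> g * Q)"
  shows "is_rep G r (\<lambda>g. D * \<rho> g * C)"
proof -
  interpret group G by fact
  show ?thesis
    unfolding is_rep_def
  proof (intro conjI ballI)
    show "D * \<rho> \<one>\<^bsub>G\<^esub> * C = 1\<^sub>m r" using assms by (auto simp: is_rep_def frame_def)
    fix g assume g: "g \<in> carrier G"
    show "D * \<rho> g * C \<in> carrier_mat r r" using assms g by (auto simp: is_rep_def frame_def)
    fix h assume h: "h \<in> carrier G"
    have "(D * \<rho> g * C) * (D * \<rho> h * C) = D * (\<rho> g * \<rho> h) * C"
      using assms g h by (intro compress_mult[of n r C D Q]) (auto simp: is_rep_def)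
    then show "D * \<rho> (g \<otimes>\<^bsub>G\<^esub> h) * C = (D * \<rho> g * C) * (D * \<rho> h * C)"
      using assms(1) g h by (simp add: is_rep_def)
  qed
qed

lemma compress_mtrace:
  assumes "frame n r C D" "C * D = Q" and A: "A \<in> carrier_mat n n"
  shows "mtrace (D * A * C) = mtrace (A * Q)"
proof -
  have C: "C \<in> carrier_mat n r" and D: "D \<in> carrier_mat r n" using assms by (auto simp: frame_def)
  have "mtrace (D * A * C) = mtrace (D * (A * C))" using A C D by simp
  also have "\<dots> = mtrace ((A * C) * D)" using A C D by (intro mtrace_comm) auto
  also have "\<dots> = mtrace (A * Q)" using A C D assms(2) by simp
  finally show ?thesis .
qed

lemma mtrace_split:
  assumes A: "A \<in> carrier_mat n n" and Q: "Q \<in> carrier_mat n n"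
  shows "mtrace A = mtrace (A * Q) + mtrace (A * (1\<^sub>m n - Q))"
proof -
  have "A * (1\<^sub>m n - Q) = A * 1\<^sub>m n - A * Q"
    using A Q by (intro mult_minus_distrib_mat[of _ n n]) auto
  then show ?thesis using A Q by (simp add: mtrace_diff[of _ n])
qed

text \<open>A composition series suffices, without complete reducibility: an invariant subspace
  gives a subrepresentation on the image of \<open>Q\<close> and a quotient on the image of
  \<open>1 - Q\<close>, and the trace is additive although that complement need not be invariant.
  Nonemptiness of the list later provides an irreducible constituent to split off.\<close>

lemma rep_char_sum:
  assumes "is_rep G n \<rho>" "group G"
  shows "\<exists>\<chi>s. set \<chi>s \<subseteq> irr_chars G \<and> (\<forall>g\<in>carrier G. mtrace (\<rho> g) = (\<Sum>\<chi>\<leftarrow>\<chi>s. \<chi> g)) \<and> (n > 0 \<longrightarrow> \<chi>s \<noteq> [])"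
  using assms(1)
proof (induction n arbitrary: \<rho> rule: less_induct)
  case (less n)
  note car = less.prems[unfolded is_rep_def, THEN conjunct1, rule_format]
  consider "n = 0" | "n > 0" "is_irr_rep G n \<rho>" | "n > 0" "\<not> is_irr_rep G n \<rho>" by auto
  then show ?case
  proof cases
    case 1
    have "dim_row (\<rho> g) = 0" if "g \<in> carrier G" for g using car[OF that] 1 by auto
    then have "\<forall>g\<in>carrier G. mtrace (\<rho> g) = 0" by (auto simp: mtrace_def)
    then show ?thesis using 1 by (intro exI[of _ "[]"]) auto
  next
    case 2
    then have "char_of G n \<rho> \<in> irr_chars G" by (auto simp: irr_chars_def)
    then show ?thesis using less.prems
      by (intro exI[of _ "[char_of G n \<rho>]"]) (auto simp: char_of_mtrace)
  next
    case 3
    then obtain W where W: "is_subspace n W" "W \<noteq> {0\<^sub>v n}" "W \<noteq> carrier_vec n"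
      and Winv: "\<And>g v. g \<in> carrier G \<Longrightarrow> v \<in> W \<Longrightarrow> \<rho> g *\<^sub>v v \<in> W"
      using less.prems by (auto simp: is_irr_rep_def)
    from subspace_frame[OF W(1)] obtain r C D where fr: "frame n r C D"
      and CW: "\<And>u. u \<in> carrier_vec r \<Longrightarrow> C *\<^sub>v u \<in> W"
      and CD: "\<And>v. v \<in> W \<Longrightarrow> C *\<^sub>v (D *\<^sub>v v) = v" by metis
    have C: "C \<in> carrier_mat n r" and D: "D \<in> carrier_mat r n" and DC: "D * C = 1\<^sub>m r"
      using fr by (auto simp: frame_def)
    define Q where "Q = C * D"
    have Q: "Q \<in> carrier_mat n n" using C D by (simp add: Q_def)
    have Qv: "Q *\<^sub>v v = C *\<^sub>v (D *\<^sub>v v)" if "v \<in> carrier_vec n" for v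
      using C D that by (simp add: Q_def assoc_mult_mat_vec[of C n r D n])
    have QW: "Q *\<^sub>v v \<in> W" if "v \<in> carrier_vec n" for v using CW D that Qv by auto
    have QQ: "Q * Q = Q"
    proof -
      have "Q * Q = C * (D * C) * D" unfolding Q_def using C D by (simp add: mult_mat_assoc_dim del: assoc_mult_mat)
      then show ?thesis using DC C D by (simp add: Q_def)
    qed
    have "\<exists>v\<in>W. v \<noteq> 0\<^sub>v n" using W(1,2) by (auto simp: is_subspace_def)
    then obtain v0 where v0: "v0 \<in> W" "v0 \<noteq> 0\<^sub>v n" by blast
    have WC: "W \<subseteq> carrier_vec n" using W(1) by (simp add: is_subspace_def)
    obtain v1 where v1: "v1 \<in> carrier_vec n" "v1 \<notin> W" using W(3) WC by blast
    have Q1: "Q \<noteq> 1\<^sub>m n" using QW[OF v1(1)] v1 by auto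
    have Q0: "1\<^sub>m n - Q \<noteq> 1\<^sub>m n"
    proof
      assume "1\<^sub>m n - Q = 1\<^sub>m n"
      then have "(1\<^sub>m n - Q) *\<^sub>v v0 = v0" using v0 WC by auto
      moreover have "(1\<^sub>m n - Q) *\<^sub>v v0 = 1\<^sub>m n *\<^sub>v v0 - Q *\<^sub>v v0"
        using Q v0 WC by (intro minus_mult_distrib_mat_vec[of _ n n]) auto
      moreover have "Q *\<^sub>v v0 = v0" using Qv CD v0 WC by auto
      ultimately show False using v0 WC by auto
    qed
    have inv: "Q * \<rho> g * Q = \<rho> g * Q" if g: "g \<in> carrier G" for g
    proof (rule eq_matI)
      fix i j assume ij: "i < dim_row (\<rho> g * Q)" "j < dim_col (\<rho> g * Q)"
      then have ij: "i < n" "j < n" using car[OF g] Q by auto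
      let ?u = "unit_vec n j :: complex vec"
      have "\<rho> g *\<^sub>v (Q *\<^sub>v ?u) \<in> W" using Winv[OF g QW[of ?u]] by simp
      then have "Q *\<^sub>v (\<rho> g *\<^sub>v (Q *\<^sub>v ?u)) = \<rho> g *\<^sub>v (Q *\<^sub>v ?u)" using CD Qv WC by auto
      then have "(Q * \<rho> g * Q) *\<^sub>v ?u = (\<rho> g * Q) *\<^sub>v ?u"
        using car[OF g] Q by (simp add: assoc_mult_mat_vec[of _ n n _ n])
      then have "((Q * \<rho> g * Q) *\<^sub>v ?u) $ i = ((\<rho> g * Q) *\<^sub>v ?u) $ i" by simp
      moreover have "(M *\<^sub>v ?u) $ i = M $$ (i, j)" if "M \<in> carrier_mat n n" for M
        using that ij by simp
      from this[of "Q * \<rho> g * Q"] this[of "\<rho> g * Q"]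
      have "((Q * \<rho> g * Q) *\<^sub>v ?u) $ i = (Q * \<rho> g * Q) $$ (i, j)"
        "((\<rho> g * Q) *\<^sub>v ?u) $ i = (\<rho> g * Q) $$ (i, j)" using car[OF g] Q by (metis mult_carrier_mat)+
      ultimately show "(Q * \<rho> g * Q) $$ (i, j) = (\<rho> g * Q) $$ (i, j)" by argo
    qed (use car[OF g] Q in auto)
    have rn: "r < n"
    proof -
      have "r \<noteq> n"
      proof
        assume "r = n"
        then have "C * D = 1\<^sub>m n" using mat_mult_left_right_inverse[of D n C] C D DC by simp
        then show False using Q1 Q_def by simp
      qed
      then show ?thesis using frame_le[OF fr] by simp
    qed
    let ?Q' = "1\<^sub>m n - Q"
    have Q': "?Q' \<in> carrier_mat n n" using Q by auto
    from idem_frame[OF Q' idem_compl[OF Q QQ]] obtain s C' D' where fr': "frame n s C' D'"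
      and CD': "C' * D' = ?Q'" and sn: "s < n" using Q0 by metis
    \<comment> \<open>The kernel of \<open>1 - Q\<close> is the invariant image of \<open>Q\<close>,
      so this is the kernel form of the invariance condition, and compression to
      \<open>1 - Q\<close> realises the quotient representation.\<close>
    have inv': "?Q' * \<rho> g * ?Q' = ?Q' * \<rho> g" if g: "g \<in> carrier G" for g
    proof -
      note R = car[OF g]
      have "?Q' * \<rho> g * ?Q' = ?Q' * \<rho> g * 1\<^sub>m n - ?Q' * \<rho> g * Q"
        using Q R Q' by (intro mult_minus_distrib_mat[of _ n n]) auto
      also have "?Q' * \<rho> g * Q = ?Q' * (\<rho> g * Q)" using Q R Q' by simp
      also have "\<dots> = 1\<^sub>m n * (\<rho> g * Q) - Q * (\<rho> g * Q)"
        using Q R by (intro minus_mult_distrib_mat[of _ n n]) auto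
      also have "Q * (\<rho> g * Q) = \<rho> g * Q" using inv[OF g] Q R by simp
      finally show ?thesis using Q R by (intro eq_matI) auto
    qed
    have "is_rep G r (\<lambda>g. D * \<rho> g * C)"
      using compress_rep[OF less.prems assms(2) fr Q_def[symmetric]] inv by blast
    from less.IH[OF rn this] obtain xs where xs: "set xs \<subseteq> irr_chars G"
      "\<And>g. g \<in> carrier G \<Longrightarrow> mtrace (D * \<rho> g * C) = (\<Sum>\<chi>\<leftarrow>xs. \<chi> g)" by blast
    have "is_rep G s (\<lambda>g. D' * \<rho> g * C')"
      using compress_rep[OF less.prems assms(2) fr' CD'] inv' by blast
    from less.IH[OF sn this] obtain ys where ys: "set ys \<subseteq> irr_chars G"
      "\<And>g. g \<in> carrier G \<Longrightarrow> mtrace (D' * \<rho> g * C') = (\<Sum>\<chi>\<leftarrow>ys. \<chi> g)" by blast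
    have eq: "mtrace (\<rho> g) = (\<Sum>\<chi>\<leftarrow>xs @ ys. \<chi> g)" if g: "g \<in> carrier G" for g
      using mtrace_split[OF car[OF g] Q] compress_mtrace[OF fr Q_def[symmetric] car[OF g]]
        compress_mtrace[OF fr' CD' car[OF g]] xs ys g by simp
    interpret group G by fact
    \<comment> \<open>The trace at the identity is the degree, so a positive degree excludes the
      empty list.\<close>
    have "mtrace (\<rho> \<one>\<^bsub>G\<^esub>) = of_nat n" using less.prems by (simp add: is_rep_def)
    then have "xs @ ys \<noteq> []" using eq[of "\<one>\<^bsub>G\<^esub>"] 3 by auto
    then show ?thesis using xs ys eq by (intro exI[of _ "xs @ ys"]) auto
  qed
qed

section \<open>Schur orthogonality\<close>

text \<open>Matrices of all sizes share one type. With the size passed explicitly and the sum formed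
  entrywise, even an empty sum has a definite size.\<close>

definition mat_sum :: "nat \<Rightarrow> nat \<Rightarrow> 'k set \<Rightarrow> ('k \<Rightarrow> complex mat) \<Rightarrow> complex mat" where
  "mat_sum n m K f = mat n m (\<lambda>ij. \<Sum>k\<in>K. f k $$ ij)"

lemma mat_sum_carrier [simp]: "mat_sum n m K f \<in> carrier_mat n m"
  and mat_sum_index [simp]: "i < n \<Longrightarrow> j < m \<Longrightarrow> mat_sum n m K f $$ (i, j) = (\<Sum>k\<in>K. f k $$ (i, j))"
  and mat_sum_dim [simp]: "dim_row (mat_sum n m K f) = n" "dim_col (mat_sum n m K f) = m"
  by (auto simp: mat_sum_def)

lemma mat_sum_cong: "(\<And>k. k \<in> K \<Longrightarrow> f k = g k) \<Longrightarrow> mat_sum n m K f = mat_sum n m K g"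
  by (rule eq_matI) auto

lemma mat_sum_reindex_bij_betw: "bij_betw h K K' \<Longrightarrow> mat_sum n m K (\<lambda>k. f (h k)) = mat_sum n m K' f"
  by (rule eq_matI) (auto intro: sum.reindex_bij_betw)

lemma mult_mat_sum:
  assumes A: "A \<in> carrier_mat p n" and f: "\<And>k. k \<in> K \<Longrightarrow> f k \<in> carrier_mat n m"
  shows "A * mat_sum n m K f = mat_sum p m K (\<lambda>k. A * f k)"
proof (rule eq_matI)
  fix i j assume "i < dim_row (mat_sum p m K (\<lambda>k. A * f k))" "j < dim_col (mat_sum p m K (\<lambda>k. A * f k))"
  then have ij: "i < p" "j < m" by auto
  have "(A * mat_sum n m K f) $$ (i, j) = (\<Sum>l<n. A $$ (i, l) * (\<Sum>k\<in>K. f k $$ (l, j)))"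
    using ij A by (auto simp: scalar_prod_def lessThan_atLeast0)
  also have "\<dots> = (\<Sum>k\<in>K. \<Sum>l<n. A $$ (i, l) * f k $$ (l, j))"
    by (simp add: sum_distrib_left) (rule sum.swap)
  also have "\<dots> = (\<Sum>k\<in>K. (A * f k) $$ (i, j))"
  proof (rule sum.cong[OF refl])
    fix k assume "k \<in> K"
    from f[OF this] show "(\<Sum>l<n. A $$ (i, l) * f k $$ (l, j)) = (A * f k) $$ (i, j)"
      using ij A by (auto simp: scalar_prod_def lessThan_atLeast0)
  qed
  finally show "(A * mat_sum n m K f) $$ (i, j) = mat_sum p m K (\<lambda>k. A * f k) $$ (i, j)" using ij by simp
qed (use A in auto)

lemma mat_sum_mult:
  assumes A: "A \<in> carrier_mat m p" and f: "\<And>k. k \<in> K \<Longrightarrow> f k \<in> carrier_mat n m"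
  shows "mat_sum n m K f * A = mat_sum n p K (\<lambda>k. f k * A)"
proof (rule eq_matI)
  fix i j assume "i < dim_row (mat_sum n p K (\<lambda>k. f k * A))" "j < dim_col (mat_sum n p K (\<lambda>k. f k * A))"
  then have ij: "i < n" "j < p" by auto
  have "(mat_sum n m K f * A) $$ (i, j) = (\<Sum>l<m. (\<Sum>k\<in>K. f k $$ (i, l)) * A $$ (l, j))"
    using ij A by (auto simp: scalar_prod_def lessThan_atLeast0)
  also have "\<dots> = (\<Sum>k\<in>K. \<Sum>l<m. f k $$ (i, l) * A $$ (l, j))"
    by (simp add: sum_distrib_right) (rule sum.swap)
  also have "\<dots> = (\<Sum>k\<in>K. (f k * A) $$ (i, j))"
  proof (rule sum.cong[OF refl])
    fix k assume "k \<in> K"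
    from f[OF this] show "(\<Sum>l<m. f k $$ (i, l) * A $$ (l, j)) = (f k * A) $$ (i, j)"
      using ij A by (auto simp: scalar_prod_def lessThan_atLeast0)
  qed
  finally show "(mat_sum n m K f * A) $$ (i, j) = mat_sum n p K (\<lambda>k. f k * A) $$ (i, j)" using ij by simp
qed (use A in auto)

lemma mtrace_mat_sum:
  assumes "\<And>k. k \<in> K \<Longrightarrow> f k \<in> carrier_mat n n"
  shows "mtrace (mat_sum n n K f) = (\<Sum>k\<in>K. mtrace (f k))"
proof -
  have "mtrace (mat_sum n n K f) = (\<Sum>k\<in>K. \<Sum>i<n. f k $$ (i, i))"
    by (simp add: mtrace_def) (rule sum.swap)
  also have "\<dots> = (\<Sum>k\<in>K. mtrace (f k))"
    using assms by (intro sum.cong) (auto simp: mtrace_def)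
  finally show ?thesis .
qed

lemma mtrace_smult: "mtrace (c \<cdot>\<^sub>m A) = c * mtrace A" if "A \<in> carrier_mat n n"
  using that by (simp add: mtrace_def sum_distrib_left)

lemma mult_unit_vec:
  assumes "(T :: complex mat) \<in> carrier_mat n m" "j < m"
  shows "T *\<^sub>v unit_vec m j = col T j"
  using assms by (intro eq_vecI) auto

lemma irr_invariant_subspace:
  assumes "is_irr_rep G n R" "is_subspace n W" "\<And>g v. g \<in> carrier G \<Longrightarrow> v \<in> W \<Longrightarrow> R g *\<^sub>v v \<in> W"
    and "w \<in> W" "w \<noteq> 0\<^sub>v n"
  shows "W = carrier_vec n"
proof (rule ccontr)
  assume "W \<noteq> carrier_vec n"
  moreover have "W \<noteq> {0\<^sub>v n}" using assms(4,5) by blast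
  ultimately have "\<exists>W. is_subspace n W \<and> W \<noteq> {0\<^sub>v n} \<and> W \<noteq> carrier_vec n \<and>
      (\<forall>g\<in>carrier G. \<forall>v\<in>W. R g *\<^sub>v v \<in> W)" using assms(2,3) by blast
  then show False using assms(1) unfolding is_irr_rep_def by blast
qed

text \<open>Schur's lemma: the kernel of \<open>T\<close> is invariant under \<open>S\<close> and
  the image under \<open>R\<close>. Irreducibility makes the kernel zero and the image everything,
  so \<open>T\<close> is invertible and conjugates one representation into the other. Equality of
  the traces is the only consequence used.\<close>

lemma irr_intertwiner:
  assumes R: "is_irr_rep G n R" and S: "is_irr_rep G m S"
    and T: "T \<in> carrier_mat n m" and RT: "\<And>g. g \<in> carrier G \<Longrightarrow> R g * T = T * S g"
    and T0: "T \<noteq> 0\<^sub>m n m" and g: "g \<in> carrier G"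
  shows "mtrace (R g) = mtrace (S g)"
proof -
  have Rc: "R h \<in> carrier_mat n n" and Sc: "S h \<in> carrier_mat m m" if "h \<in> carrier G" for h
    using R S that by (auto simp: is_irr_rep_def is_rep_def)
  note ass = assoc_mult_mat_vec[of _ n n T m] assoc_mult_mat_vec[of T n m _ m]
  have sw: "T *\<^sub>v (S h *\<^sub>v v) = R h *\<^sub>v (T *\<^sub>v v)" if "h \<in> carrier G" "v \<in> carrier_vec m" for h v
    using ass(1)[of "R h" v] ass(2)[of "S h" v] RT[OF that(1)] Rc Sc T that by simp
  define W where "W = {v \<in> carrier_vec m. T *\<^sub>v v = 0\<^sub>v n}"
  define W' where "W' = (\<lambda>v. T *\<^sub>v v) ` carrier_vec m"
  have z: "A *\<^sub>v 0\<^sub>v k = 0\<^sub>v l" if "A \<in> carrier_mat l k" for A :: "complex mat" and k l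
    using that by (intro eq_vecI) auto
  have sW: "is_subspace m W"
    using T z[OF T] unfolding is_subspace_def W_def
    by (auto simp: mult_add_distrib_mat_vec[of T n m] mult_mat_vec[of T n m])
  have W_inv: "S h *\<^sub>v v \<in> W" if h: "h \<in> carrier G" and v: "v \<in> W" for h v
  proof -
    from that have "T *\<^sub>v (S h *\<^sub>v v) = 0\<^sub>v n" using sw[OF h, of v] z[OF Rc[OF h]] by (auto simp: W_def)
    then show "S h *\<^sub>v v \<in> W" using Sc[OF h] v by (auto simp: W_def)
  qed
  note colT = mult_unit_vec[OF T]
  obtain a b where ab: "a < n" "b < m" "T $$ (a, b) \<noteq> 0"
  proof (rule ccontr)
    assume "\<not> thesis"
    then have "T = 0\<^sub>m n m" using T that by (intro eq_matI) auto
    then show False using T0 by simp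
  qed
  have nz: "T *\<^sub>v unit_vec m b \<noteq> 0\<^sub>v n"
  proof
    assume "T *\<^sub>v unit_vec m b = 0\<^sub>v n"
    then have "col T b $ a = 0" using colT ab by simp
    then show False using ab T by simp
  qed
  have nW: "unit_vec m b \<notin> W" using nz by (simp add: W_def)
  have W: "w = 0\<^sub>v m" if "w \<in> W" for w
  proof (rule ccontr)
    assume "w \<noteq> 0\<^sub>v m"
    from irr_invariant_subspace[OF S sW W_inv that this] nW show False by simp
  qed
  have sW': "is_subspace n W'"
    unfolding is_subspace_def
  proof (intro conjI ballI allI)
    show "W' \<subseteq> carrier_vec n" using T by (auto simp: W'_def)
    show "0\<^sub>v n \<in> W'" unfolding W'_def by (rule image_eqI[of _ _ "0\<^sub>v m"]) (use z[OF T] in auto)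
    fix u assume "u \<in> W'"
    then obtain u' where u': "u' \<in> carrier_vec m" "u = T *\<^sub>v u'" by (auto simp: W'_def)
    show "c \<cdot>\<^sub>v u \<in> W'" for c unfolding W'_def
      by (rule image_eqI[of _ _ "c \<cdot>\<^sub>v u'"]) (use u' mult_mat_vec[OF T] in auto)
    fix v assume "v \<in> W'"
    then obtain v' where v': "v' \<in> carrier_vec m" "v = T *\<^sub>v v'" by (auto simp: W'_def)
    show "u + v \<in> W'" unfolding W'_def
      by (rule image_eqI[of _ _ "u' + v'"]) (use u' v' mult_add_distrib_mat_vec[OF T] in auto)
  qed
  have W'_inv: "R h *\<^sub>v v \<in> W'" if h: "h \<in> carrier G" and v: "v \<in> W'" for h v
  proof -
    from v obtain v' where v': "v' \<in> carrier_vec m" "v = T *\<^sub>v v'" by (auto simp: W'_def)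
    show "R h *\<^sub>v v \<in> W'" unfolding W'_def
      by (rule image_eqI[of _ _ "S h *\<^sub>v v'"]) (use v' sw[OF h] Sc[OF h] in auto)
  qed
  have "T *\<^sub>v unit_vec m b \<in> W'" unfolding W'_def by simp
  from irr_invariant_subspace[OF R sW' W'_inv this nz] have W': "W' = carrier_vec n" .
  have "\<forall>j. \<exists>u. u \<in> carrier_vec m \<and> T *\<^sub>v u = unit_vec n j"
    using W' unfolding W'_def by (metis imageE unit_vec_carrier)
  then obtain u where u: "\<And>j. u j \<in> carrier_vec m" "\<And>j. T *\<^sub>v u j = unit_vec n j" by metis
  define U where "U = mat m n (\<lambda>(i, j). u j $ i)"
  have U: "U \<in> carrier_mat m n" by (simp add: U_def)
  have TU: "T * U = 1\<^sub>m n"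
  proof (rule eq_matI)
    fix i j assume "i < dim_row (1\<^sub>m n :: complex mat)" "j < dim_col (1\<^sub>m n :: complex mat)"
    then have ij: "i < n" "j < n" by auto
    have "col U j = u j" using u(1)[of j] ij by (intro eq_vecI) (auto simp: U_def)
    then have "(T * U) $$ (i, j) = (T *\<^sub>v u j) $ i" using T U ij by simp
    then show "(T * U) $$ (i, j) = 1\<^sub>m n $$ (i, j)" using u(2) ij by auto
  qed (use T U in auto)
  have UT: "U * T = 1\<^sub>m m"
  proof (rule eq_matI)
    fix i j assume "i < dim_row (1\<^sub>m m :: complex mat)" "j < dim_col (1\<^sub>m m :: complex mat)"
    then have ij: "i < m" "j < m" by auto
    \<comment> \<open>Since \<open>T * U * T = T\<close>, this vector lies in the kernel of
      \<open>T\<close>, which is zero.\<close>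
    define v where "v = (U * T) *\<^sub>v unit_vec m j - unit_vec m j"
    have vc: "v \<in> carrier_vec m" unfolding v_def using U T by auto
    have UTu: "(U * T) *\<^sub>v unit_vec m j \<in> carrier_vec m" using U T by auto
    have e1: "T *\<^sub>v ((U * T) *\<^sub>v unit_vec m j) = (T * (U * T)) *\<^sub>v unit_vec m j"
      using T U by (intro assoc_mult_mat_vec[symmetric, of _ n m _ m]) auto
    have e2: "T * (U * T) = T"
      using TU T U assoc_mult_mat[OF T U T] by simp
    have e3: "T *\<^sub>v v = T *\<^sub>v ((U * T) *\<^sub>v unit_vec m j) - T *\<^sub>v unit_vec m j"
      unfolding v_def using T UTu by (intro mult_minus_distrib_mat_vec) auto
    have "T *\<^sub>v v = 0\<^sub>v n"
      unfolding e3 e1 e2 using T by (intro minus_cancel_vec) auto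
    then have "v = 0\<^sub>v m" using W[of v] vc by (simp add: W_def)
    then have "v $ i = 0" using ij by simp
    moreover have "v $ i = (U * T) $$ (i, j) - unit_vec m j $ i"
    proof -
      have "(U * T) *\<^sub>v unit_vec m j = col (U * T) j"
        using mult_unit_vec[of "U * T" m m j] U T ij by auto
      then show ?thesis unfolding v_def using ij U T by simp
    qed
    ultimately show "(U * T) $$ (i, j) = 1\<^sub>m m $$ (i, j)" using ij by auto
  qed (use T U in auto)
  have "mtrace (R g) = mtrace (R g * (T * U))" using TU Rc[OF g] by simp
  also have "R g * (T * U) = (T * S g) * U" using RT[OF g] assoc_mult_mat[OF Rc[OF g] T U] by simp
  also have "\<dots> = T * (S g * U)" using assoc_mult_mat[OF T Sc[OF g] U] .
  also have "mtrace \<dots> = mtrace ((S g * U) * T)" using T U Sc[OF g] by (intro mtrace_comm[of _ n m]) auto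
  also have "(S g * U) * T = S g" using assoc_mult_mat[OF Sc[OF g] U T] UT Sc[OF g] by simp
  finally show ?thesis .
qed

text \<open>Over the complex numbers \<open>T\<close> has an eigenvalue. Its eigenspace is nonzero
  and invariant, hence the whole space.\<close>

lemma irr_commutant:
  assumes R: "is_irr_rep G n R" and T: "T \<in> carrier_mat n n"
    and RT: "\<And>g. g \<in> carrier G \<Longrightarrow> R g * T = T * R g"
  obtains c where "T = c \<cdot>\<^sub>m 1\<^sub>m n"
proof -
  have n: "n > 0" and Rc: "\<And>h. h \<in> carrier G \<Longrightarrow> R h \<in> carrier_mat n n"
    using R by (auto simp: is_irr_rep_def is_rep_def)
  from spectrum_non_empty[OF T n] obtain c v where v: "v \<in> carrier_vec n" "v \<noteq> 0\<^sub>v n" "T *\<^sub>v v = c \<cdot>\<^sub>v v"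
    using T by (auto simp: spectrum_def eigenvalue_def eigenvector_def)
  define W where "W = {v \<in> carrier_vec n. T *\<^sub>v v = c \<cdot>\<^sub>v v}"
  have "T *\<^sub>v 0\<^sub>v n = c \<cdot>\<^sub>v 0\<^sub>v n" using T by (intro eq_vecI) auto
  then have "is_subspace n W"
    using T unfolding is_subspace_def W_def
    by (auto simp: mult_add_distrib_mat_vec[of T n n] mult_mat_vec[of T n n] smult_add_distrib_vec[of _ n]
        smult_smult_assoc mult.commute)
  then have sW: "is_subspace n W" .
  have W_inv: "R h *\<^sub>v v \<in> W" if h: "h \<in> carrier G" and v: "v \<in> W" for h v
  proof -
    from v have vc: "v \<in> carrier_vec n" by (simp add: W_def)
    have "T *\<^sub>v (R h *\<^sub>v v) = (T * R h) *\<^sub>v v" using assoc_mult_mat_vec[OF T Rc[OF h] vc] by simp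
    also have "\<dots> = R h *\<^sub>v (T *\<^sub>v v)" using assoc_mult_mat_vec[OF Rc[OF h] T vc] RT[OF h] by simp
    also have "\<dots> = c \<cdot>\<^sub>v (R h *\<^sub>v v)" using v mult_mat_vec[OF Rc[OF h] vc] by (simp add: W_def)
    finally show "R h *\<^sub>v v \<in> W" using Rc[OF h] vc by (auto simp: W_def)
  qed
  have "v \<in> W" using v by (simp add: W_def)
  from irr_invariant_subspace[OF R sW W_inv this v(2)] have W: "W = carrier_vec n" .
  have "T = c \<cdot>\<^sub>m 1\<^sub>m n"
  proof (rule eq_matI)
    fix i j assume "i < dim_row (c \<cdot>\<^sub>m 1\<^sub>m n)" "j < dim_col (c \<cdot>\<^sub>m 1\<^sub>m n)"
    then have ij: "i < n" "j < n" by auto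
    have "unit_vec n j \<in> W" using W by simp
    then have "(T *\<^sub>v unit_vec n j) $ i = (c \<cdot>\<^sub>v unit_vec n j) $ i" by (simp add: W_def)
    then show "T $$ (i, j) = (c \<cdot>\<^sub>m 1\<^sub>m n) $$ (i, j)" using ij T by auto
  qed (use T in auto)
  then show ?thesis by (rule that)
qed

text \<open>Averaging an elementary matrix and reading off one entry of the result gives a sum of
  products of single matrix entries. This is how intertwiners yield orthogonality relations.\<close>

lemma rank_one_conj:
  assumes "(P :: complex mat) \<in> carrier_mat n n" "Q \<in> carrier_mat m m" "a < n" "b < n" "c < m" "d < m"
  shows "(P * (mat n m (\<lambda>(i, j). if i = b \<and> j = c then 1 else 0) * Q)) $$ (a, d) = P $$ (a, b) * Q $$ (c, d)"
proof -
  let ?A = "mat n m (\<lambda>(i, j). if i = b \<and> j = c then 1 else 0) :: complex mat"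
  have AQ: "(?A * Q) $$ (i, d) = (if i = b then Q $$ (c, d) else 0)" if "i < n" for i
  proof -
    have "(?A * Q) $$ (i, d) = (\<Sum>l<m. ?A $$ (i, l) * Q $$ (l, d))"
      using assms that by (auto simp: scalar_prod_def lessThan_atLeast0)
    also have "\<dots> = (\<Sum>l<m. if l = c then (if i = b then Q $$ (c, d) else 0) else 0)"
      using that by (intro sum.cong) auto
    finally show ?thesis using assms by simp
  qed
  have "(P * (?A * Q)) $$ (a, d) = (\<Sum>l<n. P $$ (a, l) * (?A * Q) $$ (l, d))"
    using assms by (auto simp: scalar_prod_def lessThan_atLeast0)
  also have "\<dots> = (\<Sum>l<n. if l = b then P $$ (a, b) * Q $$ (c, d) else 0)"
    using AQ by (intro sum.cong) auto
  finally show ?thesis using assms by simp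
qed

context
  fixes G :: "('g, 'b) monoid_scheme"
  assumes G: "group G" and fin: "finite (carrier G)"
begin

interpretation group G by (rule G)

lemma bij_betw_mult_left: "h \<in> carrier G \<Longrightarrow> bij_betw (\<lambda>g. h \<otimes>\<^bsub>G\<^esub> g) (carrier G) (carrier G)"
  by (rule bij_betw_byWitness[where f' = "\<lambda>g. inv\<^bsub>G\<^esub> h \<otimes>\<^bsub>G\<^esub> g"]) (auto simp: m_assoc[symmetric])

lemma bij_betw_mult_right: "h \<in> carrier G \<Longrightarrow> bij_betw (\<lambda>g. g \<otimes>\<^bsub>G\<^esub> h) (carrier G) (carrier G)"
  by (rule bij_betw_byWitness[where f' = "\<lambda>g. g \<otimes>\<^bsub>G\<^esub> inv\<^bsub>G\<^esub> h"]) (auto simp: m_assoc)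

text \<open>Left multiplication by \<open>h\<close> permutes the summands, and the inverse inside
  \<open>S\<close> releases a factor \<open>S h\<close> on the right.\<close>

lemma rep_average:
  assumes R: "is_rep G n R" and S: "is_rep G m S" and A: "A \<in> carrier_mat n m" and h: "h \<in> carrier G"
  defines "T \<equiv> mat_sum n m (carrier G) (\<lambda>g. R g * (A * S (inv\<^bsub>G\<^esub> g)))"
  shows "R h * T = T * S h"
proof -
  have Rc: "R k \<in> carrier_mat n n" and Sc: "S k \<in> carrier_mat m m" if "k \<in> carrier G" for k
    using R S that by (auto simp: is_rep_def)
  have trm: "R (h \<otimes>\<^bsub>G\<^esub> g) * (A * S (inv\<^bsub>G\<^esub> (h \<otimes>\<^bsub>G\<^esub> g))) * S h = R h * (R g * (A * S (inv\<^bsub>G\<^esub> g)))"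
    if g: "g \<in> carrier G" for g
  proof -
    have "R (h \<otimes>\<^bsub>G\<^esub> g) = R h * R g" using R g h by (simp add: is_rep_def)
    moreover have "S (inv\<^bsub>G\<^esub> (h \<otimes>\<^bsub>G\<^esub> g)) * S h = S (inv\<^bsub>G\<^esub> g)"
    proof -
      have "S (inv\<^bsub>G\<^esub> (h \<otimes>\<^bsub>G\<^esub> g)) * S h = S (inv\<^bsub>G\<^esub> (h \<otimes>\<^bsub>G\<^esub> g) \<otimes>\<^bsub>G\<^esub> h)"
        using S g h by (simp add: is_rep_def)
      then show ?thesis using g h by (simp add: inv_mult_group m_assoc)
    qed
    ultimately show ?thesis
      using Rc[OF h] Rc[OF g] Sc[OF h] Sc[of "inv\<^bsub>G\<^esub> (h \<otimes>\<^bsub>G\<^esub> g)"] A g h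
      by (simp add: mult_mat_assoc_dim del: assoc_mult_mat)
  qed
  have "R h * T = mat_sum n m (carrier G) (\<lambda>g. R h * (R g * (A * S (inv\<^bsub>G\<^esub> g))))"
    unfolding T_def using Rc[OF h] Rc Sc A by (intro mult_mat_sum) (auto intro!: mult_carrier_mat)
  also have "\<dots> = mat_sum n m (carrier G) (\<lambda>g. R (h \<otimes>\<^bsub>G\<^esub> g) * (A * S (inv\<^bsub>G\<^esub> (h \<otimes>\<^bsub>G\<^esub> g))) * S h)"
    by (intro mat_sum_cong) (simp add: trm)
  also have "\<dots> = mat_sum n m (carrier G) (\<lambda>g. R g * (A * S (inv\<^bsub>G\<^esub> g)) * S h)"
    using mat_sum_reindex_bij_betw[OF bij_betw_mult_left[OF h], where f = "\<lambda>g. R g * (A * S (inv\<^bsub>G\<^esub> g)) * S h"] .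
  also have "\<dots> = T * S h"
    unfolding T_def using Sc[OF h] Rc Sc A by (intro mat_sum_mult[symmetric]) (auto intro!: mult_carrier_mat)
  finally show ?thesis .
qed

text \<open>Inequivalence is expressed by traces that differ at some \<open>k\<close>. By
  \<open>irr_intertwiner\<close>, the average of an elementary matrix must then vanish.\<close>

lemma schur_neq:
  assumes R: "is_irr_rep G n R" and S: "is_irr_rep G m S"
    and ne: "k \<in> carrier G" "mtrace (R k) \<noteq> mtrace (S k)" and ix: "a < n" "b < n" "c < m" "d < m"
  shows "(\<Sum>g\<in>carrier G. R g $$ (a, b) * S (inv\<^bsub>G\<^esub> g) $$ (c, d)) = 0"
proof -
  let ?A = "mat n m (\<lambda>(i, j). if i = b \<and> j = c then 1 else 0) :: complex mat"
  define T where "T = mat_sum n m (carrier G) (\<lambda>g. R g * (?A * S (inv\<^bsub>G\<^esub> g)))"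
  have Rr: "is_rep G n R" and Sr: "is_rep G m S" using R S by (auto simp: is_irr_rep_def)
  have "T = 0\<^sub>m n m"
  proof (rule ccontr)
    assume "T \<noteq> 0\<^sub>m n m"
    then have "mtrace (R k) = mtrace (S k)"
      using rep_average[OF Rr Sr, of ?A] ne(1)
      by (intro irr_intertwiner[OF R S, of T]) (auto simp: T_def)
    then show False using ne by simp
  qed
  then have "T $$ (a, d) = 0" using ix by simp
  moreover have "T $$ (a, d) = (\<Sum>g\<in>carrier G. R g $$ (a, b) * S (inv\<^bsub>G\<^esub> g) $$ (c, d))"
    unfolding T_def using Rr Sr ix
    by (simp del: index_mult_mat) (intro sum.cong refl rank_one_conj, auto simp: is_rep_def)
  ultimately show ?thesis by simp
qed

text \<open>The average is a scalar matrix. Every summand is conjugate to the elementary matrix, so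
  comparing traces determines the scalar.\<close>

lemma schur_eq:
  assumes R: "is_irr_rep G n R" and ix: "a < n" "b < n" "c < n" "d < n"
  shows "(\<Sum>g\<in>carrier G. R g $$ (a, b) * R (inv\<^bsub>G\<^esub> g) $$ (c, d)) =
    (if a = d \<and> b = c then of_nat (card (carrier G)) / of_nat n else 0)"
proof -
  let ?A = "mat n n (\<lambda>(i, j). if i = b \<and> j = c then 1 else 0) :: complex mat"
  define T where "T = mat_sum n n (carrier G) (\<lambda>g. R g * (?A * R (inv\<^bsub>G\<^esub> g)))"
  have Rr: "is_rep G n R" using R by (auto simp: is_irr_rep_def)
  then have Rc: "R k \<in> carrier_mat n n" if "k \<in> carrier G" for k using that by (auto simp: is_rep_def)
  obtain l where l: "T = l \<cdot>\<^sub>m 1\<^sub>m n"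
    using rep_average[OF Rr Rr, of ?A] irr_commutant[OF R, of T] by (auto simp: T_def)
  have tA: "mtrace ?A = (if b = c then 1 else 0)"
  proof -
    have "mtrace ?A = (\<Sum>i<n. if i = b then (if b = c then 1 else 0) else 0)"
      unfolding mtrace_def by (intro sum.cong) auto
    then show ?thesis using ix by simp
  qed
  have "mtrace T = (\<Sum>g\<in>carrier G. mtrace (R g * (?A * R (inv\<^bsub>G\<^esub> g))))"
    unfolding T_def using Rc by (intro mtrace_mat_sum) (auto intro!: mult_carrier_mat)
  also have "\<dots> = (\<Sum>g\<in>carrier G. mtrace ?A)"
  proof (rule sum.cong[OF refl])
    fix g assume g: "g \<in> carrier G"
    have "mtrace (R g * (?A * R (inv\<^bsub>G\<^esub> g))) = mtrace ((?A * R (inv\<^bsub>G\<^esub> g)) * R g)"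
      using Rc g by (intro mtrace_comm[of _ n n]) (auto intro!: mult_carrier_mat)
    also have "(?A * R (inv\<^bsub>G\<^esub> g)) * R g = ?A * (R (inv\<^bsub>G\<^esub> g) * R g)"
      using Rc[of "inv\<^bsub>G\<^esub> g"] Rc[OF g] g by (intro assoc_mult_mat[of _ n n]) auto
    also have "R (inv\<^bsub>G\<^esub> g) * R g = 1\<^sub>m n"
    proof -
      have "R (inv\<^bsub>G\<^esub> g \<otimes>\<^bsub>G\<^esub> g) = R (inv\<^bsub>G\<^esub> g) * R g"
        using Rr g inv_closed[OF g] unfolding is_rep_def by blast
      then show ?thesis using Rr l_inv[OF g] by (simp add: is_rep_def)
    qed
    finally show "mtrace (R g * (?A * R (inv\<^bsub>G\<^esub> g))) = mtrace ?A" by simp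
  qed
  finally have "l * of_nat n = of_nat (card (carrier G)) * (if b = c then 1 else 0)"
    using l tA by (simp add: mtrace_smult[of _ n])
  moreover have "n > 0" using ix by simp
  ultimately have l': "l = (if b = c then of_nat (card (carrier G)) / of_nat n else 0)"
    by (auto simp: field_simps)
  have "T $$ (a, d) = (\<Sum>g\<in>carrier G. R g $$ (a, b) * R (inv\<^bsub>G\<^esub> g) $$ (c, d))"
    unfolding T_def using Rc ix
    by (simp del: index_mult_mat) (intro sum.cong refl rank_one_conj, auto)
  then show ?thesis using l l' ix by auto
qed

end

section \<open>Group algebra operators and isotypic projections\<close>

definition group_op :: "nat \<Rightarrow> ('g, 'b) monoid_scheme \<Rightarrow> ('g \<Rightarrow> complex mat) \<Rightarrow> ('g \<Rightarrow> complex) \<Rightarrow> complex mat" where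
  "group_op n G \<rho> a = mat_sum n n (carrier G) (\<lambda>g. a g \<cdot>\<^sub>m \<rho> g)"

text \<open>The element of the group algebra acting as the matrix unit \<open>e_{ab}\<close> in the irreducible representation
  \<open>R\<close> and as zero in the irreducible representations not isomorphic to \<open>R\<close>.\<close>

definition munit :: "('g, 'b) monoid_scheme \<Rightarrow> nat \<Rightarrow> ('g \<Rightarrow> complex mat) \<Rightarrow> nat \<Rightarrow> nat \<Rightarrow> 'g \<Rightarrow> complex" where
  "munit G n R a b g = of_nat n / of_nat (card (carrier G)) * R (inv\<^bsub>G\<^esub> g) $$ (b, a)"

lemma group_op_carrier [simp]: "group_op n G \<rho> a \<in> carrier_mat n n"
  by (simp add: group_op_def)

lemma group_op_cong: "(\<And>g. g \<in> carrier G \<Longrightarrow> a g = b g) \<Longrightarrow> group_op n G \<rho> a = group_op n G \<rho> b"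
  unfolding group_op_def by (rule mat_sum_cong) simp

lemma group_op_zero: "is_rep G n \<rho> \<Longrightarrow> group_op n G \<rho> (\<lambda>_. 0) = 0\<^sub>m n n"
  unfolding group_op_def by (rule eq_matI) (auto simp: is_rep_def intro!: sum.neutral)

lemma mtrace_group_op:
  assumes "is_rep G n \<rho>" "B \<in> carrier_mat n n"
  shows "mtrace (B * group_op n G \<rho> a) = (\<Sum>g\<in>carrier G. a g * mtrace (B * \<rho> g))"
proof -
  have c: "\<rho> g \<in> carrier_mat n n" if "g \<in> carrier G" for g using assms that by (auto simp: is_rep_def)
  have "B * group_op n G \<rho> a = mat_sum n n (carrier G) (\<lambda>g. B * (a g \<cdot>\<^sub>m \<rho> g))"
    unfolding group_op_def using assms(2) c by (intro mult_mat_sum) auto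
  also have "mtrace \<dots> = (\<Sum>g\<in>carrier G. mtrace (B * (a g \<cdot>\<^sub>m \<rho> g)))"
    using assms(2) c by (intro mtrace_mat_sum) (auto intro!: mult_carrier_mat)
  also have "\<dots> = (\<Sum>g\<in>carrier G. a g * mtrace (B * \<rho> g))"
  proof (rule sum.cong[OF refl])
    fix g assume g: "g \<in> carrier G"
    show "mtrace (B * (a g \<cdot>\<^sub>m \<rho> g)) = a g * mtrace (B * \<rho> g)"
      using mult_smult_distrib[OF assms(2) c[OF g], of "a g"] mtrace_smult[OF mult_carrier_mat[OF assms(2) c[OF g]]]
      by simp
  qed
  finally show ?thesis .
qed

lemma group_op_commute:
  assumes "is_rep G n \<rho>" "B \<in> carrier_mat n n" "\<And>g. g \<in> carrier G \<Longrightarrow> B * \<rho> g = \<rho> g * B"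
  shows "B * group_op n G \<rho> a = group_op n G \<rho> a * B"
proof -
  have c: "\<rho> g \<in> carrier_mat n n" if "g \<in> carrier G" for g using assms that by (auto simp: is_rep_def)
  have "B * group_op n G \<rho> a = mat_sum n n (carrier G) (\<lambda>g. B * (a g \<cdot>\<^sub>m \<rho> g))"
    unfolding group_op_def using assms(2) c by (intro mult_mat_sum) auto
  also have "\<dots> = mat_sum n n (carrier G) (\<lambda>g. (a g \<cdot>\<^sub>m \<rho> g) * B)"
  proof (rule mat_sum_cong)
    fix g assume g: "g \<in> carrier G"
    show "B * (a g \<cdot>\<^sub>m \<rho> g) = (a g \<cdot>\<^sub>m \<rho> g) * B"
      using mult_smult_distrib[OF assms(2) c[OF g], of "a g"] mult_smult_assoc_mat[OF c[OF g] assms(2), of "a g"]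
        assms(3)[OF g] by simp
  qed
  also have "\<dots> = group_op n G \<rho> a * B"
    unfolding group_op_def using assms(2) c by (intro mat_sum_mult[symmetric]) auto
  finally show ?thesis .
qed

primrec mprod :: "nat \<Rightarrow> nat \<Rightarrow> (nat \<Rightarrow> complex mat) \<Rightarrow> complex mat" where
  "mprod n 0 A = 1\<^sub>m n"
| "mprod n (Suc s) A = mprod n s A * A s"

lemma mprod_carrier: "(\<And>i. i < s \<Longrightarrow> A i \<in> carrier_mat n n) \<Longrightarrow> mprod n s A \<in> carrier_mat n n"
  by (induction s) (auto intro!: mult_carrier_mat)

lemma mprod_commute:
  assumes "\<And>i. i < s \<Longrightarrow> A i \<in> carrier_mat n n" "B \<in> carrier_mat n n" "\<And>i. i < s \<Longrightarrow> A i * B = B * A i"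
  shows "mprod n s A * B = B * mprod n s A"
  using assms(1,3)
proof (induction s)
  case 0
  then show ?case using assms(2) by simp
next
  case (Suc s)
  have P: "mprod n s A \<in> carrier_mat n n" using Suc.prems by (intro mprod_carrier) auto
  have As: "A s \<in> carrier_mat n n" using Suc.prems by simp
  have "mprod n (Suc s) A * B = mprod n s A * (A s * B)" using assoc_mult_mat[OF P As assms(2)] by simp
  also have "\<dots> = mprod n s A * B * A s" using Suc.prems(2)[of s] assoc_mult_mat[OF P assms(2) As] by simp
  also have "\<dots> = B * mprod n s A * A s" using Suc by simp
  also have "\<dots> = B * mprod n (Suc s) A" using assoc_mult_mat[OF assms(2) P As] by simp
  finally show ?case .
qed

text \<open>All factors commute with \<open>Q\<close>, so \<open>compress_mult\<close> applies to
  one factor after the other.\<close>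

lemma mprod_compress:
  assumes fr: "frame n r C D" "C * D = Q" and A: "\<And>i. i < s \<Longrightarrow> A i \<in> carrier_mat n n"
    and AQ: "\<And>i. i < s \<Longrightarrow> A i * Q = Q * A i" and QQ: "Q * Q = Q"
  shows "mprod r s (\<lambda>i. D * A i * C) = D * mprod n s A * C"
  using A AQ
proof (induction s)
  case 0
  then show ?case using fr by (auto simp: frame_def)
next
  case (Suc s)
  have Q: "Q \<in> carrier_mat n n" using fr by (auto simp: frame_def)
  have P: "mprod n s A \<in> carrier_mat n n" using Suc.prems by (intro mprod_carrier) auto
  have As: "A s \<in> carrier_mat n n" using Suc.prems by simp
  have "Q * A s * Q = A s * Q"
    using Suc.prems(2)[of s] assoc_mult_mat[OF As Q Q] QQ by simp
  then have "(D * mprod n s A * C) * (D * A s * C) = D * (mprod n s A * A s) * C"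
    using compress_mult[OF fr P As] by simp
  then show ?case using Suc by simp
qed

lemma smult_smult_mat: "c \<cdot>\<^sub>m (d \<cdot>\<^sub>m A) = (c * d) \<cdot>\<^sub>m (A :: complex mat)"
  by (rule eq_matI) auto

context
  fixes G :: "('g, 'b) monoid_scheme"
  assumes G: "group G" and fin: "finite (carrier G)"
begin

interpretation group G by (rule G)

lemma card_carrier_pos: "card (carrier G) > 0"
  using fin one_closed card_gt_0_iff by blast

text \<open>The substitution \<open>g = h k\<close> turns products of operators into convolutions of
  coefficients. Idempotency and commutation can therefore be checked on coefficients, for all
  representations at once.\<close>

lemma group_op_mult:
  assumes rho: "is_rep G n \<rho>"
  shows "group_op n G \<rho> a * group_op n G \<rho> b = group_op n G \<rho> (\<lambda>g. \<Sum>h\<in>carrier G. a h * b (inv\<^bsub>G\<^esub> h \<otimes>\<^bsub>G\<^esub> g))"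
proof -
  have c: "\<rho> g \<in> carrier_mat n n" if "g \<in> carrier G" for g using rho that by (auto simp: is_rep_def)
  have 1: "(a h \<cdot>\<^sub>m \<rho> h) * group_op n G \<rho> b = mat_sum n n (carrier G) (\<lambda>g. (a h * b (inv\<^bsub>G\<^esub> h \<otimes>\<^bsub>G\<^esub> g)) \<cdot>\<^sub>m \<rho> g)"
    if h: "h \<in> carrier G" for h
  proof -
    have "(a h \<cdot>\<^sub>m \<rho> h) * group_op n G \<rho> b = mat_sum n n (carrier G) (\<lambda>k. (a h \<cdot>\<^sub>m \<rho> h) * (b k \<cdot>\<^sub>m \<rho> k))"
      unfolding group_op_def using c h by (intro mult_mat_sum) auto
    also have "\<dots> = mat_sum n n (carrier G) (\<lambda>k. (a h * b (inv\<^bsub>G\<^esub> h \<otimes>\<^bsub>G\<^esub> (h \<otimes>\<^bsub>G\<^esub> k))) \<cdot>\<^sub>m \<rho> (h \<otimes>\<^bsub>G\<^esub> k))"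
    proof (rule mat_sum_cong)
      fix k assume k: "k \<in> carrier G"
      have "(a h \<cdot>\<^sub>m \<rho> h) * (b k \<cdot>\<^sub>m \<rho> k) = a h \<cdot>\<^sub>m (b k \<cdot>\<^sub>m (\<rho> h * \<rho> k))"
        using mult_smult_assoc_mat[OF c[OF h] smult_carrier_mat[OF c[OF k]], of "a h" "b k"]
          mult_smult_distrib[OF c[OF h] c[OF k], of "b k"] by simp
      also have "\<rho> h * \<rho> k = \<rho> (h \<otimes>\<^bsub>G\<^esub> k)" using rho h k by (simp add: is_rep_def)
      finally show "(a h \<cdot>\<^sub>m \<rho> h) * (b k \<cdot>\<^sub>m \<rho> k) = (a h * b (inv\<^bsub>G\<^esub> h \<otimes>\<^bsub>G\<^esub> (h \<otimes>\<^bsub>G\<^esub> k))) \<cdot>\<^sub>m \<rho> (h \<otimes>\<^bsub>G\<^esub> k)"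
        using h k by (simp add: m_assoc[symmetric] smult_smult_mat)
    qed
    also have "\<dots> = mat_sum n n (carrier G) (\<lambda>g. (a h * b (inv\<^bsub>G\<^esub> h \<otimes>\<^bsub>G\<^esub> g)) \<cdot>\<^sub>m \<rho> g)"
      by (rule mat_sum_reindex_bij_betw[OF bij_betw_mult_left[OF G fin h], where f = "\<lambda>g. (a h * b (inv\<^bsub>G\<^esub> h \<otimes>\<^bsub>G\<^esub> g)) \<cdot>\<^sub>m \<rho> g"])
    finally show ?thesis .
  qed
  have "group_op n G \<rho> a * group_op n G \<rho> b = mat_sum n n (carrier G) (\<lambda>h. (a h \<cdot>\<^sub>m \<rho> h) * group_op n G \<rho> b)"
    unfolding group_op_def[of n G \<rho> a] using c by (intro mat_sum_mult) auto
  also have "\<dots> = mat_sum n n (carrier G) (\<lambda>h. mat_sum n n (carrier G) (\<lambda>g. (a h * b (inv\<^bsub>G\<^esub> h \<otimes>\<^bsub>G\<^esub> g)) \<cdot>\<^sub>m \<rho> g))"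
    by (intro mat_sum_cong 1)
  also have "\<dots> = group_op n G \<rho> (\<lambda>g. \<Sum>h\<in>carrier G. a h * b (inv\<^bsub>G\<^esub> h \<otimes>\<^bsub>G\<^esub> g))"
  proof (rule eq_matI)
    fix i j assume "i < dim_row (group_op n G \<rho> (\<lambda>g. \<Sum>h\<in>carrier G. a h * b (inv\<^bsub>G\<^esub> h \<otimes>\<^bsub>G\<^esub> g)))"
      "j < dim_col (group_op n G \<rho> (\<lambda>g. \<Sum>h\<in>carrier G. a h * b (inv\<^bsub>G\<^esub> h \<otimes>\<^bsub>G\<^esub> g)))"
    then have ij: "i < n" "j < n" by (auto simp: group_op_def)
    have e: "(x \<cdot>\<^sub>m \<rho> g) $$ (i, j) = x * \<rho> g $$ (i, j)" if "g \<in> carrier G" for x g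
      using c[OF that] ij by simp
    show "mat_sum n n (carrier G) (\<lambda>h. mat_sum n n (carrier G) (\<lambda>g. (a h * b (inv\<^bsub>G\<^esub> h \<otimes>\<^bsub>G\<^esub> g)) \<cdot>\<^sub>m \<rho> g)) $$ (i, j) =
      group_op n G \<rho> (\<lambda>g. \<Sum>h\<in>carrier G. a h * b (inv\<^bsub>G\<^esub> h \<otimes>\<^bsub>G\<^esub> g)) $$ (i, j)"
      using ij by (simp add: group_op_def e sum_distrib_right cong: sum.cong) (rule sum.swap)
  qed (auto simp: group_op_def)
  finally show ?thesis .
qed

lemma rep_group_op:
  assumes rho: "is_rep G n \<rho>" and k: "k \<in> carrier G"
  shows "\<rho> k * group_op n G \<rho> a = group_op n G \<rho> (\<lambda>g. a (inv\<^bsub>G\<^esub> k \<otimes>\<^bsub>G\<^esub> g))"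
proof -
  have c: "\<rho> g \<in> carrier_mat n n" if "g \<in> carrier G" for g using rho that by (auto simp: is_rep_def)
  have "\<rho> k * group_op n G \<rho> a = mat_sum n n (carrier G) (\<lambda>g. \<rho> k * (a g \<cdot>\<^sub>m \<rho> g))"
    unfolding group_op_def using c k by (intro mult_mat_sum) auto
  also have "\<dots> = mat_sum n n (carrier G) (\<lambda>g. a (inv\<^bsub>G\<^esub> k \<otimes>\<^bsub>G\<^esub> (k \<otimes>\<^bsub>G\<^esub> g)) \<cdot>\<^sub>m \<rho> (k \<otimes>\<^bsub>G\<^esub> g))"
  proof (rule mat_sum_cong)
    fix g assume g: "g \<in> carrier G"
    have "\<rho> k * \<rho> g = \<rho> (k \<otimes>\<^bsub>G\<^esub> g)" using rho k g by (simp add: is_rep_def)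
    then show "\<rho> k * (a g \<cdot>\<^sub>m \<rho> g) = a (inv\<^bsub>G\<^esub> k \<otimes>\<^bsub>G\<^esub> (k \<otimes>\<^bsub>G\<^esub> g)) \<cdot>\<^sub>m \<rho> (k \<otimes>\<^bsub>G\<^esub> g)"
      using mult_smult_distrib[OF c[OF k] c[OF g], of "a g"] k g by (simp add: m_assoc[symmetric])
  qed
  also have "\<dots> = mat_sum n n (carrier G) (\<lambda>g. a (inv\<^bsub>G\<^esub> k \<otimes>\<^bsub>G\<^esub> g) \<cdot>\<^sub>m \<rho> g)"
    by (rule mat_sum_reindex_bij_betw[OF bij_betw_mult_left[OF G fin k], where f = "\<lambda>g. a (inv\<^bsub>G\<^esub> k \<otimes>\<^bsub>G\<^esub> g) \<cdot>\<^sub>m \<rho> g"])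
  finally show ?thesis by (simp add: group_op_def)
qed

lemma group_op_rep:
  assumes rho: "is_rep G n \<rho>" and k: "k \<in> carrier G"
  shows "group_op n G \<rho> a * \<rho> k = group_op n G \<rho> (\<lambda>g. a (g \<otimes>\<^bsub>G\<^esub> inv\<^bsub>G\<^esub> k))"
proof -
  have c: "\<rho> g \<in> carrier_mat n n" if "g \<in> carrier G" for g using rho that by (auto simp: is_rep_def)
  have "group_op n G \<rho> a * \<rho> k = mat_sum n n (carrier G) (\<lambda>g. (a g \<cdot>\<^sub>m \<rho> g) * \<rho> k)"
    unfolding group_op_def using c k by (intro mat_sum_mult) auto
  also have "\<dots> = mat_sum n n (carrier G) (\<lambda>g. a (g \<otimes>\<^bsub>G\<^esub> k \<otimes>\<^bsub>G\<^esub> inv\<^bsub>G\<^esub> k) \<cdot>\<^sub>m \<rho> (g \<otimes>\<^bsub>G\<^esub> k))"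
  proof (rule mat_sum_cong)
    fix g assume g: "g \<in> carrier G"
    have "\<rho> g * \<rho> k = \<rho> (g \<otimes>\<^bsub>G\<^esub> k)" using rho k g by (simp add: is_rep_def)
    then show "(a g \<cdot>\<^sub>m \<rho> g) * \<rho> k = a (g \<otimes>\<^bsub>G\<^esub> k \<otimes>\<^bsub>G\<^esub> inv\<^bsub>G\<^esub> k) \<cdot>\<^sub>m \<rho> (g \<otimes>\<^bsub>G\<^esub> k)"
      using mult_smult_assoc_mat[OF c[OF g] c[OF k], of "a g"] k g by (simp add: m_assoc)
  qed
  also have "\<dots> = mat_sum n n (carrier G) (\<lambda>g. a (g \<otimes>\<^bsub>G\<^esub> inv\<^bsub>G\<^esub> k) \<cdot>\<^sub>m \<rho> g)"
    by (rule mat_sum_reindex_bij_betw[OF bij_betw_mult_right[OF G fin k], where f = "\<lambda>g. a (g \<otimes>\<^bsub>G\<^esub> inv\<^bsub>G\<^esub> k) \<cdot>\<^sub>m \<rho> g"])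
  finally show ?thesis by (simp add: group_op_def)
qed

lemma rep_mult_entry:
  assumes "is_rep G n R" "g \<in> carrier G" "h \<in> carrier G" "a < n" "b < n"
  shows "R (g \<otimes>\<^bsub>G\<^esub> h) $$ (a, b) = (\<Sum>f<n. R g $$ (a, f) * R h $$ (f, b))"
proof -
  have "R g \<in> carrier_mat n n" "R h \<in> carrier_mat n n" using assms by (auto simp: is_rep_def)
  moreover have "R (g \<otimes>\<^bsub>G\<^esub> h) = R g * R h" using assms by (simp add: is_rep_def)
  ultimately show ?thesis using assms(4,5) by (simp add: scalar_prod_def lessThan_atLeast0)
qed

text \<open>This is the multiplication rule of matrix units. Expanding \<open>R (inv g * h)\<close>
  by entries leaves a Schur sum over \<open>h\<close> in which only \<open>f = c\<close> survives,
  and the value of that sum cancels one of the two normalising factors.\<close>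

lemma munit_conv:
  assumes R: "is_irr_rep G n R" and g: "g \<in> carrier G" and ix: "a < n" "b < n" "c < n" "d < n"
  shows "(\<Sum>h\<in>carrier G. munit G n R c d h * munit G n R a b (inv\<^bsub>G\<^esub> h \<otimes>\<^bsub>G\<^esub> g)) =
    (if a = d then munit G n R c b g else 0)"
proof -
  let ?q = "of_nat n / of_nat (card (carrier G)) :: complex"
  have Rr: "is_rep G n R" using R by (simp add: is_irr_rep_def)
  have q: "?q * (of_nat (card (carrier G)) / of_nat n) = 1" using card_carrier_pos ix by simp
  have "(\<Sum>h\<in>carrier G. munit G n R c d h * munit G n R a b (inv\<^bsub>G\<^esub> h \<otimes>\<^bsub>G\<^esub> g)) =
    (\<Sum>h\<in>carrier G. \<Sum>f<n. ?q * ?q * (R (inv\<^bsub>G\<^esub> g) $$ (b, f) * (R h $$ (f, a) * R (inv\<^bsub>G\<^esub> h) $$ (d, c))))"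
  proof (rule sum.cong[OF refl])
    fix h assume h: "h \<in> carrier G"
    have "inv\<^bsub>G\<^esub> (inv\<^bsub>G\<^esub> h \<otimes>\<^bsub>G\<^esub> g) = inv\<^bsub>G\<^esub> g \<otimes>\<^bsub>G\<^esub> h" using g h by (simp add: inv_mult_group)
    then show "munit G n R c d h * munit G n R a b (inv\<^bsub>G\<^esub> h \<otimes>\<^bsub>G\<^esub> g) =
      (\<Sum>f<n. ?q * ?q * (R (inv\<^bsub>G\<^esub> g) $$ (b, f) * (R h $$ (f, a) * R (inv\<^bsub>G\<^esub> h) $$ (d, c))))"
      using rep_mult_entry[OF Rr inv_closed[OF g] h ix(2,1)]
      by (simp add: munit_def sum_distrib_left sum_distrib_right ac_simps)
  qed
  also have "\<dots> = (\<Sum>f<n. ?q * ?q * (R (inv\<^bsub>G\<^esub> g) $$ (b, f) * (\<Sum>h\<in>carrier G. R h $$ (f, a) * R (inv\<^bsub>G\<^esub> h) $$ (d, c))))"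
    by (subst sum.swap) (simp add: sum_distrib_left)
  also have "\<dots> = (\<Sum>f<n. if f = c then (if a = d then munit G n R c b g else 0) else 0)"
  proof (rule sum.cong[OF refl])
    fix f assume f: "f \<in> {..<n}"
    show "?q * ?q * (R (inv\<^bsub>G\<^esub> g) $$ (b, f) * (\<Sum>h\<in>carrier G. R h $$ (f, a) * R (inv\<^bsub>G\<^esub> h) $$ (d, c))) =
      (if f = c then (if a = d then munit G n R c b g else 0) else 0)"
      using schur_eq[OF G fin R, of f a d c] f ix q by (simp add: munit_def)
  qed
  finally show ?thesis using ix by simp
qed

text \<open>In the block of \<open>R\<close>, the group element \<open>k\<close> times the sum of
  the diagonal units is the matrix \<open>R k\<close> written out in matrix units. The lemma is the
  coefficient form of this.\<close>

lemma munit_translate: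
  assumes R: "is_rep G n R" and g: "g \<in> carrier G" and k: "k \<in> carrier G"
  shows "(\<Sum>a<n. munit G n R a a (inv\<^bsub>G\<^esub> k \<otimes>\<^bsub>G\<^esub> g)) = (\<Sum>a<n. \<Sum>c<n. R k $$ (c, a) * munit G n R c a g)"
proof (rule sum.cong[OF refl])
  fix a assume "a \<in> {..<n}"
  moreover have "inv\<^bsub>G\<^esub> (inv\<^bsub>G\<^esub> k \<otimes>\<^bsub>G\<^esub> g) = inv\<^bsub>G\<^esub> g \<otimes>\<^bsub>G\<^esub> k" using g k by (simp add: inv_mult_group)
  ultimately show "munit G n R a a (inv\<^bsub>G\<^esub> k \<otimes>\<^bsub>G\<^esub> g) = (\<Sum>c<n. R k $$ (c, a) * munit G n R c a g)"
    using rep_mult_entry[OF R inv_closed[OF g] k, of a a]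
    by (simp add: munit_def sum_distrib_left ac_simps)
qed

text \<open>The pairing is the trace of a diagonal matrix unit in the representation affording
  \<psi>. A unit of rank one gives exactly 1 on its own character, where the central idempotent
  would give the degree, so multiplicities are read off without denominators.\<close>

lemma munit_char:
  assumes R: "is_irr_rep G n R" and psi: "\<psi> \<in> irr_chars G" and a: "a < n"
  shows "(\<Sum>g\<in>carrier G. munit G n R a a g * \<psi> g) = (if \<psi> = char_of G n R then 1 else 0)"
proof -
  let ?q = "of_nat n / of_nat (card (carrier G)) :: complex"
  have Rr: "is_rep G n R" using R by (simp add: is_irr_rep_def)
  have q: "?q * (of_nat (card (carrier G)) / of_nat n) = 1" using card_carrier_pos a by simp
  have exp: "(\<Sum>g\<in>carrier G. munit G n R a a g * char_of G m S g) =
    ?q * (\<Sum>b<m. \<Sum>g\<in>carrier G. S g $$ (b, b) * R (inv\<^bsub>G\<^esub> g) $$ (a, a))"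
    if "is_rep G m S" for m S
  proof -
    have "(\<Sum>g\<in>carrier G. munit G n R a a g * char_of G m S g) =
      (\<Sum>g\<in>carrier G. \<Sum>b<m. ?q * (S g $$ (b, b) * R (inv\<^bsub>G\<^esub> g) $$ (a, a)))"
      by (intro sum.cong) (auto simp: char_of_def munit_def sum_distrib_left sum_divide_distrib ac_simps)
    also have "\<dots> = (\<Sum>b<m. \<Sum>g\<in>carrier G. ?q * (S g $$ (b, b) * R (inv\<^bsub>G\<^esub> g) $$ (a, a)))"
      by (rule sum.swap)
    finally show ?thesis by (simp add: sum_distrib_left)
  qed
  show ?thesis
  proof (cases "\<psi> = char_of G n R")
    case True
    have "(\<Sum>g\<in>carrier G. munit G n R a a g * char_of G n R g) =
      ?q * (\<Sum>b<n. if b = a then of_nat (card (carrier G)) / of_nat n else 0)"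
      unfolding exp[OF Rr] using a by (intro arg_cong[where f = "\<lambda>x. ?q * x"] sum.cong refl)
        (simp add: schur_eq[OF G fin R])
    then show ?thesis using True a q by simp
  next
    case False
    from psi obtain m S where S: "is_irr_rep G m S" "\<psi> = char_of G m S" by (auto simp: irr_chars_def)
    have Sr: "is_rep G m S" using S by (simp add: is_irr_rep_def)
    \<comment> \<open>Characters vanish off the group, so distinct ones already differ at a group
      element.\<close>
    have "\<exists>k\<in>carrier G. char_of G m S k \<noteq> char_of G n R k"
    proof (rule ccontr)
      assume "\<not> ?thesis"
      then have "char_of G m S = char_of G n R" by (auto simp: char_of_def fun_eq_iff)
      then show False using False S by simp
    qed
    then obtain k where k: "k \<in> carrier G" "mtrace (S k) \<noteq> mtrace (R k)"
      using char_of_mtrace[OF Sr] char_of_mtrace[OF Rr] by metis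
    have "(\<Sum>g\<in>carrier G. munit G n R a a g * \<psi> g) = 0"
      unfolding S(2) exp[OF Sr] using schur_neq[OF G fin S(1) R k] a by simp
    then show ?thesis using False by simp
  qed
qed

lemma group_op_munit_mult:
  assumes rho: "is_rep G N \<rho>" and R: "is_irr_rep G n R" and ix: "a < n" "b < n" "c < n" "d < n"
  shows "group_op N G \<rho> (munit G n R c d) * group_op N G \<rho> (munit G n R a b) =
    (if a = d then group_op N G \<rho> (munit G n R c b) else 0\<^sub>m N N)"
proof -
  have "group_op N G \<rho> (munit G n R c d) * group_op N G \<rho> (munit G n R a b) =
    group_op N G \<rho> (\<lambda>g. if a = d then munit G n R c b g else 0)"
    unfolding group_op_mult[OF rho] by (intro group_op_cong munit_conv[OF R] ix)
  then show ?thesis using group_op_zero[OF rho] by simp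
qed

text \<open>The image of \<open>z\<close> has the shape of \<open>R\<close> tensored with a
  multiplicity space, and \<open>B\<close>, commuting with the group, acts on the second factor
  only. The image of the unit at (0, 0) is a copy of the multiplicity space, which explains the
  factorisation of the trace.\<close>

lemma isotypic_projection:
  assumes rho: "is_rep G N \<rho>" and R: "is_irr_rep G n R"
  defines "z \<equiv> group_op N G \<rho> (\<lambda>g. \<Sum>a<n. munit G n R a a g)"
  shows isotypic_idem: "z * z = z"
    and isotypic_central: "k \<in> carrier G \<Longrightarrow> z * \<rho> k = \<rho> k * z"
    and isotypic_mtrace: "\<lbrakk>k \<in> carrier G; B \<in> carrier_mat N N; \<And>g. g \<in> carrier G \<Longrightarrow> B * \<rho> g = \<rho> g * B\<rbrakk> \<Longrightarrow>
      mtrace (B * (\<rho> k * z)) = mtrace (R k) * mtrace (B * group_op N G \<rho> (munit G n R 0 0))"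
proof -
  have Rr: "is_rep G n R" and n: "n > 0" using R by (auto simp: is_irr_rep_def)
  show "z * z = z"
    unfolding z_def group_op_mult[OF rho]
  proof (rule group_op_cong)
    fix g assume g: "g \<in> carrier G"
    have "(\<Sum>h\<in>carrier G. (\<Sum>a<n. munit G n R a a h) * (\<Sum>a<n. munit G n R a a (inv\<^bsub>G\<^esub> h \<otimes>\<^bsub>G\<^esub> g))) =
      (\<Sum>a<n. \<Sum>b<n. \<Sum>h\<in>carrier G. munit G n R a a h * munit G n R b b (inv\<^bsub>G\<^esub> h \<otimes>\<^bsub>G\<^esub> g))"
    proof -
      have "(\<Sum>h\<in>carrier G. (\<Sum>a<n. munit G n R a a h) * (\<Sum>a<n. munit G n R a a (inv\<^bsub>G\<^esub> h \<otimes>\<^bsub>G\<^esub> g))) =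
        (\<Sum>h\<in>carrier G. \<Sum>a<n. \<Sum>b<n. munit G n R a a h * munit G n R b b (inv\<^bsub>G\<^esub> h \<otimes>\<^bsub>G\<^esub> g))"
        by (simp add: sum_product)
      also have "\<dots> = (\<Sum>a<n. \<Sum>h\<in>carrier G. \<Sum>b<n. munit G n R a a h * munit G n R b b (inv\<^bsub>G\<^esub> h \<otimes>\<^bsub>G\<^esub> g))"
        by (rule sum.swap)
      also have "\<dots> = (\<Sum>a<n. \<Sum>b<n. \<Sum>h\<in>carrier G. munit G n R a a h * munit G n R b b (inv\<^bsub>G\<^esub> h \<otimes>\<^bsub>G\<^esub> g))"
        by (rule sum.cong[OF refl], rule sum.swap)
      finally show ?thesis .
    qed
    also have "\<dots> = (\<Sum>a<n. \<Sum>b<n. if b = a then munit G n R a b g else 0)"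
      by (intro sum.cong refl) (simp add: munit_conv[OF R g])
    also have "\<dots> = (\<Sum>a<n. munit G n R a a g)" by simp
    finally show "(\<Sum>h\<in>carrier G. (\<Sum>a<n. munit G n R a a h) * (\<Sum>a<n. munit G n R a a (inv\<^bsub>G\<^esub> h \<otimes>\<^bsub>G\<^esub> g))) =
      (\<Sum>a<n. munit G n R a a g)" .
  qed
  show "z * \<rho> k = \<rho> k * z" if k: "k \<in> carrier G"
    unfolding z_def group_op_rep[OF rho k] rep_group_op[OF rho k]
  proof (rule group_op_cong)
    fix g assume g: "g \<in> carrier G"
    have "(\<Sum>a<n. munit G n R a a (g \<otimes>\<^bsub>G\<^esub> inv\<^bsub>G\<^esub> k)) = (\<Sum>a<n. \<Sum>c<n. R k $$ (a, c) * munit G n R a c g)"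
    proof (rule sum.cong[OF refl])
      fix a assume "a \<in> {..<n}"
      moreover have "inv\<^bsub>G\<^esub> (g \<otimes>\<^bsub>G\<^esub> inv\<^bsub>G\<^esub> k) = k \<otimes>\<^bsub>G\<^esub> inv\<^bsub>G\<^esub> g" using g k by (simp add: inv_mult_group)
      ultimately show "munit G n R a a (g \<otimes>\<^bsub>G\<^esub> inv\<^bsub>G\<^esub> k) = (\<Sum>c<n. R k $$ (a, c) * munit G n R a c g)"
        using rep_mult_entry[OF Rr k inv_closed[OF g], of a a]
        by (simp add: munit_def sum_distrib_left ac_simps)
    qed
    also have "\<dots> = (\<Sum>a<n. munit G n R a a (inv\<^bsub>G\<^esub> k \<otimes>\<^bsub>G\<^esub> g))"
      unfolding munit_translate[OF Rr g k] by (rule sum.swap)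
    finally show "(\<Sum>a<n. munit G n R a a (g \<otimes>\<^bsub>G\<^esub> inv\<^bsub>G\<^esub> k)) = (\<Sum>a<n. munit G n R a a (inv\<^bsub>G\<^esub> k \<otimes>\<^bsub>G\<^esub> g))" .
  qed
  show "mtrace (B * (\<rho> k * z)) = mtrace (R k) * mtrace (B * group_op N G \<rho> (munit G n R 0 0))"
    if k: "k \<in> carrier G" and B: "B \<in> carrier_mat N N" and comm: "\<And>g. g \<in> carrier G \<Longrightarrow> B * \<rho> g = \<rho> g * B"
  proof -
    let ?e = "\<lambda>a b. group_op N G \<rho> (munit G n R a b)"
    have ec: "?e a b \<in> carrier_mat N N" for a b by simp
    have B0: "mtrace (B * 0\<^sub>m N N) = 0" using B by (simp add: mtrace_def)
    \<comment> \<open>Write the unit at (c, a) as the product of those at (c, 0) and (0, a). Moving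
      the latter cyclically to the front and past \<open>B\<close> leaves the unit at (0, 0) or
      zero.\<close>
    have te: "mtrace (B * ?e c a) = (if c = a then mtrace (B * ?e 0 0) else 0)" if ca: "c < n" "a < n" for c a
    proof -
      have "B * ?e c a = B * (?e c 0 * ?e 0 a)"
        using group_op_munit_mult[OF rho R, of 0 a c 0] n ca by simp
      also have "\<dots> = B * ?e c 0 * ?e 0 a" using assoc_mult_mat[OF B ec ec] by simp
      also have "mtrace \<dots> = mtrace (?e 0 a * (B * ?e c 0))"
        using B ec by (intro mtrace_comm[of _ N N]) (auto intro!: mult_carrier_mat)
      also have "?e 0 a * (B * ?e c 0) = ?e 0 a * B * ?e c 0" using assoc_mult_mat[OF ec B ec] by simp
      also have "\<dots> = B * ?e 0 a * ?e c 0" using group_op_commute[OF rho B comm] by simp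
      also have "\<dots> = B * (?e 0 a * ?e c 0)" using assoc_mult_mat[OF B ec ec] by simp
      also have "\<dots> = B * (if c = a then ?e 0 0 else 0\<^sub>m N N)"
        using group_op_munit_mult[OF rho R, of c 0 0 a] n ca by simp
      finally show ?thesis using B0 by simp
    qed
    have "mtrace (B * (\<rho> k * z)) = (\<Sum>g\<in>carrier G. (\<Sum>a<n. \<Sum>c<n. R k $$ (c, a) * munit G n R c a g) * mtrace (B * \<rho> g))"
      unfolding z_def rep_group_op[OF rho k] mtrace_group_op[OF rho B]
      by (intro sum.cong refl) (simp add: munit_translate[OF Rr _ k])
    also have "\<dots> = (\<Sum>g\<in>carrier G. \<Sum>a<n. \<Sum>c<n. R k $$ (c, a) * (munit G n R c a g * mtrace (B * \<rho> g)))"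
      by (simp add: sum_distrib_right mult.assoc)
    also have "\<dots> = (\<Sum>a<n. \<Sum>g\<in>carrier G. \<Sum>c<n. R k $$ (c, a) * (munit G n R c a g * mtrace (B * \<rho> g)))"
      by (rule sum.swap)
    also have "\<dots> = (\<Sum>a<n. \<Sum>c<n. \<Sum>g\<in>carrier G. R k $$ (c, a) * (munit G n R c a g * mtrace (B * \<rho> g)))"
      by (rule sum.cong[OF refl], rule sum.swap)
    also have "\<dots> = (\<Sum>a<n. \<Sum>c<n. R k $$ (c, a) * mtrace (B * ?e c a))"
      unfolding mtrace_group_op[OF rho B] by (simp add: sum_distrib_left)
    also have "\<dots> = (\<Sum>a<n. \<Sum>c<n. if c = a then R k $$ (a, a) * mtrace (B * ?e 0 0) else 0)"
    proof (intro sum.cong refl)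
      fix a c assume "a \<in> {..<n}" "c \<in> {..<n}"
      then show "R k $$ (c, a) * mtrace (B * ?e c a) = (if c = a then R k $$ (a, a) * mtrace (B * ?e 0 0) else 0)"
        by (subst te) auto
    qed
    also have "\<dots> = (\<Sum>a<n. R k $$ (a, a)) * mtrace (B * ?e 0 0)"
      by (simp add: sum_distrib_right)
    also have "(\<Sum>a<n. R k $$ (a, a)) = mtrace (R k)"
      using Rr k by (auto simp: mtrace_def is_rep_def)
    finally show ?thesis .
  qed
qed

text \<open>The trace of the projection is the degree of \<open>R\<close> times the number of
  occurrences of its character in the list, which is positive.\<close>

lemma isotypic_mtrace_pos:
  assumes rho: "is_rep G N \<rho>" and R: "is_irr_rep G n R"
    and xs: "set \<chi>s \<subseteq> irr_chars G" "\<And>g. g \<in> carrier G \<Longrightarrow> mtrace (\<rho> g) = (\<Sum>\<chi>\<leftarrow>\<chi>s. \<chi> g)"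
    and mem: "char_of G n R \<in> set \<chi>s"
  shows "group_op N G \<rho> (\<lambda>g. \<Sum>a<n. munit G n R a a g) \<noteq> 0\<^sub>m N N"
proof
  let ?z = "group_op N G \<rho> (\<lambda>g. \<Sum>a<n. munit G n R a a g)"
  assume z: "?z = 0\<^sub>m N N"
  have n: "n > 0" using R by (auto simp: is_irr_rep_def)
  have sw: "(\<Sum>g\<in>carrier G. u g * (\<Sum>\<chi>\<leftarrow>ys. \<chi> g)) = (\<Sum>\<chi>\<leftarrow>ys. \<Sum>g\<in>carrier G. u g * \<chi> g)" for u :: "'g \<Rightarrow> complex" and ys
    by (induction ys) (auto simp: sum.distrib distrib_left)
  have one: "(\<Sum>g\<in>carrier G. (\<Sum>a<n. munit G n R a a g) * \<chi> g) = (if \<chi> = char_of G n R then of_nat n else 0)"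
    if "\<chi> \<in> irr_chars G" for \<chi>
  proof -
    have "(\<Sum>g\<in>carrier G. (\<Sum>a<n. munit G n R a a g) * \<chi> g) = (\<Sum>a<n. \<Sum>g\<in>carrier G. munit G n R a a g * \<chi> g)"
      by (simp add: sum_distrib_right) (rule sum.swap)
    also have "\<dots> = (\<Sum>a<n. if \<chi> = char_of G n R then 1 else 0)"
      by (intro sum.cong refl munit_char[OF R that]) simp
    finally show ?thesis by simp
  qed
  have "mtrace ?z = mtrace (1\<^sub>m N * ?z)" by (subst left_mult_one_mat[OF group_op_carrier]) (rule refl)
  also have "\<dots> = (\<Sum>g\<in>carrier G. (\<Sum>a<n. munit G n R a a g) * mtrace (1\<^sub>m N * \<rho> g))"
    by (rule mtrace_group_op[OF rho]) simp
  also have "\<dots> = (\<Sum>g\<in>carrier G. (\<Sum>a<n. munit G n R a a g) * (\<Sum>\<chi>\<leftarrow>\<chi>s. \<chi> g))"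
    using rho xs(2) by (intro sum.cong refl) (auto simp: is_rep_def)
  also have "\<dots> = (\<Sum>\<chi>\<leftarrow>\<chi>s. if \<chi> = char_of G n R then of_nat n else 0)"
    unfolding sw using one xs(1) by (intro arg_cong[where f = sum_list] map_cong) auto
  also have "\<dots> = of_nat (count_list \<chi>s (char_of G n R) * n)"
    by (induction \<chi>s) (auto simp: algebra_simps)
  also have "\<dots> \<noteq> 0"
    using mem n count_notin[of "char_of G n R" \<chi>s] by (auto simp: count_list_0_iff)
  finally show False using z by (simp add: mtrace_def)
qed

end

section \<open>Characters of commuting representations\<close>

lemma idem_compl_neq_one:
  assumes Q: "Q \<in> carrier_mat n n" and QQ: "Q * Q = (Q :: complex mat)" and Q0: "Q \<noteq> 0\<^sub>m n n"
  shows "1\<^sub>m n - Q \<noteq> 1\<^sub>m n"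
proof
  assume h: "1\<^sub>m n - Q = 1\<^sub>m n"
  have "Q = 0\<^sub>m n n"
  proof (rule eq_matI)
    fix i j assume "i < dim_row (0\<^sub>m n n :: complex mat)" "j < dim_col (0\<^sub>m n n :: complex mat)"
    then have ij: "i < n" "j < n" by auto
    then have "(1\<^sub>m n - Q) $$ (i, j) = 1\<^sub>m n $$ (i, j) - Q $$ (i, j)" using Q by simp
    then show "Q $$ (i, j) = 0\<^sub>m n n $$ (i, j)" using ij unfolding h by simp
  qed (use Q in auto)
  then show False using Q0 by simp
qed

lemma commute_compl:
  assumes "Q \<in> carrier_mat n n" "A \<in> carrier_mat n n" "A * Q = Q * (A :: complex mat)"
  shows "A * (1\<^sub>m n - Q) = (1\<^sub>m n - Q) * A"
  using mult_minus_distrib_mat[of A n n "1\<^sub>m n" n Q] minus_mult_distrib_mat[of "1\<^sub>m n" n n Q A n] assms by auto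

text \<open>Commuting families on one space stand for a representation of the direct product of the
  \<open>K i\<close>, without that group being formed. The outer induction removes the last family
  by passing to a multiplicity space; the inner one, on the degree, removes one isotypic
  component.\<close>

theorem commuting_reps_char:
  assumes "\<And>i. i < s \<Longrightarrow> group (K i)" "\<And>i. i < s \<Longrightarrow> finite (carrier (K i))"
    and "\<And>i. i < s \<Longrightarrow> is_rep (K i) N (\<rho> i)"
    and "\<And>i j g h. i < s \<Longrightarrow> j < s \<Longrightarrow> i \<noteq> j \<Longrightarrow> g \<in> carrier (K i) \<Longrightarrow> h \<in> carrier (K j) \<Longrightarrow>
      \<rho> i g * \<rho> j h = \<rho> j h * \<rho> i g"
  shows "\<exists>ms. (\<forall>\<chi>s\<in>set ms. length \<chi>s = s \<and> (\<forall>i<s. \<chi>s ! i \<in> irr_chars (K i))) \<and>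
    (\<forall>ks. (\<forall>i<s. ks i \<in> carrier (K i)) \<longrightarrow>
      mtrace (mprod N s (\<lambda>i. \<rho> i (ks i))) = (\<Sum>\<chi>s\<leftarrow>ms. \<Prod>i<s. (\<chi>s ! i) (ks i)))"
  using assms
proof (induction s arbitrary: N \<rho>)
  case 0
  \<comment> \<open>Without families the product is the identity matrix, whose trace is
    \<open>N\<close> copies of the empty product.\<close>
  show ?case by (intro exI[of _ "replicate N []"]) (auto simp: sum_list_replicate)
next
  case (Suc s)
  note outer = Suc.IH
  note gr = Suc.prems(1) and fi = Suc.prems(2)
  show ?case
    using Suc.prems(3,4)
  proof (induction N arbitrary: \<rho> rule: less_induct)
    case (less N)
    have c: "\<rho> i g \<in> carrier_mat N N" if "i < Suc s" "g \<in> carrier (K i)" for i g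
      using less.prems(1)[OF that(1)] that(2) by (simp add: is_rep_def)
    note comm = less.prems(2)
    show ?case
    proof (cases "N = 0")
      case True
      have "mtrace (mprod N (Suc s) (\<lambda>i. \<rho> i (ks i))) = 0" if "\<forall>i<Suc s. ks i \<in> carrier (K i)" for ks
      proof -
        have "mprod N (Suc s) (\<lambda>i. \<rho> i (ks i)) \<in> carrier_mat N N"
          using c that by (intro mprod_carrier) auto
        then show ?thesis using True by (auto simp: mtrace_def)
      qed
      then show ?thesis by (intro exI[of _ "[]"]) auto
    next
      case False
      have rs: "is_rep (K s) N (\<rho> s)" and gs: "group (K s)" and fs: "finite (carrier (K s))"
        using less.prems(1) gr fi by auto
      from rep_char_sum[OF rs gs] False obtain xs where xs: "set xs \<subseteq> irr_chars (K s)"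
        "\<And>g. g \<in> carrier (K s) \<Longrightarrow> mtrace (\<rho> s g) = (\<Sum>\<chi>\<leftarrow>xs. \<chi> g)" "xs \<noteq> []" by blast
      obtain x where x: "x \<in> set xs" using xs(3) by (cases xs) auto
      then have "x \<in> irr_chars (K s)" using xs(1) by blast
      then obtain n R where R: "is_irr_rep (K s) n R" and xR: "x = char_of (K s) n R"
        by (auto simp: irr_chars_def)
      have n: "n > 0" using R by (simp add: is_irr_rep_def)
      \<comment> \<open>\<open>z\<close> projects onto the \<open>R\<close>-isotypic component of
        the last family. \<open>e\<close> cuts out the multiplicity space, on which the first
        \<open>s\<close> families still act because they commute with the last one.\<close>
      define z where "z = group_op N (K s) (\<rho> s) (\<lambda>g. \<Sum>a<n. munit (K s) n R a a g)"
      define e where "e = group_op N (K s) (\<rho> s) (munit (K s) n R 0 0)"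
      have zc: "z \<in> carrier_mat N N" and ec: "e \<in> carrier_mat N N" by (simp_all add: z_def e_def)
      have zz: "z * z = z" unfolding z_def by (rule isotypic_idem[OF gs fs rs R])
      have ee: "e * e = e" unfolding e_def using group_op_munit_mult[OF gs fs rs R, of 0 0 0 0] n by simp
      have z0: "z \<noteq> 0\<^sub>m N N" unfolding z_def
        using isotypic_mtrace_pos[OF gs fs rs R xs(1,2)] x xR by simp
      have cz: "\<rho> i g * z = z * \<rho> i g" if "i < Suc s" "g \<in> carrier (K i)" for i g
      proof (cases "i = s")
        case True
        then show ?thesis using isotypic_central[OF gs fs rs R, of g] that unfolding z_def by simp
      next
        case False
        then show ?thesis unfolding z_def using that c comm by (intro group_op_commute[OF rs]) auto
      qed
      have ce: "\<rho> i g * e = e * \<rho> i g" if "i < s" "g \<in> carrier (K i)" for i g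
        unfolding e_def using that c comm by (intro group_op_commute[OF rs]) auto
      let ?z' = "1\<^sub>m N - z"
      have z'c: "?z' \<in> carrier_mat N N" using zc by auto
      have z'z': "?z' * ?z' = ?z'" by (rule idem_compl[OF zc zz])
      have cz': "\<rho> i g * ?z' = ?z' * \<rho> i g" if "i < Suc s" "g \<in> carrier (K i)" for i g
        using commute_compl[OF zc c[OF that] cz[OF that]] .
      from idem_frame[OF ec ee] obtain r C D where fr: "frame N r C D" "C * D = e" by metis
      \<comment> \<open>\<open>z\<close> is nonzero, so the complement has smaller degree. As
        \<open>1 - z\<close> commutes with everything, all \<open>Suc s\<close> families act on it
        and the inner induction applies.\<close>
      from idem_frame[OF z'c z'z'] idem_compl_neq_one[OF zc zz z0] obtain r' C' D' where
        fr': "frame N r' C' D'" "C' * D' = ?z'" and r': "r' < N" by metis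
      have inv: "Q * A * Q = A * Q" if "Q \<in> carrier_mat N N" "A \<in> carrier_mat N N" "Q * Q = Q" "A * Q = Q * A"
        for A Q :: "complex mat"
        using that assoc_mult_mat[of A N N Q N Q N] by simp
      have compr: "\<exists>ms. (\<forall>\<chi>s\<in>set ms. length \<chi>s = s \<and> (\<forall>i<s. \<chi>s ! i \<in> irr_chars (K i))) \<and>
        (\<forall>ks. (\<forall>i<s. ks i \<in> carrier (K i)) \<longrightarrow>
          mtrace (mprod r s (\<lambda>i. D * \<rho> i (ks i) * C)) = (\<Sum>\<chi>s\<leftarrow>ms. \<Prod>i<s. (\<chi>s ! i) (ks i)))"
      proof (rule outer[where \<rho> = "\<lambda>i g. D * \<rho> i g * C"])
        fix i assume i: "i < s"
        show "group (K i)" "finite (carrier (K i))" using gr fi i by auto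
        show "is_rep (K i) r (\<lambda>g. D * \<rho> i g * C)"
          using less.prems(1)[of i] i gr inv[OF ec c ee ce]
          by (intro compress_rep[OF _ _ fr]) auto
      next
        fix i j g h assume ij: "i < s" "j < s" "i \<noteq> j" and g: "g \<in> carrier (K i)" and h: "h \<in> carrier (K j)"
        have "(D * \<rho> i g * C) * (D * \<rho> j h * C) = D * (\<rho> i g * \<rho> j h) * C"
          using c ij g h inv[OF ec c ee ce] by (intro compress_mult[OF fr]) auto
        moreover have "(D * \<rho> j h * C) * (D * \<rho> i g * C) = D * (\<rho> j h * \<rho> i g) * C"
          using c ij g h inv[OF ec c ee ce] by (intro compress_mult[OF fr]) auto
        ultimately show "(D * \<rho> i g * C) * (D * \<rho> j h * C) = (D * \<rho> j h * C) * (D * \<rho> i g * C)"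
          using comm[of i j g h] ij g h by simp
      qed
      then obtain ms where ms: "\<And>\<chi>s. \<chi>s \<in> set ms \<Longrightarrow> length \<chi>s = s \<and> (\<forall>i<s. \<chi>s ! i \<in> irr_chars (K i))"
        "\<And>ks. (\<forall>i<s. ks i \<in> carrier (K i)) \<Longrightarrow>
          mtrace (mprod r s (\<lambda>i. D * \<rho> i (ks i) * C)) = (\<Sum>\<chi>s\<leftarrow>ms. \<Prod>i<s. (\<chi>s ! i) (ks i))" by blast
      have "\<exists>ms. (\<forall>\<chi>s\<in>set ms. length \<chi>s = Suc s \<and> (\<forall>i<Suc s. \<chi>s ! i \<in> irr_chars (K i))) \<and>
        (\<forall>ks. (\<forall>i<Suc s. ks i \<in> carrier (K i)) \<longrightarrow>
          mtrace (mprod r' (Suc s) (\<lambda>i. D' * \<rho> i (ks i) * C')) = (\<Sum>\<chi>s\<leftarrow>ms. \<Prod>i<Suc s. (\<chi>s ! i) (ks i)))"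
      proof (rule less.IH[OF r', where \<rho> = "\<lambda>i g. D' * \<rho> i g * C'"])
        fix i assume i: "i < Suc s"
        show "is_rep (K i) r' (\<lambda>g. D' * \<rho> i g * C')"
          using less.prems(1)[of i] i gr inv[OF z'c c z'z' cz']
          by (intro compress_rep[OF _ _ fr']) auto
      next
        fix i j g h assume ij: "i < Suc s" "j < Suc s" "i \<noteq> j" and g: "g \<in> carrier (K i)" and h: "h \<in> carrier (K j)"
        have "(D' * \<rho> i g * C') * (D' * \<rho> j h * C') = D' * (\<rho> i g * \<rho> j h) * C'"
          using c ij g h inv[OF z'c c z'z' cz'] by (intro compress_mult[OF fr']) auto
        moreover have "(D' * \<rho> j h * C') * (D' * \<rho> i g * C') = D' * (\<rho> j h * \<rho> i g) * C'"
          using c ij g h inv[OF z'c c z'z' cz'] by (intro compress_mult[OF fr']) auto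
        ultimately show "(D' * \<rho> i g * C') * (D' * \<rho> j h * C') = (D' * \<rho> j h * C') * (D' * \<rho> i g * C')"
          using comm[of i j g h] ij g h by simp
      qed
      then obtain ms' where ms': "\<And>\<chi>s. \<chi>s \<in> set ms' \<Longrightarrow> length \<chi>s = Suc s \<and> (\<forall>i<Suc s. \<chi>s ! i \<in> irr_chars (K i))"
        "\<And>ks. (\<forall>i<Suc s. ks i \<in> carrier (K i)) \<Longrightarrow>
          mtrace (mprod r' (Suc s) (\<lambda>i. D' * \<rho> i (ks i) * C')) = (\<Sum>\<chi>s\<leftarrow>ms'. \<Prod>i<Suc s. (\<chi>s ! i) (ks i))" by blast
      have main: "mtrace (mprod N (Suc s) (\<lambda>i. \<rho> i (ks i))) =
          (\<Sum>\<chi>s\<leftarrow>map (\<lambda>\<chi>s. \<chi>s @ [x]) ms @ ms'. \<Prod>i<Suc s. (\<chi>s ! i) (ks i))"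
        if ks: "\<forall>i<Suc s. ks i \<in> carrier (K i)" for ks
      proof -
        let ?P = "mprod N (Suc s) (\<lambda>i. \<rho> i (ks i))"
        let ?B = "mprod N s (\<lambda>i. \<rho> i (ks i))"
        have Pc: "?P \<in> carrier_mat N N" using c ks by (intro mprod_carrier) auto
        have Bc: "?B \<in> carrier_mat N N" using c ks by (intro mprod_carrier) auto
        have sc: "\<rho> s (ks s) \<in> carrier_mat N N" using c ks by auto
        have "mtrace (?P * z) = mtrace (?B * (\<rho> s (ks s) * z))"
          using assoc_mult_mat[OF Bc sc zc] by simp
        also have "\<dots> = mtrace (R (ks s)) * mtrace (?B * e)"
          unfolding z_def e_def
        proof (rule isotypic_mtrace[OF gs fs rs R _ Bc])
          show "ks s \<in> carrier (K s)" using ks by simp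
          show "?B * \<rho> s g = \<rho> s g * ?B" if "g \<in> carrier (K s)" for g
            using c ks comm that by (intro mprod_commute) auto
        qed
        also have "mtrace (?B * e) = mtrace (D * ?B * C)" using compress_mtrace[OF fr Bc] by simp
        also have "D * ?B * C = mprod r s (\<lambda>i. D * \<rho> i (ks i) * C)"
          using c ks ce ee by (intro mprod_compress[OF fr, symmetric]) auto
        also have "mtrace \<dots> = (\<Sum>\<chi>s\<leftarrow>ms. \<Prod>i<s. (\<chi>s ! i) (ks i))" using ms(2) ks by simp
        also have "mtrace (R (ks s)) = x (ks s)"
          unfolding xR using char_of_mtrace[of "K s" n R "ks s"] R ks by (simp add: is_irr_rep_def)
        also have "x (ks s) * (\<Sum>\<chi>s\<leftarrow>ms. \<Prod>i<s. (\<chi>s ! i) (ks i)) =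
            (\<Sum>\<chi>s\<leftarrow>ms. (\<Prod>i<s. (\<chi>s ! i) (ks i)) * x (ks s))"
          by (simp add: sum_list_const_mult mult.commute)
        also have "\<dots> = (\<Sum>\<chi>s\<leftarrow>map (\<lambda>\<chi>s. \<chi>s @ [x]) ms. \<Prod>i<Suc s. (\<chi>s ! i) (ks i))"
          using ms(1) by (auto simp: nth_append comp_def intro!: arg_cong[where f = sum_list] prod.cong)
        finally have 1: "mtrace (?P * z) = (\<Sum>\<chi>s\<leftarrow>map (\<lambda>\<chi>s. \<chi>s @ [x]) ms. \<Prod>i<Suc s. (\<chi>s ! i) (ks i))" .
        have "mtrace (?P * ?z') = mtrace (D' * ?P * C')" using compress_mtrace[OF fr' Pc] by simp
        also have "D' * ?P * C' = mprod r' (Suc s) (\<lambda>i. D' * \<rho> i (ks i) * C')"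
          using c ks cz' z'z' by (intro mprod_compress[OF fr', symmetric]) auto
        also have "mtrace \<dots> = (\<Sum>\<chi>s\<leftarrow>ms'. \<Prod>i<Suc s. (\<chi>s ! i) (ks i))" using ms'(2) ks by simp
        finally show ?thesis using mtrace_split[OF Pc zc] 1 by simp
      qed
      have "\<forall>\<chi>s\<in>set (map (\<lambda>\<chi>s. \<chi>s @ [x]) ms @ ms'). length \<chi>s = Suc s \<and> (\<forall>i<Suc s. \<chi>s ! i \<in> irr_chars (K i))"
        using ms(1) ms'(1) x xs(1) by (auto simp: nth_append less_Suc_eq)
      then show ?thesis using main by (intro exI[of _ "map (\<lambda>\<chi>s. \<chi>s @ [x]) ms @ ms'"]) blast
    qed
  qed
qed

section \<open>Wreath products and cycle products\<close>

definition orb :: "('x \<Rightarrow> 'x) \<Rightarrow> 'x \<Rightarrow> 'x set" where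
  "orb \<sigma> p = range (\<lambda>i. (\<sigma> ^^ i) p)"

definition orbs :: "nat \<Rightarrow> (nat \<Rightarrow> nat) \<Rightarrow> nat set set" where
  "orbs w \<sigma> = orb \<sigma> ` {1..w}"

text \<open>Reading \<open>v\<close> at least points matches the position of the entry in
  \<open>ycyc\<close>; for functions constant along orbits any other point would do. Fixed points
  are orbits of their own, as marked singletons are.\<close>

definition orbit_prod :: "nat \<Rightarrow> (nat \<Rightarrow> nat) \<Rightarrow> (nat \<Rightarrow> complex) \<Rightarrow> complex" where
  "orbit_prod w \<sigma> v = (\<Prod>B\<in>orbs w \<sigma>. v (Min B))"

lemma self_in_orb: "p \<in> orb \<sigma> p"
  unfolding orb_def by (rule range_eqI[of _ _ 0]) simp

lemma permutes_funpow_in: "\<sigma> permutes S \<Longrightarrow> p \<in> S \<Longrightarrow> (\<sigma> ^^ i) p \<in> S"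
  by (induction i) (auto simp: permutes_in_image)

lemma orb_subset: "\<sigma> permutes S \<Longrightarrow> p \<in> S \<Longrightarrow> orb \<sigma> p \<subseteq> S"
  unfolding orb_def using permutes_funpow_in by fastforce

text \<open>\<open>orb\<close> uses forward iterates only. Since \<sigma> has finite order,
  iterating further leads from \<open>q\<close> back to \<open>p\<close>.\<close>

lemma orb_eq:
  assumes "permutation \<sigma>" "q \<in> orb \<sigma> p"
  shows "orb \<sigma> q = orb \<sigma> p"
proof
  obtain i where i: "q = (\<sigma> ^^ i) p" using assms(2) by (auto simp: orb_def)
  show "orb \<sigma> q \<subseteq> orb \<sigma> p"
  proof
    fix r assume "r \<in> orb \<sigma> q"
    then obtain j where "r = (\<sigma> ^^ (j + i)) p" by (auto simp: orb_def i funpow_add)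
    then show "r \<in> orb \<sigma> p" unfolding orb_def by blast
  qed
  obtain n where n: "\<sigma> ^^ n = id" "n > i" by (rule permutation_is_nilpotent'[OF assms(1)])
  have pq: "p = (\<sigma> ^^ (n - i)) q"
  proof -
    have "(\<sigma> ^^ (n - i)) q = (\<sigma> ^^ (n - i + i)) p" by (simp add: i funpow_add)
    then show ?thesis using n by simp
  qed
  show "orb \<sigma> p \<subseteq> orb \<sigma> q"
  proof
    fix r assume "r \<in> orb \<sigma> p"
    then obtain j where "r = (\<sigma> ^^ j) p" by (auto simp: orb_def)
    also have "\<dots> = (\<sigma> ^^ j) ((\<sigma> ^^ (n - i)) q)" using pq by simp
    finally have "r = (\<sigma> ^^ (j + (n - i))) q" by (simp add: funpow_add)
    then show "r \<in> orb \<sigma> q" unfolding orb_def by blast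
  qed
qed

lemma const_on_orb:
  assumes "\<sigma> permutes S" "\<And>p. p \<in> S \<Longrightarrow> v (\<sigma> p) = v p" "p \<in> S" "q \<in> orb \<sigma> p"
  shows "v q = v p"
proof -
  have "v ((\<sigma> ^^ i) p) = v p" for i
    by (induction i) (use assms permutes_funpow_in[OF assms(1,3)] in auto)
  then show ?thesis using assms(4) by (auto simp: orb_def)
qed

lemma Min_orb_in:
  fixes \<sigma> :: "nat \<Rightarrow> nat"
  assumes "\<sigma> permutes {1..w}" "p \<in> {1..w}"
  shows "Min (orb \<sigma> p) \<in> orb \<sigma> p"
  using self_in_orb[of p \<sigma>] finite_subset[OF orb_subset[OF assms]] by (intro Min_in) auto

lemma finite_orbs: "finite (orbs w \<sigma>)"
  by (simp add: orbs_def)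

lemma orbit_prod_cong:
  assumes "\<sigma> permutes {1..w}" "\<And>p. p \<in> {1..w} \<Longrightarrow> u p = v p"
  shows "orbit_prod w \<sigma> u = orbit_prod w \<sigma> v"
  unfolding orbit_prod_def
proof (rule prod.cong[OF refl])
  fix B assume "B \<in> orbs w \<sigma>"
  then obtain p where "p \<in> {1..w}" "B = orb \<sigma> p" by (auto simp: orbs_def)
  then show "u (Min B) = v (Min B)"
    using Min_orb_in[OF assms(1)] orb_subset[OF assms(1)] assms(2) by blast
qed

lemma funpow_conj:
  assumes "\<sigma>' \<circ> \<pi> = \<pi> \<circ> \<sigma>"
  shows "(\<sigma>' ^^ i) (\<pi> p) = \<pi> ((\<sigma> ^^ i) p)"
  by (induction i) (use assms in \<open>auto simp: fun_eq_iff\<close>)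

lemma orb_conj:
  assumes "\<sigma>' \<circ> \<pi> = \<pi> \<circ> \<sigma>"
  shows "orb \<sigma>' (\<pi> p) = \<pi> ` orb \<sigma> p"
  unfolding orb_def by (simp add: funpow_conj[OF assms] image_image)

text \<open>\<open>\<pi>\<close> carries orbits to orbits but need not carry least points to least
  points. The invariance of \<open>v\<close> under \<open>\<sigma>'\<close> makes up for
  this.\<close>

lemma orbit_prod_conj:
  assumes \<sigma>: "\<sigma> permutes {1..w}" and \<sigma>': "\<sigma>' permutes {1..w}" and \<pi>: "\<pi> permutes {1..w}"
    and conj: "\<sigma>' \<circ> \<pi> = \<pi> \<circ> \<sigma>" and v: "\<And>p. p \<in> {1..w} \<Longrightarrow> v (\<sigma>' p) = v p"
  shows "orbit_prod w \<sigma>' v = orbit_prod w \<sigma> (\<lambda>p. v (\<pi> p))"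
proof -
  have b: "bij_betw (image \<pi>) (orbs w \<sigma>) (orbs w \<sigma>')"
  proof (rule bij_betw_imageI)
    show "inj_on ((`) \<pi>) (orbs w \<sigma>)"
      using permutes_inj[OF \<pi>] by (auto intro!: inj_onI simp: inj_image_eq_iff)
    have "(`) \<pi> ` orbs w \<sigma> = (\<lambda>p. orb \<sigma>' (\<pi> p)) ` {1..w}"
      by (simp add: orbs_def image_image orb_conj[OF conj])
    also have "\<dots> = orb \<sigma>' ` (\<pi> ` {1..w})" by (simp add: image_image)
    also have "\<pi> ` {1..w} = {1..w}" by (rule permutes_image[OF \<pi>])
    finally show "(`) \<pi> ` orbs w \<sigma> = orbs w \<sigma>'" by (simp add: orbs_def)
  qed
  have "orbit_prod w \<sigma>' v = (\<Prod>B\<in>orbs w \<sigma>. v (Min (\<pi> ` B)))"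
    unfolding orbit_prod_def by (rule prod.reindex_bij_betw[OF b, symmetric])
  also have "\<dots> = orbit_prod w \<sigma> (\<lambda>p. v (\<pi> p))"
    unfolding orbit_prod_def
  proof (rule prod.cong[OF refl])
    fix B assume "B \<in> orbs w \<sigma>"
    then obtain p where p: "p \<in> {1..w}" "B = orb \<sigma> p" by (auto simp: orbs_def)
    have pp: "\<pi> p \<in> {1..w}" using p \<pi> by (simp only: permutes_in_image)
    have 1: "Min (\<pi> ` B) \<in> orb \<sigma>' (\<pi> p)"
      using Min_orb_in[OF \<sigma>' pp] p(2) orb_conj[OF conj, of p] by simp
    have 2: "\<pi> (Min B) \<in> orb \<sigma>' (\<pi> p)"
      using Min_orb_in[OF \<sigma> p(1)] p(2) orb_conj[OF conj, of p] by simp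
    have "v q = v (\<pi> p)" if "q \<in> orb \<sigma>' (\<pi> p)" for q
      by (rule const_on_orb[where v = v and \<sigma> = \<sigma>' and S = "{1..w}" and p = "\<pi> p"]; fact)
    then show "v (Min (\<pi> ` B)) = v (\<pi> (Min B))" using 1 2 by metis
  qed
  finally show ?thesis .
qed

section \<open>Disjoint cycles given by lists\<close>

definition cycles_perm :: "nat list list \<Rightarrow> nat \<Rightarrow> nat" where
  "cycles_perm css = foldr (\<lambda>c f. cycle_of_list c \<circ> f) css id"

text \<open>A relation leaves \<open>\<sigma>\<close> free off the listed points and applies to any
  given permutation. If the lists cover everything, it determines \<open>\<sigma>\<close>, by
  \<open>acts_unique\<close>.\<close>

definition acts :: "nat list list \<Rightarrow> (nat \<Rightarrow> nat) \<Rightarrow> bool" where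
  "acts css \<sigma> \<longleftrightarrow> (\<forall>j<length css. \<forall>i<length (css ! j).
     \<sigma> (css ! j ! i) = css ! j ! (Suc i mod length (css ! j)))"

definition dj_cycles :: "nat list list \<Rightarrow> bool" where
  "dj_cycles cs \<longleftrightarrow> (\<forall>c\<in>set cs. c \<noteq> [] \<and> distinct c) \<and>
     (\<forall>i<length cs. \<forall>j<length cs. i \<noteq> j \<longrightarrow> set (cs ! i) \<inter> set (cs ! j) = {})"

lemma marked_decomp_dj: "marked_decomp m cs \<longleftrightarrow> dj_cycles cs \<and> (\<Union>c\<in>set cs. set c) = {1..m}"
  by (auto simp: marked_decomp_def dj_cycles_def)

lemma dj_cycles_disjoint:
  "dj_cycles cs \<Longrightarrow> i < length cs \<Longrightarrow> j < length cs \<Longrightarrow> i \<noteq> j \<Longrightarrow> set (cs ! i) \<inter> set (cs ! j) = {}"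
  unfolding dj_cycles_def by blast

lemma dj_cycles_Cons:
  assumes "dj_cycles (c # cs)"
  shows "dj_cycles cs" "c \<noteq> []" "distinct c" "\<And>j. j < length cs \<Longrightarrow> set c \<inter> set (cs ! j) = {}"
proof -
  have disj: "set ((c # cs) ! i) \<inter> set ((c # cs) ! j) = {}"
    if "i < Suc (length cs)" "j < Suc (length cs)" "i \<noteq> j" for i j
    using assms that unfolding dj_cycles_def length_Cons by blast
  show "c \<noteq> []" "distinct c" using assms by (auto simp: dj_cycles_def)
  have "set (cs ! i) \<inter> set (cs ! j) = {}" if "i < length cs" "j < length cs" "i \<noteq> j" for i j
    using disj[of "Suc i" "Suc j"] that by simp
  then show "dj_cycles cs" using assms by (simp add: dj_cycles_def)
  show "set c \<inter> set (cs ! j) = {}" if "j < length cs" for j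
    using disj[of 0 "Suc j"] that by simp
qed

lemma cycle_of_list_nth:
  assumes "distinct c" "i < length c"
  shows "cycle_of_list c (c ! i) = c ! (Suc i mod length c)"
proof -
  have "map (cycle_of_list c ^^ 1) c = rotate 1 c" by (rule cyclic_rotation[OF assms(1)])
  then have "map (cycle_of_list c) c ! i = rotate 1 c ! i" by simp
  then show ?thesis using assms(2) nth_rotate[of i c 1] by simp
qed

lemma cycles_perm_outside: "(\<And>c. c \<in> set cs \<Longrightarrow> p \<notin> set c) \<Longrightarrow> cycles_perm cs p = p"
  unfolding cycles_perm_def by (induction cs) (auto simp: id_outside_supp)

lemma cycles_perm_permutes:
  assumes "\<And>c. c \<in> set cs \<Longrightarrow> set c \<subseteq> S"
  shows "cycles_perm cs permutes S"
  using assms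
proof (induction cs)
  case Nil
  have "cycles_perm [] = id" by (simp add: cycles_perm_def fun_eq_iff)
  then show ?case by (simp only: permutes_id)
next
  case (Cons c cs)
  have "cycle_of_list c permutes S"
    using cycle_permutes[of c] Cons.prems[of c] by (auto intro: permutes_subset)
  moreover have "cycles_perm cs permutes S" using Cons by simp
  moreover have "cycles_perm (c # cs) = cycle_of_list c \<circ> cycles_perm cs" by (simp add: cycles_perm_def)
  ultimately show ?case by (simp only: permutes_compose)
qed

lemma cycles_perm_acts: "dj_cycles cs \<Longrightarrow> acts cs (cycles_perm cs)"
proof (induction cs)
  case Nil
  then show ?case by (simp add: acts_def)
next
  case (Cons c cs)
  note d = dj_cycles_Cons[OF Cons.prems]
  have "cycles_perm (c # cs) ((c # cs) ! j ! i) = (c # cs) ! j ! (Suc i mod length ((c # cs) ! j))"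
    if j: "j < Suc (length cs)" and i: "i < length ((c # cs) ! j)" for i j
  proof (cases j)
    case 0
    have "c ! i \<notin> set c'" if c': "c' \<in> set cs" for c'
    proof -
      obtain k where "k < length cs" "c' = cs ! k" using c' by (auto simp: in_set_conv_nth)
      then show ?thesis using d(4)[of k] i 0 by (auto dest: nth_mem)
    qed
    then have "cycles_perm cs (c ! i) = c ! i" by (rule cycles_perm_outside)
    then show ?thesis using 0 i cycle_of_list_nth[OF d(3)] by (simp add: cycles_perm_def)
  next
    case (Suc k)
    then have k: "k < length cs" "i < length (cs ! k)" using i j by auto
    then have "cycles_perm cs (cs ! k ! i) = cs ! k ! (Suc i mod length (cs ! k))"
      using Cons.IH[OF d(1)] by (simp add: acts_def)
    moreover have "cs ! k ! (Suc i mod length (cs ! k)) \<in> set (cs ! k)"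
      using k(2) by (intro nth_mem mod_less_divisor) auto
    then have "cs ! k ! (Suc i mod length (cs ! k)) \<notin> set c" using d(4)[OF k(1)] by blast
    ultimately show ?thesis using Suc by (simp add: cycles_perm_def id_outside_supp)
  qed
  then show ?case by (simp add: acts_def)
qed

lemma acts_unique:
  assumes "acts css \<sigma>" "acts css \<tau>" "(\<Union>c\<in>set css. set c) = S" "\<sigma> permutes S" "\<tau> permutes S"
  shows "\<sigma> = \<tau>"
proof
  fix p
  show "\<sigma> p = \<tau> p"
  proof (cases "p \<in> S")
    case True
    then obtain c where c: "c \<in> set css" "p \<in> set c" using assms(3) by auto
    then obtain j i where "j < length css" "c = css ! j" "i < length c" "p = c ! i"
      by (auto simp: in_set_conv_nth)
    then show ?thesis using assms(1,2) by (simp add: acts_def)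
  next
    case False
    then show ?thesis using assms(4,5) by (simp add: permutes_not_in)
  qed
qed

context
  fixes \<sigma> :: "nat \<Rightarrow> nat" and c :: "nat list"
  assumes \<sigma>: "permutation \<sigma>" and c: "c \<noteq> []" "distinct c"
    and act: "\<And>i. i < length c \<Longrightarrow> \<sigma> (c ! i) = c ! (Suc i mod length c)"
begin

lemma cycle_funpow: "i < length c \<Longrightarrow> (\<sigma> ^^ k) (c ! i) = c ! ((i + k) mod length c)"
proof (induction k)
  case 0
  then show ?case by simp
next
  case (Suc k)
  then have "(\<sigma> ^^ Suc k) (c ! i) = \<sigma> (c ! ((i + k) mod length c))" by simp
  also have "\<dots> = c ! (Suc ((i + k) mod length c) mod length c)"
    using c by (intro act) simp
  finally show ?case by (simp add: mod_Suc_eq)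
qed

lemma cycle_funpow_fix:
  assumes "i < length c"
  shows "(\<sigma> ^^ k) (c ! i) = c ! i \<longleftrightarrow> length c dvd k"
proof -
  have "(\<sigma> ^^ k) (c ! i) = c ! i \<longleftrightarrow> (i + k) mod length c = i"
    unfolding cycle_funpow[OF assms] using c assms by (simp add: nth_eq_iff_index_eq)
  also have "\<dots> \<longleftrightarrow> (i + k) mod length c = i mod length c" using assms by simp
  also have "\<dots> \<longleftrightarrow> length c dvd k"
    using mod_eq_dvd_iff_nat[of i "i + k" "length c"] by simp
  finally show ?thesis .
qed

lemma cycle_least_power: "p \<in> set c \<Longrightarrow> least_power \<sigma> p = length c"
proof -
  assume "p \<in> set c"
  then obtain i where i: "i < length c" "p = c ! i" by (auto simp: in_set_conv_nth)
  have "least_power \<sigma> p dvd length c"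
    using cycle_funpow_fix[OF i(1)] i(2) by (intro least_power_minimal) auto
  moreover have "length c dvd least_power \<sigma> p"
    using least_power_of_permutation(1)[OF \<sigma>, of p] cycle_funpow_fix[OF i(1)] i(2) by auto
  ultimately show ?thesis by (rule dvd_antisym)
qed

lemma cycle_orb: "p \<in> set c \<Longrightarrow> orb \<sigma> p = set c"
proof -
  assume "p \<in> set c"
  then obtain i where i: "i < length c" "p = c ! i" by (auto simp: in_set_conv_nth)
  have sub: "orb \<sigma> p \<subseteq> set c"
    unfolding orb_def i(2) cycle_funpow[OF i(1)] using c(1) by auto
  have "set c \<subseteq> orb \<sigma> p"
  proof
    fix q assume "q \<in> set c"
    then obtain j where j: "j < length c" "q = c ! j" by (auto simp: in_set_conv_nth)
    have "(i + (j + (length c - i))) mod length c = j" using i(1) j(1) by simp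
    then have "(\<sigma> ^^ (j + (length c - i))) p = q" using cycle_funpow[OF i(1)] i(2) j(2) by simp
    then show "q \<in> orb \<sigma> p" unfolding orb_def by blast
  qed
  then show ?thesis using sub by blast
qed

lemma cycle_inv_funpow_mem:
  assumes "p \<in> set c"
  shows "(inv' \<sigma> ^^ k) p \<in> set c"
proof -
  have *: "inv' \<sigma> q \<in> set c" if q: "q \<in> set c" for q
  proof -
    obtain i where i: "i < length c" "q = c ! i" using q by (auto simp: in_set_conv_nth)
    let ?j = "(i + (length c - 1)) mod length c"
    have "Suc (i + (length c - 1)) = i + length c" using c(1) by (cases c) auto
    then have "Suc ?j mod length c = (i + length c) mod length c" by (simp only: mod_Suc_eq)
    then have "\<sigma> (c ! ?j) = q" using act[of ?j] c i by simp
    moreover have "c ! ?j \<in> set c" using c by simp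
    ultimately show ?thesis
      using inv_f_f[OF bij_is_inj[OF permutation_bijective[OF \<sigma>]], of "c ! ?j"] by simp
  qed
  show ?thesis by (induction k) (use assms * in auto)
qed

text \<open>Powers in the wreath product read entries along the inverse permutation. Not returning
  to the start before the cycle closes is what leaves a single nontrivial factor in the cycle
  product of a marked cycle.\<close>

lemma cycle_inv_funpow_neq:
  assumes "p \<in> set c" "0 < k" "k < length c"
  shows "(inv' \<sigma> ^^ k) p \<noteq> p"
proof
  assume h: "(inv' \<sigma> ^^ k) p = p"
  have "(\<sigma> ^^ k) ((inv' \<sigma> ^^ k) p) = p"
  proof -
    have b: "bij (\<sigma> ^^ k)" by (rule bij_fn[OF permutation_bijective[OF \<sigma>]])
    have "inv' (\<sigma> ^^ k) = inv' \<sigma> ^^ k" by (rule inv_fn[OF permutation_bijective[OF \<sigma>]])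
    then show ?thesis using surj_f_inv_f[OF bij_is_surj[OF b], of p] by simp
  qed
  then have "(\<sigma> ^^ k) p = p" using h by simp
  moreover obtain i where "i < length c" "p = c ! i" using assms(1) by (auto simp: in_set_conv_nth)
  ultimately have "length c dvd k" using cycle_funpow_fix by auto
  then show False using assms(2,3) by (auto dest: dvd_imp_le)
qed

end

lemma acts_cycle:
  assumes "acts css \<sigma>" "dj_cycles css" "j < length css"
  shows "css ! j \<noteq> []" "distinct (css ! j)"
    "\<And>i. i < length (css ! j) \<Longrightarrow> \<sigma> (css ! j ! i) = css ! j ! (Suc i mod length (css ! j))"
  using assms by (auto simp: acts_def dj_cycles_def)

lemma Min_cycle_in: "c \<noteq> [] \<Longrightarrow> Min (set c) \<in> set c"
  by (intro Min_in) auto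

lemma orbit_prod_cycles:
  assumes md: "marked_decomp w css" and act: "acts css \<sigma>" and \<sigma>: "\<sigma> permutes {1..w}"
  shows "orbit_prod w \<sigma> v = (\<Prod>j<length css. v (Min (set (css ! j))))"
proof -
  have dj: "dj_cycles css" and U: "(\<Union>c\<in>set css. set c) = {1..w}" using md by (auto simp: marked_decomp_dj)
  have perm: "permutation \<sigma>" using \<sigma> permutation_permutes by blast
  note ac = acts_cycle[OF act dj]
  have o: "orb \<sigma> p = set (css ! j)" if "j < length css" "p \<in> set (css ! j)" for j p
    using cycle_orb[OF perm ac[OF that(1)] that(2)] by simp
  have "bij_betw (\<lambda>j. set (css ! j)) {..<length css} (orbs w \<sigma>)"
  proof (rule bij_betw_imageI)
    show "inj_on (\<lambda>j. set (css ! j)) {..<length css}"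
    proof (rule inj_onI)
      fix i j assume ij: "i \<in> {..<length css}" "j \<in> {..<length css}" "set (css ! i) = set (css ! j)"
      show "i = j"
      proof (rule ccontr)
        assume "i \<noteq> j"
        then have "set (css ! i) \<inter> set (css ! j) = {}" using dj_cycles_disjoint[OF dj] ij by blast
        then show False using ij ac(1)[of i] by simp
      qed
    qed
    show "(\<lambda>j. set (css ! j)) ` {..<length css} = orbs w \<sigma>"
    proof
      show "(\<lambda>j. set (css ! j)) ` {..<length css} \<subseteq> orbs w \<sigma>"
      proof
        fix B assume "B \<in> (\<lambda>j. set (css ! j)) ` {..<length css}"
        then obtain j where j: "j < length css" "B = set (css ! j)" by auto
        let ?p = "css ! j ! 0"
        have p: "?p \<in> set (css ! j)" using ac(1)[OF j(1)] by simp
        then have "?p \<in> {1..w}" using U j(1) by (metis UN_I nth_mem)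
        then show "B \<in> orbs w \<sigma>" unfolding orbs_def using o[OF j(1) p] j(2) by (intro image_eqI[of _ _ ?p]) auto
      qed
      show "orbs w \<sigma> \<subseteq> (\<lambda>j. set (css ! j)) ` {..<length css}"
      proof
        fix B assume "B \<in> orbs w \<sigma>"
        then obtain p where p: "p \<in> {1..w}" "B = orb \<sigma> p" by (auto simp: orbs_def)
        then obtain c where "c \<in> set css" "p \<in> set c" using U by blast
        then obtain j where "j < length css" "p \<in> set (css ! j)" by (metis in_set_conv_nth)
        then show "B \<in> (\<lambda>j. set (css ! j)) ` {..<length css}" using o p by auto
      qed
    qed
  qed
  from prod.reindex_bij_betw[OF this, of "\<lambda>B. v (Min B)"] show ?thesis by (simp add: orbit_prod_def)
qed

lemma least_power_conj:
  assumes "\<sigma>' \<circ> \<pi> = \<pi> \<circ> \<sigma>" "inj \<pi>"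
  shows "least_power \<sigma>' (\<pi> p) = least_power \<sigma> p"
  unfolding least_power_def funpow_conj[OF assms(1)] using assms(2) by (simp add: inj_eq)

section \<open>The wreath product as a finite group\<close>

locale finite_group = group L for L (structure) +
  assumes finite_carrier: "finite (carrier L)"
begin

abbreviation WR :: "nat \<Rightarrow> 'a wr monoid" where "WR w \<equiv> wreath L w"

text \<open>An arbitrary set of positions is allowed so that sums over the base group can be split
  along cycles.\<close>

definition base :: "nat set \<Rightarrow> (nat \<Rightarrow> 'a) set" where
  "base A = {x. (\<forall>i\<in>A. x i \<in> carrier L) \<and> (\<forall>i. i \<notin> A \<longrightarrow> x i = \<one>)}"

lemma wreath_carrier: "carrier (WR w) = base {1..w} \<times> {\<sigma>. \<sigma> permutes {1..w}}"
  by (auto simp: wreath_def base_def)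

lemma wreath_mult: "(x, \<sigma>) \<otimes>\<^bsub>WR w\<^esub> (y, \<tau>) = (\<lambda>i. x i \<otimes> y (inv' \<sigma> i), \<sigma> \<circ> \<tau>)"
  by (simp add: wreath_def)

lemma wreath_one: "\<one>\<^bsub>WR w\<^esub> = (\<lambda>_. \<one>, id)"
  by (simp add: wreath_def)

lemma base_closed: "x \<in> base A \<Longrightarrow> x i \<in> carrier L"
  by (cases "i \<in> A") (auto simp: base_def)

lemma finite_base: "finite A \<Longrightarrow> finite (base A)"
  unfolding base_def using finite_set_of_finite_funs[OF _ finite_carrier, of A \<one>]
  by (rule rev_finite_subset) auto

lemma wreath_group: "group (WR w)"
proof (rule groupI)
  show "\<one>\<^bsub>WR w\<^esub> \<in> carrier (WR w)"
    by (simp add: wreath_one wreath_carrier base_def permutes_id)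
  fix g assume g: "g \<in> carrier (WR w)"
  obtain x \<sigma> where g': "g = (x, \<sigma>)" by (cases g)
  have x: "x \<in> base {1..w}" and \<sigma>: "\<sigma> permutes {1..w}" using g g' by (auto simp: wreath_carrier)
  have \<sigma>i: "inv' \<sigma> permutes {1..w}" by (rule permutes_inv[OF \<sigma>])
  show "\<one>\<^bsub>WR w\<^esub> \<otimes>\<^bsub>WR w\<^esub> g = g"
    using base_closed[OF x] by (simp add: g' wreath_one wreath_mult)
  show "\<exists>h\<in>carrier (WR w). h \<otimes>\<^bsub>WR w\<^esub> g = \<one>\<^bsub>WR w\<^esub>"
  proof (intro bexI)
    show "(\<lambda>i. inv (x (\<sigma> i)), inv' \<sigma>) \<otimes>\<^bsub>WR w\<^esub> g = \<one>\<^bsub>WR w\<^esub>"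
      using base_closed[OF x] permutes_inv_o(2)[OF \<sigma>] permutes_inv_inv[OF \<sigma>]
      by (simp add: g' wreath_one wreath_mult)
    show "(\<lambda>i. inv (x (\<sigma> i)), inv' \<sigma>) \<in> carrier (WR w)"
      using x \<sigma> \<sigma>i by (auto simp: wreath_carrier base_def permutes_in_image permutes_not_in simp del: atLeastAtMost_iff)
  qed
  fix h assume h: "h \<in> carrier (WR w)"
  obtain y \<tau> where h': "h = (y, \<tau>)" by (cases h)
  have y: "y \<in> base {1..w}" and \<tau>: "\<tau> permutes {1..w}" using h h' by (auto simp: wreath_carrier)
  show "g \<otimes>\<^bsub>WR w\<^esub> h \<in> carrier (WR w)"
    using x y \<sigma> \<tau> \<sigma>i permutes_compose[OF \<tau> \<sigma>]
    by (auto simp: g' h' wreath_mult wreath_carrier base_def permutes_in_image permutes_not_in simp del: atLeastAtMost_iff)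
  fix k assume k: "k \<in> carrier (WR w)"
  obtain z \<rho> where k': "k = (z, \<rho>)" by (cases k)
  have z: "z \<in> base {1..w}" using k k' by (auto simp: wreath_carrier)
  have "inv' (\<sigma> \<circ> \<tau>) = inv' \<tau> \<circ> inv' \<sigma>"
    using o_inv_distrib[OF permutes_bij[OF \<sigma>] permutes_bij[OF \<tau>]] .
  then show "g \<otimes>\<^bsub>WR w\<^esub> h \<otimes>\<^bsub>WR w\<^esub> k = g \<otimes>\<^bsub>WR w\<^esub> (h \<otimes>\<^bsub>WR w\<^esub> k)"
    using base_closed[OF x] base_closed[OF y] base_closed[OF z]
    by (simp add: g' h' k' wreath_mult m_assoc comp_assoc)
qed

lemma finite_wreath: "finite (carrier (WR w))"
  unfolding wreath_carrier by (intro finite_cartesian_product finite_base finite_permutations) auto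

sublocale wr: group "WR w" for w
  by (rule wreath_group)

lemma wreath_pow:
  assumes g: "g \<in> carrier (WR w)"
  shows snd_wreath_pow: "snd (g [^]\<^bsub>WR w\<^esub> k) = snd g ^^ k"
    and fst_wreath_pow_Suc: "fst (g [^]\<^bsub>WR w\<^esub> Suc k) p =
      fst (g [^]\<^bsub>WR w\<^esub> k) p \<otimes> fst g ((inv' (snd g) ^^ k) p)"
proof -
  obtain x \<sigma> where g': "g = (x, \<sigma>)" by (cases g)
  have \<sigma>: "\<sigma> permutes {1..w}" using g g' by (auto simp: wreath_carrier)
  have snd_mult: "snd (a \<otimes>\<^bsub>WR w\<^esub> b) = snd a \<circ> snd b" and fst_mult: "fst (a \<otimes>\<^bsub>WR w\<^esub> b) = (\<lambda>i. fst a i \<otimes> fst b (inv' (snd a) i))" for a b :: "'a wr"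
    using wreath_mult[where x="fst a" and y="fst b"] by (cases a; cases b; simp)+
  show s: "snd (g [^]\<^bsub>WR w\<^esub> k) = snd g ^^ k" for k
  proof (induction k)
    case 0
    show ?case by (simp add: wreath_one)
  next
    case (Suc k)
    have "snd (g [^]\<^bsub>WR w\<^esub> Suc k) = snd g ^^ k \<circ> snd g" using Suc by (simp add: snd_mult)
    then show ?case by (simp add: funpow_swap1 fun_eq_iff)
  qed
  have "inv' (snd g ^^ k) = inv' (snd g) ^^ k"
    unfolding g' using inv_fn[OF permutes_bij[OF \<sigma>]] by simp
  then show "fst (g [^]\<^bsub>WR w\<^esub> Suc k) p = fst (g [^]\<^bsub>WR w\<^esub> k) p \<otimes> fst g ((inv' (snd g) ^^ k) p)"
    by (simp add: fst_mult s)
qed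

text \<open>The product of the entries of \<open>g\<close> along the cycle through \<open>p\<close>, starting at \<open>p\<close>.\<close>

definition cyc_val :: "nat \<Rightarrow> 'a wr \<Rightarrow> nat \<Rightarrow> 'a" where
  "cyc_val w g p = fst (g [^]\<^bsub>WR w\<^esub> least_power (snd g) p) p"

lemma fst_closed: "g \<in> carrier (WR w) \<Longrightarrow> fst g p \<in> carrier L"
  using base_closed by (auto simp: wreath_carrier)

lemma snd_permutes: "g \<in> carrier (WR w) \<Longrightarrow> snd g permutes {1..w}"
  by (auto simp: wreath_carrier)

lemma cyc_val_closed: "g \<in> carrier (WR w) \<Longrightarrow> cyc_val w g p \<in> carrier L"
  unfolding cyc_val_def by (intro fst_closed[of _ w] wr.nat_pow_closed)

text \<open>With \<open>k\<close> the cycle length, compare the entries of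
  \<open>h g^k = g'^k h\<close> at the image of \<open>p\<close>. The permutation part of
  \<open>g'^k\<close> fixes that point, so the same entry of \<open>h\<close> occurs on both sides
  and conjugates one cycle product into the other.\<close>

lemma cyc_val_conj:
  assumes g: "g \<in> carrier (WR w)" and g': "g' \<in> carrier (WR w)" and h: "h \<in> carrier (WR w)"
    and eq: "h \<otimes>\<^bsub>WR w\<^esub> g = g' \<otimes>\<^bsub>WR w\<^esub> h"
  shows "\<exists>y\<in>carrier L. cyc_val w g' (snd h p) = y \<otimes> cyc_val w g p \<otimes> inv y"
    and "snd g' \<circ> snd h = snd h \<circ> snd g"
proof -
  obtain x \<sigma> where gd: "g = (x, \<sigma>)" by (cases g)
  obtain x' \<sigma>' where gd': "g' = (x', \<sigma>')" by (cases g')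
  obtain y \<pi> where hd: "h = (y, \<pi>)" by (cases h)
  have \<pi>: "\<pi> permutes {1..w}" and \<sigma>: "\<sigma> permutes {1..w}" and \<sigma>': "\<sigma>' permutes {1..w}"
    using g g' h by (auto simp: gd gd' hd wreath_carrier)
  have conj: "\<sigma>' \<circ> \<pi> = \<pi> \<circ> \<sigma>"
    using eq unfolding gd gd' hd wreath_mult by simp
  then show "snd g' \<circ> snd h = snd h \<circ> snd g" by (simp add: gd gd' hd)
  define k where "k = least_power \<sigma> p"
  have k': "least_power \<sigma>' (\<pi> p) = k"
    unfolding k_def by (rule least_power_conj[OF conj permutes_inj[OF \<pi>]])
  have perm: "permutation \<sigma>'" using \<sigma>' permutation_permutes by blast
  have fix': "inv' (\<sigma>' ^^ k) (\<pi> p) = \<pi> p"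
    using least_power_of_permutation(1)[OF perm, of "\<pi> p"] k'
      permutes_inv_eq[OF permutes_funpow[OF \<sigma>'], of k "\<pi> p" "\<pi> p"] by simp
  have pw: "h \<otimes>\<^bsub>WR w\<^esub> g [^]\<^bsub>WR w\<^esub> n = g' [^]\<^bsub>WR w\<^esub> n \<otimes>\<^bsub>WR w\<^esub> h" for n :: nat
  proof (induction n)
    case 0
    then show ?case using h by simp
  next
    case (Suc n)
    have "h \<otimes>\<^bsub>WR w\<^esub> g [^]\<^bsub>WR w\<^esub> Suc n = (h \<otimes>\<^bsub>WR w\<^esub> g [^]\<^bsub>WR w\<^esub> n) \<otimes>\<^bsub>WR w\<^esub> g"
      using g h by (simp add: wr.m_assoc)
    also have "\<dots> = g' [^]\<^bsub>WR w\<^esub> n \<otimes>\<^bsub>WR w\<^esub> (h \<otimes>\<^bsub>WR w\<^esub> g)" using Suc g g' h by (simp add: wr.m_assoc)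
    also have "\<dots> = g' [^]\<^bsub>WR w\<^esub> Suc n \<otimes>\<^bsub>WR w\<^esub> h" unfolding eq using g g' h by (simp add: wr.m_assoc)
    finally show ?case .
  qed
  obtain a \<alpha> where a: "g [^]\<^bsub>WR w\<^esub> k = (a, \<alpha>)" by (cases "g [^]\<^bsub>WR w\<^esub> k")
  obtain a' \<alpha>' where a': "g' [^]\<^bsub>WR w\<^esub> k = (a', \<alpha>')" by (cases "g' [^]\<^bsub>WR w\<^esub> k")
  have al': "\<alpha>' = \<sigma>' ^^ k" using snd_wreath_pow[OF g', of k] a' by (simp add: gd')
  have "fst (h \<otimes>\<^bsub>WR w\<^esub> g [^]\<^bsub>WR w\<^esub> k) (\<pi> p) = fst (g' [^]\<^bsub>WR w\<^esub> k \<otimes>\<^bsub>WR w\<^esub> h) (\<pi> p)"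
    using pw by simp
  then have e: "y (\<pi> p) \<otimes> a p = a' (\<pi> p) \<otimes> y (\<pi> p)"
    unfolding a a' hd wreath_mult using permutes_inverses(2)[OF \<pi>] fix' al' by simp
  have v: "cyc_val w g p = a p" "cyc_val w g' (\<pi> p) = a' (\<pi> p)"
    using a a' k' by (auto simp: cyc_val_def gd gd' k_def)
  have yc: "y (\<pi> p) \<in> carrier L" using fst_closed[OF h] by (simp add: hd)
  have ac: "a p \<in> carrier L" "a' (\<pi> p) \<in> carrier L" using cyc_val_closed[OF g, of p] cyc_val_closed[OF g', of "\<pi> p"] v by simp_all
  have "y (\<pi> p) \<otimes> a p \<otimes> inv (y (\<pi> p)) = a' (\<pi> p)"
    unfolding e using yc ac by (simp add: m_assoc)
  then show "\<exists>y\<in>carrier L. cyc_val w g' (snd h p) = y \<otimes> cyc_val w g p \<otimes> inv y"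
    using yc v by (intro bexI[of _ "y (\<pi> p)"]) (auto simp: hd)
qed

definition class_fun :: "('a \<Rightarrow> complex) \<Rightarrow> bool" where
  "class_fun \<phi> \<longleftrightarrow> (\<forall>a\<in>carrier L. \<forall>b\<in>carrier L. \<phi> (a \<otimes> b \<otimes> inv a) = \<phi> b)"

lemma class_fun_cyc_val_conj:
  assumes "class_fun \<phi>" "g \<in> carrier (WR w)" "g' \<in> carrier (WR w)" "h \<in> carrier (WR w)"
    "h \<otimes>\<^bsub>WR w\<^esub> g = g' \<otimes>\<^bsub>WR w\<^esub> h"
  shows "\<phi> (cyc_val w g' (snd h p)) = \<phi> (cyc_val w g p)"
  using cyc_val_conj(1)[OF assms(2-5), of p] cyc_val_closed[OF assms(2), of p] assms(1)
  by (auto simp: class_fun_def)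

text \<open>Conjugating \<open>g\<close> by itself moves the starting point one step along the
  cycle.\<close>

lemma class_fun_cyc_val_step:
  assumes "class_fun \<phi>" "g \<in> carrier (WR w)"
  shows "\<phi> (cyc_val w g (snd g p)) = \<phi> (cyc_val w g p)"
  using class_fun_cyc_val_conj[OF assms(1,2,2,2) refl] .

text \<open>Well-definedness of tilde powers rests on this: the product over cycles depends only on
  the conjugacy class.\<close>

lemma orbit_prod_class_fun_conj:
  assumes \<phi>: "class_fun \<phi>" and g: "g \<in> carrier (WR w)" "g' \<in> carrier (WR w)" "h \<in> carrier (WR w)"
    and eq: "h \<otimes>\<^bsub>WR w\<^esub> g = g' \<otimes>\<^bsub>WR w\<^esub> h"
  shows "orbit_prod w (snd g') (\<lambda>p. \<phi> (cyc_val w g' p)) = orbit_prod w (snd g) (\<lambda>p. \<phi> (cyc_val w g p))"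
proof -
  have "orbit_prod w (snd g') (\<lambda>p. \<phi> (cyc_val w g' p)) = orbit_prod w (snd g) (\<lambda>p. \<phi> (cyc_val w g' (snd h p)))"
    by (rule orbit_prod_conj[OF snd_permutes[OF g(1)] snd_permutes[OF g(2)] snd_permutes[OF g(3)] cyc_val_conj(2)[OF g eq]])
      (rule class_fun_cyc_val_step[OF \<phi> g(2)])
  then show ?thesis using class_fun_cyc_val_conj[OF \<phi> g eq] by simp
qed

text \<open>A further marked cycle moves only positions of its own support, where the product formed
  so far has trivial entries. The entries at the least points therefore never interfere.\<close>

lemma wr_prod_cycles:
  assumes "dj_cycles cs" "length xs = length cs" "set xs \<subseteq> carrier L" "\<And>c. c \<in> set cs \<Longrightarrow> set c \<subseteq> {1..w}"
  shows "\<exists>y. wr_prod L w (map2 (ycyc L) cs xs) = (y, cycles_perm cs) \<and> y \<in> base {1..w} \<and>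
    (\<forall>j<length cs. y (Min (set (cs ! j))) = xs ! j) \<and> (\<forall>p. (\<forall>j<length cs. p \<noteq> Min (set (cs ! j))) \<longrightarrow> y p = \<one>)"
  using assms
proof (induction cs arbitrary: xs)
  case Nil
  then show ?case by (auto simp: wr_prod_def wreath_one cycles_perm_def base_def)
next
  case (Cons c cs)
  note d = dj_cycles_Cons[OF Cons.prems(1)]
  obtain x xs' where xs: "xs = x # xs'" using Cons.prems(2) by (cases xs) auto
  from Cons.IH[OF d(1), of xs'] Cons.prems xs obtain y where y:
    "wr_prod L w (map2 (ycyc L) cs xs') = (y, cycles_perm cs)" "y \<in> base {1..w}"
    "\<And>j. j < length cs \<Longrightarrow> y (Min (set (cs ! j))) = xs' ! j"
    "\<And>p. (\<And>j. j < length cs \<Longrightarrow> p \<noteq> Min (set (cs ! j))) \<Longrightarrow> y p = \<one>" by fastforce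
  have xc: "x \<in> carrier L" using Cons.prems xs by simp
  have mc: "Min (set c) \<in> set c" using d(2) by (rule Min_cycle_in)
  have mcs: "Min (set (cs ! j)) \<in> set (cs ! j)" if "j < length cs" for j
    using d(1) that by (intro Min_cycle_in) (auto simp: dj_cycles_def)
  have yc: "y p = \<one>" if "p \<in> set c" for p
  proof (rule y(4))
    fix j assume "j < length cs"
    then show "p \<noteq> Min (set (cs ! j))" using mcs d(4)[of j] that by blast
  qed
  have fst_eq: "(if i = Min (set c) then x else \<one>) \<otimes> y (inv' (cycle_of_list c) i) = (y(Min (set c) := x)) i" for i
  proof (cases "i \<in> set c")
    case True
    then have "inv' (cycle_of_list c) i \<in> set c"
      using permutes_inv[OF cycle_permutes, of c] permutes_in_image by metis
    then show ?thesis using yc[of i] yc[of "inv' (cycle_of_list c) i"] True xc by simp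
  next
    case False
    then have "inv' (cycle_of_list c) i = i"
      using permutes_inv[OF cycle_permutes, of c] by (simp add: permutes_not_in)
    then show ?thesis using False mc base_closed[OF y(2), of i] by auto
  qed
  have "wr_prod L w (map2 (ycyc L) (c # cs) xs) = ycyc L c x \<otimes>\<^bsub>WR w\<^esub> (y, cycles_perm cs)"
    using y(1) xs by (simp add: wr_prod_def)
  also have "\<dots> = (y(Min (set c) := x), cycles_perm (c # cs))"
    unfolding ycyc_def wreath_mult fst_eq by (auto simp: cycles_perm_def)
  finally have 1: "wr_prod L w (map2 (ycyc L) (c # cs) xs) = (y(Min (set c) := x), cycles_perm (c # cs))" .
  have 2: "y(Min (set c) := x) \<in> base {1..w}"
    using y(2) xc mc Cons.prems(4)[of c] by (auto simp: base_def subset_iff)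
  have 3: "(y(Min (set c) := x)) (Min (set ((c # cs) ! j))) = xs ! j" if "j < length (c # cs)" for j
  proof (cases j)
    case 0
    then show ?thesis using xs by simp
  next
    case (Suc k)
    then have k: "k < length cs" using that by simp
    have "Min (set (cs ! k)) \<noteq> Min (set c)" using mcs[OF k] d(4)[OF k] mc by fastforce
    then show ?thesis using Suc xs y(3)[OF k] by simp
  qed
  have 4: "(y(Min (set c) := x)) p = \<one>" if h: "\<forall>j<length (c # cs). p \<noteq> Min (set ((c # cs) ! j))" for p
  proof -
    have "p \<noteq> Min (set c)" using h[rule_format, of 0] by simp
    moreover have "y p = \<one>" using h[rule_format, of "Suc j" for j] by (intro y(4)) auto
    ultimately show ?thesis by simp
  qed
  show ?case using 1 2 3 4 by blast
qed

lemma wr_prod_marked: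
  assumes md: "marked_decomp w cs" and xs: "length xs = length cs" "set xs \<subseteq> carrier L"
  defines "g \<equiv> wr_prod L w (map2 (ycyc L) cs xs)"
  shows wr_prod_marked_closed: "g \<in> carrier (WR w)"
    and wr_prod_marked_snd: "snd g = cycles_perm cs" "acts cs (snd g)"
    and wr_prod_marked_fst: "j < length cs \<Longrightarrow> fst g (Min (set (cs ! j))) = xs ! j"
      "(\<And>j. j < length cs \<Longrightarrow> p \<noteq> Min (set (cs ! j))) \<Longrightarrow> fst g p = \<one>"
    and wr_prod_marked_cyc_val: "j < length cs \<Longrightarrow> cyc_val w g (Min (set (cs ! j))) = xs ! j"
proof -
  have dj: "dj_cycles cs" and U: "(\<Union>c\<in>set cs. set c) = {1..w}" using md by (auto simp: marked_decomp_dj)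
  have sub: "set c \<subseteq> {1..w}" if "c \<in> set cs" for c using U that by blast
  obtain y where y: "g = (y, cycles_perm cs)" "y \<in> base {1..w}"
    "\<And>j. j < length cs \<Longrightarrow> y (Min (set (cs ! j))) = xs ! j"
    "\<And>p. (\<forall>j<length cs. p \<noteq> Min (set (cs ! j))) \<Longrightarrow> y p = \<one>"
    using wr_prod_cycles[OF dj xs sub] unfolding g_def by blast
  have cp: "cycles_perm cs permutes {1..w}" using sub by (rule cycles_perm_permutes)
  show gc: "g \<in> carrier (WR w)" using y(1,2) cp by (simp add: wreath_carrier)
  show s: "snd g = cycles_perm cs" using y by simp
  show act: "acts cs (snd g)" using cycles_perm_acts[OF dj] s by simp
  show f1: "j < length cs \<Longrightarrow> fst g (Min (set (cs ! j))) = xs ! j" for j using y by simp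
  show f2: "(\<And>j. j < length cs \<Longrightarrow> p \<noteq> Min (set (cs ! j))) \<Longrightarrow> fst g p = \<one>" for p using y by simp
  show "cyc_val w g (Min (set (cs ! j))) = xs ! j" if j: "j < length cs"
  proof -
    have perm: "permutation (snd g)" using cp s permutation_permutes by (metis finite_atLeastAtMost)
    note ac = acts_cycle[OF act dj j]
    let ?m = "Min (set (cs ! j))"
    have m: "?m \<in> set (cs ! j)" using ac(1) by (rule Min_cycle_in)
    have xj: "xs ! j \<in> carrier L" using xs j by (auto simp: subset_iff)
    have ot: "fst g q = \<one>" if q: "q \<in> set (cs ! j)" "q \<noteq> ?m" for q
    proof (rule f2)
      fix i assume i: "i < length cs"
      have "Min (set (cs ! i)) \<in> set (cs ! i)" using dj i by (intro Min_cycle_in) (auto simp: dj_cycles_def)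
      then show "q \<noteq> Min (set (cs ! i))"
        using q dj_cycles_disjoint[OF dj i j] by (cases "i = j") auto
    qed
    \<comment> \<open>The first factor read from the least point is \<open>xs ! j\<close>. All later
      ones sit at other points of the cycle, where the entry is trivial.\<close>
    have "fst (g [^]\<^bsub>WR w\<^esub> Suc k) ?m = xs ! j" if "Suc k \<le> length (cs ! j)" for k
      using that
    proof (induction k)
      case 0
      show ?case using gc f1[OF j] by simp
    next
      case (Suc k)
      have "(inv' (snd g) ^^ Suc k) ?m \<in> set (cs ! j)" "(inv' (snd g) ^^ Suc k) ?m \<noteq> ?m"
        using cycle_inv_funpow_mem[OF perm ac m, of "Suc k"] cycle_inv_funpow_neq[OF perm ac m, of "Suc k"]
          Suc.prems by (simp_all del: funpow.simps)
      then have "fst g ((inv' (snd g) ^^ Suc k) ?m) = \<one>" by (rule ot)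
      then show ?case unfolding fst_wreath_pow_Suc[OF gc, of "Suc k"] using Suc xj by simp
    qed
    from this[of "length (cs ! j) - 1"] show ?thesis
      using ac(1) cycle_least_power[OF perm ac m] by (simp add: cyc_val_def)
  qed
qed

lemma orbit_prod_wr_prod:
  assumes "marked_decomp w cs" "length xs = length cs" "set xs \<subseteq> carrier L"
  defines "g \<equiv> wr_prod L w (map2 (ycyc L) cs xs)"
  shows "orbit_prod w (snd g) (\<lambda>p. \<phi> (cyc_val w g p)) = (\<Prod>j<length cs. \<phi> (xs ! j))"
  using orbit_prod_cycles[OF assms(1) wr_prod_marked_snd(2)[OF assms(1-3)]
      snd_permutes[OF wr_prod_marked_closed[OF assms(1-3)]]]
    wr_prod_marked_cyc_val[OF assms(1-3)] by (simp add: g_def)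

end

section \<open>Conjugation to products of marked cycles\<close>

lemma offs_Suc: "i < length ws \<Longrightarrow> offs ws (Suc i) = offs ws i + ws ! i"
  by (simp add: offs_def take_Suc_conv_app_nth)

lemma offs_mono: "i \<le> j \<Longrightarrow> offs ws i \<le> offs ws j"
proof (induction j)
  case 0
  then show ?case by simp
next
  case (Suc j)
  have "offs ws j \<le> offs ws (Suc j)"
    by (cases "j < length ws") (simp_all add: offs_Suc, simp add: offs_def)
  then show ?case using Suc by (cases "i = Suc j") auto
qed

lemma offs_block_le: "i < j \<Longrightarrow> i < length ws \<Longrightarrow> offs ws i + ws ! i \<le> offs ws j"
  using offs_mono[of "Suc i" j ws] offs_Suc[of i ws] by simp

lemma block_disjoint:
  assumes "i < length ws" "j < length ws" "i \<noteq> j"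
  shows "block ws i \<inter> block ws j = {}"
  using assms offs_block_le[of i j ws] offs_block_le[of j i ws]
  by (cases "i < j") (auto simp: block_def)

lemma block_Union: "(\<Union>i<length ws. block ws i) = {1..sum_list ws}"
proof -
  have "(\<Union>i<k. block ws i) = {1..offs ws k}" if "k \<le> length ws" for k
    using that
  proof (induction k)
    case 0
    then show ?case by (simp add: offs_def)
  next
    case (Suc k)
    then have "(\<Union>i<Suc k. block ws i) = {1..offs ws k} \<union> block ws k"
      by (simp add: lessThan_Suc Un_commute)
    then show ?case using Suc.prems by (auto simp: block_def offs_Suc)
  qed
  from this[of "length ws"] show ?thesis by (simp add: offs_def)
qed

lemma block_subset: "i < length ws \<Longrightarrow> block ws i \<subseteq> {1..sum_list ws}"
  using block_Union[of ws] by blast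

lemma canon_cycles_simps:
  "length (canon_cycles lam) = length lam"
  "j < length lam \<Longrightarrow> length (canon_cycles lam ! j) = lam ! j"
  "j < length lam \<Longrightarrow> set (canon_cycles lam ! j) = block lam j"
  by (auto simp: canon_cycles_def block_def)

lemma canon_marked_decomp:
  assumes "\<forall>k\<in>set lam. k > 0"
  shows "marked_decomp (sum_list lam) (canon_cycles lam)"
  unfolding marked_decomp_def
proof (intro conjI allI impI ballI)
  fix c assume "c \<in> set (canon_cycles lam)"
  then obtain j where j: "j < length lam" "c = canon_cycles lam ! j"
    by (metis canon_cycles_simps(1) in_set_conv_nth)
  then have "length c > 0" using assms canon_cycles_simps(2)[OF j(1)] by simp
  then show "c \<noteq> []" by simp
  show "distinct c" using j by (simp add: canon_cycles_def)
next
  fix i j assume "i < length (canon_cycles lam)" "j < length (canon_cycles lam)" "i \<noteq> j"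
  then show "set (canon_cycles lam ! i) \<inter> set (canon_cycles lam ! j) = {}"
    using block_disjoint[of i lam j] by (simp add: canon_cycles_simps)
next
  have "(\<Union>c\<in>set (canon_cycles lam). set c) = (\<Union>j<length lam. set (canon_cycles lam ! j))"
    unfolding set_conv_nth[of "canon_cycles lam"] by (auto simp: canon_cycles_simps(1))
  also have "\<dots> = {1..sum_list lam}" using block_Union[of lam] by (simp add: canon_cycles_simps)
  finally show "(\<Union>c\<in>set (canon_cycles lam). set c) = {1..sum_list lam}" .
qed

text \<open>This form depends only on the set of cycles and on distinctness, so it survives sorting
  the cycles by length.\<close>

lemma dj_cycles_iff:
  "dj_cycles cs \<longleftrightarrow> (\<forall>c\<in>set cs. c \<noteq> [] \<and> distinct c) \<and> distinct cs \<and>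
    (\<forall>c\<in>set cs. \<forall>d\<in>set cs. c \<noteq> d \<longrightarrow> set c \<inter> set d = {})" (is "?L \<longleftrightarrow> ?R")
proof
  assume L: ?L
  have ne: "\<forall>c\<in>set cs. c \<noteq> [] \<and> distinct c" using L by (simp add: dj_cycles_def)
  have "distinct cs"
    unfolding distinct_conv_nth
  proof (intro allI impI)
    fix i j assume ij: "i < length cs" "j < length cs" "i \<noteq> j"
    then have "set (cs ! i) \<inter> set (cs ! j) = {}" by (rule dj_cycles_disjoint[OF L])
    moreover have "cs ! i \<noteq> []" using ne ij by simp
    ultimately show "cs ! i \<noteq> cs ! j" by auto
  qed
  moreover have "set c \<inter> set d = {}" if cd: "c \<in> set cs" "d \<in> set cs" "c \<noteq> d" for c d
  proof -
    obtain i j where "i < length cs" "j < length cs" "c = cs ! i" "d = cs ! j"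
      using cd by (metis in_set_conv_nth)
    then show ?thesis using dj_cycles_disjoint[OF L, of i j] cd(3) by auto
  qed
  ultimately show ?R using ne by blast
next
  assume R: ?R
  then have "set (cs ! i) \<inter> set (cs ! j) = {}" if "i < length cs" "j < length cs" "i \<noteq> j" for i j
    using that nth_eq_iff_index_eq[of cs i j] by simp
  then show ?L using R by (simp add: dj_cycles_def)
qed

lemma acts_iff:
  "acts cs \<sigma> \<longleftrightarrow> (\<forall>c\<in>set cs. \<forall>i<length c. \<sigma> (c ! i) = c ! (Suc i mod length c))"
  unfolding acts_def by (metis in_set_conv_nth)

lemma exists_cycles:
  assumes "\<sigma> permutes S" "finite S"
  shows "\<exists>cs. dj_cycles cs \<and> (\<Union>c\<in>set cs. set c) = S \<and> acts cs \<sigma>"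
proof -
  have "\<sigma> permutes S \<and> (\<exists>cs. dj_cycles cs \<and> (\<Union>c\<in>set cs. set c) = S \<and> acts cs \<sigma>)"
    if "cycle_decomp S \<sigma>" for S and \<sigma> :: "nat \<Rightarrow> nat"
    using that
  proof (induction rule: cycle_decomp.induct)
    case empty
    show ?case by (auto intro!: exI[of _ "[]"] simp: dj_cycles_def acts_def permutes_id)
  next
    case (comp I p c)
    from comp.IH obtain cs where cs: "dj_cycles cs" "(\<Union>c\<in>set cs. set c) = I" "acts cs p" and p: "p permutes I"
      by blast
    have 1: "cycle_of_list c \<circ> p permutes set c \<union> I"
      using permutes_subset[OF p] permutes_subset[OF cycle_permutes[of c]] by (intro permutes_compose) auto
    show ?case
    \<comment> \<open>\<open>cycle_decomp\<close> admits the empty cycle, which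
      \<open>dj_cycles\<close> excludes.\<close>
    proof (cases "c = []")
      case True
      then show ?thesis using 1 cs by (intro conjI exI[of _ cs]) auto
    next
      case False
      have "c \<notin> set cs"
      proof
        assume "c \<in> set cs"
        then have "set c \<subseteq> I" using cs(2) by blast
        then have "set c \<inter> I = set c" by (rule Int_absorb2)
        then show False using comp.hyps(3) False by simp
      qed
      then have dj: "dj_cycles (c # cs)"
        using cs(1,2) comp.hyps(2,3) False unfolding dj_cycles_iff by auto
      have "(cycle_of_list c \<circ> p) (d ! i) = d ! (Suc i mod length d)" if d: "d \<in> set (c # cs)" "i < length d" for d i
      proof (cases "d = c")
        case True
        then have "c ! i \<notin> I" using comp.hyps(3) d by (auto dest: nth_mem)
        then have "p (c ! i) = c ! i" using p by (simp add: permutes_not_in)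
        then show ?thesis using True d cycle_of_list_nth[OF comp.hyps(2)] by simp
      next
        case False
        then have d': "d \<in> set cs" using d by simp
        then have "p (d ! i) = d ! (Suc i mod length d)" using cs(3) d(2) by (simp add: acts_iff)
        moreover have "d ! (Suc i mod length d) \<in> set d" using d(2) by (intro nth_mem mod_less_divisor) auto
        then have "d ! (Suc i mod length d) \<in> I" using cs(2) d' by blast
        then have "d ! (Suc i mod length d) \<notin> set c" using comp.hyps(3) by blast
        ultimately show ?thesis by (simp add: id_outside_supp)
      qed
      then have "acts (c # cs) (cycle_of_list c \<circ> p)" unfolding acts_iff by blast
      moreover have "(\<Union>d\<in>set (c # cs). set d) = set c \<union> I" using cs(2) by simp
      ultimately show ?thesis using 1 dj by blast
    qed
  qed
  then show ?thesis using cycle_decomposition[OF assms] by blast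
qed

text \<open>Cycle number and place in the cycle serve as coordinates on \<open>{1..w}\<close>. They
  give the count of points and the matching of two decompositions of the same shape.\<close>

lemma marked_decomp_bij:
  assumes "marked_decomp w cs"
  shows "bij_betw (\<lambda>(j, i). cs ! j ! i) (SIGMA j:{..<length cs}. {..<length (cs ! j)}) {1..w}"
proof (rule bij_betw_imageI)
  have dj: "dj_cycles cs" and U: "(\<Union>c\<in>set cs. set c) = {1..w}" using assms by (auto simp: marked_decomp_dj)
  show "inj_on (\<lambda>(j, i). cs ! j ! i) (SIGMA j:{..<length cs}. {..<length (cs ! j)})"
  proof (rule inj_onI)
    fix a b assume ab: "a \<in> (SIGMA j:{..<length cs}. {..<length (cs ! j)})"
      "b \<in> (SIGMA j:{..<length cs}. {..<length (cs ! j)})"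
      "(case a of (j, i) \<Rightarrow> cs ! j ! i) = (case b of (j, i) \<Rightarrow> cs ! j ! i)"
    obtain j i j' i' where p: "a = (j, i)" "b = (j', i')" by (cases a; cases b)
    have h: "j \<in> {..<length cs}" "i \<in> {..<length (cs ! j)}" "j' \<in> {..<length cs}"
      "i' \<in> {..<length (cs ! j')}" "cs ! j ! i = cs ! j' ! i'" using ab by (auto simp: p)
    have 1: "cs ! j ! i \<in> set (cs ! j)" using h(2) by simp
    have 2: "cs ! j ! i \<in> set (cs ! j')" unfolding h(5) using h(4) by simp
    have jj: "j = j'" using 1 2 dj_cycles_disjoint[OF dj, of j j'] h(1,3) by (cases "j = j'") auto
    have d: "distinct (cs ! j)" using dj h(1) by (simp add: dj_cycles_def)
    have "cs ! j ! i = cs ! j ! i'" "i < length (cs ! j)" "i' < length (cs ! j)"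
      using h(2,4,5) unfolding jj by simp_all
    then have "i = i'" using nth_eq_iff_index_eq[OF d] by blast
    with jj show "a = b" by (simp add: p)
  qed
  have "(\<lambda>(j, i). cs ! j ! i) ` (SIGMA j:{..<length cs}. {..<length (cs ! j)}) = (\<Union>c\<in>set cs. set c)"
  proof
    show "(\<lambda>(j, i). cs ! j ! i) ` (SIGMA j:{..<length cs}. {..<length (cs ! j)}) \<subseteq> (\<Union>c\<in>set cs. set c)"
    proof
      fix p assume "p \<in> (\<lambda>(j, i). cs ! j ! i) ` (SIGMA j:{..<length cs}. {..<length (cs ! j)})"
      then obtain j i where ji: "j < length cs" "i < length (cs ! j)" "p = cs ! j ! i" by auto
      then have "cs ! j ! i \<in> set (cs ! j)" "cs ! j \<in> set cs" by simp_all
      then show "p \<in> (\<Union>c\<in>set cs. set c)" unfolding ji(3) by blast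
    qed
    show "(\<Union>c\<in>set cs. set c) \<subseteq> (\<lambda>(j, i). cs ! j ! i) ` (SIGMA j:{..<length cs}. {..<length (cs ! j)})"
    proof
      fix p assume "p \<in> (\<Union>c\<in>set cs. set c)"
      then obtain c where c: "c \<in> set cs" "p \<in> set c" by blast
      then obtain j i where "j < length cs" "c = cs ! j" "i < length c" "p = c ! i" by (metis in_set_conv_nth)
      then show "p \<in> (\<lambda>(j, i). cs ! j ! i) ` (SIGMA j:{..<length cs}. {..<length (cs ! j)})"
        by (intro image_eqI[of _ _ "(j, i)"]) auto
    qed
  qed
  then show "(\<lambda>(j, i). cs ! j ! i) ` (SIGMA j:{..<length cs}. {..<length (cs ! j)}) = {1..w}" using U by simp
qed

lemma marked_decomp_sum:
  assumes "marked_decomp w cs"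
  shows "sum_list (map length cs) = w"
proof -
  have "card (SIGMA j:{..<length cs}. {..<length (cs ! j)}) = card {1..w}"
    by (rule bij_betw_same_card[OF marked_decomp_bij[OF assms]])
  then have "(\<Sum>j<length cs. length (cs ! j)) = w" by simp
  then show ?thesis by (simp add: sum_list_sum_nth lessThan_atLeast0)
qed

text \<open>\<open>\<pi>\<close> sends each point to the point with the same coordinates in the
  other decomposition.\<close>

lemma conj_to_marked:
  assumes md: "marked_decomp w cs" and md': "marked_decomp w cs'" and len: "map length cs = map length cs'"
    and act: "acts cs \<sigma>"
  obtains \<pi> where "\<pi> permutes {1..w}" "acts cs' (\<pi> \<circ> \<sigma> \<circ> inv' \<pi>)"
proof -
  let ?I = "SIGMA j:{..<length cs}. {..<length (cs ! j)}"
  let ?f = "\<lambda>(j, i). cs ! j ! i" and ?f' = "\<lambda>(j, i). cs' ! j ! i"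
  have ll: "length cs = length cs'" using len by (metis length_map)
  have lj: "length (cs ! j) = length (cs' ! j)" if "j < length cs" for j
    using len that ll by (metis nth_map)
  have I': "?I = (SIGMA j:{..<length cs'}. {..<length (cs' ! j)})"
    using ll lj by (intro Sigma_cong) auto
  have b: "bij_betw ?f ?I {1..w}" by (rule marked_decomp_bij[OF md])
  have b': "bij_betw ?f' ?I {1..w}" unfolding I' by (rule marked_decomp_bij[OF md'])
  define \<pi> where "\<pi> p = (if p \<in> {1..w} then ?f' (inv_into ?I ?f p) else p)" for p
  have "bij_betw (?f' \<circ> inv_into ?I ?f) {1..w} {1..w}"
    by (rule bij_betw_trans[OF bij_betw_inv_into[OF b] b'])
  then have "bij_betw \<pi> {1..w} {1..w}" by (rule bij_betw_cong[THEN iffD1, rotated]) (simp add: \<pi>_def)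
  then have \<pi>: "\<pi> permutes {1..w}" by (rule bij_imp_permutes) (auto simp: \<pi>_def)
  have \<pi>f: "\<pi> (cs ! j ! i) = cs' ! j ! i" if ji: "j < length cs" "i < length (cs ! j)" for j i
  proof -
    have m: "(j, i) \<in> ?I" using ji by simp
    have "inv_into ?I ?f (?f (j, i)) = (j, i)" using b m by (intro inv_into_f_f) (auto simp: bij_betw_def)
    moreover have "?f (j, i) \<in> {1..w}" using b m by (rule bij_betwE[THEN bspec])
    ultimately show ?thesis by (simp add: \<pi>_def)
  qed
  have "(\<pi> \<circ> \<sigma> \<circ> inv' \<pi>) (cs' ! j ! i) = cs' ! j ! (Suc i mod length (cs' ! j))"
    if ji: "j < length cs'" "i < length (cs' ! j)" for j i
  proof -
    have ji': "j < length cs" "i < length (cs ! j)" using ji ll lj by auto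
    have "inv' \<pi> (cs' ! j ! i) = cs ! j ! i"
      using permutes_inverses(2)[OF \<pi>, of "cs ! j ! i"] \<pi>f[OF ji'] by simp
    moreover have "\<sigma> (cs ! j ! i) = cs ! j ! (Suc i mod length (cs ! j))" using act ji' by (simp add: acts_def)
    moreover have "Suc i mod length (cs ! j) < length (cs ! j)" using ji'(2) by (intro mod_less_divisor) auto
    ultimately show ?thesis using \<pi>f[OF ji'(1)] lj[OF ji'(1)] by simp
  qed
  then have "acts cs' (\<pi> \<circ> \<sigma> \<circ> inv' \<pi>)" unfolding acts_def by blast
  with \<pi> show ?thesis by (rule that)
qed

lemma exists_partition_cycles:
  assumes "\<sigma> permutes {1..w}"
  obtains cs where "marked_decomp w cs" "acts cs \<sigma>" "is_partition w (map length cs)"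
proof -
  obtain cs0 where cs0: "dj_cycles cs0" "(\<Union>c\<in>set cs0. set c) = {1..w}" "acts cs0 \<sigma>"
    using exists_cycles[OF assms] by auto
  \<comment> \<open>A partition lists its parts in weakly decreasing order, so the cycles are
    arranged by decreasing length.\<close>
  define cs where "cs = rev (sort_key length cs0)"
  have s: "set cs = set cs0" "distinct cs \<longleftrightarrow> distinct cs0" by (simp_all add: cs_def distinct_sort)
  have md: "marked_decomp w cs" using cs0 unfolding marked_decomp_dj dj_cycles_iff s by blast
  moreover have "acts cs \<sigma>" using cs0(3) unfolding acts_iff s .
  moreover have "is_partition w (map length cs)"
    unfolding is_partition_def
  proof (intro conjI)
    show "sum_list (map length cs) = w" by (rule marked_decomp_sum[OF md])
    show "\<forall>k\<in>set (map length cs). 0 < k" using md by (auto simp: marked_decomp_def)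
    have "sorted (map length (sort_key length cs0))" by (rule sorted_sort_key)
    then show "sorted_wrt (\<ge>) (map length cs)"
      unfolding cs_def by (simp add: rev_map[symmetric] sorted_wrt_rev)
  qed
  ultimately show ?thesis by (rule that)
qed

section \<open>Normal forms up to conjugacy and the values of tilde powers\<close>

context finite_group
begin

text \<open>The permutation part is already the right one, so a conjugating element of the base
  group suffices. It gathers all entries of a cycle at its least point.\<close>

lemma conj_base_marked:
  assumes md: "marked_decomp w cs" and g: "g \<in> carrier (WR w)" and act: "acts cs (snd g)"
  defines "zs \<equiv> map (\<lambda>c. cyc_val w g (Min (set c))) cs"
  shows "\<exists>h\<in>carrier (WR w). h \<otimes>\<^bsub>WR w\<^esub> g = wr_prod L w (map2 (ycyc L) cs zs) \<otimes>\<^bsub>WR w\<^esub> h"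
proof -
  obtain x \<sigma> where gd: "g = (x, \<sigma>)" by (cases g)
  have x: "x \<in> base {1..w}" and \<sigma>: "\<sigma> permutes {1..w}" using g by (auto simp: gd wreath_carrier)
  have perm: "permutation \<sigma>" using \<sigma> permutation_permutes by blast
  have dj: "dj_cycles cs" and U: "(\<Union>c\<in>set cs. set c) = {1..w}" using md by (auto simp: marked_decomp_dj)
  have zs: "length zs = length cs" "set zs \<subseteq> carrier L" using cyc_val_closed[OF g] by (auto simp: zs_def)
  have U': "set c \<subseteq> {1..w}" if "c \<in> set cs" for c using U that by blast
  define g' where "g' = wr_prod L w (map2 (ycyc L) cs zs)"
  note wp = wr_prod_marked[OF md zs, folded g'_def]
  have sg': "snd g' = \<sigma>"
    using acts_unique[OF wp(3) act U snd_permutes[OF wp(1)] snd_permutes[OF g]] gd by simp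
  define m where "m p = Min (orb \<sigma> p)" for p
  define i where "i p = (LEAST k. (\<sigma> ^^ k) (m p) = p)" for p
  have mo: "m p \<in> orb \<sigma> p" if "p \<in> {1..w}" for p unfolding m_def by (rule Min_orb_in[OF \<sigma> that])
  have i: "(\<sigma> ^^ i p) (m p) = p" if "p \<in> {1..w}" for p
  proof -
    have "p \<in> orb \<sigma> (m p)" using orb_eq[OF perm mo[OF that]] self_in_orb by auto
    then obtain k where "p = (\<sigma> ^^ k) (m p)" by (auto simp: orb_def)
    then have "(\<sigma> ^^ k) (m p) = p" by simp
    then show ?thesis unfolding i_def by (rule LeastI)
  qed
  \<comment> \<open>With \<open>i p\<close> steps from the least point to \<open>p\<close>, the
    inverted entry is the product of the entries of \<open>g\<close> from \<open>p\<close> back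
    along the cycle, ending just after the least point. At the least point itself it is
    trivial.\<close>
  define y where "y p = (if p \<in> {1..w} then inv (fst (g [^]\<^bsub>WR w\<^esub> i p) p) else \<one>)" for p
  have gk: "g [^]\<^bsub>WR w\<^esub> k \<in> carrier (WR w)" for k :: nat using g by (rule wr.nat_pow_closed)
  have fk: "fst (g [^]\<^bsub>WR w\<^esub> k) p \<in> carrier L" for k :: nat and p by (rule fst_closed[OF gk])
  have yb: "y \<in> base {1..w}" unfolding y_def base_def using fk by auto
  define h where "h = (y, id :: nat \<Rightarrow> nat)"
  have h: "h \<in> carrier (WR w)" using yb by (simp add: h_def wreath_carrier permutes_id)
  have Suc2: "fst (g [^]\<^bsub>WR w\<^esub> Suc k) p = x p \<otimes> fst (g [^]\<^bsub>WR w\<^esub> k) (inv' \<sigma> p)" for k p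
  proof -
    have "g [^]\<^bsub>WR w\<^esub> Suc k = g \<otimes>\<^bsub>WR w\<^esub> g [^]\<^bsub>WR w\<^esub> k" by (rule wr.nat_pow_Suc2[OF g])
    moreover obtain a \<alpha> where "g [^]\<^bsub>WR w\<^esub> k = (a, \<alpha>)" by (cases "g [^]\<^bsub>WR w\<^esub> k")
    ultimately show ?thesis by (simp add: gd wreath_mult)
  qed
  \<comment> \<open>The relation \<open>h g = g' h\<close> at position \<open>p\<close>.\<close>
  have key: "y p \<otimes> x p = fst g' p \<otimes> y (inv' \<sigma> p)" for p
  proof (cases "p \<in> {1..w}")
    case False
    then have "inv' \<sigma> p = p" using permutes_inv[OF \<sigma>] by (simp add: permutes_not_in)
    moreover have "fst g' p = \<one>" using wp(1) False by (auto simp: wreath_carrier base_def)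
    moreover have "x p = \<one>" using x False by (auto simp: base_def)
    moreover have "y p = \<one>" using False by (simp only: y_def if_False)
    ultimately show ?thesis by simp
  next
    case True
    let ?q = "inv' \<sigma> p"
    have q: "?q \<in> {1..w}" using True permutes_in_image[OF permutes_inv[OF \<sigma>]] by blast
    have \<sigma>q: "\<sigma> ?q = p" using permutes_inverses(1)[OF \<sigma>] by simp
    have "p \<in> orb \<sigma> ?q" unfolding orb_def by (rule range_eqI[of _ _ 1]) (simp add: \<sigma>q)
    then have mq: "m ?q = m p" unfolding m_def using orb_eq[OF perm] by metis
    have pw: "(\<sigma> ^^ k) (m p) = ?q \<longleftrightarrow> (\<sigma> ^^ Suc k) (m p) = p" for k
      using \<sigma>q permutes_inverses(2)[OF \<sigma>] by (metis comp_apply funpow.simps(2))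
    obtain j where j: "j < length cs" "p \<in> set (cs ! j)" using True U by (metis UN_E in_set_conv_nth)
    note ac = acts_cycle[OF act dj j(1)]
    have act\<sigma>: "\<And>i. i < length (cs ! j) \<Longrightarrow> \<sigma> (cs ! j ! i) = cs ! j ! (Suc i mod length (cs ! j))"
      using ac(3) by (simp add: gd)
    have mp: "m p = Min (set (cs ! j))" unfolding m_def using cycle_orb[OF perm ac(1,2) act\<sigma> j(2)] by simp
    show ?thesis
    \<comment> \<open>At the least point the predecessor is \<open>k - 1\<close> steps away and the
      cycle closes, so the full cycle product appears. Elsewhere the number of steps rises by one,
      \<open>g'\<close> has a trivial entry and both sides telescope.\<close>
    proof (cases "p = m p")
      case perm_elt: True
      have i0: "i p = 0" unfolding i_def using perm_elt by (intro Least_equality) auto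
      have yp: "y p = \<one>" using True i0 by (simp add: y_def wreath_one)
      define k where "k = least_power \<sigma> p"
      have k0: "k > 0" using least_power_of_permutation(2)[OF perm] by (simp add: k_def)
      have iq: "i ?q = k - 1"
        unfolding i_def mq
      proof (rule Least_equality)
        show "(\<sigma> ^^ (k - 1)) (m p) = ?q"
          unfolding pw using least_power_of_permutation(1)[OF perm, of p] k0 perm_elt by (simp add: k_def)
        fix l assume "(\<sigma> ^^ l) (m p) = ?q"
        then have "(\<sigma> ^^ Suc l) p = p" unfolding pw using perm_elt by simp
        then have "k \<le> Suc l" unfolding k_def by (rule least_power_le) simp
        then show "k - 1 \<le> l" by simp
      qed
      have "fst g' p = zs ! j" using wp(4)[OF j(1)] perm_elt mp by simp
      also have "\<dots> = cyc_val w g p" using j(1) perm_elt mp by (simp add: zs_def)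
      also have "\<dots> = x p \<otimes> fst (g [^]\<^bsub>WR w\<^esub> (k - 1)) ?q"
      proof -
        have "snd g = \<sigma>" by (simp add: gd)
        then have "cyc_val w g p = fst (g [^]\<^bsub>WR w\<^esub> Suc (k - 1)) p"
          unfolding cyc_val_def using k0 by (simp only: k_def[symmetric] Suc_diff_1)
        then show ?thesis by (simp only: Suc2)
      qed
      finally have "fst g' p = x p \<otimes> fst (g [^]\<^bsub>WR w\<^esub> (k - 1)) ?q" .
      moreover have "y ?q = inv (fst (g [^]\<^bsub>WR w\<^esub> (k - 1)) ?q)" using q iq by (simp add: y_def)
      ultimately show ?thesis using yp fk[of "k - 1" ?q] base_closed[OF x, of p] by (simp add: m_assoc)
    next
      case perm_elt: False
      have ip: "i p \<noteq> 0" using i[OF True] perm_elt by (metis funpow_0)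
      then obtain k where k: "i p = Suc k" by (cases "i p") auto
      have iq: "i ?q = k"
        unfolding i_def mq
      proof (rule Least_equality)
        show "(\<sigma> ^^ k) (m p) = ?q" unfolding pw using i[OF True] k by simp
        fix l assume "(\<sigma> ^^ l) (m p) = ?q"
        then have "(\<sigma> ^^ Suc l) (m p) = p" unfolding pw .
        then have "i p \<le> Suc l" unfolding i_def by (rule Least_le)
        then show "k \<le> l" using k by simp
      qed
      have "fst g' p = \<one>"
      proof (rule wp(5))
        fix j' assume j': "j' < length cs"
        show "p \<noteq> Min (set (cs ! j'))"
        proof
          assume e: "p = Min (set (cs ! j'))"
          have "cs ! j' \<noteq> []" using dj j' by (simp add: dj_cycles_def)
          then have "p \<in> set (cs ! j')" using e Min_cycle_in by simp
          then have "j' = j" using dj_cycles_disjoint[OF dj j' j(1)] j(2) by auto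
          then show False using e mp perm_elt by simp
        qed
      qed
      moreover have "y p = inv (x p \<otimes> fst (g [^]\<^bsub>WR w\<^esub> k) ?q)"
        using True by (simp only: y_def k Suc2 if_True)
      moreover have "y ?q = inv (fst (g [^]\<^bsub>WR w\<^esub> k) ?q)" using q iq by (simp add: y_def)
      ultimately show ?thesis
        using fk[of k ?q] base_closed[OF x, of p] by (simp add: inv_mult_group m_assoc)
    qed
  qed
  have "h \<otimes>\<^bsub>WR w\<^esub> g = g' \<otimes>\<^bsub>WR w\<^esub> h"
  proof -
    obtain x' where g'd: "g' = (x', \<sigma>)" using sg' by (cases g') auto
    show ?thesis using key by (simp add: g'd gd h_def wreath_mult)
  qed
  then show ?thesis using h g'_def by blast
qed

text \<open>A permutation moves the cycles to the standard places, and an element of the base group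
  then gathers the entries. Class functions are thereby determined by their values on the arguments
  of \<open>omega\<close>.\<close>

lemma conj_canonical:
  assumes g: "g \<in> carrier (WR w)"
  obtains lam zs h where "is_partition w lam" "length zs = length lam" "set zs \<subseteq> carrier L"
    "h \<in> carrier (WR w)" "h \<otimes>\<^bsub>WR w\<^esub> g = wr_prod L w (map2 (ycyc L) (canon_cycles lam) zs) \<otimes>\<^bsub>WR w\<^esub> h"
proof -
  obtain cs where cs: "marked_decomp w cs" "acts cs (snd g)" "is_partition w (map length cs)"
    by (rule exists_partition_cycles[OF snd_permutes[OF g]])
  define lam where "lam = map length cs"
  have lam: "is_partition w lam" using cs(3) by (simp add: lam_def)
  have md: "marked_decomp w (canon_cycles lam)"
    using canon_marked_decomp[of lam] lam by (auto simp: is_partition_def)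
  have len: "map length cs = map length (canon_cycles lam)"
    by (rule nth_equalityI) (simp_all add: lam_def canon_cycles_simps)
  obtain \<pi> where \<pi>: "\<pi> permutes {1..w}" "acts (canon_cycles lam) (\<pi> \<circ> snd g \<circ> inv' \<pi>)"
    by (rule conj_to_marked[OF cs(1) md len cs(2)])
  define h1 where "h1 = ((\<lambda>_. \<one>) :: nat \<Rightarrow> 'a, \<pi>)"
  have h1: "h1 \<in> carrier (WR w)" using \<pi>(1) by (simp add: h1_def wreath_carrier base_def)
  define g1 where "g1 = h1 \<otimes>\<^bsub>WR w\<^esub> g \<otimes>\<^bsub>WR w\<^esub> inv\<^bsub>WR w\<^esub> h1"
  have g1: "g1 \<in> carrier (WR w)" using h1 g by (simp add: g1_def)
  have e1: "h1 \<otimes>\<^bsub>WR w\<^esub> g = g1 \<otimes>\<^bsub>WR w\<^esub> h1" using h1 g by (simp add: g1_def wr.m_assoc)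
  have "snd g1 \<circ> \<pi> = \<pi> \<circ> snd g" using cyc_val_conj(2)[OF g g1 h1 e1] by (simp add: h1_def)
  then have "snd g1 = \<pi> \<circ> snd g \<circ> inv' \<pi>"
    using permutes_inv_o(1)[OF \<pi>(1)] by (metis comp_assoc comp_id)
  then have act1: "acts (canon_cycles lam) (snd g1)" using \<pi>(2) by simp
  define zs where "zs = map (\<lambda>c. cyc_val w g1 (Min (set c))) (canon_cycles lam)"
  obtain h2 where h2: "h2 \<in> carrier (WR w)"
    "h2 \<otimes>\<^bsub>WR w\<^esub> g1 = wr_prod L w (map2 (ycyc L) (canon_cycles lam) zs) \<otimes>\<^bsub>WR w\<^esub> h2"
    using conj_base_marked[OF md g1 act1] unfolding zs_def by blast
  have zs: "length zs = length (canon_cycles lam)" "set zs \<subseteq> carrier L"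
    using cyc_val_closed[OF g1] by (auto simp: zs_def)
  have P: "wr_prod L w (map2 (ycyc L) (canon_cycles lam) zs) \<in> carrier (WR w)"
    by (rule wr_prod_marked_closed[OF md zs])
  have "h2 \<otimes>\<^bsub>WR w\<^esub> h1 \<otimes>\<^bsub>WR w\<^esub> g = h2 \<otimes>\<^bsub>WR w\<^esub> g1 \<otimes>\<^bsub>WR w\<^esub> h1"
    using h1 h2(1) g g1 e1 by (simp add: wr.m_assoc)
  also have "\<dots> = wr_prod L w (map2 (ycyc L) (canon_cycles lam) zs) \<otimes>\<^bsub>WR w\<^esub> (h2 \<otimes>\<^bsub>WR w\<^esub> h1)"
    unfolding h2(2) using h1 h2(1) P by (simp add: wr.m_assoc)
  finally show ?thesis
    using zs h1 h2(1) lam canon_cycles_simps(1)[of lam] by (intro that[of lam zs "h2 \<otimes>\<^bsub>WR w\<^esub> h1"]) auto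
qed

text \<open>The definition chooses a value: \<open>conj_canonical\<close> shows that one exists, and
  invariance of the orbit product under conjugation shows that there is only one.\<close>

lemma tilde_pow_eq:
  assumes \<phi>: "class_fun \<phi>" and g: "g \<in> carrier (WR m)"
  shows "tilde_pow L \<phi> m g = orbit_prod m (snd g) (\<lambda>p. \<phi> (cyc_val m g p))"
proof -
  let ?P = "\<lambda>v. \<exists>cs xs h. marked_decomp m cs \<and> length xs = length cs \<and> set xs \<subseteq> carrier L \<and>
         h \<in> carrier (WR m) \<and>
         g = h \<otimes>\<^bsub>WR m\<^esub> wr_prod L m (map2 (ycyc L) cs xs) \<otimes>\<^bsub>WR m\<^esub> inv\<^bsub>WR m\<^esub> h \<and>
         v = (\<Prod>j<length xs. \<phi> (xs ! j))"
  have uniq: "v = orbit_prod m (snd g) (\<lambda>p. \<phi> (cyc_val m g p))" if "?P v" for v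
  proof -
    from that obtain cs xs h where *: "marked_decomp m cs" "length xs = length cs" "set xs \<subseteq> carrier L"
      "h \<in> carrier (WR m)"
      "g = h \<otimes>\<^bsub>WR m\<^esub> wr_prod L m (map2 (ycyc L) cs xs) \<otimes>\<^bsub>WR m\<^esub> inv\<^bsub>WR m\<^esub> h"
      "v = (\<Prod>j<length xs. \<phi> (xs ! j))" by blast
    note P = wr_prod_marked_closed[OF *(1-3)]
    have "h \<otimes>\<^bsub>WR m\<^esub> wr_prod L m (map2 (ycyc L) cs xs) = g \<otimes>\<^bsub>WR m\<^esub> h"
      unfolding *(5) using *(4) P by (simp add: wr.m_assoc)
    from orbit_prod_class_fun_conj[OF \<phi> P g *(4) this] orbit_prod_wr_prod[OF *(1-3), of \<phi>]
    show ?thesis using *(2,6) by simp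
  qed
  obtain lam zs h where l: "is_partition m lam" "length zs = length lam" "set zs \<subseteq> carrier L"
    "h \<in> carrier (WR m)" "h \<otimes>\<^bsub>WR m\<^esub> g = wr_prod L m (map2 (ycyc L) (canon_cycles lam) zs) \<otimes>\<^bsub>WR m\<^esub> h"
    by (rule conj_canonical[OF g])
  have md: "marked_decomp m (canon_cycles lam)"
    using canon_marked_decomp[of lam] l(1) by (auto simp: is_partition_def)
  have len: "length zs = length (canon_cycles lam)" using l(2) by (simp add: canon_cycles_simps)
  note P = wr_prod_marked_closed[OF md len l(3)]
  have "g = inv\<^bsub>WR m\<^esub> h \<otimes>\<^bsub>WR m\<^esub> (h \<otimes>\<^bsub>WR m\<^esub> g)" using l(4) g by (simp add: wr.m_assoc[symmetric])
  also have "\<dots> = inv\<^bsub>WR m\<^esub> h \<otimes>\<^bsub>WR m\<^esub> wr_prod L m (map2 (ycyc L) (canon_cycles lam) zs) \<otimes>\<^bsub>WR m\<^esub> inv\<^bsub>WR m\<^esub> (inv\<^bsub>WR m\<^esub> h)"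
    unfolding l(5) using l(4) P by (simp add: wr.m_assoc[symmetric])
  finally have "?P (\<Prod>j<length zs. \<phi> (zs ! j))"
    using md len l(3,4) by (intro exI[of _ "canon_cycles lam"] exI[of _ zs] exI[of _ "inv\<^bsub>WR m\<^esub> h"]) auto
  then have "?P (SOME v. ?P v)" by (rule someI)
  from uniq[OF this] show ?thesis using g by (simp add: tilde_pow_def)
qed

end

section \<open>Young subgroups and colourings\<close>

text \<open>As a function of \<open>p\<close> this is the standard colouring with class sizes
  \<open>ws\<close>, from which the other colourings of this type arise by permuting
  positions.\<close>

definition block_of :: "nat list \<Rightarrow> nat \<Rightarrow> nat" where
  "block_of ws p = (THE i. i < length ws \<and> p \<in> block ws i)"

lemma block_of_eq: "i < length ws \<Longrightarrow> p \<in> block ws i \<Longrightarrow> block_of ws p = i"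
  unfolding block_of_def using block_disjoint[of _ ws i] by (intro the_equality) auto

lemma block_of_mem:
  assumes "p \<in> {1..sum_list ws}"
  shows "block_of ws p < length ws" "p \<in> block ws (block_of ws p)"
proof -
  obtain i where "i < length ws" "p \<in> block ws i" using assms block_Union[of ws] by blast
  then show "block_of ws p < length ws" "p \<in> block ws (block_of ws p)" using block_of_eq by auto
qed

lemma block_stable_iff:
  assumes "\<sigma> permutes {1..sum_list ws}"
  shows "(\<forall>i<length ws. \<sigma> ` block ws i = block ws i) \<longleftrightarrow> (\<forall>p\<in>{1..sum_list ws}. block_of ws (\<sigma> p) = block_of ws p)"
    (is "?L \<longleftrightarrow> ?R")
proof
  assume L: ?L
  show ?R
  proof
    fix p assume p: "p \<in> {1..sum_list ws}"
    note c = block_of_mem[OF p]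
    have "\<sigma> p \<in> block ws (block_of ws p)" using L c by blast
    then show "block_of ws (\<sigma> p) = block_of ws p" using c(1) by (intro block_of_eq)
  qed
next
  assume R: ?R
  show ?L
  proof (intro allI impI)
    fix i assume i: "i < length ws"
    have "\<sigma> ` block ws i \<subseteq> block ws i"
    proof
      fix q assume "q \<in> \<sigma> ` block ws i"
      then obtain p where p: "p \<in> block ws i" "q = \<sigma> p" by blast
      have pw: "p \<in> {1..sum_list ws}" using p block_subset[OF i] by blast
      then have "\<sigma> p \<in> {1..sum_list ws}" using permutes_in_image[OF assms] by blast
      from block_of_mem(2)[OF this] show "q \<in> block ws i" using R pw block_of_eq[OF i p(1)] p(2) by auto
    qed
    then show "\<sigma> ` block ws i = block ws i"
      using permutes_inj[OF assms] by (intro endo_inj_surj) (auto simp: block_def intro: inj_on_subset)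
  qed
qed

lemma block_shift: "i < length ws \<Longrightarrow> block ws i = (\<lambda>j. offs ws i + j) ` {1..ws ! i}"
  by (auto simp: block_def image_iff intro!: bexI[of _ "_ - offs ws i"])

context
  fixes \<sigma> \<tau> :: "nat \<Rightarrow> nat" and m d w :: nat
  assumes \<sigma>: "\<sigma> permutes {1..w}" and \<tau>: "\<tau> permutes {1..m}"
    and sh: "\<And>j. j \<in> {1..m} \<Longrightarrow> \<sigma> (d + j) = d + \<tau> j"
begin

lemma shift_funpow: "j \<in> {1..m} \<Longrightarrow> (\<sigma> ^^ k) (d + j) = d + (\<tau> ^^ k) j"
  by (induction k) (simp_all add: sh permutes_funpow_in[OF \<tau>] del: atLeastAtMost_iff One_nat_def)

lemma shift_least_power: "j \<in> {1..m} \<Longrightarrow> least_power \<sigma> (d + j) = least_power \<tau> j"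
  unfolding least_power_def by (simp add: shift_funpow del: atLeastAtMost_iff One_nat_def)

lemma shift_orb: "j \<in> {1..m} \<Longrightarrow> orb \<sigma> (d + j) = (\<lambda>j. d + j) ` orb \<tau> j"
  unfolding orb_def by (simp add: shift_funpow image_image del: atLeastAtMost_iff One_nat_def)

lemma shift_inv_funpow:
  assumes "j \<in> {1..m}"
  shows "(inv' \<sigma> ^^ k) (d + j) = d + (inv' \<tau> ^^ k) j"
proof (induction k)
  case 0
  then show ?case by simp
next
  case (Suc k)
  let ?q = "(inv' \<tau> ^^ k) j"
  have q: "inv' \<tau> ?q \<in> {1..m}"
    using permutes_funpow_in[OF permutes_inv[OF \<tau>] assms, of "Suc k"] by simp
  have "\<sigma> (d + inv' \<tau> ?q) = d + ?q" using sh[OF q] permutes_inverses(1)[OF \<tau>] by simp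
  then have "inv' \<sigma> (d + ?q) = d + inv' \<tau> ?q" using permutes_inv_eq[OF \<sigma>] by blast
  then show ?case using Suc by simp
qed

end

context finite_group
begin

lemma young_wr_iff:
  "g \<in> young_wr L ws \<longleftrightarrow> g \<in> carrier (WR (sum_list ws)) \<and> (\<forall>p\<in>{1..sum_list ws}. block_of ws (snd g p) = block_of ws p)"
proof (cases "g \<in> carrier (WR (sum_list ws))")
  case True
  then have "snd g permutes {1..sum_list ws}" by (rule snd_permutes)
  from block_stable_iff[OF this] True show ?thesis by (cases g) (simp add: young_wr_def)
next
  case False
  then show ?thesis by (auto simp: young_wr_def)
qed

text \<open>Cycles of an element of the Young subgroup stay inside the blocks, so restricting to a
  block and shifting by its offset keeps cycle lengths and cycle products.\<close>

lemma young_comp_props: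
  assumes g: "g \<in> young_wr L ws" and i: "i < length ws"
  defines "gi \<equiv> young_comp L ws i g"
  shows young_comp_closed: "gi \<in> carrier (WR (ws ! i))"
    and young_comp_snd: "j \<in> {1..ws ! i} \<Longrightarrow> snd g (offs ws i + j) = offs ws i + snd gi j"
    and young_comp_cyc_val: "j \<in> {1..ws ! i} \<Longrightarrow>
      cyc_val (ws ! i) gi j = cyc_val (sum_list ws) g (offs ws i + j)"
proof -
  let ?w = "sum_list ws" and ?d = "offs ws i" and ?m = "ws ! i"
  obtain x \<sigma> where gd: "g = (x, \<sigma>)" by (cases g)
  have gw: "g \<in> carrier (WR ?w)" and st: "\<sigma> ` block ws i = block ws i"
    using g i by (auto simp: young_wr_def gd)
  have x: "x \<in> base {1..?w}" and \<sigma>: "\<sigma> permutes {1..?w}" using gw by (auto simp: gd wreath_carrier)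
  define \<tau> where "\<tau> j = (if j \<in> {1..?m} then \<sigma> (?d + j) - ?d else j)" for j
  define x' where "x' j = (if j \<in> {1..?m} then x (?d + j) else \<one>)" for j
  have gi: "gi = (x', \<tau>)" unfolding gi_def young_comp_def gd x'_def \<tau>_def by simp
  have in_block: "?d + j \<in> block ws i" if "j \<in> {1..?m}" for j using that by (auto simp: block_def)
  have \<sigma>j: "\<sigma> (?d + j) = ?d + \<tau> j" "\<tau> j \<in> {1..?m}" if "j \<in> {1..?m}" for j
  proof -
    have "\<sigma> (?d + j) \<in> block ws i" using st in_block[OF that] by blast
    then show "\<sigma> (?d + j) = ?d + \<tau> j" "\<tau> j \<in> {1..?m}" using that by (auto simp: \<tau>_def block_def)
  qed
  have "inj_on \<tau> {1..?m}"
  proof (rule inj_onI)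
    fix a b assume ab: "a \<in> {1..?m}" "b \<in> {1..?m}" "\<tau> a = \<tau> b"
    then have "\<sigma> (?d + a) = \<sigma> (?d + b)" using \<sigma>j(1) by simp
    then show "a = b" using permutes_inj[OF \<sigma>] by (simp add: inj_eq)
  qed
  moreover have "\<tau> ` {1..?m} \<subseteq> {1..?m}" using \<sigma>j(2) by blast
  ultimately have "bij_betw \<tau> {1..?m} {1..?m}" by (simp add: bij_betw_def endo_inj_surj)
  then have \<tau>: "\<tau> permutes {1..?m}" by (rule bij_imp_permutes) (simp only: \<tau>_def if_False)
  show gic: "gi \<in> carrier (WR ?m)"
    unfolding gi wreath_carrier using \<tau> base_closed[OF x] by (auto simp: base_def x'_def)
  show "j \<in> {1..?m} \<Longrightarrow> snd g (?d + j) = ?d + snd gi j" for j using \<sigma>j(1) by (simp add: gd gi)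
  show "cyc_val ?m gi j = cyc_val ?w g (?d + j)" if j: "j \<in> {1..?m}" for j
  proof -
    note sh = \<sigma>j(1)
    have "fst (gi [^]\<^bsub>WR ?m\<^esub> k) j = fst (g [^]\<^bsub>WR ?w\<^esub> k) (?d + j)" for k :: nat
    proof (induction k)
      case 0
      then show ?case by (simp add: wreath_one)
    next
      case (Suc k)
      have "(inv' \<tau> ^^ k) j \<in> {1..?m}" by (rule permutes_funpow_in[OF permutes_inv[OF \<tau>] j])
      then have "fst gi ((inv' \<tau> ^^ k) j) = fst g (?d + (inv' \<tau> ^^ k) j)"
        by (simp add: gi gd x'_def)
      then show ?case
        unfolding fst_wreath_pow_Suc[OF gic] fst_wreath_pow_Suc[OF gw] Suc
        using shift_inv_funpow[OF \<sigma> \<tau> sh j, of k] by (simp add: gi gd)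
    qed
    then show ?thesis
      using shift_least_power[OF \<sigma> \<tau> sh j] by (simp add: cyc_val_def gi gd)
  qed
qed

text \<open>The orbits are distributed over the blocks. Shifting by an offset is monotone, hence it
  takes least points to least points.\<close>

lemma orbit_prod_young:
  assumes g: "g \<in> young_wr L ws"
  shows "orbit_prod (sum_list ws) (snd g) v =
    (\<Prod>i<length ws. orbit_prod (ws ! i) (snd (young_comp L ws i g)) (\<lambda>j. v (offs ws i + j)))"
proof -
  let ?w = "sum_list ws" and ?\<tau> = "\<lambda>i. snd (young_comp L ws i g)" and ?d = "offs ws"
  let ?S = "\<lambda>i. (\<lambda>B. (\<lambda>j. ?d i + j) ` B) ` orbs (ws ! i) (?\<tau> i)"
  have gw: "g \<in> carrier (WR ?w)" using g by (simp add: young_wr_iff)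
  note \<sigma> = snd_permutes[OF gw]
  note \<tau> = snd_permutes[OF young_comp_closed[OF g]]
  note sh = young_comp_snd[OF g]
  have S: "?S i = orb (snd g) ` block ws i" if i: "i < length ws" for i
  proof -
    have "?S i = (\<lambda>j. orb (snd g) (?d i + j)) ` {1..ws ! i}"
      unfolding orbs_def image_image
      by (intro image_cong refl) (rule shift_orb[OF \<sigma> \<tau>[OF i] sh[OF i], symmetric])
    then show ?thesis unfolding block_shift[OF i] by (simp only: image_image)
  qed
  have orbs: "orbs ?w (snd g) = (\<Union>i<length ws. ?S i)"
  proof -
    have "orbs ?w (snd g) = orb (snd g) ` (\<Union>i<length ws. block ws i)" by (simp add: orbs_def block_Union)
    also have "\<dots> = (\<Union>i<length ws. orb (snd g) ` block ws i)" by blast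
    finally show ?thesis using S by simp
  qed
  have sub: "B \<subseteq> block ws i \<and> B \<noteq> {}" if Bi: "B \<in> ?S i" and il: "i < length ws" for B i
  proof -
    obtain B' where B': "B' \<in> orbs (ws ! i) (?\<tau> i)" "B = (\<lambda>j. ?d i + j) ` B'" using Bi by blast
    then obtain j where j: "j \<in> {1..ws ! i}" "B' = orb (?\<tau> i) j" by (auto simp: orbs_def)
    have "B' \<subseteq> {1..ws ! i}" unfolding j(2) by (rule orb_subset[OF \<tau>[OF il] j(1)])
    moreover have "B' \<noteq> {}" using j(2) self_in_orb[of j "?\<tau> i"] by blast
    ultimately show ?thesis unfolding B'(2) block_shift[OF il] by blast
  qed
  have "orbit_prod ?w (snd g) v = (\<Prod>i<length ws. \<Prod>B\<in>?S i. v (Min B))"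
    unfolding orbit_prod_def orbs
  proof (rule prod.UNION_disjoint)
    show "\<forall>i\<in>{..<length ws}. finite (?S i)" by (simp add: finite_orbs)
    show "\<forall>i\<in>{..<length ws}. \<forall>j\<in>{..<length ws}. i \<noteq> j \<longrightarrow> ?S i \<inter> ?S j = {}"
    proof (intro ballI impI)
      fix i j assume ij: "i \<in> {..<length ws}" "j \<in> {..<length ws}" "i \<noteq> j"
      show "?S i \<inter> ?S j = {}"
      proof (rule ccontr)
        assume "?S i \<inter> ?S j \<noteq> {}"
        then obtain B where B: "B \<in> ?S i" "B \<in> ?S j" by blast
        have "B \<subseteq> block ws i \<inter> block ws j" "B \<noteq> {}" using sub[OF B(1)] sub[OF B(2)] ij by auto
        then show False using block_disjoint[of i ws j] ij by auto
      qed
    qed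
  qed simp
  also have "\<dots> = (\<Prod>i<length ws. orbit_prod (ws ! i) (?\<tau> i) (\<lambda>j. v (?d i + j)))"
  proof (rule prod.cong[OF refl])
    fix i assume "i \<in> {..<length ws}"
    then have i: "i < length ws" by simp
    have inj: "inj_on (\<lambda>B. (\<lambda>j. ?d i + j) ` B) (orbs (ws ! i) (?\<tau> i))"
      by (rule inj_onI) (simp add: inj_image_eq_iff)
    have "(\<Prod>B\<in>?S i. v (Min B)) = (\<Prod>B\<in>orbs (ws ! i) (?\<tau> i). v (Min ((\<lambda>j. ?d i + j) ` B)))"
      using prod.reindex[OF inj, of "\<lambda>B. v (Min B)"] by (simp add: comp_def)
    also have "\<dots> = orbit_prod (ws ! i) (?\<tau> i) (\<lambda>j. v (?d i + j))"
      unfolding orbit_prod_def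
    proof (rule prod.cong[OF refl])
      fix B assume "B \<in> orbs (ws ! i) (?\<tau> i)"
      then obtain j where j: "j \<in> {1..ws ! i}" "B = orb (?\<tau> i) j" by (auto simp: orbs_def)
      have "finite B" unfolding j(2) using orb_subset[OF \<tau>[OF i] j(1)] by (rule finite_subset) simp
      moreover have "B \<noteq> {}" using self_in_orb[of j "?\<tau> i"] j(2) by blast
      moreover have "mono (\<lambda>j. ?d i + j)" by (simp add: mono_def)
      ultimately have "Min ((\<lambda>j. ?d i + j) ` B) = ?d i + Min B" using mono_Min_commute by metis
      then show "v (Min ((\<lambda>j. ?d i + j) ` B)) = v (?d i + Min B)" by simp
    qed
    finally show "(\<Prod>B\<in>?S i. v (Min B)) = orbit_prod (ws ! i) (?\<tau> i) (\<lambda>j. v (?d i + j))" .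
  qed
  finally show ?thesis .
qed

text \<open>The tilde powers on the blocks merge into one orbit product in which the colour of a
  cycle selects the class function. In this form the product can be carried to any other
  colouring.\<close>

lemma prod_tilde_pow_young:
  assumes \<phi>: "\<And>i. i < length ws \<Longrightarrow> class_fun (\<phi> i)" and g: "g \<in> young_wr L ws"
  shows "(\<Prod>i<length ws. tilde_pow L (\<phi> i) (ws ! i) (young_comp L ws i g)) =
    orbit_prod (sum_list ws) (snd g) (\<lambda>p. \<phi> (block_of ws p) (cyc_val (sum_list ws) g p))"
  unfolding orbit_prod_young[OF g]
proof (rule prod.cong[OF refl])
  fix i assume "i \<in> {..<length ws}"
  then have i: "i < length ws" by simp
  note gi = young_comp_closed[OF g i]
  have "tilde_pow L (\<phi> i) (ws ! i) (young_comp L ws i g) =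
    orbit_prod (ws ! i) (snd (young_comp L ws i g)) (\<lambda>j. \<phi> i (cyc_val (ws ! i) (young_comp L ws i g) j))"
    by (rule tilde_pow_eq[OF \<phi>[OF i] gi])
  also have "\<dots> = orbit_prod (ws ! i) (snd (young_comp L ws i g))
      (\<lambda>j. \<phi> (block_of ws (offs ws i + j)) (cyc_val (sum_list ws) g (offs ws i + j)))"
  proof (rule orbit_prod_cong[OF snd_permutes[OF gi]])
    fix j assume j: "j \<in> {1..ws ! i}"
    then have "offs ws i + j \<in> block ws i" by (auto simp: block_def)
    then show "\<phi> i (cyc_val (ws ! i) (young_comp L ws i g) j) =
      \<phi> (block_of ws (offs ws i + j)) (cyc_val (sum_list ws) g (offs ws i + j))"
      using block_of_eq[OF i] young_comp_cyc_val[OF g i j] by simp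
  qed
  finally show "tilde_pow L (\<phi> i) (ws ! i) (young_comp L ws i g) =
    orbit_prod (ws ! i) (snd (young_comp L ws i g))
      (\<lambda>j. \<phi> (block_of ws (offs ws i + j)) (cyc_val (sum_list ws) g (offs ws i + j)))" .
qed

section \<open>Colourings as cosets of Young subgroups\<close>

definition colorings :: "nat \<Rightarrow> nat \<Rightarrow> (nat \<Rightarrow> nat) set" where
  "colorings w n = {1..w} \<rightarrow>\<^sub>E {..<n}"

text \<open>The class sizes form a composition of \<open>w\<close> into \<open>n\<close> parts, zero
  parts allowed.\<close>

definition ctype :: "nat \<Rightarrow> nat \<Rightarrow> (nat \<Rightarrow> nat) \<Rightarrow> nat list" where
  "ctype w n c = map (\<lambda>i. card {p\<in>{1..w}. c p = i}) [0..<n]"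

text \<open>The standard colouring pulled back along \<open>h\<close>. Its fibres are the right
  cosets of the Young subgroup, so colourings of type \<open>ws\<close> label these cosets.\<close>

definition coloring_of :: "nat list \<Rightarrow> 'a wr \<Rightarrow> nat \<Rightarrow> nat" where
  "coloring_of ws h = (\<lambda>p\<in>{1..sum_list ws}. block_of ws (snd h p))"

lemma finite_colorings: "finite (colorings w n)"
  unfolding colorings_def by (intro finite_PiE) auto

lemma ctype_sum:
  assumes "c \<in> colorings w n"
  shows "length (ctype w n c) = n" "sum_list (ctype w n c) = w"
proof -
  show "length (ctype w n c) = n" by (simp add: ctype_def)
  have "sum_list (ctype w n c) = (\<Sum>i<n. card {p\<in>{1..w}. c p = i})"
    by (simp add: ctype_def sum_list_sum_nth lessThan_atLeast0)
  also have "\<dots> = card (\<Union>i<n. {p\<in>{1..w}. c p = i})"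
    by (rule card_UN_disjoint[symmetric]) auto
  also have "(\<Union>i<n. {p\<in>{1..w}. c p = i}) = {1..w}" using assms by (auto simp: colorings_def)
  finally show "sum_list (ctype w n c) = w" by simp
qed

text \<open>Permuting positions is transitive on colourings of one type: bijections between the
  colour classes and the blocks of equal size glue to a permutation.\<close>

lemma coloring_of_image: "coloring_of ws ` carrier (WR (sum_list ws)) =
    {c \<in> colorings (sum_list ws) (length ws). ctype (sum_list ws) (length ws) c = ws}"
proof
  let ?w = "sum_list ws" and ?n = "length ws"
  show "coloring_of ws ` carrier (WR ?w) \<subseteq> {c \<in> colorings ?w ?n. ctype ?w ?n c = ws}"
  proof
    fix c assume "c \<in> coloring_of ws ` carrier (WR ?w)"
    then obtain h where h: "h \<in> carrier (WR ?w)" "c = coloring_of ws h" by blast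
    note \<pi> = snd_permutes[OF h(1)]
    have im: "snd h p \<in> {1..?w}" if "p \<in> {1..?w}" for p using that permutes_in_image[OF \<pi>] by blast
    have "c \<in> colorings ?w ?n" unfolding h(2) colorings_def coloring_of_def using block_of_mem(1)[OF im] by auto
    moreover have "card {p\<in>{1..?w}. c p = i} = ws ! i" if i: "i < ?n" for i
    proof -
      have "{p\<in>{1..?w}. c p = i} = {p\<in>{1..?w}. snd h p \<in> block ws i}"
      proof (rule Collect_cong, rule conj_cong[OF refl])
        fix p assume p: "p \<in> {1..?w}"
        have "c p = block_of ws (snd h p)" unfolding h(2) coloring_of_def using p by (simp only: restrict_apply if_True)
        then show "c p = i \<longleftrightarrow> snd h p \<in> block ws i" using block_of_mem(2)[OF im[OF p]] block_of_eq[OF i] by metis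
      qed
      also have "\<dots> = snd h -` block ws i"
      proof -
        have "p \<in> {1..?w}" if "snd h p \<in> block ws i" for p
          using that block_subset[OF i] permutes_in_image[OF \<pi>] by blast
        then show ?thesis by blast
      qed
      also have "\<dots> = inv' (snd h) ` block ws i" by (rule bij_vimage_eq_inv_image[OF permutes_bij[OF \<pi>]])
      also have "card \<dots> = card (block ws i)"
        using permutes_inj[OF permutes_inv[OF \<pi>]] by (intro card_image) (auto intro: inj_on_subset)
      finally show ?thesis by (simp add: block_def)
    qed
    then have "ctype ?w ?n c = ws" unfolding ctype_def by (intro nth_equalityI) auto
    ultimately show "c \<in> {c \<in> colorings ?w ?n. ctype ?w ?n c = ws}" by blast
  qed
  show "{c \<in> colorings ?w ?n. ctype ?w ?n c = ws} \<subseteq> coloring_of ws ` carrier (WR ?w)"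
  proof
    fix c assume c: "c \<in> {c \<in> colorings ?w ?n. ctype ?w ?n c = ws}"
    let ?A = "\<lambda>i. {p\<in>{1..?w}. c p = i}"
    have "\<forall>i. \<exists>f. i < ?n \<longrightarrow> bij_betw f (?A i) (block ws i)"
    proof
      fix i
      show "\<exists>f. i < ?n \<longrightarrow> bij_betw f (?A i) (block ws i)"
      proof (cases "i < ?n")
        case True
        have "card (?A i) = ctype ?w ?n c ! i" using True by (simp add: ctype_def)
        also have "\<dots> = card (block ws i)" using c by (simp add: block_def)
        finally have "card (?A i) = card (block ws i)" .
        then have "\<exists>f. bij_betw f (?A i) (block ws i)"
          by (intro finite_same_card_bij) (auto simp: block_def)
        then show ?thesis by blast
      qed simp
    qed
    then obtain f where f: "\<And>i. i < ?n \<Longrightarrow> bij_betw (f i) (?A i) (block ws i)" by metis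
    define \<pi> where "\<pi> p = (if p \<in> {1..?w} then f (c p) p else p)" for p
    have cn: "c p < ?n" if "p \<in> {1..?w}" for p using c that by (auto simp: colorings_def)
    have \<pi>b: "\<pi> p \<in> block ws (c p)" if p: "p \<in> {1..?w}" for p
    proof -
      have "f (c p) p \<in> block ws (c p)" using bij_betwE[OF f[OF cn[OF p]]] p by blast
      then show ?thesis unfolding \<pi>_def using p by (simp only: if_True)
    qed
    have "inj_on \<pi> {1..?w}"
    proof (rule inj_onI)
      fix a b assume ab: "a \<in> {1..?w}" "b \<in> {1..?w}" "\<pi> a = \<pi> b"
      have "c a = c b"
        using block_of_eq[OF cn[OF ab(1)] \<pi>b[OF ab(1)]] block_of_eq[OF cn[OF ab(2)] \<pi>b[OF ab(2)]] ab(3) by simp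
      then have "f (c a) a = f (c a) b" using ab(3) unfolding \<pi>_def using ab(1,2) by (simp only: if_True)
      moreover have "inj_on (f (c a)) (?A (c a))" using f[OF cn[OF ab(1)]] by (simp add: bij_betw_def)
      moreover have "a \<in> ?A (c a)" "b \<in> ?A (c a)" using ab(1,2) \<open>c a = c b\<close> by auto
      ultimately show "a = b" by (meson inj_onD)
    qed
    moreover have "\<pi> ` {1..?w} \<subseteq> {1..?w}" using \<pi>b block_subset cn by fast
    ultimately have "bij_betw \<pi> {1..?w} {1..?w}" by (simp add: bij_betw_def endo_inj_surj)
    then have \<pi>: "\<pi> permutes {1..?w}" by (rule bij_imp_permutes) (simp only: \<pi>_def if_False)
    let ?h = "((\<lambda>_. \<one>) :: nat \<Rightarrow> 'a, \<pi>)"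
    have "?h \<in> carrier (WR ?w)" using \<pi> by (simp add: wreath_carrier base_def)
    moreover have "c = coloring_of ws ?h"
    proof
      fix p
      show "c p = coloring_of ws ?h p"
      proof (cases "p \<in> {1..?w}")
        case True
        show ?thesis unfolding coloring_of_def restrict_apply if_P[OF True] snd_conv
          by (rule block_of_eq[OF cn[OF True] \<pi>b[OF True], symmetric])
      next
        case False
        have "c p = undefined" using c False unfolding colorings_def by (intro PiE_arb[of c "{1..?w}" "\<lambda>_. {..<?n}"]) auto
        then show ?thesis unfolding coloring_of_def using False by (simp only: restrict_def if_False)
      qed
    qed
    ultimately show "c \<in> coloring_of ws ` carrier (WR ?w)" by blast
  qed
qed

text \<open>The fibre is the right coset of the Young subgroup through \<open>h0\<close>.\<close>

lemma coloring_of_fibre_card: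
  assumes h0: "h0 \<in> carrier (WR (sum_list ws))"
  shows "card {h \<in> carrier (WR (sum_list ws)). coloring_of ws h = coloring_of ws h0} = card (young_wr L ws)"
proof -
  let ?w = "sum_list ws"
  have sm: "snd (a \<otimes>\<^bsub>WR ?w\<^esub> b) = snd a \<circ> snd b" for a b :: "'a wr"
    using wreath_mult[where x="fst a" and y="fst b"] by (cases a; cases b; simp)
  have yc: "y \<in> carrier (WR ?w)" if "y \<in> young_wr L ws" for y using that by (simp add: young_wr_iff)
  note \<pi>0 = snd_permutes[OF h0]
  have eq: "{h \<in> carrier (WR ?w). coloring_of ws h = coloring_of ws h0} = (\<lambda>y. y \<otimes>\<^bsub>WR ?w\<^esub> h0) ` young_wr L ws"
  proof
    show "(\<lambda>y. y \<otimes>\<^bsub>WR ?w\<^esub> h0) ` young_wr L ws \<subseteq> {h \<in> carrier (WR ?w). coloring_of ws h = coloring_of ws h0}"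
    proof
      fix h assume "h \<in> (\<lambda>y. y \<otimes>\<^bsub>WR ?w\<^esub> h0) ` young_wr L ws"
      then obtain y where y: "y \<in> young_wr L ws" "h = y \<otimes>\<^bsub>WR ?w\<^esub> h0" by blast
      have "block_of ws (snd y (snd h0 p)) = block_of ws (snd h0 p)" if "p \<in> {1..?w}" for p
      proof -
        have "snd h0 p \<in> {1..?w}" using that permutes_in_image[OF \<pi>0] by blast
        then show ?thesis using y(1) by (simp add: young_wr_iff)
      qed
      then have "coloring_of ws h = coloring_of ws h0" unfolding coloring_of_def y(2) sm by (intro restrict_ext) simp
      then show "h \<in> {h \<in> carrier (WR ?w). coloring_of ws h = coloring_of ws h0}" using yc[OF y(1)] h0 y(2) by simp
    qed
    show "{h \<in> carrier (WR ?w). coloring_of ws h = coloring_of ws h0} \<subseteq> (\<lambda>y. y \<otimes>\<^bsub>WR ?w\<^esub> h0) ` young_wr L ws"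
    proof
      fix h assume h: "h \<in> {h \<in> carrier (WR ?w). coloring_of ws h = coloring_of ws h0}"
      let ?y = "h \<otimes>\<^bsub>WR ?w\<^esub> inv\<^bsub>WR ?w\<^esub> h0"
      have yc': "?y \<in> carrier (WR ?w)" using h h0 by simp
      have hy: "h = ?y \<otimes>\<^bsub>WR ?w\<^esub> h0" using h h0 by (simp add: wr.m_assoc)
      have "block_of ws (snd ?y q) = block_of ws q" if q: "q \<in> {1..?w}" for q
      proof -
        let ?p = "inv' (snd h0) q"
        have p: "?p \<in> {1..?w}" using q permutes_in_image[OF permutes_inv[OF \<pi>0]] by blast
        have "coloring_of ws h ?p = coloring_of ws h0 ?p" using h by simp
        then have "block_of ws (snd h ?p) = block_of ws (snd h0 ?p)" unfolding coloring_of_def using p by simp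
        moreover have "snd h ?p = snd ?y (snd h0 ?p)" using arg_cong[OF hy, of snd] unfolding sm by (metis comp_apply)
        moreover have "snd h0 ?p = q" using permutes_inverses(1)[OF \<pi>0] by simp
        ultimately show ?thesis by simp
      qed
      then have "?y \<in> young_wr L ws" using yc' by (simp add: young_wr_iff)
      then show "h \<in> (\<lambda>y. y \<otimes>\<^bsub>WR ?w\<^esub> h0) ` young_wr L ws" using hy by blast
    qed
  qed
  have "inj_on (\<lambda>y. y \<otimes>\<^bsub>WR ?w\<^esub> h0) (young_wr L ws)"
    using yc h0 by (auto intro!: inj_onI)
  then show ?thesis unfolding eq by (rule card_image)
qed

text \<open>In the induction formula the term at \<open>h\<close> depends only on the coset of
  \<open>h\<close>, that is, on a colouring, and the conjugate of \<open>g\<close> lies in the Young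
  subgroup exactly if \<open>g\<close> preserves this colouring. The size of the fibres cancels the
  denominator.\<close>

lemma induce_colorings:
  assumes g: "g \<in> carrier (WR (sum_list ws))"
    and F: "\<And>h g'. h \<in> carrier (WR (sum_list ws)) \<Longrightarrow> g' \<in> young_wr L ws \<Longrightarrow>
      h \<otimes>\<^bsub>WR (sum_list ws)\<^esub> g = g' \<otimes>\<^bsub>WR (sum_list ws)\<^esub> h \<Longrightarrow> F g' = \<Phi> (coloring_of ws h)"
  shows "induce (WR (sum_list ws)) (young_wr L ws) F g =
    (\<Sum>c | c \<in> colorings (sum_list ws) (length ws) \<and> ctype (sum_list ws) (length ws) c = ws \<and>
        (\<forall>p\<in>{1..sum_list ws}. c (snd g p) = c p). \<Phi> c)"
proof -
  let ?w = "sum_list ws" and ?n = "length ws"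
  let ?G = "carrier (WR ?w)" and ?Y = "young_wr L ws"
  let ?inv = "\<lambda>c. \<forall>p\<in>{1..?w}. c (snd g p) = c p"
  have sm: "snd (a \<otimes>\<^bsub>WR ?w\<^esub> b) = snd a \<circ> snd b" for a b :: "'a wr"
    using wreath_mult[where x="fst a" and y="fst b"] by (cases a; cases b; simp)
  have fG: "finite ?G" by (rule finite_wreath)
  have "\<one>\<^bsub>WR ?w\<^esub> \<in> ?Y" by (simp add: young_wr_iff) (simp add: wreath_one)
  moreover have "?Y \<subseteq> ?G" using young_wr_iff by blast
  then have "finite ?Y" using fG by (rule finite_subset)
  ultimately have Y0: "card ?Y > 0" unfolding card_gt_0_iff by blast
  have conj_iff: "h \<otimes>\<^bsub>WR ?w\<^esub> g \<otimes>\<^bsub>WR ?w\<^esub> inv\<^bsub>WR ?w\<^esub> h \<in> ?Y \<longleftrightarrow> ?inv (coloring_of ws h)" if h: "h \<in> ?G" for h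
  proof -
    let ?g' = "h \<otimes>\<^bsub>WR ?w\<^esub> g \<otimes>\<^bsub>WR ?w\<^esub> inv\<^bsub>WR ?w\<^esub> h"
    have g': "?g' \<in> ?G" using h g by simp
    have e: "h \<otimes>\<^bsub>WR ?w\<^esub> g = ?g' \<otimes>\<^bsub>WR ?w\<^esub> h" using h g by (simp add: wr.m_assoc)
    note \<pi> = snd_permutes[OF h]
    have cj: "snd ?g' (snd h p) = snd h (snd g p)" for p
      using cyc_val_conj(2)[OF g g' h e] by (metis comp_apply)
    have sg: "snd g p \<in> {1..?w}" if "p \<in> {1..?w}" for p
      using that permutes_in_image[OF snd_permutes[OF g]] by blast
    have "?g' \<in> ?Y \<longleftrightarrow> (\<forall>q\<in>{1..?w}. block_of ws (snd ?g' q) = block_of ws q)" using g' by (simp add: young_wr_iff)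
    also have "\<dots> \<longleftrightarrow> (\<forall>q\<in>snd h ` {1..?w}. block_of ws (snd ?g' q) = block_of ws q)" unfolding permutes_image[OF \<pi>] ..
    also have "\<dots> \<longleftrightarrow> (\<forall>p\<in>{1..?w}. block_of ws (snd h (snd g p)) = block_of ws (snd h p))" by (simp add: cj)
    also have "\<dots> \<longleftrightarrow> ?inv (coloring_of ws h)" unfolding coloring_of_def using sg by (simp del: atLeastAtMost_iff One_nat_def)
    finally show ?thesis .
  qed
  have Feq: "F (h \<otimes>\<^bsub>WR ?w\<^esub> g \<otimes>\<^bsub>WR ?w\<^esub> inv\<^bsub>WR ?w\<^esub> h) = \<Phi> (coloring_of ws h)" if h: "h \<in> ?G" "?inv (coloring_of ws h)" for h
    using h g conj_iff[OF h(1)] by (intro F) (simp_all add: wr.m_assoc)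
  let ?T = "\<lambda>c. if ?inv c then \<Phi> c else 0"
  have "(\<Sum>h\<in>?G. if h \<otimes>\<^bsub>WR ?w\<^esub> g \<otimes>\<^bsub>WR ?w\<^esub> inv\<^bsub>WR ?w\<^esub> h \<in> ?Y then F (h \<otimes>\<^bsub>WR ?w\<^esub> g \<otimes>\<^bsub>WR ?w\<^esub> inv\<^bsub>WR ?w\<^esub> h) else 0) =
      (\<Sum>h\<in>?G. ?T (coloring_of ws h))"
  proof (rule sum.cong[OF refl])
    fix h assume h: "h \<in> ?G"
    show "(if h \<otimes>\<^bsub>WR ?w\<^esub> g \<otimes>\<^bsub>WR ?w\<^esub> inv\<^bsub>WR ?w\<^esub> h \<in> ?Y then F (h \<otimes>\<^bsub>WR ?w\<^esub> g \<otimes>\<^bsub>WR ?w\<^esub> inv\<^bsub>WR ?w\<^esub> h) else 0) =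
      ?T (coloring_of ws h)"
    proof (cases "?inv (coloring_of ws h)")
      case True
      show ?thesis unfolding conj_iff[OF h] if_P[OF True] by (rule Feq[OF h True])
    next
      case False
      show ?thesis unfolding conj_iff[OF h] if_not_P[OF False] ..
    qed
  qed
  also have "\<dots> = (\<Sum>c\<in>coloring_of ws ` ?G. \<Sum>h | h \<in> ?G \<and> coloring_of ws h = c. ?T (coloring_of ws h))"
    by (rule sum.image_gen[OF fG])
  also have "\<dots> = (\<Sum>c\<in>coloring_of ws ` ?G. of_nat (card ?Y) * ?T c)"
  proof (rule sum.cong[OF refl])
    fix c assume "c \<in> coloring_of ws ` ?G"
    then obtain h0 where h0: "h0 \<in> ?G" "c = coloring_of ws h0" by blast
    have "(\<Sum>h | h \<in> ?G \<and> coloring_of ws h = c. ?T (coloring_of ws h)) = (\<Sum>h | h \<in> ?G \<and> coloring_of ws h = c. ?T c)"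
      by (rule sum.cong[OF refl]) (simp only: mem_Collect_eq)
    also have "\<dots> = of_nat (card {h. h \<in> ?G \<and> coloring_of ws h = c}) * ?T c" by (rule sum_constant)
    also have "card {h. h \<in> ?G \<and> coloring_of ws h = c} = card ?Y" unfolding h0(2) by (rule coloring_of_fibre_card[OF h0(1)])
    finally show "(\<Sum>h | h \<in> ?G \<and> coloring_of ws h = c. ?T (coloring_of ws h)) = of_nat (card ?Y) * ?T c" .
  qed
  also have "\<dots> = of_nat (card ?Y) * (\<Sum>c\<in>coloring_of ws ` ?G. ?T c)" by (simp add: sum_distrib_left)
  also have "(\<Sum>c\<in>coloring_of ws ` ?G. ?T c) = (\<Sum>c | c \<in> coloring_of ws ` ?G \<and> ?inv c. \<Phi> c)"
    using fG by (intro sum.inter_filter[symmetric]) simp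
  also have "{c. c \<in> coloring_of ws ` ?G \<and> ?inv c} = {c. c \<in> colorings ?w ?n \<and> ctype ?w ?n c = ws \<and> ?inv c}"
    unfolding coloring_of_image by blast
  finally show ?thesis using g Y0 by (simp add: induce_def)
qed

end

section \<open>Convolution over the base group\<close>

text \<open>The symmetric group on \<open>{1..ws ! i}\<close> as the factor that permutes block
  \<open>i\<close>. Inside the block \<open>p\<close> exceeds the offset, so the subtraction of
  naturals is exact.\<close>

definition emb :: "nat list \<Rightarrow> nat \<Rightarrow> (nat \<Rightarrow> nat) \<Rightarrow> nat \<Rightarrow> nat" where
  "emb ws i \<tau> p = (if p \<in> block ws i then offs ws i + \<tau> (p - offs ws i) else p)"

lemma emb_in_block:
  assumes "\<tau> permutes {1..ws ! i}" "p \<in> block ws i"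
  shows "emb ws i \<tau> p \<in> block ws i"
proof -
  have "p - offs ws i \<in> {1..ws ! i}" using assms(2) by (auto simp: block_def)
  then have "\<tau> (p - offs ws i) \<in> {1..ws ! i}" using permutes_in_image[OF assms(1)] by blast
  then show ?thesis using assms(2) by (auto simp: emb_def block_def)
qed

lemma emb_comp:
  assumes "\<tau>' permutes {1..ws ! i}"
  shows "emb ws i (\<tau> \<circ> \<tau>') = emb ws i \<tau> \<circ> emb ws i \<tau>'"
proof
  fix p
  show "emb ws i (\<tau> \<circ> \<tau>') p = (emb ws i \<tau> \<circ> emb ws i \<tau>') p"
  proof (cases "p \<in> block ws i")
    case True
    have "emb ws i \<tau>' p \<in> block ws i" by (rule emb_in_block[OF assms True])
    then show ?thesis using True by (simp add: emb_def)
  next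
    case False
    then show ?thesis by (simp add: emb_def)
  qed
qed

lemma emb_id: "emb ws i id = id"
  by (auto simp: emb_def block_def fun_eq_iff)

lemma emb_permutes:
  assumes "\<tau> permutes {1..ws ! i}" "i < length ws"
  shows "emb ws i \<tau> permutes {1..sum_list ws}"
proof -
  have "emb ws i \<tau> \<circ> emb ws i (inv' \<tau>) = id" "emb ws i (inv' \<tau>) \<circ> emb ws i \<tau> = id"
    using emb_comp[OF permutes_inv[OF assms(1)], of \<tau>] emb_comp[OF assms(1), of "inv' \<tau>"]
      permutes_inv_o[OF assms(1)] emb_id[of ws i] by simp_all
  then have "bij (emb ws i \<tau>)" by (metis o_bij)
  moreover have "emb ws i \<tau> p = p" if "p \<notin> {1..sum_list ws}" for p
    using that block_subset[OF assms(2)] by (auto simp: emb_def)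
  ultimately show ?thesis unfolding permutes_def bij_iff by blast
qed

lemma emb_commute:
  assumes "\<tau> permutes {1..ws ! i}" "\<tau>' permutes {1..ws ! j}" "i < length ws" "j < length ws" "i \<noteq> j"
  shows "emb ws i \<tau> \<circ> emb ws j \<tau>' = emb ws j \<tau>' \<circ> emb ws i \<tau>"
proof
  fix p
  note d = block_disjoint[OF assms(3-5)]
  consider "p \<in> block ws i" | "p \<in> block ws j" | "p \<notin> block ws i" "p \<notin> block ws j" by blast
  then show "(emb ws i \<tau> \<circ> emb ws j \<tau>') p = (emb ws j \<tau>' \<circ> emb ws i \<tau>) p"
  proof cases
    case 1
    then have "p \<notin> block ws j" "emb ws i \<tau> p \<notin> block ws j" using emb_in_block[OF assms(1) 1] d by blast+
    then show ?thesis by (simp add: emb_def[of ws j])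
  next
    case 2
    then have "p \<notin> block ws i" "emb ws j \<tau>' p \<notin> block ws i" using emb_in_block[OF assms(2) 2] d by blast+
    then show ?thesis by (simp add: emb_def[of ws i])
  next
    case 3
    then show ?thesis by (simp add: emb_def)
  qed
qed

lemma block_of_emb:
  assumes "\<tau> permutes {1..ws ! i}" "i < length ws"
  shows "block_of ws (emb ws i \<tau> p) = block_of ws p"
  using emb_in_block[OF assms(1), of p] block_of_eq[OF assms(2)] by (cases "p \<in> block ws i") (auto simp: emb_def)

context finite_group
begin

section \<open>Sums over the base group\<close>

lemma sum_base_Un:
  assumes "A \<inter> B = {}"
  shows "(\<Sum>x\<in>base (A \<union> B). F x) = (\<Sum>y\<in>base A. \<Sum>z\<in>base B. F (\<lambda>i. if i \<in> A then y i else z i))"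
proof -
  have "bij_betw (\<lambda>(y, z) i. if i \<in> A then y i else z i) (base A \<times> base B) (base (A \<union> B))"
    by (rule bij_betw_byWitness[where f' = "\<lambda>x. (\<lambda>i. if i \<in> A then x i else \<one>, \<lambda>i. if i \<in> B then x i else \<one>)"])
      (use assms in \<open>auto simp: base_def fun_eq_iff\<close>)
  from sum.reindex_bij_betw[OF this, of F] show ?thesis
    by (simp add: sum.cartesian_product case_prod_unfold)
qed

lemma base_empty: "base {} = {\<lambda>_. \<one>}"
  by (auto simp: base_def)

lemma sum_base_insert:
  assumes "q \<notin> A"
  shows "(\<Sum>x\<in>base (insert q A). F x) = (\<Sum>a\<in>carrier L. \<Sum>z\<in>base A. F (z(q := a)))"
proof -
  have "bij_betw (\<lambda>a i. if i = q then a else \<one>) (carrier L) (base {q})"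
    by (rule bij_betw_byWitness[where f' = "\<lambda>x. x q"]) (auto simp: base_def fun_eq_iff)
  from sum.reindex_bij_betw[OF this, of "\<lambda>y. \<Sum>z\<in>base A. F (\<lambda>i. if i \<in> {q} then y i else z i)", symmetric]
  have "(\<Sum>y\<in>base {q}. \<Sum>z\<in>base A. F (\<lambda>i. if i \<in> {q} then y i else z i)) =
    (\<Sum>a\<in>carrier L. \<Sum>z\<in>base A. F (\<lambda>i. if i \<in> {q} then (if i = q then a else \<one>) else z i))" .
  also have "\<dots> = (\<Sum>a\<in>carrier L. \<Sum>z\<in>base A. F (z(q := a)))"
    by (intro sum.cong refl arg_cong[where f = F]) auto
  finally show ?thesis using sum_base_Un[of "{q}" A F] assms by simp
qed

lemma sum_base_prod:
  assumes "finite A"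
  shows "(\<Sum>x\<in>base A. \<Prod>p\<in>A. f p (x p)) = (\<Prod>p\<in>A. \<Sum>a\<in>carrier L. f p a :: complex)"
  using assms
proof (induction A)
  case empty
  then show ?case by (simp add: base_empty)
next
  case (insert q A)
  have "(\<Sum>x\<in>base (insert q A). \<Prod>p\<in>insert q A. f p (x p)) =
    (\<Sum>a\<in>carrier L. \<Sum>z\<in>base A. \<Prod>p\<in>insert q A. f p ((z(q := a)) p))"
    using insert.hyps by (intro sum_base_insert)
  also have "\<dots> = (\<Sum>a\<in>carrier L. \<Sum>z\<in>base A. f q a * (\<Prod>p\<in>A. f p (z p)))"
  proof (intro sum.cong refl)
    fix a z
    have "(\<Prod>p\<in>A. f p ((z(q := a)) p)) = (\<Prod>p\<in>A. f p (z p))"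
      using insert.hyps(2) by (intro prod.cong) auto
    then show "(\<Prod>p\<in>insert q A. f p ((z(q := a)) p)) = f q a * (\<Prod>p\<in>A. f p (z p))"
      using insert.hyps by simp
  qed
  also have "\<dots> = (\<Sum>a\<in>carrier L. f q a) * (\<Sum>z\<in>base A. \<Prod>p\<in>A. f p (z p))"
    by (simp add: sum_product)
  finally show ?case using insert by simp
qed

text \<open>The distributive law for factors that depend on disjoint sets of positions. It separates
  the cycles in \<open>Psi\<close>.\<close>

lemma sum_base_UN:
  assumes "finite J" "\<And>j. j \<in> J \<Longrightarrow> finite (A j)"
    and "\<And>i j. i \<in> J \<Longrightarrow> j \<in> J \<Longrightarrow> i \<noteq> j \<Longrightarrow> A i \<inter> A j = {}"
    and "\<And>j x y. j \<in> J \<Longrightarrow> (\<And>p. p \<in> A j \<Longrightarrow> x p = y p) \<Longrightarrow> G j x = G j y"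
  shows "(\<Sum>x\<in>base (\<Union>j\<in>J. A j). \<Prod>j\<in>J. G j x) = (\<Prod>j\<in>J. \<Sum>x\<in>base (A j). G j x :: complex)"
  using assms
proof (induction J)
  case empty
  then show ?case by (simp add: base_empty)
next
  case (insert k J)
  let ?B = "\<Union>j\<in>J. A j"
  have dis: "A k \<inter> ?B = {}"
  proof -
    have "A k \<inter> A j = {}" if "j \<in> J" for j using insert.prems(2)[of k j] insert.hyps that by auto
    then show ?thesis by blast
  qed
  have "(\<Sum>x\<in>base (\<Union>j\<in>insert k J. A j). \<Prod>j\<in>insert k J. G j x) =
    (\<Sum>x\<in>base (A k \<union> ?B). G k x * (\<Prod>j\<in>J. G j x))"
    using insert.hyps by simp
  also have "\<dots> = (\<Sum>y\<in>base (A k). \<Sum>z\<in>base ?B. G k y * (\<Prod>j\<in>J. G j z))"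
    unfolding sum_base_Un[OF dis]
  proof (intro sum.cong refl)
    fix y z :: "nat \<Rightarrow> 'a"
    let ?m = "\<lambda>i. if i \<in> A k then y i else z i"
    have "G k ?m = G k y" by (rule insert.prems(3)) auto
    moreover have "G j ?m = G j z" if "j \<in> J" for j
    proof (rule insert.prems(3))
      fix p assume "p \<in> A j"
      then have "p \<notin> A k" using dis that by blast
      then show "?m p = z p" by simp
    qed (use that in simp)
    ultimately show "G k ?m * (\<Prod>j\<in>J. G j ?m) = G k y * (\<Prod>j\<in>J. G j z)" by simp
  qed
  also have "\<dots> = (\<Sum>y\<in>base (A k). G k y) * (\<Sum>z\<in>base ?B. \<Prod>j\<in>J. G j z)"
    by (simp add: sum_product)
  also have "(\<Sum>z\<in>base ?B. \<Prod>j\<in>J. G j z) = (\<Prod>j\<in>J. \<Sum>x\<in>base (A j). G j x)"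
  proof (rule insert.IH)
    show "finite (A j)" if "j \<in> J" for j using insert.prems(1)[of j] that by simp
    show "A i \<inter> A j = {}" if "i \<in> J" "j \<in> J" "i \<noteq> j" for i j using insert.prems(2)[of i j] that by simp
    show "G j x = G j y" if "j \<in> J" "\<And>p. p \<in> A j \<Longrightarrow> x p = y p" for j x y
      by (rule insert.prems(3)) (use that in simp_all)
  qed
  finally show ?case using insert.hyps by simp
qed

definition lprod :: "(nat \<Rightarrow> 'a) \<Rightarrow> nat list \<Rightarrow> 'a" where
  "lprod x l = foldr (\<lambda>p a. x p \<otimes> a) l \<one>"

lemma lprod_closed: "(\<And>p. x p \<in> carrier L) \<Longrightarrow> lprod x l \<in> carrier L"
  by (induction l) (auto simp: lprod_def)

lemma lprod_snoc:
  assumes "\<And>p. x p \<in> carrier L"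
  shows "lprod x (l @ [q]) = lprod x l \<otimes> x q"
proof (induction l)
  case Nil
  then show ?case using assms by (simp add: lprod_def)
next
  case (Cons a l)
  then show ?case using assms lprod_closed[of x l, OF assms] by (simp add: lprod_def m_assoc)
qed

lemma lprod_cong: "(\<And>p. p \<in> set l \<Longrightarrow> x p = y p) \<Longrightarrow> lprod x l = lprod y l"
  unfolding lprod_def by (rule foldr_cong) auto

lemma fst_wreath_pow_lprod:
  assumes "(x, \<sigma>) \<in> carrier (WR w)"
  shows "fst ((x, \<sigma>) [^]\<^bsub>WR w\<^esub> k) p = lprod x (map (\<lambda>i. (inv' \<sigma> ^^ i) p) [0..<k])"
proof (induction k)
  case 0
  then show ?case by (simp add: wreath_one lprod_def)
next
  case (Suc k)
  have "\<And>p. x p \<in> carrier L" using fst_closed[OF assms] by simp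
  from lprod_snoc[of x, OF this] show ?case
    unfolding fst_wreath_pow_Suc[OF assms] using Suc by simp
qed

text \<open>The left side pairs \<open>\<phi>\<close> with the convolution power of \<epsilon> of
  exponent \<open>length l\<close>, which is \<epsilon> again since it is idempotent. Putting
  \<epsilon> at every position of a cycle thus amounts to pairing once with the cycle
  product.\<close>

lemma sum_base_lprod:
  assumes conv: "\<And>c. c \<in> carrier L \<Longrightarrow> (\<Sum>a\<in>carrier L. \<epsilon> a * \<epsilon> (inv a \<otimes> c)) = \<epsilon> c"
    and l: "distinct l" "l \<noteq> []"
  shows "(\<Sum>x\<in>base (set l). (\<Prod>p\<in>set l. \<epsilon> (x p)) * \<phi> (lprod x l)) = (\<Sum>a\<in>carrier L. \<epsilon> a * \<phi> a :: complex)"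
  using l
proof (induction l arbitrary: \<phi>)
  case Nil
  then show ?case by simp
next
  case (Cons q l)
  have q: "q \<notin> set l" and dl: "distinct l" using Cons.prems by auto
  have "(\<Sum>x\<in>base (set (q # l)). (\<Prod>p\<in>set (q # l). \<epsilon> (x p)) * \<phi> (lprod x (q # l))) =
    (\<Sum>a\<in>carrier L. \<Sum>z\<in>base (set l). (\<Prod>p\<in>insert q (set l). \<epsilon> ((z(q := a)) p)) * \<phi> (lprod (z(q := a)) (q # l)))"
    unfolding list.set by (rule sum_base_insert[OF q])
  also have "\<dots> = (\<Sum>a\<in>carrier L. \<epsilon> a * (\<Sum>z\<in>base (set l). (\<Prod>p\<in>set l. \<epsilon> (z p)) * \<phi> (a \<otimes> lprod z l)))"
    unfolding sum_distrib_left
  proof (intro sum.cong refl)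
    fix a z
    have 1: "(\<Prod>p\<in>set l. \<epsilon> ((z(q := a)) p)) = (\<Prod>p\<in>set l. \<epsilon> (z p))"
      using q by (intro prod.cong) auto
    have "lprod (z(q := a)) l = lprod z l" using q by (intro lprod_cong) auto
    then have "lprod (z(q := a)) (q # l) = a \<otimes> lprod z l" by (simp add: lprod_def)
    then show "(\<Prod>p\<in>insert q (set l). \<epsilon> ((z(q := a)) p)) * \<phi> (lprod (z(q := a)) (q # l)) =
      \<epsilon> a * ((\<Prod>p\<in>set l. \<epsilon> (z p)) * \<phi> (a \<otimes> lprod z l))"
      using q 1 by simp
  qed
  also have "\<dots> = (\<Sum>a\<in>carrier L. \<epsilon> a * \<phi> a)"
  proof (cases "l = []")
    case True
    then show ?thesis by (simp add: base_empty lprod_def)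
  next
    case False
    have "(\<Sum>a\<in>carrier L. \<epsilon> a * (\<Sum>z\<in>base (set l). (\<Prod>p\<in>set l. \<epsilon> (z p)) * \<phi> (a \<otimes> lprod z l))) =
      (\<Sum>a\<in>carrier L. \<epsilon> a * (\<Sum>b\<in>carrier L. \<epsilon> b * \<phi> (a \<otimes> b)))"
    proof (rule sum.cong[OF refl])
      fix a
      show "\<epsilon> a * (\<Sum>z\<in>base (set l). (\<Prod>p\<in>set l. \<epsilon> (z p)) * \<phi> (a \<otimes> lprod z l)) =
        \<epsilon> a * (\<Sum>b\<in>carrier L. \<epsilon> b * \<phi> (a \<otimes> b))"
        using Cons.IH[OF dl False, of "\<lambda>b. \<phi> (a \<otimes> b)"] by simp
    qed
    \<comment> \<open>Substituting \<open>c = a b\<close> brings out the convolution square of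
      \<epsilon>.\<close>
    also have "\<dots> = (\<Sum>a\<in>carrier L. \<Sum>c\<in>carrier L. \<epsilon> a * \<epsilon> (inv a \<otimes> c) * \<phi> c)"
    proof (rule sum.cong[OF refl])
      fix a assume a: "a \<in> carrier L"
      have "(\<Sum>b\<in>carrier L. \<epsilon> b * \<phi> (a \<otimes> b)) =
        (\<Sum>b\<in>carrier L. \<epsilon> (inv a \<otimes> (a \<otimes> b)) * \<phi> (a \<otimes> b))"
        using a by (intro sum.cong refl) (simp add: m_assoc[symmetric])
      also have "\<dots> = (\<Sum>c\<in>carrier L. \<epsilon> (inv a \<otimes> c) * \<phi> c)"
        by (rule sum.reindex_bij_betw[OF bij_betw_mult_left[OF is_group finite_carrier a],
              of "\<lambda>c. \<epsilon> (inv a \<otimes> c) * \<phi> c"])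
      finally show "\<epsilon> a * (\<Sum>b\<in>carrier L. \<epsilon> b * \<phi> (a \<otimes> b)) = (\<Sum>c\<in>carrier L. \<epsilon> a * \<epsilon> (inv a \<otimes> c) * \<phi> c)"
        by (simp add: sum_distrib_left mult.assoc)
    qed
    also have "\<dots> = (\<Sum>c\<in>carrier L. (\<Sum>a\<in>carrier L. \<epsilon> a * \<epsilon> (inv a \<otimes> c)) * \<phi> c)"
      by (subst sum.swap) (simp add: sum_distrib_right)
    also have "\<dots> = (\<Sum>c\<in>carrier L. \<epsilon> c * \<phi> c)" by (simp add: conv)
    finally show ?thesis .
  qed
  finally show ?case .
qed

section \<open>The multiplicity functions\<close>

definition Psi :: "nat \<Rightarrow> (nat \<Rightarrow> 'a \<Rightarrow> complex) \<Rightarrow> ('a wr \<Rightarrow> complex) \<Rightarrow> (nat \<Rightarrow> nat) \<Rightarrow> (nat \<Rightarrow> nat) \<Rightarrow> complex" where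
  "Psi w \<epsilon> \<xi> c \<sigma> = (\<Sum>x\<in>base {1..w}. (\<Prod>p\<in>{1..w}. \<epsilon> (c p) (x p)) * \<xi> (x, \<sigma>))"

lemma Psi_cong:
  "(\<And>p. p \<in> {1..w} \<Longrightarrow> c p = c' p) \<Longrightarrow> Psi w \<epsilon> \<xi> c \<sigma> = Psi w \<epsilon> \<xi> c' \<sigma>"
  unfolding Psi_def by (intro sum.cong prod.cong refl arg_cong2[where f = "(*)"]) simp

text \<open>Permuting the positions of the summation variable by \<open>\<pi>\<close> is conjugation
  by the element with trivial entries and permutation \<open>\<pi>\<close>, under which \<xi> is
  invariant.\<close>

lemma Psi_conj:
  assumes \<xi>: "\<And>g g' h. g \<in> carrier (WR w) \<Longrightarrow> g' \<in> carrier (WR w) \<Longrightarrow> h \<in> carrier (WR w) \<Longrightarrow>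
      h \<otimes>\<^bsub>WR w\<^esub> g = g' \<otimes>\<^bsub>WR w\<^esub> h \<Longrightarrow> \<xi> g' = \<xi> g"
    and \<pi>: "\<pi> permutes {1..w}" and \<sigma>: "\<sigma> permutes {1..w}" and \<sigma>': "\<sigma>' permutes {1..w}"
    and conj: "\<sigma>' \<circ> \<pi> = \<pi> \<circ> \<sigma>"
  shows "Psi w \<epsilon> \<xi> c \<sigma>' = Psi w \<epsilon> \<xi> (\<lambda>p. c (\<pi> p)) \<sigma>"
proof -
  note \<pi>i = permutes_inv[OF \<pi>]
  have cl: "(\<lambda>i. x (\<tau> i)) \<in> base {1..w}" if "x \<in> base {1..w}" "\<tau> permutes {1..w}" for x \<tau>
    using that permutes_in_image[OF that(2)] unfolding base_def by blast
  have b: "bij_betw (\<lambda>x i. x (inv' \<pi> i)) (base {1..w}) (base {1..w})"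
    by (rule bij_betw_byWitness[where f' = "\<lambda>x i. x (\<pi> i)"])
      (use cl[OF _ \<pi>] cl[OF _ \<pi>i] permutes_inverses[OF \<pi>] in auto)
  have "Psi w \<epsilon> \<xi> c \<sigma>' = (\<Sum>x\<in>base {1..w}. (\<Prod>p\<in>{1..w}. \<epsilon> (c p) (x (inv' \<pi> p))) * \<xi> (\<lambda>i. x (inv' \<pi> i), \<sigma>'))"
    unfolding Psi_def
    by (rule sum.reindex_bij_betw[OF b, of "\<lambda>x. (\<Prod>p\<in>{1..w}. \<epsilon> (c p) (x p)) * \<xi> (x, \<sigma>')", symmetric])
  also have "\<dots> = Psi w \<epsilon> \<xi> (\<lambda>p. c (\<pi> p)) \<sigma>"
    unfolding Psi_def
  proof (rule sum.cong[OF refl])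
    fix x assume x: "x \<in> base {1..w}"
    have "(\<Prod>p\<in>{1..w}. \<epsilon> (c p) (x (inv' \<pi> p))) = (\<Prod>p\<in>{1..w}. \<epsilon> (c (\<pi> p)) (x (inv' \<pi> (\<pi> p))))"
      by (rule prod.reindex_bij_betw[OF permutes_imp_bij[OF \<pi>], of "\<lambda>p. \<epsilon> (c p) (x (inv' \<pi> p))", symmetric])
    also have "\<dots> = (\<Prod>p\<in>{1..w}. \<epsilon> (c (\<pi> p)) (x p))" using permutes_inverses(2)[OF \<pi>] by simp
    finally have 1: "(\<Prod>p\<in>{1..w}. \<epsilon> (c p) (x (inv' \<pi> p))) = (\<Prod>p\<in>{1..w}. \<epsilon> (c (\<pi> p)) (x p))" .
    have "\<xi> (\<lambda>i. x (inv' \<pi> i), \<sigma>') = \<xi> (x, \<sigma>)"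
    proof (rule \<xi>)
      show "(x, \<sigma>) \<in> carrier (WR w)" using x \<sigma> by (simp add: wreath_carrier)
      show "(\<lambda>i. x (inv' \<pi> i), \<sigma>') \<in> carrier (WR w)" using cl[OF x \<pi>i] \<sigma>' by (simp add: wreath_carrier)
      show "((\<lambda>_. \<one>), \<pi>) \<in> carrier (WR w)" using \<pi> by (simp add: wreath_carrier base_def)
      show "((\<lambda>_. \<one>), \<pi>) \<otimes>\<^bsub>WR w\<^esub> (x, \<sigma>) = (\<lambda>i. x (inv' \<pi> i), \<sigma>') \<otimes>\<^bsub>WR w\<^esub> ((\<lambda>_. \<one>), \<pi>)"
        using base_closed[OF x] conj by (simp add: wreath_mult)
    qed
    with 1 show "(\<Prod>p\<in>{1..w}. \<epsilon> (c p) (x (inv' \<pi> p))) * \<xi> (\<lambda>i. x (inv' \<pi> i), \<sigma>') =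
      (\<Prod>p\<in>{1..w}. \<epsilon> (c (\<pi> p)) (x p)) * \<xi> (x, \<sigma>)" by simp
  qed
  finally show ?thesis .
qed

text \<open>Grouping positions by cycles gives one factor for each cycle. A cycle product runs
  through every position of its cycle once, so \<open>sum_base_lprod\<close> reduces the factor to
  one pairing with \<open>\<epsilon> (f j)\<close>.\<close>

lemma Psi_tensor:
  assumes md: "marked_decomp w cs" and act: "acts cs \<sigma>" and \<sigma>: "\<sigma> permutes {1..w}"
    and conv: "\<And>j a. j < length cs \<Longrightarrow> a \<in> carrier L \<Longrightarrow>
      (\<Sum>b\<in>carrier L. \<epsilon> (f j) b * \<epsilon> (f j) (inv b \<otimes> a)) = \<epsilon> (f j) a"
    and c: "\<And>j p. j < length cs \<Longrightarrow> p \<in> set (cs ! j) \<Longrightarrow> c p = f j"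
    and \<xi>: "\<And>x. x \<in> base {1..w} \<Longrightarrow>
      \<xi> (x, \<sigma>) = (\<Sum>k\<in>K. u k * (\<Prod>j<length cs. \<phi> k j (cyc_val w (x, \<sigma>) (Min (set (cs ! j))))))"
  shows "Psi w \<epsilon> \<xi> c \<sigma> = (\<Sum>k\<in>K. u k * (\<Prod>j<length cs. \<Sum>a\<in>carrier L. \<epsilon> (f j) a * \<phi> k j a))"
proof -
  let ?r = "length cs"
  have dj: "dj_cycles cs" and U: "(\<Union>c\<in>set cs. set c) = {1..w}" using md by (auto simp: marked_decomp_dj)
  have perm: "permutation \<sigma>" using \<sigma> permutation_permutes by blast
  note ac = acts_cycle[OF act dj]
  have U': "(\<Union>j<?r. set (cs ! j)) = {1..w}" unfolding U[symmetric] set_conv_nth[of cs] by auto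
  define m where "m j = Min (set (cs ! j))" for j
  have m: "m j \<in> set (cs ! j)" if "j < ?r" for j unfolding m_def using ac(1)[OF that] by (rule Min_cycle_in)
  \<comment> \<open>The points of the cycle in the order in which the cycle product reads them:
    backwards along \<open>\<sigma>\<close> from the least point.\<close>
  define l where "l j = map (\<lambda>i. (inv' \<sigma> ^^ i) (m j)) [0..<length (cs ! j)]" for j
  have l: "distinct (l j)" "set (l j) = set (cs ! j)" "l j \<noteq> []" if j: "j < ?r" for j
  proof -
    have sub: "set (l j) \<subseteq> set (cs ! j)" using cycle_inv_funpow_mem[OF perm ac[OF j] m[OF j]] by (auto simp: l_def)
    show d: "distinct (l j)"
      unfolding l_def distinct_map
    proof (intro conjI distinct_upt inj_onI)
      have *: "a = b" if ab: "a \<le> b" "b < length (cs ! j)" "(inv' \<sigma> ^^ a) (m j) = (inv' \<sigma> ^^ b) (m j)" for a b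
      proof (rule ccontr)
        assume "a \<noteq> b"
        have "(inv' \<sigma> ^^ (b - a)) (m j) = m j"
          using funpow_diff[OF permutes_inj[OF permutes_inv[OF \<sigma>]] ab(1,3)] .
        moreover have "0 < b - a" "b - a < length (cs ! j)" using ab \<open>a \<noteq> b\<close> by auto
        ultimately show False using cycle_inv_funpow_neq[OF perm ac[OF j] m[OF j]] by blast
      qed
      fix a b assume "a \<in> set [0..<length (cs ! j)]" "b \<in> set [0..<length (cs ! j)]"
        "(inv' \<sigma> ^^ a) (m j) = (inv' \<sigma> ^^ b) (m j)"
      then show "a = b" using *[of a b] *[of b a] by (cases "a \<le> b") auto
    qed
    have "card (set (l j)) = card (set (cs ! j))"
      using distinct_card[OF d] distinct_card[OF ac(2)[OF j]] by (simp add: l_def)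
    then show "set (l j) = set (cs ! j)" using sub by (intro card_subset_eq) auto
    show "l j \<noteq> []" using ac(1)[OF j] by (simp add: l_def)
  qed
  have cv: "cyc_val w (x, \<sigma>) (m j) = lprod x (l j)" if x: "x \<in> base {1..w}" and j: "j < ?r" for x j
  proof -
    have lp: "least_power \<sigma> (m j) = length (cs ! j)" by (rule cycle_least_power[OF perm ac[OF j] m[OF j]])
    have xc: "(x, \<sigma>) \<in> carrier (WR w)" using x \<sigma> by (simp add: wreath_carrier)
    show ?thesis unfolding cyc_val_def l_def snd_conv lp by (rule fst_wreath_pow_lprod[OF xc])
  qed
  have split: "(\<Prod>p\<in>{1..w}. v p) = (\<Prod>j<?r. \<Prod>p\<in>set (cs ! j). v p)" for v :: "nat \<Rightarrow> complex"
    unfolding U'[symmetric]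
  proof (rule prod.UNION_disjoint)
    show "\<forall>i\<in>{..<?r}. \<forall>j\<in>{..<?r}. i \<noteq> j \<longrightarrow> set (cs ! i) \<inter> set (cs ! j) = {}"
      using dj_cycles_disjoint[OF dj] by blast
  qed auto
  have one: "(\<Sum>x\<in>base {1..w}. (\<Prod>p\<in>{1..w}. \<epsilon> (c p) (x p)) * (\<Prod>j<?r. \<phi> k j (cyc_val w (x, \<sigma>) (m j)))) =
      (\<Prod>j<?r. \<Sum>a\<in>carrier L. \<epsilon> (f j) a * \<phi> k j a)" for k
  proof -
    let ?H = "\<lambda>j x. (\<Prod>p\<in>set (cs ! j). \<epsilon> (f j) (x p)) * \<phi> k j (lprod x (l j))"
    have "(\<Sum>x\<in>base {1..w}. (\<Prod>p\<in>{1..w}. \<epsilon> (c p) (x p)) * (\<Prod>j<?r. \<phi> k j (cyc_val w (x, \<sigma>) (m j)))) =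
      (\<Sum>x\<in>base {1..w}. \<Prod>j<?r. ?H j x)"
    proof (rule sum.cong[OF refl])
      fix x assume x: "x \<in> base {1..w}"
      have "(\<Prod>p\<in>{1..w}. \<epsilon> (c p) (x p)) = (\<Prod>j<?r. \<Prod>p\<in>set (cs ! j). \<epsilon> (f j) (x p))"
        unfolding split by (intro prod.cong refl) (simp add: c)
      moreover have "(\<Prod>j<?r. \<phi> k j (cyc_val w (x, \<sigma>) (m j))) = (\<Prod>j<?r. \<phi> k j (lprod x (l j)))"
        by (intro prod.cong refl) (simp add: cv[OF x])
      ultimately show "(\<Prod>p\<in>{1..w}. \<epsilon> (c p) (x p)) * (\<Prod>j<?r. \<phi> k j (cyc_val w (x, \<sigma>) (m j))) = (\<Prod>j<?r. ?H j x)"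
        by (simp add: prod.distrib)
    qed
    also have "\<dots> = (\<Prod>j<?r. \<Sum>x\<in>base (set (cs ! j)). ?H j x)"
      unfolding U'[symmetric]
    proof (rule sum_base_UN)
      fix i j assume "i \<in> {..<?r}" "j \<in> {..<?r}" "i \<noteq> j"
      then show "set (cs ! i) \<inter> set (cs ! j) = {}" using dj_cycles_disjoint[OF dj] by blast
    next
      fix j and x y :: "nat \<Rightarrow> 'a"
      assume j: "j \<in> {..<?r}" and xy: "\<And>p. p \<in> set (cs ! j) \<Longrightarrow> x p = y p"
      have "lprod x (l j) = lprod y (l j)" using xy l(2) j by (intro lprod_cong) auto
      moreover have "(\<Prod>p\<in>set (cs ! j). \<epsilon> (f j) (x p)) = (\<Prod>p\<in>set (cs ! j). \<epsilon> (f j) (y p))"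
        using xy by (intro prod.cong) auto
      ultimately show "?H j x = ?H j y" by simp
    qed auto
    also have "\<dots> = (\<Prod>j<?r. \<Sum>a\<in>carrier L. \<epsilon> (f j) a * \<phi> k j a)"
    proof (rule prod.cong[OF refl])
      fix j assume "j \<in> {..<?r}"
      then have j: "j < ?r" by simp
      have "(\<Sum>x\<in>base (set (l j)). (\<Prod>p\<in>set (l j). \<epsilon> (f j) (x p)) * \<phi> k j (lprod x (l j))) =
        (\<Sum>a\<in>carrier L. \<epsilon> (f j) a * \<phi> k j a)"
        using conv[OF j] l(1,3)[OF j] by (intro sum_base_lprod)
      then show "(\<Sum>x\<in>base (set (cs ! j)). ?H j x) = (\<Sum>a\<in>carrier L. \<epsilon> (f j) a * \<phi> k j a)"
        unfolding l(2)[OF j] .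
    qed
    finally show ?thesis .
  qed
  have "Psi w \<epsilon> \<xi> c \<sigma> = (\<Sum>x\<in>base {1..w}. \<Sum>k\<in>K. u k *
      ((\<Prod>p\<in>{1..w}. \<epsilon> (c p) (x p)) * (\<Prod>j<?r. \<phi> k j (cyc_val w (x, \<sigma>) (m j)))))"
    unfolding Psi_def m_def by (rule sum.cong[OF refl]) (simp add: \<xi> sum_distrib_left mult.left_commute)
  also have "\<dots> = (\<Sum>k\<in>K. \<Sum>x\<in>base {1..w}. u k *
      ((\<Prod>p\<in>{1..w}. \<epsilon> (c p) (x p)) * (\<Prod>j<?r. \<phi> k j (cyc_val w (x, \<sigma>) (m j)))))"
    by (rule sum.swap)
  also have "\<dots> = (\<Sum>k\<in>K. u k * (\<Prod>j<?r. \<Sum>a\<in>carrier L. \<epsilon> (f j) a * \<phi> k j a))"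
    by (simp only: sum_distrib_left[symmetric] one)
  finally show ?thesis .
qed

end

section \<open>The multiplicity functions are virtual characters\<close>

text \<open>Diagonal matrix units are dual to the irreducible characters, so any finite set of these
  gives a frame in the functions on \<open>G\<close>, and \<open>frame_le\<close> bounds its size by
  the order of \<open>G\<close>.\<close>

lemma finite_irr_chars:
  assumes G: "group G" and fin: "finite (carrier G)"
  shows "finite (irr_chars G)"
proof (rule finite_if_finite_subsets_card_bdd[THEN conjunct1])
  fix S assume S: "S \<subseteq> irr_chars G" "finite S"
  let ?m = "card (carrier G)"
  obtain xs where xs: "set xs = S" "distinct xs" using finite_distinct_list[OF S(2)] by blast
  obtain b where b: "bij_betw b {0..<?m} (carrier G)" using ex_bij_betw_nat_finite[OF fin] by blast
  have "\<forall>\<chi>\<in>S. \<exists>nR. is_irr_rep G (fst nR) (snd nR) \<and> \<chi> = char_of G (fst nR) (snd nR)"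
    using S(1) by (auto simp: irr_chars_def) blast
  then obtain nR where nR: "\<And>\<chi>. \<chi> \<in> S \<Longrightarrow> is_irr_rep G (fst (nR \<chi>)) (snd (nR \<chi>))"
    "\<And>\<chi>. \<chi> \<in> S \<Longrightarrow> \<chi> = char_of G (fst (nR \<chi>)) (snd (nR \<chi>))" by metis
  define C where "C = mat ?m (length xs) (\<lambda>(k, j). (xs ! j) (b k))"
  define D where "D = mat (length xs) ?m (\<lambda>(i, k). munit G (fst (nR (xs ! i))) (snd (nR (xs ! i))) 0 0 (b k))"
  have "D * C = 1\<^sub>m (length xs)"
  proof (rule eq_matI)
    fix i j assume "i < dim_row (1\<^sub>m (length xs) :: complex mat)" "j < dim_col (1\<^sub>m (length xs) :: complex mat)"
    then have ij: "i < length xs" "j < length xs" by auto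
    have mem: "xs ! i \<in> S" "xs ! j \<in> irr_chars G" using ij xs(1) S(1) by auto
    let ?u = "munit G (fst (nR (xs ! i))) (snd (nR (xs ! i))) 0 0"
    have "(D * C) $$ (i, j) = (\<Sum>k\<in>{0..<?m}. ?u (b k) * (xs ! j) (b k))"
      using ij by (simp add: C_def D_def scalar_prod_def)
    also have "\<dots> = (\<Sum>g\<in>carrier G. ?u g * (xs ! j) g)"
      by (rule sum.reindex_bij_betw[OF b, of "\<lambda>g. ?u g * (xs ! j) g"])
    also have "\<dots> = (if xs ! j = char_of G (fst (nR (xs ! i))) (snd (nR (xs ! i))) then 1 else 0)"
      using nR(1)[OF mem(1)] mem(2) by (intro munit_char[OF G fin]) (auto simp: is_irr_rep_def)
    also have "\<dots> = (if i = j then 1 else 0)"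
      unfolding nR(2)[OF mem(1), symmetric] using nth_eq_iff_index_eq[OF xs(2) ij(2,1)] by auto
    finally show "(D * C) $$ (i, j) = 1\<^sub>m (length xs) $$ (i, j)" using ij by simp
  qed (auto simp: C_def D_def)
  then have "frame ?m (length xs) C D" by (simp add: frame_def C_def D_def)
  then show "card S \<le> ?m" using frame_le xs distinct_card by metis
qed

lemma char_of_conj:
  assumes G: "group G" and \<rho>: "is_rep G n \<rho>" and g: "g \<in> carrier G" "g' \<in> carrier G" "h \<in> carrier G"
    and eq: "h \<otimes>\<^bsub>G\<^esub> g = g' \<otimes>\<^bsub>G\<^esub> h"
  shows "char_of G n \<rho> g' = char_of G n \<rho> g"
proof -
  interpret group G by fact
  have c: "\<rho> k \<in> carrier_mat n n" if "k \<in> carrier G" for k using \<rho> that by (auto simp: is_rep_def)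
  have g': "g' = h \<otimes>\<^bsub>G\<^esub> g \<otimes>\<^bsub>G\<^esub> inv\<^bsub>G\<^esub> h" unfolding eq using g by (simp add: m_assoc)
  have "\<rho> g' = \<rho> (h \<otimes>\<^bsub>G\<^esub> g) * \<rho> (inv\<^bsub>G\<^esub> h)"
    unfolding g' using \<rho> g by (simp add: is_rep_def)
  then have "mtrace (\<rho> g') = mtrace (\<rho> (inv\<^bsub>G\<^esub> h) * \<rho> (h \<otimes>\<^bsub>G\<^esub> g))"
    using c g mtrace_comm[of "\<rho> (h \<otimes>\<^bsub>G\<^esub> g)" n n "\<rho> (inv\<^bsub>G\<^esub> h)"] by simp
  also have "\<rho> (inv\<^bsub>G\<^esub> h) * \<rho> (h \<otimes>\<^bsub>G\<^esub> g) = \<rho> (inv\<^bsub>G\<^esub> h \<otimes>\<^bsub>G\<^esub> (h \<otimes>\<^bsub>G\<^esub> g))"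
    using \<rho> g by (simp add: is_rep_def)
  also have "inv\<^bsub>G\<^esub> h \<otimes>\<^bsub>G\<^esub> (h \<otimes>\<^bsub>G\<^esub> g) = g" using g by (simp add: m_assoc[symmetric])
  finally show ?thesis using g by (simp add: char_of_mtrace[OF \<rho>])
qed

lemma vchars_conj:
  assumes G: "group G" and \<xi>: "\<xi> \<in> vchars G" and g: "g \<in> carrier G" "g' \<in> carrier G" "h \<in> carrier G"
    and hg: "h \<otimes>\<^bsub>G\<^esub> g = g' \<otimes>\<^bsub>G\<^esub> h"
  shows "\<xi> g' = \<xi> g"
proof -
  obtain F c where F: "F \<subseteq> irr_chars G" "\<xi> = (\<lambda>x. \<Sum>\<chi>\<in>F. of_int (c \<chi>) * \<chi> x)"
    using \<xi> by (auto simp: vchars_def int_span_def)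
  have eq: "\<chi> g' = \<chi> g" if \<chi>: "\<chi> \<in> F" for \<chi>
  proof -
    obtain n \<rho> where "is_irr_rep G n \<rho>" "\<chi> = char_of G n \<rho>" using \<chi> F(1) by (auto simp: irr_chars_def)
    then show ?thesis using char_of_conj[OF G _ g hg, of n \<rho>] by (simp add: is_irr_rep_def)
  qed
  show ?thesis unfolding F(2) by (intro sum.cong refl) (simp add: eq)
qed

lemma vchars_outside:
  assumes "\<xi> \<in> vchars G" "g \<notin> carrier G"
  shows "\<xi> g = 0"
proof -
  obtain F c where F: "F \<subseteq> irr_chars G" "\<xi> = (\<lambda>x. \<Sum>\<chi>\<in>F. of_int (c \<chi>) * \<chi> x)"
    using assms(1) by (auto simp: vchars_def int_span_def)
  have "\<chi> g = 0" if "\<chi> \<in> F" for \<chi>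
    using that F(1) assms(2) by (auto simp: irr_chars_def char_of_def)
  then show ?thesis unfolding F(2) by simp
qed

lemma int_span_base: "f \<in> S \<Longrightarrow> f \<in> int_span S"
  unfolding int_span_def by (intro CollectI exI[of _ "{f}"] exI[of _ "\<lambda>_. 1"]) simp

lemma int_span_zero: "(\<lambda>_. 0) \<in> int_span S"
  unfolding int_span_def by (intro CollectI exI[of _ "{}"]) simp

lemma int_span_add:
  assumes "f \<in> int_span S" "g \<in> int_span S"
  shows "(\<lambda>x. f x + g x) \<in> int_span S"
proof -
  obtain F c where F: "finite F" "F \<subseteq> S" "f = (\<lambda>x. \<Sum>\<chi>\<in>F. of_int (c \<chi>) * \<chi> x)"
    using assms(1) unfolding int_span_def by blast
  obtain F' c' where F': "finite F'" "F' \<subseteq> S" "g = (\<lambda>x. \<Sum>\<chi>\<in>F'. of_int (c' \<chi>) * \<chi> x)"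
    using assms(2) unfolding int_span_def by blast
  let ?d = "\<lambda>\<chi>. (if \<chi> \<in> F then c \<chi> else 0) + (if \<chi> \<in> F' then c' \<chi> else 0)"
  have ext: "(\<Sum>\<chi>\<in>A. of_int (a \<chi>) * \<chi> x) = (\<Sum>\<chi>\<in>F \<union> F'. of_int (if \<chi> \<in> A then a \<chi> else 0) * \<chi> x)"
    if "A \<subseteq> F \<union> F'" for A and a :: "_ \<Rightarrow> int" and x
    using F(1) F'(1) that by (intro sum.mono_neutral_cong_left) auto
  have "f x + g x = (\<Sum>\<chi>\<in>F \<union> F'. of_int (?d \<chi>) * \<chi> x)" for x
    unfolding F(3) F'(3) ext[of F c x, OF Un_upper1] ext[of F' c' x, OF Un_upper2]
    by (simp only: sum.distrib[symmetric] of_int_add distrib_right)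
  then show ?thesis unfolding int_span_def
    using F F' by (intro CollectI exI[of _ "F \<union> F'"] exI[of _ ?d]) auto
qed

lemma int_span_smult:
  assumes "f \<in> int_span S"
  shows "(\<lambda>x. of_int a * f x) \<in> int_span S"
proof -
  obtain F c where F: "finite F" "F \<subseteq> S" "f = (\<lambda>x. \<Sum>\<chi>\<in>F. of_int (c \<chi>) * \<chi> x)"
    using assms(1) unfolding int_span_def by blast
  have "(\<lambda>x. of_int a * f x) = (\<lambda>x. \<Sum>\<chi>\<in>F. of_int (a * c \<chi>) * \<chi> x)"
    unfolding F(3) by (simp add: sum_distrib_left mult.assoc)
  with F(1,2) show ?thesis unfolding int_span_def
    by (intro CollectI exI[of _ F] exI[of _ "\<lambda>\<chi>. a * c \<chi>"] conjI)
qed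

lemma int_span_sum:
  assumes "finite A" "\<And>i. i \<in> A \<Longrightarrow> f i \<in> int_span S"
  shows "(\<lambda>x. \<Sum>i\<in>A. f i x) \<in> int_span S"
  using assms
proof (induction A)
  case empty
  then show ?case by (simp add: int_span_zero)
next
  case (insert a A)
  then show ?case using int_span_add[of "f a" S "\<lambda>x. \<Sum>i\<in>A. f i x"] by simp
qed

lemma int_span_sum_list:
  assumes "\<And>t. t \<in> set T \<Longrightarrow> f t \<in> int_span S"
  shows "(\<lambda>x. \<Sum>t\<leftarrow>T. f t x) \<in> int_span S"
  using assms
proof (induction T)
  case Nil
  then show ?case by (simp add: int_span_zero)
next
  case (Cons a T)
  then show ?case using int_span_add[of "f a" S "\<lambda>x. \<Sum>t\<leftarrow>T. f t x"] by simp
qed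

context finite_group
begin

lemma vchars_class_fun: "\<phi> \<in> vchars L \<Longrightarrow> class_fun \<phi>"
  unfolding class_fun_def
proof (intro ballI)
  fix a b assume \<phi>: "\<phi> \<in> vchars L" and ab: "a \<in> carrier L" "b \<in> carrier L"
  then have "a \<otimes> b = a \<otimes> b \<otimes> inv a \<otimes> a" by (simp add: m_assoc)
  then show "\<phi> (a \<otimes> b \<otimes> inv a) = \<phi> b" using ab by (intro vchars_conj[OF is_group \<phi>, of _ _ a]) auto
qed

section \<open>The idempotent of a colouring and the character of its image\<close>

context
  fixes ws :: "nat list" and d :: "nat \<Rightarrow> nat" and R :: "nat \<Rightarrow> 'a \<Rightarrow> complex mat" and \<epsilon> :: "nat \<Rightarrow> 'a \<Rightarrow> complex"
  assumes R: "\<And>i. i < length ws \<Longrightarrow> is_irr_rep L (d i) (R i)"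
    and \<epsilon>: "\<And>i. i < length ws \<Longrightarrow> \<epsilon> i = munit L (d i) (R i) 0 0"
begin

lemma epsilon_conv:
  assumes "i < length ws" "c \<in> carrier L"
  shows "(\<Sum>b\<in>carrier L. \<epsilon> i b * \<epsilon> i (inv b \<otimes> c)) = \<epsilon> i c"
proof -
  have "d i > 0" using R[OF assms(1)] by (simp add: is_irr_rep_def)
  then show ?thesis
    using munit_conv[OF is_group finite_carrier R[OF assms(1)] assms(2), of 0 0 0 0] \<epsilon>[OF assms(1)] by simp
qed

text \<open>The product over all positions of the primitive idempotents chosen by the blocks, as an
  element of the group algebra of the wreath product supported on the base group.\<close>

definition young_idem :: "'a wr \<Rightarrow> complex" where
  "young_idem g = (if snd g = id then \<Prod>p\<in>{1..sum_list ws}. \<epsilon> (block_of ws p) (fst g p) else 0)"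

lemma sum_young_idem:
  "(\<Sum>g\<in>carrier (WR (sum_list ws)). young_idem g * F g) =
    (\<Sum>x\<in>base {1..sum_list ws}. (\<Prod>p\<in>{1..sum_list ws}. \<epsilon> (block_of ws p) (x p)) * F (x, id))"
proof -
  have "(\<Sum>g\<in>carrier (WR (sum_list ws)). young_idem g * F g) =
    (\<Sum>g\<in>(\<lambda>x. (x, id)) ` base {1..sum_list ws}. young_idem g * F g)"
  proof (rule sum.mono_neutral_right[OF finite_wreath])
    show "(\<lambda>x. (x, id)) ` base {1..sum_list ws} \<subseteq> carrier (WR (sum_list ws))"
      by (auto simp: wreath_carrier permutes_id)
    show "\<forall>g\<in>carrier (WR (sum_list ws)) - (\<lambda>x. (x, id)) ` base {1..sum_list ws}. young_idem g * F g = 0"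
    proof
      fix g assume g: "g \<in> carrier (WR (sum_list ws)) - (\<lambda>x. (x, id)) ` base {1..sum_list ws}"
      obtain x \<sigma> where gd: "g = (x, \<sigma>)" by (cases g)
      have "x \<in> base {1..sum_list ws}" using g by (simp add: gd wreath_carrier)
      then have "\<sigma> \<noteq> id" using g gd by blast
      then show "young_idem g * F g = 0" by (simp add: young_idem_def gd)
    qed
  qed
  also have "\<dots> = (\<Sum>x\<in>base {1..sum_list ws}. young_idem (x, id) * F (x, id))"
    by (subst sum.reindex) (auto simp: inj_on_def)
  finally show ?thesis by (simp only: young_idem_def snd_conv fst_conv if_True simp_thms)
qed

text \<open>Inversion and multiplication in the base group are entrywise, so the convolution factors
  over the positions and each factor reproduces itself by \<open>epsilon_conv\<close>.\<close>

lemma young_idem_conv: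
  assumes g: "g \<in> carrier (WR (sum_list ws))"
  shows "(\<Sum>h\<in>carrier (WR (sum_list ws)). young_idem h * young_idem (inv\<^bsub>WR (sum_list ws)\<^esub> h \<otimes>\<^bsub>WR (sum_list ws)\<^esub> g)) = young_idem g"
proof -
  let ?w = "sum_list ws"
  obtain x \<sigma> where gd: "g = (x, \<sigma>)" by (cases g)
  have x: "x \<in> base {1..?w}" using g by (simp add: gd wreath_carrier)
  have inv: "inv\<^bsub>WR ?w\<^esub> (y, id) \<otimes>\<^bsub>WR ?w\<^esub> g = (\<lambda>i. inv (y i) \<otimes> x i, \<sigma>)" if y: "y \<in> base {1..?w}" for y
  proof -
    have yc: "(y, id) \<in> carrier (WR ?w)" using y by (simp add: wreath_carrier permutes_id)
    have y'c: "(\<lambda>i. inv (y i), id) \<in> carrier (WR ?w)" using y by (auto simp: wreath_carrier permutes_id base_def)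
    have "(\<lambda>i. inv (y i), id) \<otimes>\<^bsub>WR ?w\<^esub> (y, id) = \<one>\<^bsub>WR ?w\<^esub>"
      using base_closed[OF y] by (simp add: wreath_mult wreath_one)
    then have "inv\<^bsub>WR ?w\<^esub> (y, id) = (\<lambda>i. inv (y i), id)" using wr.inv_equality[OF _ yc y'c] by simp
    then show ?thesis by (simp add: gd wreath_mult)
  qed
  have "(\<Sum>h\<in>carrier (WR ?w). young_idem h * young_idem (inv\<^bsub>WR ?w\<^esub> h \<otimes>\<^bsub>WR ?w\<^esub> g)) =
    (\<Sum>y\<in>base {1..?w}. (\<Prod>p\<in>{1..?w}. \<epsilon> (block_of ws p) (y p)) * young_idem (\<lambda>i. inv (y i) \<otimes> x i, \<sigma>))"
    unfolding sum_young_idem by (intro sum.cong refl) (simp only: inv)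
  also have "\<dots> = young_idem g"
  proof (cases "\<sigma> = id")
    case True
    have "(\<Sum>y\<in>base {1..?w}. (\<Prod>p\<in>{1..?w}. \<epsilon> (block_of ws p) (y p)) * young_idem (\<lambda>i. inv (y i) \<otimes> x i, \<sigma>)) =
      (\<Sum>y\<in>base {1..?w}. \<Prod>p\<in>{1..?w}. \<epsilon> (block_of ws p) (y p) * \<epsilon> (block_of ws p) (inv (y p) \<otimes> x p))"
      unfolding young_idem_def snd_conv fst_conv if_P[OF True] prod.distrib ..
    also have "\<dots> = (\<Prod>p\<in>{1..?w}. \<Sum>b\<in>carrier L. \<epsilon> (block_of ws p) b * \<epsilon> (block_of ws p) (inv b \<otimes> x p))"
      by (rule sum_base_prod[of "{1..?w}" "\<lambda>p b. \<epsilon> (block_of ws p) b * \<epsilon> (block_of ws p) (inv b \<otimes> x p)"]) simp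
    also have "\<dots> = (\<Prod>p\<in>{1..?w}. \<epsilon> (block_of ws p) (x p))"
      by (intro prod.cong refl epsilon_conv block_of_mem(1) base_closed[OF x])
    finally show ?thesis unfolding young_idem_def gd snd_conv fst_conv if_P[OF True] .
  next
    case False
    then show ?thesis by (simp add: young_idem_def gd)
  qed
  finally show ?thesis .
qed

definition perm_elt :: "(nat \<Rightarrow> nat) \<Rightarrow> 'a wr" where
  "perm_elt \<pi> = (\<lambda>_. \<one>, \<pi>)"

lemma perm_elt_closed: "\<pi> permutes {1..w} \<Longrightarrow> perm_elt \<pi> \<in> carrier (WR w)"
  by (simp add: perm_elt_def wreath_carrier base_def)

lemma perm_elt_mult: "perm_elt \<pi> \<otimes>\<^bsub>WR w\<^esub> perm_elt \<pi>' = perm_elt (\<pi> \<circ> \<pi>')"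
  by (simp add: perm_elt_def wreath_mult)

text \<open>This is the coefficient form of commutation with the lift of \<open>\<tau>\<close>. Both
  sides vanish unless \<open>\<sigma> = \<tau>\<close>; in that case \<open>\<tau>\<close> permutes
  positions carrying equal idempotents.\<close>

lemma young_idem_commute:
  assumes \<tau>: "\<tau> permutes {1..sum_list ws}" and block_of: "\<And>p. block_of ws (\<tau> p) = block_of ws p"
    and g: "g \<in> carrier (WR (sum_list ws))"
  shows "young_idem (inv\<^bsub>WR (sum_list ws)\<^esub> (perm_elt \<tau>) \<otimes>\<^bsub>WR (sum_list ws)\<^esub> g) =
    young_idem (g \<otimes>\<^bsub>WR (sum_list ws)\<^esub> inv\<^bsub>WR (sum_list ws)\<^esub> (perm_elt \<tau>))"
proof -
  let ?w = "sum_list ws"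
  obtain x \<sigma> where gd: "g = (x, \<sigma>)" by (cases g)
  have x: "x \<in> base {1..?w}" and \<sigma>: "\<sigma> permutes {1..?w}" using g by (simp_all add: gd wreath_carrier)
  note \<tau>i = permutes_inv[OF \<tau>]
  have "perm_elt (inv' \<tau>) \<otimes>\<^bsub>WR ?w\<^esub> perm_elt \<tau> = \<one>\<^bsub>WR ?w\<^esub>"
    unfolding perm_elt_mult using permutes_inv_o(2)[OF \<tau>] by (simp add: perm_elt_def wreath_one)
  then have inv: "inv\<^bsub>WR ?w\<^esub> (perm_elt \<tau>) = perm_elt (inv' \<tau>)"
    using wr.inv_equality[OF _ perm_elt_closed[OF \<tau>] perm_elt_closed[OF \<tau>i]] by simp
  have l: "inv\<^bsub>WR ?w\<^esub> (perm_elt \<tau>) \<otimes>\<^bsub>WR ?w\<^esub> g = (\<lambda>i. x (\<tau> i), inv' \<tau> \<circ> \<sigma>)"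
    unfolding inv unfolding perm_elt_def gd wreath_mult using base_closed[OF x] permutes_inv_inv[OF \<tau>] by simp
  have r: "g \<otimes>\<^bsub>WR ?w\<^esub> inv\<^bsub>WR ?w\<^esub> (perm_elt \<tau>) = (x, \<sigma> \<circ> inv' \<tau>)"
    unfolding inv unfolding perm_elt_def gd wreath_mult using base_closed[OF x] by simp
  have "inv' \<tau> \<circ> \<sigma> = id \<longleftrightarrow> \<sigma> = \<tau>"
    using permutes_inv_o[OF \<tau>] by (metis comp_assoc comp_id id_comp)
  moreover have "\<sigma> \<circ> inv' \<tau> = id \<longleftrightarrow> \<sigma> = \<tau>"
    using permutes_inv_o[OF \<tau>] by (metis comp_assoc comp_id id_comp)
  moreover have "(\<Prod>p\<in>{1..?w}. \<epsilon> (block_of ws p) (x (\<tau> p))) = (\<Prod>p\<in>{1..?w}. \<epsilon> (block_of ws p) (x p))"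
  proof -
    have "(\<Prod>p\<in>{1..?w}. \<epsilon> (block_of ws p) (x (\<tau> p))) = (\<Prod>p\<in>{1..?w}. \<epsilon> (block_of ws (\<tau> p)) (x (\<tau> p)))"
      by (simp only: block_of)
    also have "\<dots> = (\<Prod>p\<in>{1..?w}. \<epsilon> (block_of ws p) (x p))"
      by (rule prod.reindex_bij_betw[OF permutes_imp_bij[OF \<tau>], of "\<lambda>p. \<epsilon> (block_of ws p) (x p)"])
    finally show ?thesis .
  qed
  ultimately show ?thesis unfolding l r young_idem_def snd_conv fst_conv by (simp only:)
qed

text \<open>The idempotent commutes with the lifts of all block-preserving permutations, so the
  symmetric groups of the blocks act on its image by commuting representations. \<open>Psi\<close>
  is the trace of this action, and \<open>commuting_reps_char\<close> writes it as a sum of products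
  of irreducible characters with no denominators.\<close>

lemma Psi_rep:
  assumes \<rho>: "is_rep (WR (sum_list ws)) N \<rho>"
  shows "\<exists>ms. (\<forall>\<chi>s\<in>set ms. length \<chi>s = length ws \<and> (\<forall>i<length ws. \<chi>s ! i \<in> irr_chars (sym_group (ws ! i)))) \<and>
    (\<forall>g\<in>young_wr L ws. Psi (sum_list ws) \<epsilon> (char_of (WR (sum_list ws)) N \<rho>) (block_of ws) (snd g) =
      (\<Sum>\<chi>s\<leftarrow>ms. \<Prod>i<length ws. (\<chi>s ! i) (snd (young_comp L ws i g))))"
proof -
  let ?w = "sum_list ws" and ?n = "length ws"
  let ?G = "WR ?w"
  have c: "\<rho> g \<in> carrier_mat N N" if "g \<in> carrier ?G" for g using \<rho> that by (simp add: is_rep_def)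
  have \<rho>m: "\<rho> g * \<rho> h = \<rho> (g \<otimes>\<^bsub>?G\<^esub> h)" if "g \<in> carrier ?G" "h \<in> carrier ?G" for g h
    using \<rho> that by (simp add: is_rep_def)
  define E where "E = group_op N ?G \<rho> young_idem"
  have Ec: "E \<in> carrier_mat N N" by (simp add: E_def)
  have EE: "E * E = E" unfolding E_def group_op_mult[OF wreath_group finite_wreath \<rho>] by (rule group_op_cong) (rule young_idem_conv)
  have EC: "\<rho> (perm_elt \<tau>) * E = E * \<rho> (perm_elt \<tau>)"
    if "\<tau> permutes {1..?w}" "\<And>p. block_of ws (\<tau> p) = block_of ws p" for \<tau>
    unfolding E_def rep_group_op[OF wreath_group finite_wreath \<rho> perm_elt_closed[OF that(1)]]
      group_op_rep[OF wreath_group finite_wreath \<rho> perm_elt_closed[OF that(1)]]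
    by (rule group_op_cong) (rule young_idem_commute[OF that])
  from idem_frame[OF Ec EE] obtain r C D where fr: "frame N r C D" and CD: "C * D = E" by metis
  define K where "K i = sym_group (ws ! i)" for i
  define \<rho>i where "\<rho>i i \<tau> = \<rho> (perm_elt (emb ws i \<tau>))" for i \<tau>
  have Kc: "\<tau> permutes {1..ws ! i}" if "\<tau> \<in> carrier (K i)" for \<tau> i using that by (simp add: K_def sym_group_def)
  have ec: "perm_elt (emb ws i \<tau>) \<in> carrier ?G" if "i < ?n" "\<tau> \<in> carrier (K i)" for i \<tau>
    by (rule perm_elt_closed[OF emb_permutes[OF Kc[OF that(2)] that(1)]])
  have \<rho>ic: "\<rho>i i \<tau> \<in> carrier_mat N N" if "i < ?n" "\<tau> \<in> carrier (K i)" for i \<tau>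
    unfolding \<rho>i_def by (rule c[OF ec[OF that]])
  have \<rho>iE: "\<rho>i i \<tau> * E = E * \<rho>i i \<tau>" if "i < ?n" "\<tau> \<in> carrier (K i)" for i \<tau>
    unfolding \<rho>i_def using EC[OF emb_permutes[OF Kc[OF that(2)] that(1)] block_of_emb[OF Kc[OF that(2)] that(1)]] .
  have inv: "E * \<rho>i i \<tau> * E = \<rho>i i \<tau> * E" if "i < ?n" "\<tau> \<in> carrier (K i)" for i \<tau>
    unfolding \<rho>iE[OF that, symmetric] using assoc_mult_mat[OF \<rho>ic[OF that] Ec Ec] EE by simp
  have gK: "group (K i)" for i unfolding K_def by (rule sym_group_is_group)
  have fK: "finite (carrier (K i))" for i by (simp add: K_def sym_group_def finite_permutations)
  have "\<exists>ms. (\<forall>\<chi>s\<in>set ms. length \<chi>s = ?n \<and> (\<forall>i<?n. \<chi>s ! i \<in> irr_chars (K i))) \<and>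
    (\<forall>ks. (\<forall>i<?n. ks i \<in> carrier (K i)) \<longrightarrow>
      mtrace (mprod r ?n (\<lambda>i. D * \<rho>i i (ks i) * C)) = (\<Sum>\<chi>s\<leftarrow>ms. \<Prod>i<?n. (\<chi>s ! i) (ks i)))"
  proof (rule commuting_reps_char[where \<rho> = "\<lambda>i k. D * \<rho>i i k * C"])
    fix i assume i: "i < ?n"
    show "group (K i)" "finite (carrier (K i))" by (rule gK, rule fK)
    have "is_rep (K i) N (\<rho>i i)"
      unfolding is_rep_def
    proof (intro conjI ballI)
      show "\<rho>i i \<one>\<^bsub>K i\<^esub> = 1\<^sub>m N"
        using \<rho> by (simp add: K_def sym_group_def \<rho>i_def emb_id is_rep_def perm_elt_def wreath_one)
      fix k assume k: "k \<in> carrier (K i)"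
      show "\<rho>i i k \<in> carrier_mat N N" by (rule \<rho>ic[OF i k])
      fix k' assume k': "k' \<in> carrier (K i)"
      have "emb ws i (k \<otimes>\<^bsub>K i\<^esub> k') = emb ws i k \<circ> emb ws i k'"
        using emb_comp[OF Kc[OF k'], of k] by (simp add: K_def sym_group_def)
      then show "\<rho>i i (k \<otimes>\<^bsub>K i\<^esub> k') = \<rho>i i k * \<rho>i i k'"
        unfolding \<rho>i_def \<rho>m[OF ec[OF i k] ec[OF i k']] perm_elt_mult by simp
    qed
    then show "is_rep (K i) r (\<lambda>k. D * \<rho>i i k * C)"
      using inv[OF i] by (intro compress_rep[OF _ gK fr CD]) auto
  next
    fix i j g h assume ij: "i < ?n" "j < ?n" "i \<noteq> j" and g: "g \<in> carrier (K i)" and h: "h \<in> carrier (K j)"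
    have "\<rho>i i g * \<rho>i j h = \<rho>i j h * \<rho>i i g"
      unfolding \<rho>i_def \<rho>m[OF ec[OF ij(1) g] ec[OF ij(2) h]] \<rho>m[OF ec[OF ij(2) h] ec[OF ij(1) g]] perm_elt_mult
      using emb_commute[OF Kc[OF g] Kc[OF h] ij] by simp
    moreover have "(D * \<rho>i i g * C) * (D * \<rho>i j h * C) = D * (\<rho>i i g * \<rho>i j h) * C"
      using inv[OF ij(2) h] by (intro compress_mult[OF fr CD \<rho>ic[OF ij(1) g] \<rho>ic[OF ij(2) h]]) auto
    moreover have "(D * \<rho>i j h * C) * (D * \<rho>i i g * C) = D * (\<rho>i j h * \<rho>i i g) * C"
      using inv[OF ij(1) g] by (intro compress_mult[OF fr CD \<rho>ic[OF ij(2) h] \<rho>ic[OF ij(1) g]]) auto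
    ultimately show "(D * \<rho>i i g * C) * (D * \<rho>i j h * C) = (D * \<rho>i j h * C) * (D * \<rho>i i g * C)" by simp
  qed
  then obtain ms where ms: "\<forall>\<chi>s\<in>set ms. length \<chi>s = ?n \<and> (\<forall>i<?n. \<chi>s ! i \<in> irr_chars (K i))"
    "\<And>ks. (\<forall>i<?n. ks i \<in> carrier (K i)) \<Longrightarrow>
      mtrace (mprod r ?n (\<lambda>i. D * \<rho>i i (ks i) * C)) = (\<Sum>\<chi>s\<leftarrow>ms. \<Prod>i<?n. (\<chi>s ! i) (ks i))" by blast
  have "Psi ?w \<epsilon> (char_of ?G N \<rho>) (block_of ws) (snd g) =
      (\<Sum>\<chi>s\<leftarrow>ms. \<Prod>i<?n. (\<chi>s ! i) (snd (young_comp L ws i g)))" if g: "g \<in> young_wr L ws" for g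
  proof -
    let ?\<sigma> = "snd g" and ?k = "\<lambda>i. snd (young_comp L ws i g)"
    have gw: "g \<in> carrier ?G" using g by (simp add: young_wr_iff)
    note \<sigma> = snd_permutes[OF gw]
    have colp: "block_of ws (?\<sigma> p) = block_of ws p" if "p \<in> {1..?w}" for p using g that unfolding young_wr_iff by blast
    have k: "?k i \<in> carrier (K i)" if "i < ?n" for i
      using snd_permutes[OF young_comp_closed[OF g that]] by (simp add: K_def sym_group_def)
    \<comment> \<open>\<open>P j\<close> agrees with \<open>?\<sigma>\<close> on the first
      \<open>j\<close> blocks and is the identity elsewhere. It is the product of the first
      \<open>j\<close> block components.\<close>
    define P where "P j p = (if p \<in> {1..?w} \<and> block_of ws p < j then ?\<sigma> p else p)" for j p
    have step: "P (Suc j) = P j \<circ> emb ws j (?k j)" if j: "j < ?n" for j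
    proof
      fix p
      show "P (Suc j) p = (P j \<circ> emb ws j (?k j)) p"
      proof (cases "p \<in> block ws j")
        case True
        then have pw: "p \<in> {1..?w}" and cp: "block_of ws p = j" using block_subset[OF j] block_of_eq[OF j] by auto
        have pj: "p - offs ws j \<in> {1..ws ! j}" "offs ws j + (p - offs ws j) = p" using True by (auto simp: block_def)
        have "emb ws j (?k j) p = ?\<sigma> p"
          using young_comp_snd[OF g j pj(1)] pj(2) True by (simp add: emb_def)
        moreover have "block_of ws (?\<sigma> p) = j" using colp[OF pw] cp by simp
        ultimately show ?thesis using pw cp by (simp add: P_def)
      next
        case False
        have "block_of ws p \<noteq> j" if "p \<in> {1..?w}" using block_of_mem(2)[OF that] False by auto
        then show ?thesis using False by (auto simp: P_def emb_def less_Suc_eq)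
      qed
    qed
    have PP: "P j permutes {1..?w} \<and> mprod N j (\<lambda>i. \<rho>i i (?k i)) = \<rho> (perm_elt (P j))" if "j \<le> ?n" for j
      using that
    proof (induction j)
      case 0
      have P0: "P 0 = id" by (auto simp: P_def)
      have "\<rho> (perm_elt id) = 1\<^sub>m N" using \<rho> by (simp add: is_rep_def perm_elt_def wreath_one)
      then show ?case unfolding P0 mprod.simps by (intro conjI permutes_id) (rule sym)
    next
      case (Suc j)
      then have j: "j < ?n" and IH: "P j permutes {1..?w}" "mprod N j (\<lambda>i. \<rho>i i (?k i)) = \<rho> (perm_elt (P j))" by auto
      have "P (Suc j) permutes {1..?w}"
        unfolding step[OF j] by (rule permutes_compose[OF emb_permutes[OF Kc[OF k[OF j]] j] IH(1)])
      moreover have "mprod N (Suc j) (\<lambda>i. \<rho>i i (?k i)) = \<rho> (perm_elt (P (Suc j)))"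
        unfolding step[OF j] perm_elt_mult[symmetric, of _ _ ?w]
        using IH(2) \<rho>m[OF perm_elt_closed[OF IH(1)] ec[OF j k[OF j]]] by (simp add: \<rho>i_def)
      ultimately show ?case by blast
    qed
    have "P ?n = ?\<sigma>"
    proof
      fix p
      show "P ?n p = ?\<sigma> p"
      proof (cases "p \<in> {1..?w}")
        case True
        then show ?thesis using block_of_mem(1)[OF True] by (simp add: P_def)
      next
        case False
        then show ?thesis using permutes_not_in[OF \<sigma> False] by (auto simp: P_def)
      qed
    qed
    then have full: "mprod N ?n (\<lambda>i. \<rho>i i (?k i)) = \<rho> (perm_elt ?\<sigma>)" using PP[of ?n] by simp
    have pc: "perm_elt ?\<sigma> \<in> carrier ?G" by (rule perm_elt_closed[OF \<sigma>])
    have "mtrace (mprod r ?n (\<lambda>i. D * \<rho>i i (?k i) * C)) = mtrace (D * mprod N ?n (\<lambda>i. \<rho>i i (?k i)) * C)"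
      using \<rho>ic k \<rho>iE EE by (subst mprod_compress[OF fr CD]) auto
    also have "\<dots> = mtrace (\<rho> (perm_elt ?\<sigma>) * E)" unfolding full by (rule compress_mtrace[OF fr CD c[OF pc]])
    also have "\<dots> = (\<Sum>h\<in>carrier ?G. young_idem h * mtrace (\<rho> (perm_elt ?\<sigma>) * \<rho> h))"
      unfolding E_def by (rule mtrace_group_op[OF \<rho> c[OF pc]])
    also have "\<dots> = (\<Sum>x\<in>base {1..?w}. (\<Prod>p\<in>{1..?w}. \<epsilon> (block_of ws p) (x p)) * mtrace (\<rho> (perm_elt ?\<sigma>) * \<rho> (x, id)))"
      by (rule sum_young_idem)
    also have "\<dots> = Psi ?w \<epsilon> (char_of ?G N \<rho>) (block_of ws) ?\<sigma>"
      unfolding Psi_def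
    proof (rule sum.cong[OF refl])
      fix x assume x: "x \<in> base {1..?w}"
      have xc: "(x, id) \<in> carrier ?G" using x by (simp add: wreath_carrier permutes_id)
      have xs: "(x, id) \<otimes>\<^bsub>?G\<^esub> perm_elt ?\<sigma> = (x, ?\<sigma>)" using base_closed[OF x] by (simp add: perm_elt_def wreath_mult)
      \<comment> \<open>In \<open>(x, \<sigma>)\<close> the base element stands on the left;
        cyclicity of the trace brings it there.\<close>
      have "mtrace (\<rho> (perm_elt ?\<sigma>) * \<rho> (x, id)) = mtrace (\<rho> (x, id) * \<rho> (perm_elt ?\<sigma>))" by (rule mtrace_comm[OF c[OF pc] c[OF xc]])
      also have "\<dots> = mtrace (\<rho> (x, ?\<sigma>))" unfolding \<rho>m[OF xc pc] xs ..
      also have "\<dots> = char_of ?G N \<rho> (x, ?\<sigma>)"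
        using x \<sigma> by (intro char_of_mtrace[OF \<rho>, symmetric]) (simp add: wreath_carrier)
      finally show "(\<Prod>p\<in>{1..?w}. \<epsilon> (block_of ws p) (x p)) * mtrace (\<rho> (perm_elt ?\<sigma>) * \<rho> (x, id)) =
        (\<Prod>p\<in>{1..?w}. \<epsilon> (block_of ws p) (x p)) * char_of ?G N \<rho> (x, ?\<sigma>)" by simp
    qed
    finally show ?thesis using ms(2)[of ?k] k by simp
  qed
  then show ?thesis using ms(1) unfolding K_def by blast
qed

text \<open>\<open>Psi\<close> is linear in \<xi>. The integers stand beside the lists of
  characters, since for empty \<open>ws\<close> there is no factor to absorb them.\<close>

lemma Psi_vchars:
  assumes \<xi>: "\<xi> \<in> vchars (WR (sum_list ws))"
  shows "\<exists>T :: (int \<times> ((nat \<Rightarrow> nat) \<Rightarrow> complex) list) list.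
    (\<forall>t\<in>set T. length (snd t) = length ws \<and> (\<forall>i<length ws. snd t ! i \<in> vchars (sym_group (ws ! i)))) \<and>
    (\<forall>g\<in>young_wr L ws. Psi (sum_list ws) \<epsilon> \<xi> (block_of ws) (snd g) =
      (\<Sum>t\<leftarrow>T. of_int (fst t) * (\<Prod>i<length ws. (snd t ! i) (snd (young_comp L ws i g)))))"
proof -
  let ?w = "sum_list ws" and ?n = "length ws"
  obtain F c where F: "finite F" "F \<subseteq> irr_chars (WR ?w)" "\<xi> = (\<lambda>x. \<Sum>\<chi>\<in>F. of_int (c \<chi>) * \<chi> x)"
    using \<xi> unfolding vchars_def int_span_def by blast
  let ?Q = "\<lambda>\<chi> ms. (\<forall>\<chi>s\<in>set ms. length \<chi>s = ?n \<and> (\<forall>i<?n. \<chi>s ! i \<in> irr_chars (sym_group (ws ! i)))) \<and>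
    (\<forall>g\<in>young_wr L ws. Psi ?w \<epsilon> \<chi> (block_of ws) (snd g) =
      (\<Sum>\<chi>s\<leftarrow>ms. \<Prod>i<?n. (\<chi>s ! i) (snd (young_comp L ws i g))))"
  have "\<exists>ms. ?Q \<chi> ms" if \<chi>: "\<chi> \<in> F" for \<chi>
  proof -
    obtain N \<rho> where "is_irr_rep (WR ?w) N \<rho>" "\<chi> = char_of (WR ?w) N \<rho>"
      using \<chi> F(2) by (auto simp: irr_chars_def)
    then show ?thesis using Psi_rep[of N \<rho>] by (simp add: is_irr_rep_def)
  qed
  then have "\<exists>ms. \<forall>\<chi>\<in>F. ?Q \<chi> (ms \<chi>)" by (intro bchoice ballI)
  then obtain ms where ms: "\<And>\<chi>. \<chi> \<in> F \<Longrightarrow> ?Q \<chi> (ms \<chi>)" by (elim exE) (rule that, erule bspec)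
  obtain xs where xs: "set xs = F" "distinct xs" using finite_distinct_list[OF F(1)] by blast
  define T where "T = concat (map (\<lambda>\<chi>. map (Pair (c \<chi>)) (ms \<chi>)) xs)"
  have 1: "length (snd t) = ?n \<and> (\<forall>i<?n. snd t ! i \<in> vchars (sym_group (ws ! i)))" if t: "t \<in> set T" for t
  proof -
    obtain \<chi> \<chi>s where "\<chi> \<in> F" "\<chi>s \<in> set (ms \<chi>)" "t = (c \<chi>, \<chi>s)" using t xs(1) by (auto simp: T_def)
    then show ?thesis using ms[of \<chi>] by (auto simp: vchars_def intro: int_span_base)
  qed
  have 2: "Psi ?w \<epsilon> \<xi> (block_of ws) (snd g) = (\<Sum>t\<leftarrow>T. of_int (fst t) * (\<Prod>i<?n. (snd t ! i) (snd (young_comp L ws i g))))"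
    if g: "g \<in> young_wr L ws" for g
  proof -
    have "Psi ?w \<epsilon> \<xi> (block_of ws) (snd g) =
      (\<Sum>x\<in>base {1..?w}. \<Sum>\<chi>\<in>F. of_int (c \<chi>) * ((\<Prod>p\<in>{1..?w}. \<epsilon> (block_of ws p) (x p)) * \<chi> (x, snd g)))"
      unfolding Psi_def F(3) by (simp only: sum_distrib_left mult.left_commute)
    also have "\<dots> = (\<Sum>\<chi>\<in>F. of_int (c \<chi>) * Psi ?w \<epsilon> \<chi> (block_of ws) (snd g))"
      unfolding Psi_def sum_distrib_left by (rule sum.swap)
    also have "\<dots> = (\<Sum>\<chi>\<leftarrow>xs. of_int (c \<chi>) * Psi ?w \<epsilon> \<chi> (block_of ws) (snd g))"
      using xs by (simp only: sum_list_distinct_conv_sum_set)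
    also have "\<dots> = (\<Sum>\<chi>\<leftarrow>xs. of_int (c \<chi>) * (\<Sum>\<chi>s\<leftarrow>ms \<chi>. \<Prod>i<?n. (\<chi>s ! i) (snd (young_comp L ws i g))))"
      using ms g xs(1) by (intro arg_cong[where f = sum_list] map_cong refl) simp
    also have "\<dots> = (\<Sum>t\<leftarrow>T. of_int (fst t) * (\<Prod>i<?n. (snd t ! i) (snd (young_comp L ws i g))))"
      unfolding T_def by (induction xs) (simp_all add: sum_list_const_mult comp_def)
    finally show ?thesis .
  qed
  show ?thesis using 1 2 by blast
qed

end

end

section \<open>Rationally closed sublattices\<close>

text \<open>The least positive element divides all others, by division with remainder.\<close>

lemma int_subgroup_generator:
  fixes D :: "int set"
  assumes minus: "\<And>x y. x \<in> D \<Longrightarrow> y \<in> D \<Longrightarrow> x - y \<in> D" and x: "x \<in> D" "x \<noteq> 0"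
  shows "\<exists>d\<in>D. d > 0 \<and> (\<forall>y\<in>D. d dvd y)"
proof -
  have z: "0 \<in> D" using minus[OF x(1) x(1)] by simp
  have neg: "- y \<in> D" if "y \<in> D" for y using minus[OF z that] by simp
  have add: "y + z \<in> D" if "y \<in> D" "z \<in> D" for y z using minus[OF that(1) neg[OF that(2)]] by simp
  have nmult: "int n * y \<in> D" if "y \<in> D" for y n
  proof (induction n)
    case 0
    then show ?case using z by simp
  next
    case (Suc n)
    then show ?case using add[OF that Suc] by (simp add: algebra_simps)
  qed
  have mult: "k * y \<in> D" if y: "y \<in> D" for y k
  proof (cases "k \<ge> 0")
    case True
    then show ?thesis using nmult[OF y, of "nat k"] by simp
  next
    case False
    then show ?thesis using neg[OF nmult[OF y, of "nat (- k)"]] by simp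
  qed
  have "\<bar>x\<bar> \<in> D" using x(1) neg by (simp add: abs_if)
  then have ex: "\<exists>n. n > 0 \<and> int n \<in> D" using x(2) by (intro exI[of _ "nat \<bar>x\<bar>"]) auto
  define n where "n = (LEAST n. n > 0 \<and> int n \<in> D)"
  have n: "n > 0" "int n \<in> D" using LeastI_ex[OF ex] by (auto simp: n_def)
  have "int n dvd y" if y: "y \<in> D" for y
  proof (rule ccontr)
    assume "\<not> int n dvd y"
    then have m: "y mod int n \<noteq> 0" by (simp add: dvd_eq_mod_eq_0)
    have "y mod int n = y - (y div int n) * int n" by (simp add: minus_div_mult_eq_mod)
    then have D: "y mod int n \<in> D" using minus[OF y mult[OF n(2)]] by simp
    have b: "0 \<le> y mod int n" "y mod int n < int n" using n(1) by auto
    have "nat (y mod int n) > 0 \<and> int (nat (y mod int n)) \<in> D" using m b D by auto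
    then have "n \<le> nat (y mod int n)" unfolding n_def by (rule Least_le)
    then show False using b by auto
  qed
  then show ?thesis using n by (intro bexI[of _ "int n"]) auto
qed

text \<open>The rows \<open>P i\<close> are the images of the unit vectors under a projection of the lattice onto \<open>X\<close>.\<close>

lemma pure_sublattice_retract:
  fixes X :: "('i \<Rightarrow> int) set"
  assumes "finite I"
    and supp: "\<And>f i. f \<in> X \<Longrightarrow> i \<notin> I \<Longrightarrow> f i = 0"
    and zero: "(\<lambda>_. 0) \<in> X"
    and add: "\<And>f g. f \<in> X \<Longrightarrow> g \<in> X \<Longrightarrow> (\<lambda>i. f i + g i) \<in> X"
    and neg: "\<And>f. f \<in> X \<Longrightarrow> (\<lambda>i. - f i) \<in> X"
    and pure: "\<And>f n. (\<And>i. i \<notin> I \<Longrightarrow> f i = 0) \<Longrightarrow> n \<noteq> 0 \<Longrightarrow> (\<lambda>i. n * f i) \<in> X \<Longrightarrow> f \<in> X"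
  shows "\<exists>P. (\<forall>i\<in>I. P i \<in> X) \<and> (\<forall>f\<in>X. \<forall>k. f k = (\<Sum>i\<in>I. f i * P i k))"
  using assms
proof (induction I arbitrary: X)
  case empty
  then show ?case by simp
next
  case (insert q J)
  note supp = insert.prems(1) and zero = insert.prems(2) and add = insert.prems(3)
    and neg = insert.prems(4) and pure = insert.prems(5)
  have nmult: "(\<lambda>i. int n * f i) \<in> X" if "f \<in> X" for f n
  proof (induction n)
    case 0
    then show ?case using zero by simp
  next
    case (Suc n)
    then show ?case using add[OF that Suc] by (simp add: algebra_simps)
  qed
  have mult: "(\<lambda>i. k * f i) \<in> X" if f: "f \<in> X" for f k
  proof (cases "k \<ge> 0")
    case True
    then show ?thesis using nmult[OF f, of "nat k"] by simp
  next
    case False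
    then show ?thesis using neg[OF nmult[OF f, of "nat (- k)"]] by simp
  qed
  have comb: "(\<lambda>k. \<Sum>i\<in>A. a i * g i k) \<in> X" if "finite A" "\<And>i. i \<in> A \<Longrightarrow> g i \<in> X" for A a and g :: "'i \<Rightarrow> 'i \<Rightarrow> int"
    using that
  proof (induction A)
    case empty
    then show ?case using zero by simp
  next
    case (insert b A)
    then show ?case using add[OF mult[of "g b" "a b"], of "\<lambda>k. \<Sum>i\<in>A. a i * g i k"] by simp
  qed
  \<comment> \<open>The vectors vanishing at \<open>q\<close> form a pure sublattice supported on
    \<open>J\<close>, to which the induction hypothesis applies.\<close>
  define X0 where "X0 = {f \<in> X. f q = 0}"
  have "\<exists>P. (\<forall>i\<in>J. P i \<in> X0) \<and> (\<forall>f\<in>X0. \<forall>k. f k = (\<Sum>i\<in>J. f i * P i k))"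
  proof (rule insert.IH)
    show "f i = 0" if "f \<in> X0" "i \<notin> J" for f i using that supp[of f i] by (cases "i = q") (auto simp: X0_def)
    show "(\<lambda>_. 0) \<in> X0" using zero by (simp add: X0_def)
    show "(\<lambda>i. f i + g i) \<in> X0" if "f \<in> X0" "g \<in> X0" for f g using add[of f g] that by (simp add: X0_def)
    show "(\<lambda>i. - f i) \<in> X0" if "f \<in> X0" for f using neg[of f] that by (simp add: X0_def)
    show "f \<in> X0" if "\<And>i. i \<notin> J \<Longrightarrow> f i = 0" "n \<noteq> 0" "(\<lambda>i. n * f i) \<in> X0" for f n
      using pure[of f n] that insert.hyps(2) by (simp add: X0_def)
  qed
  then obtain P0 where P0: "\<And>i. i \<in> J \<Longrightarrow> P0 i \<in> X0" "\<And>f k. f \<in> X0 \<Longrightarrow> f k = (\<Sum>i\<in>J. f i * P0 i k)" by blast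
  \<comment> \<open>The retraction onto \<open>X0\<close> given by the induction, extended to
    vectors outside \<open>X0\<close>.\<close>
  define \<pi> where "\<pi> a = (\<lambda>k. \<Sum>i\<in>J. a i * P0 i k)" for a
  have \<pi>X: "\<pi> a \<in> X0" for a
    using comb[of J P0 a] P0(1) insert.hyps(1) by (simp add: \<pi>_def X0_def)
  have \<pi>id: "\<pi> f = f" if "f \<in> X0" for f unfolding \<pi>_def by (rule ext) (rule P0(2)[OF that, symmetric])
  show ?case
  proof (cases "\<forall>f\<in>X. f q = 0")
    case True
    show ?thesis
    proof (intro exI[of _ "\<lambda>i. if i \<in> J then P0 i else (\<lambda>_. 0)"] conjI ballI allI)
      show "(if i \<in> J then P0 i else (\<lambda>_. 0)) \<in> X" for i using P0(1) zero by (simp add: X0_def)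
      fix f k assume f: "f \<in> X"
      then have "f k = (\<Sum>i\<in>J. f i * P0 i k)" using True by (intro P0(2)) (simp add: X0_def)
      also have "\<dots> = (\<Sum>i\<in>insert q J. f i * (if i \<in> J then P0 i else (\<lambda>_. 0)) k)"
        using insert.hyps by simp
      finally show "f k = (\<Sum>i\<in>insert q J. f i * (if i \<in> J then P0 i else (\<lambda>_. 0)) k)" .
    qed
  next
    case False
    then obtain f1 where f1: "f1 \<in> X" "f1 q \<noteq> 0" by blast
    have sub: "x - y \<in> (\<lambda>f. f q) ` X" if xy: "x \<in> (\<lambda>f. f q) ` X" "y \<in> (\<lambda>f. f q) ` X" for x y
    proof -
      obtain f g where "f \<in> X" "g \<in> X" "x = f q" "y = g q" using xy by blast
      then show ?thesis using add[of f "\<lambda>i. - g i"] neg[of g] by (intro image_eqI[of _ _ "\<lambda>i. f i + - g i"]) auto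
    qed
    \<comment> \<open>\<open>d\<close> generates the values at \<open>q\<close>, so
      \<open>X0\<close> and one vector with value \<open>d\<close> at \<open>q\<close> generate
      \<open>X\<close>.\<close>
    obtain d where d': "d \<in> (\<lambda>f. f q) ` X" "d > 0" "\<And>y. y \<in> (\<lambda>f. f q) ` X \<Longrightarrow> d dvd y"
      using int_subgroup_generator[OF sub imageI[OF f1(1)] f1(2)] by blast
    obtain x1 where x1: "x1 \<in> X" "d = x1 q" using d'(1) by blast
    have dvd: "d dvd f q" if "f \<in> X" for f by (rule d'(3)) (use that in blast)
    note d = d'(2) x1 dvd
    \<comment> \<open>Correcting by an element of \<open>X0\<close> keeps the value \<open>d\<close>
      at \<open>q\<close> and achieves \<open>\<pi> x0 = 0\<close>, which separates the two
      summands.\<close>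
    define x0 where "x0 = (\<lambda>k. x1 k + - \<pi> x1 k)"
    have x0: "x0 \<in> X" using add[OF d(2) neg[of "\<pi> x1"]] \<pi>X by (simp add: x0_def X0_def)
    have x0q: "x0 q = d" using \<pi>X[of x1] d(3) by (simp add: x0_def X0_def)
    have \<pi>x0: "\<pi> x0 k = 0" for k
    proof -
      have "\<pi> (\<lambda>k. a k + - b k) m = \<pi> a m - \<pi> b m" for a b m
        by (simp add: \<pi>_def left_diff_distrib sum_subtractf)
      then have "\<pi> x0 k = \<pi> x1 k - \<pi> (\<pi> x1) k" unfolding x0_def .
      then show ?thesis using \<pi>id[OF \<pi>X] by simp
    qed
    let ?I = "insert q J"
    let ?S = "{\<Sum>i\<in>?I. u i * x0 i | u. True}"
    have fI: "finite ?I" using insert.hyps(1) by simp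
    have unit: "x0 i \<in> ?S" if i: "i \<in> ?I" for i
    proof -
      have "(\<Sum>k\<in>?I. (if k = i then 1 else 0) * x0 k) = (\<Sum>k\<in>?I. if k = i then x0 k else 0)"
        by (intro sum.cong) auto
      also have "\<dots> = x0 i" using fI i by (simp only: sum.delta if_True)
      finally show ?thesis by (intro CollectI exI[of _ "\<lambda>k. if k = i then 1 else 0"]) simp
    qed
    have sub2: "x - y \<in> ?S" if xy: "x \<in> ?S" "y \<in> ?S" for x y
    proof -
      obtain u v where "x = (\<Sum>i\<in>?I. u i * x0 i)" "y = (\<Sum>i\<in>?I. v i * x0 i)" using xy by blast
      then have "x - y = (\<Sum>i\<in>?I. (u i - v i) * x0 i)" by (simp only: left_diff_distrib sum_subtractf)
      then show ?thesis by (intro CollectI exI[of _ "\<lambda>i. u i - v i"]) simp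
    qed
    have dS: "d \<in> ?S" using unit[of q] x0q by simp
    have d0: "d \<noteq> 0" using d(1) by simp
    \<comment> \<open>\<open>c\<close> is the greatest common divisor of the entries of
      \<open>x0\<close>. By purity \<open>x0\<close> divided by \<open>c\<close> lies in
      \<open>X\<close>, so its value at \<open>q\<close> is again a multiple of \<open>d\<close>;
      this forces \<open>c = 1\<close>.\<close>
    obtain c where c: "c \<in> ?S" "c > 0" "\<And>y. y \<in> ?S \<Longrightarrow> c dvd y"
      using int_subgroup_generator[OF sub2 dS d0] by blast
    have cx: "c * (x0 i div c) = x0 i" for i
    proof (cases "i \<in> ?I")
      case True
      then show ?thesis using c(3)[OF unit[OF True]] by simp
    next
      case False
      then show ?thesis using supp[OF x0 False] by simp
    qed
    have "(\<lambda>i. x0 i div c) \<in> X"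
    proof (rule pure[of _ c])
      show "x0 i div c = 0" if "i \<notin> insert q J" for i using supp[OF x0 that] by simp
      show "c \<noteq> 0" using c(2) by simp
      show "(\<lambda>i. c * (x0 i div c)) \<in> X" unfolding cx by (rule x0)
    qed
    define e where "e = d div c"
    from \<open>(\<lambda>i. x0 i div c) \<in> X\<close> have de: "d dvd e" using d(4) x0q by (fastforce simp: e_def)
    have dce: "d = c * e" using cx[of q] x0q by (simp add: e_def)
    then have e0: "e > 0" using c(2) d(1) by (simp add: zero_less_mult_iff)
    then have "d \<le> e" using de by (intro zdvd_imp_le)
    have "c = 1"
    proof (rule ccontr)
      assume "c \<noteq> 1"
      then have "2 \<le> c" using c(2) by simp
      then have "2 * e \<le> c * e" using e0 by (intro mult_right_mono) auto
      then show False using \<open>d \<le> e\<close> dce e0 by simp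
    qed
    then obtain u where u: "(\<Sum>i\<in>?I. u i * x0 i) = 1" using c(1) by auto
    define P1 where "P1 i = (if i \<in> J then P0 i else (\<lambda>_. 0))" for i
    have \<pi>P1: "\<pi> a k = (\<Sum>i\<in>?I. a i * P1 i k)" for a k
      using insert.hyps by (simp add: \<pi>_def P1_def)
    \<comment> \<open>Coefficients of the functional sending \<open>a\<close> to the pairing of
      \<open>u\<close> with \<open>a - \<pi> a\<close>. On \<open>X\<close> it returns the multiple
      of \<open>x0\<close> contained in \<open>a\<close>, because \<open>u\<close> pairs to 1 with
      \<open>x0\<close>.\<close>
    define lc where "lc i = u i - (\<Sum>m\<in>?I. u m * P1 i m)" for i
    define P where "P i = (\<lambda>k. lc i * x0 k + P1 i k)" for i
    have lam: "(\<Sum>i\<in>?I. a i * lc i) = (\<Sum>m\<in>?I. u m * (a m - \<pi> a m))" for a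
    proof -
      have "(\<Sum>i\<in>?I. a i * lc i) = (\<Sum>i\<in>?I. u i * a i) - (\<Sum>i\<in>?I. \<Sum>m\<in>?I. u m * (a i * P1 i m))"
        unfolding lc_def by (simp only: right_diff_distrib sum_subtractf sum_distrib_left mult.commute mult.left_commute)
      also have "(\<Sum>i\<in>?I. \<Sum>m\<in>?I. u m * (a i * P1 i m)) = (\<Sum>m\<in>?I. u m * \<pi> a m)"
        unfolding \<pi>P1 sum_distrib_left by (rule sum.swap)
      finally show ?thesis by (simp only: right_diff_distrib sum_subtractf)
    qed
    show ?thesis
    proof (intro exI[of _ P] conjI ballI allI)
      fix i
      have "P1 i \<in> X" using P0(1) zero by (simp add: P1_def X0_def)
      then show "P i \<in> X" unfolding P_def by (intro add mult x0)
    next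
      fix f k assume f: "f \<in> X"
      obtain t where t: "f q = d * t" using d(4)[OF f] by blast
      define f0 where "f0 = (\<lambda>i. f i + - (t * x0 i))"
      have f0: "f0 \<in> X0" using add[OF f neg[OF mult[OF x0, of t]]] t x0q by (simp add: f0_def X0_def)
      have fe: "f i = t * x0 i + f0 i" for i by (simp add: f0_def)
      have \<pi>f: "\<pi> f m = f0 m" for m
      proof -
        have "\<pi> f m = t * \<pi> x0 m + \<pi> f0 m"
          unfolding \<pi>_def by (simp only: fe distrib_right sum.distrib sum_distrib_left mult.assoc)
        then show ?thesis using \<pi>x0 \<pi>id[OF f0] by simp
      qed
      have "(\<Sum>i\<in>?I. f i * lc i) = (\<Sum>m\<in>?I. t * (u m * x0 m))"
        unfolding lam \<pi>f by (intro sum.cong refl) (simp add: fe)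
      also have "\<dots> = t" using u by (simp only: sum_distrib_left[symmetric] mult_1_right)
      finally have l: "(\<Sum>i\<in>?I. f i * lc i) = t" .
      have "(\<Sum>i\<in>?I. f i * P i k) = (\<Sum>i\<in>?I. f i * lc i) * x0 k + \<pi> f k"
        unfolding P_def \<pi>P1 by (simp only: distrib_left sum.distrib sum_distrib_right mult.assoc)
      also have "\<dots> = f k" unfolding l \<pi>f by (simp add: fe[of k])
      finally show "f k = (\<Sum>i\<in>?I. f i * P i k)" by (rule sym)
    qed
  qed
qed

section \<open>The main theorem\<close>

lemma induce_conj:
  assumes G: "group G" and fin: "finite (carrier G)"
    and g: "g \<in> carrier G" "g' \<in> carrier G" "h \<in> carrier G"
    and eq: "h \<otimes>\<^bsub>G\<^esub> g = g' \<otimes>\<^bsub>G\<^esub> h"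
  shows "induce G H \<psi> g' = induce G H \<psi> g"
proof -
  interpret group G by fact
  let ?f = "\<lambda>k. if k \<in> H then \<psi> k else 0"
  have "(\<Sum>x\<in>carrier G. ?f (x \<otimes>\<^bsub>G\<^esub> g \<otimes>\<^bsub>G\<^esub> inv\<^bsub>G\<^esub> x)) =
    (\<Sum>x\<in>carrier G. ?f ((x \<otimes>\<^bsub>G\<^esub> h) \<otimes>\<^bsub>G\<^esub> g \<otimes>\<^bsub>G\<^esub> inv\<^bsub>G\<^esub> (x \<otimes>\<^bsub>G\<^esub> h)))"
    by (rule sum.reindex_bij_betw[OF bij_betw_mult_right[OF G fin g(3)],
          of "\<lambda>x. ?f (x \<otimes>\<^bsub>G\<^esub> g \<otimes>\<^bsub>G\<^esub> inv\<^bsub>G\<^esub> x)", symmetric])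
  also have "\<dots> = (\<Sum>x\<in>carrier G. ?f (x \<otimes>\<^bsub>G\<^esub> g' \<otimes>\<^bsub>G\<^esub> inv\<^bsub>G\<^esub> x))"
  proof (rule sum.cong[OF refl])
    fix x assume x: "x \<in> carrier G"
    have "(x \<otimes>\<^bsub>G\<^esub> h) \<otimes>\<^bsub>G\<^esub> g \<otimes>\<^bsub>G\<^esub> inv\<^bsub>G\<^esub> (x \<otimes>\<^bsub>G\<^esub> h) = x \<otimes>\<^bsub>G\<^esub> (h \<otimes>\<^bsub>G\<^esub> g) \<otimes>\<^bsub>G\<^esub> inv\<^bsub>G\<^esub> h \<otimes>\<^bsub>G\<^esub> inv\<^bsub>G\<^esub> x"
      using x g by (simp add: inv_mult_group m_assoc)
    also have "\<dots> = x \<otimes>\<^bsub>G\<^esub> g' \<otimes>\<^bsub>G\<^esub> inv\<^bsub>G\<^esub> x" unfolding eq using x g by (simp add: m_assoc)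
    finally show "?f ((x \<otimes>\<^bsub>G\<^esub> h) \<otimes>\<^bsub>G\<^esub> g \<otimes>\<^bsub>G\<^esub> inv\<^bsub>G\<^esub> (x \<otimes>\<^bsub>G\<^esub> h)) = ?f (x \<otimes>\<^bsub>G\<^esub> g' \<otimes>\<^bsub>G\<^esub> inv\<^bsub>G\<^esub> x)" by simp
  qed
  finally show ?thesis using g by (simp add: induce_def)
qed

lemma induce_linear:
  "induce G H (\<lambda>g. a * \<psi> g + \<psi>' g) g = a * induce G H \<psi> g + induce G H \<psi>' g"
proof -
  have eq: "(\<Sum>x\<in>carrier G. if x \<otimes>\<^bsub>G\<^esub> g \<otimes>\<^bsub>G\<^esub> inv\<^bsub>G\<^esub> x \<in> H
        then a * \<psi> (x \<otimes>\<^bsub>G\<^esub> g \<otimes>\<^bsub>G\<^esub> inv\<^bsub>G\<^esub> x) + \<psi>' (x \<otimes>\<^bsub>G\<^esub> g \<otimes>\<^bsub>G\<^esub> inv\<^bsub>G\<^esub> x) else 0) =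
    a * (\<Sum>x\<in>carrier G. if x \<otimes>\<^bsub>G\<^esub> g \<otimes>\<^bsub>G\<^esub> inv\<^bsub>G\<^esub> x \<in> H then \<psi> (x \<otimes>\<^bsub>G\<^esub> g \<otimes>\<^bsub>G\<^esub> inv\<^bsub>G\<^esub> x) else 0) +
    (\<Sum>x\<in>carrier G. if x \<otimes>\<^bsub>G\<^esub> g \<otimes>\<^bsub>G\<^esub> inv\<^bsub>G\<^esub> x \<in> H then \<psi>' (x \<otimes>\<^bsub>G\<^esub> g \<otimes>\<^bsub>G\<^esub> inv\<^bsub>G\<^esub> x) else 0)"
    unfolding sum_distrib_left sum.distrib[symmetric] by (intro sum.cong refl) simp
  show ?thesis unfolding induce_def eq by (simp add: distrib_left mult.left_commute)
qed

lemma induce_sum_list: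
  "induce G H (\<lambda>g. \<Sum>t\<leftarrow>T. u t * \<psi> t g) g = (\<Sum>t\<leftarrow>T. u t * induce G H (\<psi> t) g)"
proof (induction T)
  case Nil
  show ?case by (simp add: induce_def)
next
  case (Cons t T)
  then show ?case by (simp add: induce_linear)
qed

lemma induce_cong:
  "(\<And>g. g \<in> H \<Longrightarrow> \<psi> g = \<psi>' g) \<Longrightarrow> induce G H \<psi> = induce G H \<psi>'"
  unfolding induce_def by (intro ext if_cong refl arg_cong2[where f = "(*)"] sum.cong) simp

context finite_group
begin

definition zeta_fun :: "(nat \<Rightarrow> 'a \<Rightarrow> complex) \<Rightarrow> nat list \<Rightarrow> ((nat \<Rightarrow> nat) \<Rightarrow> complex) list \<Rightarrow> 'a wr \<Rightarrow> complex" where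
  "zeta_fun \<phi> ws \<chi>s = zeta L (map (\<lambda>i. (\<phi> i, ws ! i, \<chi>s ! i)) [0..<length ws])"

lemma zeta_fun_eq:
  "zeta_fun \<phi> ws \<chi>s = induce (WR (sum_list ws)) (young_wr L ws)
    (\<lambda>g. (\<Prod>i<length ws. tilde_pow L (\<phi> i) (ws ! i) (young_comp L ws i g)) *
         (\<Prod>i<length ws. (\<chi>s ! i) (snd (young_comp L ws i g))))"
proof -
  have ws: "map (\<lambda>(\<phi>, m, \<chi>). m) (map (\<lambda>i. (\<phi> i, ws ! i, \<chi>s ! i)) [0..<length ws]) = ws"
    by (rule nth_equalityI) auto
  have inf: "inflate \<chi> g = \<chi> (snd g)" for \<chi> and g :: "'a wr" by (cases g) (simp add: inflate_def)
  have eq: "(\<Prod>i<length ws. case map (\<lambda>i. (\<phi> i, ws ! i, \<chi>s ! i)) [0..<length ws] ! i of (\<phi>, m, \<chi>) \<Rightarrow>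
      tilde_pow L \<phi> m (young_comp L ws i g) * inflate \<chi> (young_comp L ws i g)) =
    (\<Prod>i<length ws. tilde_pow L (\<phi> i) (ws ! i) (young_comp L ws i g)) *
         (\<Prod>i<length ws. (\<chi>s ! i) (snd (young_comp L ws i g)))" for g
    unfolding prod.distrib[symmetric] by (intro prod.cong refl) (simp add: inf)
  show ?thesis unfolding zeta_fun_def zeta_def Let_def
    by (simp only: ws length_map length_upt minus_nat.diff_0 eq)
qed

text \<open>All summands share the tilde powers, so linearity in the symmetric group factors
  assembles \<open>Psi\<close> inside the induced function. Orbit product and \<open>Psi\<close> are
  then carried along \<open>h\<close> from the standard colouring to
  \<open>coloring_of ws h\<close>, as \<open>induce_colorings\<close> requires.\<close>

lemma zeta_fun_sum_colorings:
  assumes \<phi>: "\<And>i. i < length ws \<Longrightarrow> class_fun (\<phi> i)"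
    and \<xi>: "\<And>g g' h. g \<in> carrier (WR (sum_list ws)) \<Longrightarrow> g' \<in> carrier (WR (sum_list ws)) \<Longrightarrow>
      h \<in> carrier (WR (sum_list ws)) \<Longrightarrow> h \<otimes>\<^bsub>WR (sum_list ws)\<^esub> g = g' \<otimes>\<^bsub>WR (sum_list ws)\<^esub> h \<Longrightarrow> \<xi> g' = \<xi> g"
    and T: "\<And>g. g \<in> young_wr L ws \<Longrightarrow> Psi (sum_list ws) \<epsilon> \<xi> (block_of ws) (snd g) =
      (\<Sum>t\<leftarrow>T. of_int (fst t) * (\<Prod>i<length ws. (snd t ! i) (snd (young_comp L ws i g))))"
    and g: "g \<in> carrier (WR (sum_list ws))"
  shows "(\<Sum>t\<leftarrow>T. of_int (fst t) * zeta_fun \<phi> ws (snd t) g) =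
    (\<Sum>c | c \<in> colorings (sum_list ws) (length ws) \<and> ctype (sum_list ws) (length ws) c = ws \<and>
        (\<forall>p\<in>{1..sum_list ws}. c (snd g p) = c p).
      orbit_prod (sum_list ws) (snd g) (\<lambda>p. \<phi> (c p) (cyc_val (sum_list ws) g p)) * Psi (sum_list ws) \<epsilon> \<xi> c (snd g))"
proof -
  let ?w = "sum_list ws" and ?n = "length ws"
  let ?G = "carrier (WR ?w)"
  let ?A = "\<lambda>g. \<Prod>i<?n. tilde_pow L (\<phi> i) (ws ! i) (young_comp L ws i g)"
  let ?B = "\<lambda>t g. \<Prod>i<?n. (snd t ! i) (snd (young_comp L ws i g))"
  have "(\<Sum>t\<leftarrow>T. of_int (fst t) * zeta_fun \<phi> ws (snd t) g) =
    induce (WR ?w) (young_wr L ws) (\<lambda>g. \<Sum>t\<leftarrow>T. of_int (fst t) * (?A g * ?B t g)) g"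
    unfolding zeta_fun_eq by (rule induce_sum_list[symmetric])
  also have "induce (WR ?w) (young_wr L ws) (\<lambda>g. \<Sum>t\<leftarrow>T. of_int (fst t) * (?A g * ?B t g)) =
    induce (WR ?w) (young_wr L ws) (\<lambda>g. ?A g * Psi ?w \<epsilon> \<xi> (block_of ws) (snd g))"
  proof (rule induce_cong)
    fix g assume g: "g \<in> young_wr L ws"
    have "(\<Sum>t\<leftarrow>T. of_int (fst t) * (?A g * ?B t g)) = ?A g * (\<Sum>t\<leftarrow>T. of_int (fst t) * ?B t g)"
      unfolding sum_list_const_mult[symmetric] by (simp only: mult.left_commute)
    then show "(\<Sum>t\<leftarrow>T. of_int (fst t) * (?A g * ?B t g)) = ?A g * Psi ?w \<epsilon> \<xi> (block_of ws) (snd g)"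
      unfolding T[OF g] .
  qed
  also have "induce (WR ?w) (young_wr L ws) (\<lambda>g. ?A g * Psi ?w \<epsilon> \<xi> (block_of ws) (snd g)) g =
    (\<Sum>c | c \<in> colorings ?w ?n \<and> ctype ?w ?n c = ws \<and> (\<forall>p\<in>{1..?w}. c (snd g p) = c p).
      orbit_prod ?w (snd g) (\<lambda>p. \<phi> (c p) (cyc_val ?w g p)) * Psi ?w \<epsilon> \<xi> c (snd g))"
  proof (rule induce_colorings[OF g])
    fix h g' assume h: "h \<in> ?G" and g': "g' \<in> young_wr L ws" and eq: "h \<otimes>\<^bsub>WR ?w\<^esub> g = g' \<otimes>\<^bsub>WR ?w\<^esub> h"
    have g'c: "g' \<in> ?G" and g'block_of: "\<And>p. p \<in> {1..?w} \<Longrightarrow> block_of ws (snd g' p) = block_of ws p"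
      using g' unfolding young_wr_iff by blast+
    note \<pi> = snd_permutes[OF h] and \<sigma> = snd_permutes[OF g] and \<sigma>' = snd_permutes[OF g'c]
    have conj: "snd g' \<circ> snd h = snd h \<circ> snd g" by (rule cyc_val_conj(2)[OF g g'c h eq])
    have him: "snd h p \<in> {1..?w}" if "p \<in> {1..?w}" for p using that permutes_in_image[OF \<pi>] by blast
    have cc: "coloring_of ws h p = block_of ws (snd h p)" if "p \<in> {1..?w}" for p
      unfolding coloring_of_def restrict_apply if_P[OF that] ..
    have "?A g' = orbit_prod ?w (snd g') (\<lambda>p. \<phi> (block_of ws p) (cyc_val ?w g' p))"
      by (rule prod_tilde_pow_young[OF \<phi> g'])
    also have "\<dots> = orbit_prod ?w (snd g) (\<lambda>p. \<phi> (block_of ws (snd h p)) (cyc_val ?w g' (snd h p)))"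
    proof (rule orbit_prod_conj[OF \<sigma> \<sigma>' \<pi> conj])
      fix p assume p: "p \<in> {1..?w}"
      show "\<phi> (block_of ws (snd g' p)) (cyc_val ?w g' (snd g' p)) = \<phi> (block_of ws p) (cyc_val ?w g' p)"
        unfolding g'block_of[OF p] by (rule class_fun_cyc_val_step[OF \<phi>[OF block_of_mem(1)[OF p]] g'c])
    qed
    also have "\<dots> = orbit_prod ?w (snd g) (\<lambda>p. \<phi> (coloring_of ws h p) (cyc_val ?w g p))"
    proof (rule orbit_prod_cong[OF \<sigma>])
      fix p assume p: "p \<in> {1..?w}"
      show "\<phi> (block_of ws (snd h p)) (cyc_val ?w g' (snd h p)) = \<phi> (coloring_of ws h p) (cyc_val ?w g p)"
        unfolding cc[OF p] by (rule class_fun_cyc_val_conj[OF \<phi>[OF block_of_mem(1)[OF him[OF p]]] g g'c h eq])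
    qed
    finally have 1: "?A g' = orbit_prod ?w (snd g) (\<lambda>p. \<phi> (coloring_of ws h p) (cyc_val ?w g p))" .
    have "Psi ?w \<epsilon> \<xi> (block_of ws) (snd g') = Psi ?w \<epsilon> \<xi> (\<lambda>p. block_of ws (snd h p)) (snd g)"
      by (rule Psi_conj[OF \<xi> \<pi> \<sigma> \<sigma>' conj])
    also have "\<dots> = Psi ?w \<epsilon> \<xi> (coloring_of ws h) (snd g)" by (rule Psi_cong) (rule cc[symmetric])
    finally show "?A g' * Psi ?w \<epsilon> \<xi> (block_of ws) (snd g') =
      orbit_prod ?w (snd g) (\<lambda>p. \<phi> (coloring_of ws h p) (cyc_val ?w g p)) * Psi ?w \<epsilon> \<xi> (coloring_of ws h) (snd g)"
      unfolding 1 by simp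
  qed
  finally show ?thesis .
qed

text \<open>Invariant colourings are functions on the set of cycles, and each term is a product over
  the cycles. The sum over colourings therefore becomes a product of sums over colours, one for each
  cycle, and \<open>expand\<close> identifies each of these with a tensor factor of \<xi>.\<close>

lemma coloring_sum_canonical:
  fixes \<phi>' :: "'k \<Rightarrow> nat \<Rightarrow> 'a \<Rightarrow> complex"
  assumes md: "marked_decomp w cs" and zs: "length zs = length cs" "set zs \<subseteq> carrier L"
    and g: "g = wr_prod L w (map2 (ycyc L) cs zs)"
    and conv: "\<And>i a. i < n \<Longrightarrow> a \<in> carrier L \<Longrightarrow> (\<Sum>b\<in>carrier L. \<epsilon> i b * \<epsilon> i (inv b \<otimes> a)) = \<epsilon> i a"
    and \<xi>: "\<And>x. x \<in> base {1..w} \<Longrightarrow> \<xi> (x, snd g) =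
      (\<Sum>k\<in>K. u k * (\<Prod>j<length cs. \<phi>' k j (cyc_val w (x, snd g) (Min (set (cs ! j))))))"
    and expand: "\<And>k j a. k \<in> K \<Longrightarrow> j < length cs \<Longrightarrow> a \<in> carrier L \<Longrightarrow>
      \<phi>' k j a = (\<Sum>i<n. (\<Sum>b\<in>carrier L. \<epsilon> i b * \<phi>' k j b) * \<phi> i a)"
  shows "(\<Sum>c | c \<in> colorings w n \<and> (\<forall>p\<in>{1..w}. c (snd g p) = c p).
      orbit_prod w (snd g) (\<lambda>p. \<phi> (c p) (cyc_val w g p)) * Psi w \<epsilon> \<xi> c (snd g)) = \<xi> g"
proof -
  let ?r = "length cs" and ?\<sigma> = "snd g"
  note wp = wr_prod_marked[OF md zs, folded g]
  have dj: "dj_cycles cs" and U: "(\<Union>c\<in>set cs. set c) = {1..w}" using md by (auto simp: marked_decomp_dj)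
  note \<sigma> = snd_permutes[OF wp(1)]
  have perm: "permutation ?\<sigma>" using \<sigma> permutation_permutes by blast
  note ac = acts_cycle[OF wp(3) dj]
  define m where "m j = Min (set (cs ! j))" for j
  have m: "m j \<in> set (cs ! j)" if "j < ?r" for j unfolding m_def by (rule Min_cycle_in[OF ac(1)[OF that]])
  have sub: "set (cs ! j) \<subseteq> {1..w}" if "j < ?r" for j using U that nth_mem by blast
  define jj where "jj p = (THE j. j < ?r \<and> p \<in> set (cs ! j))" for p
  have jj: "jj p = j" if "j < ?r" "p \<in> set (cs ! j)" for j p
    unfolding jj_def using that dj_cycles_disjoint[OF dj] by (intro the_equality) blast+
  have jjm: "jj p < ?r \<and> p \<in> set (cs ! (jj p))" if p: "p \<in> {1..w}" for p
  proof -
    obtain c where "c \<in> set cs" "p \<in> set c" using p U by blast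
    then obtain j where "j < ?r" "p \<in> set (cs ! j)" by (metis in_set_conv_nth)
    then show ?thesis using jj by simp
  qed
  have orb: "orb ?\<sigma> (m j) = set (cs ! j)" if "j < ?r" for j by (rule cycle_orb[OF perm ac[OF that] m[OF that]])
  have \<sigma>j: "?\<sigma> p \<in> set (cs ! j)" if "j < ?r" "p \<in> set (cs ! j)" for j p
  proof -
    have "?\<sigma> p \<in> orb ?\<sigma> p" unfolding orb_def by (rule range_eqI[of _ _ 1]) simp
    then show ?thesis using cycle_orb[OF perm ac[OF that(1)] that(2)] by simp
  qed
  let ?C = "{c. c \<in> colorings w n \<and> (\<forall>p\<in>{1..w}. c (?\<sigma> p) = c p)}"
  let ?F = "{..<?r} \<rightarrow>\<^sub>E {..<n}"
  let ?c = "\<lambda>f. \<lambda>p\<in>{1..w}. f (jj p)"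
  have \<sigma>w: "?\<sigma> p \<in> {1..w}" if "p \<in> {1..w}" for p using that permutes_in_image[OF \<sigma>] by blast
  \<comment> \<open>An invariant colouring is constant on cycles, so its values at the least points
    determine it.\<close>
  have bij: "bij_betw ?c ?F ?C"
  proof (rule bij_betw_byWitness[where f' = "\<lambda>c. \<lambda>j\<in>{..<?r}. c (m j)"])
    show "\<forall>f\<in>?F. (\<lambda>j\<in>{..<?r}. ?c f (m j)) = f"
    proof
      fix f assume f: "f \<in> ?F"
      show "(\<lambda>j\<in>{..<?r}. ?c f (m j)) = f"
      proof
        fix j
        show "(\<lambda>j\<in>{..<?r}. ?c f (m j)) j = f j"
        proof (cases "j < ?r")
          case True
          have mw: "m j \<in> {1..w}" using m[OF True] sub[OF True] by blast
          have "?c f (m j) = f (jj (m j))" unfolding restrict_apply if_P[OF mw] ..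
          then show ?thesis using True jj[OF True m[OF True]] by simp
        next
          case False
          then show ?thesis using f by (simp add: PiE_arb[OF f])
        qed
      qed
    qed
    show "\<forall>c\<in>?C. ?c (\<lambda>j\<in>{..<?r}. c (m j)) = c"
    proof
      fix c assume c: "c \<in> ?C"
      show "?c (\<lambda>j\<in>{..<?r}. c (m j)) = c"
      proof
        fix p
        show "?c (\<lambda>j\<in>{..<?r}. c (m j)) p = c p"
        proof (cases "p \<in> {1..w}")
          case True
          note j = jjm[OF True]
          have mw: "m (jj p) \<in> {1..w}" using m[of "jj p"] sub[of "jj p"] j by blast
          have "c p = c (m (jj p))"
          proof (rule const_on_orb[where v = c and S = "{1..w}" and p = "m (jj p)", OF \<sigma> _ mw])
            show "c (?\<sigma> q) = c q" if "q \<in> {1..w}" for q using c that by blast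
            show "p \<in> orb ?\<sigma> (m (jj p))" using orb[of "jj p"] j by blast
          qed
          then show ?thesis unfolding restrict_apply if_P[OF True] using j by simp
        next
          case False
          have "c p = undefined" using c False unfolding colorings_def by (intro PiE_arb[of c "{1..w}" "\<lambda>_. {..<n}"]) auto
          then show ?thesis unfolding restrict_apply if_not_P[OF False] by simp
        qed
      qed
    qed
    show "?c ` ?F \<subseteq> ?C"
    proof
      fix c assume "c \<in> ?c ` ?F"
      then obtain f where f: "f \<in> ?F" "c = ?c f" by blast
      have "f (jj p) \<in> {..<n}" if "p \<in> {1..w}" for p using f(1) jjm[OF that] by (intro PiE_mem[OF f(1)]) simp
      then have "c \<in> colorings w n" unfolding f(2) colorings_def by (rule restrict_PiE_iff[THEN iffD2, OF ballI])
      moreover have "c (?\<sigma> p) = c p" if p: "p \<in> {1..w}" for p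
      proof -
        have "jj (?\<sigma> p) = jj p" using jjm[OF p] \<sigma>j by (intro jj) auto
        then show ?thesis unfolding f(2) restrict_apply if_P[OF p] if_P[OF \<sigma>w[OF p]] by simp
      qed
      ultimately show "c \<in> ?C" by blast
    qed
    show "(\<lambda>c. \<lambda>j\<in>{..<?r}. c (m j)) ` ?C \<subseteq> ?F"
    proof
      fix f assume "f \<in> (\<lambda>c. \<lambda>j\<in>{..<?r}. c (m j)) ` ?C"
      then obtain c where c: "c \<in> colorings w n" "f = (\<lambda>j\<in>{..<?r}. c (m j))" by blast
      have "c (m j) \<in> {..<n}" if "j \<in> {..<?r}" for j
      proof (rule PiE_mem[of c "{1..w}" "\<lambda>_. {..<n}"])
        show "c \<in> {1..w} \<rightarrow>\<^sub>E {..<n}" using c(1) by (simp only: colorings_def)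
        show "m j \<in> {1..w}" using m[of j] sub[of j] that by blast
      qed
      then show "f \<in> ?F" unfolding c(2) by (rule restrict_PiE_iff[THEN iffD2, OF ballI])
    qed
  qed
  define b where "b k j i = (\<Sum>a\<in>carrier L. \<epsilon> i a * \<phi>' k j a)" for k j i
  have term_eq: "orbit_prod w ?\<sigma> (\<lambda>p. \<phi> (?c f p) (cyc_val w g p)) * Psi w \<epsilon> \<xi> (?c f) ?\<sigma> =
    (\<Sum>k\<in>K. u k * (\<Prod>j<?r. \<phi> (f j) (zs ! j) * b k j (f j)))" if f: "f \<in> ?F" for f
  proof -
    have fn: "f j < n" if "j < ?r" for j using PiE_mem[OF f, of j] that by simp
    have cf: "?c f p = f j" if j: "j < ?r" "p \<in> set (cs ! j)" for j p
    proof -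
      have "p \<in> {1..w}" using sub[OF j(1)] j(2) by blast
      then show ?thesis using jj[OF j] by (simp only: restrict_apply if_True)
    qed
    have "orbit_prod w ?\<sigma> (\<lambda>p. \<phi> (?c f p) (cyc_val w g p)) = (\<Prod>j<?r. \<phi> (?c f (m j)) (cyc_val w g (m j)))"
      unfolding m_def by (rule orbit_prod_cycles[OF md wp(3) \<sigma>])
    also have "\<dots> = (\<Prod>j<?r. \<phi> (f j) (zs ! j))"
    proof (rule prod.cong[OF refl])
      fix j assume "j \<in> {..<?r}"
      then have j: "j < ?r" by simp
      show "\<phi> (?c f (m j)) (cyc_val w g (m j)) = \<phi> (f j) (zs ! j)"
        unfolding cf[OF j m[OF j]] unfolding m_def wp(6)[OF j] ..
    qed
    finally have 1: "orbit_prod w ?\<sigma> (\<lambda>p. \<phi> (?c f p) (cyc_val w g p)) = (\<Prod>j<?r. \<phi> (f j) (zs ! j))" .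
    have "Psi w \<epsilon> \<xi> (?c f) ?\<sigma> = (\<Sum>k\<in>K. u k * (\<Prod>j<?r. b k j (f j)))"
      unfolding b_def by (rule Psi_tensor[where f = f and \<epsilon> = \<epsilon> and c = "?c f" and \<phi> = \<phi>' and \<xi> = \<xi> and K = K and u = u,
            OF md wp(3) \<sigma> conv[OF fn] cf \<xi>])
    then show ?thesis unfolding 1
      by (simp only: sum_distrib_left prod.distrib mult.left_commute)
  qed
  have "(\<Sum>c\<in>?C. orbit_prod w ?\<sigma> (\<lambda>p. \<phi> (c p) (cyc_val w g p)) * Psi w \<epsilon> \<xi> c ?\<sigma>) =
    (\<Sum>f\<in>?F. orbit_prod w ?\<sigma> (\<lambda>p. \<phi> (?c f p) (cyc_val w g p)) * Psi w \<epsilon> \<xi> (?c f) ?\<sigma>)"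
    by (rule sum.reindex_bij_betw[OF bij,
          of "\<lambda>c. orbit_prod w ?\<sigma> (\<lambda>p. \<phi> (c p) (cyc_val w g p)) * Psi w \<epsilon> \<xi> c ?\<sigma>", symmetric])
  also have "\<dots> = (\<Sum>f\<in>?F. \<Sum>k\<in>K. u k * (\<Prod>j<?r. \<phi> (f j) (zs ! j) * b k j (f j)))"
    by (rule sum.cong[OF refl term_eq])
  also have "\<dots> = (\<Sum>k\<in>K. \<Sum>f\<in>?F. u k * (\<Prod>j<?r. \<phi> (f j) (zs ! j) * b k j (f j)))"
    by (rule sum.swap)
  also have "\<dots> = (\<Sum>k\<in>K. u k * (\<Prod>j<?r. \<phi>' k j (zs ! j)))"
  proof (rule sum.cong[OF refl])
    fix k assume k: "k \<in> K"
    \<comment> \<open>Choosing a colour for every cycle and multiplying is the expansion of a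
      product of sums.\<close>
    have "(\<Sum>f\<in>?F. \<Prod>j<?r. \<phi> (f j) (zs ! j) * b k j (f j)) =
      (\<Prod>j<?r. \<Sum>i<n. \<phi> i (zs ! j) * b k j i)"
      by (rule prod_sum_PiE[symmetric]) auto
    also have "\<dots> = (\<Prod>j<?r. \<phi>' k j (zs ! j))"
    proof (rule prod.cong[OF refl])
      fix j assume "j \<in> {..<?r}"
      then have j: "j < ?r" by simp
      have "zs ! j \<in> carrier L" using zs j by (auto simp: subset_iff)
      from expand[OF k j this] show "(\<Sum>i<n. \<phi> i (zs ! j) * b k j i) = \<phi>' k j (zs ! j)"
        by (simp only: b_def mult.commute)
    qed
    finally show "(\<Sum>f\<in>?F. u k * (\<Prod>j<?r. \<phi> (f j) (zs ! j) * b k j (f j))) = u k * (\<Prod>j<?r. \<phi>' k j (zs ! j))"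
      by (simp only: sum_distrib_left[symmetric])
  qed
  also have "\<dots> = \<xi> g"
  proof -
    obtain x \<tau> where gd: "g = (x, \<tau>)" by (cases g)
    have x: "x \<in> base {1..w}" using wp(1) by (simp add: gd wreath_carrier)
    have "\<xi> g = (\<Sum>k\<in>K. u k * (\<Prod>j<?r. \<phi>' k j (cyc_val w g (Min (set (cs ! j))))))"
      using \<xi>[OF x] by (simp add: gd)
    also have "\<dots> = (\<Sum>k\<in>K. u k * (\<Prod>j<?r. \<phi>' k j (zs ! j)))"
      by (intro sum.cong prod.cong refl arg_cong2[where f = "(*)"]) (simp add: wp(6))
    finally show ?thesis by simp
  qed
  finally show ?thesis .
qed

end

theorem theorem4p8:
  fixes L :: "('a, 'b) monoid_scheme" and w :: nat
    and X :: "('a \<Rightarrow> complex) set" and \<xi> :: "'a wr \<Rightarrow> complex"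
  assumes "group L" and "finite (carrier L)"
    and "rat_closed_subgroup (vchars L) X"
    and "\<xi> \<in> vchars (wreath L w)"
    and "\<forall>lam. is_partition w lam \<longrightarrow> in_tensor_pow L X (length lam) (omega L lam \<xi>)"
  shows "\<xi> \<in> wr_span L X w"
proof -
  interpret finite_group L using assms(1,2) by (simp add: finite_group_def finite_group_axioms_def)
  note X = assms(3)[unfolded rat_closed_subgroup_def]
  obtain xs where xs: "set xs = irr_chars L" "distinct xs"
    using finite_distinct_list[OF finite_irr_chars[OF assms(1,2)]] by blast
  define n where "n = length xs"
  have "\<forall>i. \<exists>dR. i < n \<longrightarrow> is_irr_rep L (fst dR) (snd dR) \<and> xs ! i = char_of L (fst dR) (snd dR)"
  proof
    fix i
    show "\<exists>dR. i < n \<longrightarrow> is_irr_rep L (fst dR) (snd dR) \<and> xs ! i = char_of L (fst dR) (snd dR)"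
    proof (cases "i < n")
      case True
      then have "xs ! i \<in> irr_chars L" unfolding xs(1)[symmetric] n_def by simp
      then obtain d R where "is_irr_rep L d R" "xs ! i = char_of L d R" by (auto simp: irr_chars_def)
      then show ?thesis by (intro exI[of _ "(d, R)"]) simp
    qed simp
  qed
  then obtain dR where dR: "\<And>i. i < n \<Longrightarrow> is_irr_rep L (fst (dR i)) (snd (dR i))"
    "\<And>i. i < n \<Longrightarrow> xs ! i = char_of L (fst (dR i)) (snd (dR i))" by metis
  define \<epsilon> where "\<epsilon> i = munit L (fst (dR i)) (snd (dR i)) 0 0" for i
  have pair: "(\<Sum>a\<in>carrier L. \<epsilon> i a * (xs ! j) a) = (if j = i then 1 else 0)" if ij: "i < n" "j < n" for i j
  proof -
    have "xs ! j \<in> irr_chars L" using ij(2) unfolding xs(1)[symmetric] n_def by simp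
    moreover have "fst (dR i) > 0" using dR(1)[OF ij(1)] by (simp add: is_irr_rep_def)
    ultimately have "(\<Sum>a\<in>carrier L. \<epsilon> i a * (xs ! j) a) = (if xs ! j = xs ! i then 1 else 0)"
      unfolding \<epsilon>_def dR(2)[OF ij(1)] by (rule munit_char[OF assms(1,2) dR(1)[OF ij(1)]])
    then show ?thesis using nth_eq_iff_index_eq[OF xs(2)] ij by (simp add: n_def)
  qed
  \<comment> \<open>The virtual character with prescribed coordinates in the basis of irreducible
    characters.\<close>
  define ev where "ev a = (\<lambda>x. \<Sum>i<n. of_int (a i) * (xs ! i) x)" for a :: "nat \<Rightarrow> int"
  have nth_irr: "xs ! i \<in> vchars L" if "i < n" for i
    using that xs(1) nth_mem[of i xs] unfolding vchars_def n_def by (intro int_span_base) blast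
  have ev_vchars: "ev a \<in> vchars L" for a
    unfolding ev_def vchars_def
    using nth_irr by (intro int_span_sum int_span_smult) (auto simp: vchars_def)
  \<comment> \<open>\<open>X\<close> in coordinates, set to zero beyond \<open>n\<close>. Rational
    closure of \<open>X\<close> becomes purity of this lattice.\<close>
  define XI where "XI = {a. (\<forall>i. i \<notin> {..<n} \<longrightarrow> a i = 0) \<and> ev a \<in> X}"
  have "\<exists>P. (\<forall>i\<in>{..<n}. P i \<in> XI) \<and> (\<forall>f\<in>XI. \<forall>k. f k = (\<Sum>i\<in>{..<n}. f i * P i k))"
  proof (rule pure_sublattice_retract)
    show "finite {..<n}" by simp
    show "f i = 0" if "f \<in> XI" "i \<notin> {..<n}" for f i using that by (simp add: XI_def)
    have "ev (\<lambda>_. 0) = (\<lambda>_. 0)" by (simp add: ev_def)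
    then show "(\<lambda>_. 0) \<in> XI" using X by (simp add: XI_def)
    show "(\<lambda>i. f i + g i) \<in> XI" if fg: "f \<in> XI" "g \<in> XI" for f g
    proof -
      have "ev (\<lambda>i. f i + g i) = (\<lambda>x. ev f x + ev g x)" by (simp add: ev_def distrib_right sum.distrib)
      moreover have "(\<lambda>x. ev f x + ev g x) \<in> X" using X fg unfolding XI_def by blast
      ultimately show ?thesis using fg by (simp add: XI_def)
    qed
    show "(\<lambda>i. - f i) \<in> XI" if f: "f \<in> XI" for f
    proof -
      have "ev (\<lambda>i. - f i) = (\<lambda>x. - ev f x)" by (simp add: ev_def sum_negf)
      moreover have "(\<lambda>x. - ev f x) \<in> X" using X f unfolding XI_def by blast
      ultimately show ?thesis using f by (simp add: XI_def)
    qed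
    show "f \<in> XI" if f: "\<And>i. i \<notin> {..<n} \<Longrightarrow> f i = 0" "k \<noteq> 0" "(\<lambda>i. k * f i) \<in> XI" for f k
    proof -
      have "ev (\<lambda>i. k * f i) = (\<lambda>x. of_int k * ev f x)" by (simp add: ev_def sum_distrib_left mult.assoc)
      then have "(\<lambda>x. of_int k * ev f x) \<in> X" using f(3) by (simp add: XI_def)
      then have "ev f \<in> X" using X f(2) ev_vchars[of f] by blast
      then show ?thesis using f(1) by (simp add: XI_def)
    qed
  qed
  then obtain P where P: "\<And>i. i < n \<Longrightarrow> P i \<in> XI" "\<And>f k. f \<in> XI \<Longrightarrow> f k = (\<Sum>i<n. f i * P i k)" by blast
  \<comment> \<open>The image of the irreducible character \<open>xs ! i\<close> under the
    retraction onto \<open>X\<close>.\<close>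
  define \<phi> where "\<phi> i = ev (P i)" for i
  have \<phi>X: "\<phi> i \<in> X" if "i < n" for i using P(1)[OF that] by (simp add: XI_def \<phi>_def)
  have \<phi>cf: "class_fun (\<phi> i)" for i unfolding \<phi>_def by (rule vchars_class_fun[OF ev_vchars])
  \<comment> \<open>Pairing with \<open>\<epsilon> i\<close> gives the coordinates of
    \<open>\<psi>\<close>, and the retraction fixes the elements of \<open>X\<close>.\<close>
  have expand: "\<psi> z = (\<Sum>i<n. (\<Sum>b\<in>carrier L. \<epsilon> i b * \<psi> b) * \<phi> i z)" if \<psi>: "\<psi> \<in> X" for \<psi> z
  proof -
    have "\<psi> \<in> vchars L" using X \<psi> by blast
    then obtain F c where F: "finite F" "F \<subseteq> irr_chars L" "\<psi> = (\<lambda>x. \<Sum>\<chi>\<in>F. of_int (c \<chi>) * \<chi> x)"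
      unfolding vchars_def int_span_def by blast
    define a where "a i = (if i < n \<and> xs ! i \<in> F then c (xs ! i) else 0)" for i
    have \<psi>a: "\<psi> = ev a"
    proof
      fix x
      have "\<psi> x = (\<Sum>\<chi>\<in>set xs. of_int (if \<chi> \<in> F then c \<chi> else 0) * \<chi> x)"
        unfolding F(3) xs(1) using F(1,2) finite_irr_chars[OF assms(1,2)]
        by (intro sum.mono_neutral_cong_left) auto
      also have "\<dots> = (\<Sum>i<n. of_int (if xs ! i \<in> F then c (xs ! i) else 0) * (xs ! i) x)"
        by (rule sum.reindex_bij_betw[OF bij_betw_nth[OF xs(2) _ refl], symmetric]) (simp add: n_def)
      also have "\<dots> = ev a x" unfolding ev_def a_def by (intro sum.cong) auto
      finally show "\<psi> x = ev a x" .
    qed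
    have aXI: "a \<in> XI" using \<psi> \<psi>a by (simp add: XI_def a_def)
    have coef: "(\<Sum>b\<in>carrier L. \<epsilon> i b * \<psi> b) = of_int (a i)" if i: "i < n" for i
    proof -
      have "(\<Sum>b\<in>carrier L. \<epsilon> i b * \<psi> b) = (\<Sum>b\<in>carrier L. \<Sum>j<n. of_int (a j) * (\<epsilon> i b * (xs ! j) b))"
        unfolding \<psi>a ev_def by (simp only: sum_distrib_left mult.left_commute)
      also have "\<dots> = (\<Sum>j<n. of_int (a j) * (\<Sum>b\<in>carrier L. \<epsilon> i b * (xs ! j) b))"
        unfolding sum_distrib_left by (rule sum.swap)
      also have "\<dots> = (\<Sum>j<n. if j = i then of_int (a i) else 0)"
        by (intro sum.cong refl) (simp add: pair[OF i])
      finally show ?thesis using i by simp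
    qed
    have "\<psi> z = (\<Sum>j<n. of_int (\<Sum>i<n. a i * P i j) * (xs ! j) z)"
      unfolding \<psi>a ev_def by (intro sum.cong refl arg_cong2[where f = "(*)"] arg_cong[where f = of_int] P(2)[OF aXI])
    also have "\<dots> = (\<Sum>j<n. \<Sum>i<n. of_int (a i) * (of_int (P i j) * (xs ! j) z))"
      by (simp add: sum_distrib_right mult.assoc)
    also have "\<dots> = (\<Sum>i<n. of_int (a i) * \<phi> i z)"
      unfolding \<phi>_def ev_def sum_distrib_left by (rule sum.swap)
    also have "\<dots> = (\<Sum>i<n. (\<Sum>b\<in>carrier L. \<epsilon> i b * \<psi> b) * \<phi> i z)"
      by (intro sum.cong refl) (simp add: coef)
    finally show ?thesis .
  qed
  have conv: "(\<Sum>b\<in>carrier L. \<epsilon> i b * \<epsilon> i (inv\<^bsub>L\<^esub> b \<otimes>\<^bsub>L\<^esub> a)) = \<epsilon> i a" if "i < n" "a \<in> carrier L" for i a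
  proof -
    have "fst (dR i) > 0" using dR(1)[OF that(1)] by (simp add: is_irr_rep_def)
    then show ?thesis
      using munit_conv[OF assms(1,2) dR(1)[OF that(1)] that(2), of 0 0 0 0] by (simp add: \<epsilon>_def)
  qed
  note \<xi>conj = vchars_conj[OF wreath_group[of w] assms(4)]
  \<comment> \<open>Types that occur among the colourings; as an image of a finite set,
    \<open>S\<close> is finite.\<close>
  define S where "S = ctype w n ` colorings w n"
  have finS: "finite S" by (simp add: S_def finite_colorings)
  have S: "length ws = n" "sum_list ws = w" if "ws \<in> S" for ws using that ctype_sum by (auto simp: S_def)
  let ?Q = "\<lambda>ws (T :: (int \<times> ((nat \<Rightarrow> nat) \<Rightarrow> complex) list) list).
    (\<forall>t\<in>set T. length (snd t) = length ws \<and> (\<forall>i<length ws. snd t ! i \<in> vchars (sym_group (ws ! i)))) \<and>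
    (\<forall>g\<in>young_wr L ws. Psi (sum_list ws) \<epsilon> \<xi> (block_of ws) (snd g) =
      (\<Sum>t\<leftarrow>T. of_int (fst t) * (\<Prod>i<length ws. (snd t ! i) (snd (young_comp L ws i g)))))"
  have "\<exists>T. ?Q ws T" if ws: "ws \<in> S" for ws
    by (rule Psi_vchars[where d = "\<lambda>i. fst (dR i)" and R = "\<lambda>i. snd (dR i)"])
      (use dR(1) S[OF ws] assms(4) in \<open>simp_all add: \<epsilon>_def\<close>)
  then have "\<exists>T. \<forall>ws\<in>S. ?Q ws (T ws)" by (intro bchoice ballI)
  then obtain T where T: "\<And>ws. ws \<in> S \<Longrightarrow> ?Q ws (T ws)" by (elim exE) (rule that, erule bspec)
  \<comment> \<open>The explicit member of the span that will turn out to be \<xi>: for each type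
    the integers and symmetric group characters come from \<open>Psi\<close>, the functions on
    \<open>L\<close> from the retraction.\<close>
  define \<eta> where "\<eta> g = (\<Sum>ws\<in>S. \<Sum>t\<leftarrow>T ws. of_int (fst t) * zeta_fun \<phi> ws (snd t) g)" for g
  have "\<eta> \<in> wr_span L X w"
    unfolding \<eta>_def[abs_def] wr_span_def
  proof (intro int_span_sum finS int_span_sum_list int_span_smult int_span_base CollectI)
    fix ws t assume ws: "ws \<in> S" and t: "t \<in> set (T ws)"
    let ?\<Theta> = "map (\<lambda>i. (\<phi> i, ws ! i, snd t ! i)) [0..<length ws]"
    have m: "map (\<lambda>(\<phi>, m, \<chi>). m) ?\<Theta> = ws" by (rule nth_equalityI) auto
    have mem: "\<forall>(\<phi>, m, \<chi>)\<in>set ?\<Theta>. \<phi> \<in> X \<and> \<chi> \<in> vchars (sym_group m)"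
      using \<phi>X S(1)[OF ws] T[OF ws] t by auto
    show "\<exists>\<Theta>. zeta_fun \<phi> ws (snd t) = zeta L \<Theta> \<and> sum_list (map (\<lambda>(\<phi>, m, \<chi>). m) \<Theta>) = w \<and>
        (\<forall>(\<phi>, m, \<chi>)\<in>set \<Theta>. \<phi> \<in> X \<and> \<chi> \<in> vchars (sym_group m))"
      by (rule exI[of _ ?\<Theta>]) (use m mem S(2)[OF ws] in \<open>simp only: zeta_fun_def simp_thms\<close>)
  qed
  moreover have "\<xi> = \<eta>"
  proof
    fix g
    show "\<xi> g = \<eta> g"
    proof (cases "g \<in> carrier (WR w)")
      case False
      \<comment> \<open>Virtual characters and induced functions are both extended by zero off the
        group.\<close>
      have "zeta_fun \<phi> ws \<chi>s g = 0" if "ws \<in> S" for ws \<chi>s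
        using False S(2)[OF that] by (simp add: zeta_fun_eq induce_def)
      then have "\<eta> g = 0" unfolding \<eta>_def by (intro sum.neutral ballI) simp
      then show ?thesis using vchars_outside[OF assms(4) False] by simp
    next
      case True
      \<comment> \<open>Both sides are class functions, so they need comparing only at the canonical
        product \<open>g0\<close> in the class of \<open>g\<close>.\<close>
      obtain lam zs h where lam: "is_partition w lam" "length zs = length lam" "set zs \<subseteq> carrier L"
        and h: "h \<in> carrier (WR w)"
        and hg: "h \<otimes>\<^bsub>WR w\<^esub> g = wr_prod L w (map2 (ycyc L) (canon_cycles lam) zs) \<otimes>\<^bsub>WR w\<^esub> h"
        by (rule conj_canonical[OF True])
      let ?cs = "canon_cycles lam"
      define g0 where "g0 = wr_prod L w (map2 (ycyc L) ?cs zs)"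
      have sl: "sum_list lam = w" using lam(1) by (simp add: is_partition_def)
      have md: "marked_decomp w ?cs" using canon_marked_decomp[of lam] lam(1) by (auto simp: is_partition_def)
      have len: "length zs = length ?cs" using lam(2) by (simp add: canon_cycles_simps)
      note wp = wr_prod_marked[OF md len lam(3), folded g0_def]
      have hg0: "h \<otimes>\<^bsub>WR w\<^esub> g = g0 \<otimes>\<^bsub>WR w\<^esub> h" using hg by (simp add: g0_def)
      have \<xi>g: "\<xi> g0 = \<xi> g" by (rule \<xi>conj[OF True wp(1) h hg0])
      have "zeta_fun \<phi> ws \<chi>s g0 = zeta_fun \<phi> ws \<chi>s g" if "ws \<in> S" for ws \<chi>s
        unfolding zeta_fun_eq S(2)[OF that]
        by (rule induce_conj[OF wreath_group finite_wreath True wp(1) h hg0])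
      then have \<eta>g: "\<eta> g0 = \<eta> g" unfolding \<eta>_def by (intro sum.cong refl) simp
      let ?I = "\<lambda>c. \<forall>p\<in>{1..w}. c (snd g0 p) = c p"
      let ?\<Phi> = "\<lambda>c. orbit_prod w (snd g0) (\<lambda>p. \<phi> (c p) (cyc_val w g0 p)) * Psi w \<epsilon> \<xi> c (snd g0)"
      have "\<eta> g0 = (\<Sum>ws\<in>S. \<Sum>c | c \<in> {c \<in> colorings w n. ?I c} \<and> ctype w n c = ws. ?\<Phi> c)"
        unfolding \<eta>_def
      proof (rule sum.cong[OF refl])
        fix ws assume ws: "ws \<in> S"
        have "(\<Sum>t\<leftarrow>T ws. of_int (fst t) * zeta_fun \<phi> ws (snd t) g0) =
          (\<Sum>c | c \<in> colorings (sum_list ws) (length ws) \<and> ctype (sum_list ws) (length ws) c = ws \<and>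
              (\<forall>p\<in>{1..sum_list ws}. c (snd g0 p) = c p).
            orbit_prod (sum_list ws) (snd g0) (\<lambda>p. \<phi> (c p) (cyc_val (sum_list ws) g0 p)) * Psi (sum_list ws) \<epsilon> \<xi> c (snd g0))"
        proof (rule zeta_fun_sum_colorings[OF \<phi>cf])
          show "\<xi> k' = \<xi> k" if "k \<in> carrier (WR (sum_list ws))" "k' \<in> carrier (WR (sum_list ws))"
            "x \<in> carrier (WR (sum_list ws))" "x \<otimes>\<^bsub>WR (sum_list ws)\<^esub> k = k' \<otimes>\<^bsub>WR (sum_list ws)\<^esub> x" for k k' x
            using \<xi>conj that unfolding S(2)[OF ws] by blast
          show "Psi (sum_list ws) \<epsilon> \<xi> (block_of ws) (snd k) =
            (\<Sum>t\<leftarrow>T ws. of_int (fst t) * (\<Prod>i<length ws. (snd t ! i) (snd (young_comp L ws i k))))"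
            if "k \<in> young_wr L ws" for k using T[OF ws] that by blast
          show "g0 \<in> carrier (WR (sum_list ws))" unfolding S(2)[OF ws] by (rule wp(1))
        qed
        also have "\<dots> = (\<Sum>c | c \<in> {c \<in> colorings w n. ?I c} \<and> ctype w n c = ws. ?\<Phi> c)"
          unfolding S[OF ws] by (rule sum.cong) auto
        finally show "(\<Sum>t\<leftarrow>T ws. of_int (fst t) * zeta_fun \<phi> ws (snd t) g0) =
          (\<Sum>c | c \<in> {c \<in> colorings w n. ?I c} \<and> ctype w n c = ws. ?\<Phi> c)" .
      qed
      \<comment> \<open>Every colouring has exactly one type, so the sums over the types combine to
        a sum over all invariant colourings.\<close>
      also have "\<dots> = (\<Sum>c\<in>{c \<in> colorings w n. ?I c}. ?\<Phi> c)"
        by (rule sum.group) (use finS finite_colorings in \<open>auto simp: S_def\<close>)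
      also have "\<dots> = \<xi> g0"
      proof -
        have "in_tensor_pow L X (length lam) (omega L lam \<xi>)" using assms(5) lam(1) by simp
        then obtain F u where F0: "finite F \<and> (\<forall>\<phi>s\<in>F. length \<phi>s = length lam \<and> set \<phi>s \<subseteq> X) \<and>
          (\<forall>ys. length ys = length lam \<and> set ys \<subseteq> carrier L \<longrightarrow>
             omega L lam \<xi> ys = (\<Sum>\<phi>s\<in>F. of_int (u \<phi>s) * (\<Prod>j<length lam. (\<phi>s ! j) (ys ! j))))"
          unfolding in_tensor_pow_def by (elim exE) (rule that)
        have F: "length \<phi>s = length lam \<and> set \<phi>s \<subseteq> X" if "\<phi>s \<in> F" for \<phi>s
          by (rule F0[THEN conjunct2, THEN conjunct1, THEN bspec, OF that])
        have F': "omega L lam \<xi> ys = (\<Sum>\<phi>s\<in>F. of_int (u \<phi>s) * (\<Prod>j<length lam. (\<phi>s ! j) (ys ! j)))"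
          if "length ys = length lam" "set ys \<subseteq> carrier L" for ys
          using F0[THEN conjunct2, THEN conjunct2, THEN spec, of ys] that by simp
        show ?thesis
        proof (rule coloring_sum_canonical[OF md len lam(3) g0_def conv,
            where K = F and u = "\<lambda>\<phi>s. of_int (u \<phi>s)" and \<phi>' = "\<lambda>\<phi>s j. \<phi>s ! j"])
          \<comment> \<open>The hypothesis on \<open>omega\<close> covers canonical products only,
            whereas \<open>Psi\<close> involves \<xi> at every \<open>(x, \<sigma>)\<close>.
            Conjugation by a base element reduces \<open>(x, \<sigma>)\<close> to the canonical
            product of its cycle products.\<close>
          fix x assume x: "x \<in> base {1..w}"
          let ?k = "(x, snd g0)"
          have kc: "?k \<in> carrier (WR w)" using x snd_permutes[OF wp(1)] by (simp add: wreath_carrier)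
          have act: "acts ?cs (snd ?k)" using wp(3) by simp
          define ys where "ys = map (\<lambda>c. cyc_val w ?k (Min (set c))) ?cs"
          have ys: "length ys = length lam" "set ys \<subseteq> carrier L"
            using cyc_val_closed[OF kc] by (auto simp: ys_def canon_cycles_simps)
          obtain l where l: "l \<in> carrier (WR w)"
            "l \<otimes>\<^bsub>WR w\<^esub> ?k = wr_prod L w (map2 (ycyc L) ?cs ys) \<otimes>\<^bsub>WR w\<^esub> l"
            using conj_base_marked[OF md kc act] unfolding ys_def by blast
          have yc: "wr_prod L w (map2 (ycyc L) ?cs ys) \<in> carrier (WR w)"
            using ys by (intro wr_prod_marked_closed[OF md]) (simp_all add: canon_cycles_simps)
          have "\<xi> ?k = \<xi> (wr_prod L w (map2 (ycyc L) ?cs ys))" by (rule \<xi>conj[OF kc yc l, symmetric])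
          also have "\<dots> = omega L lam \<xi> ys" by (simp add: omega_def sl)
          also have "\<dots> = (\<Sum>\<phi>s\<in>F. of_int (u \<phi>s) * (\<Prod>j<length lam. (\<phi>s ! j) (ys ! j)))"
            by (rule F'[OF ys])
          also have "\<dots> = (\<Sum>\<phi>s\<in>F. of_int (u \<phi>s) * (\<Prod>j<length ?cs. (\<phi>s ! j) (cyc_val w ?k (Min (set (?cs ! j))))))"
            by (simp add: ys_def canon_cycles_simps(1))
          finally show "\<xi> ?k = (\<Sum>\<phi>s\<in>F. of_int (u \<phi>s) * (\<Prod>j<length ?cs. (\<phi>s ! j) (cyc_val w ?k (Min (set (?cs ! j))))))" .
        next
          fix \<phi>s j a assume "\<phi>s \<in> F" "j < length ?cs"
          then have "\<phi>s ! j \<in> X" using F[of \<phi>s] nth_mem[of j \<phi>s] by (auto simp: canon_cycles_simps)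
          then show "(\<phi>s ! j) a = (\<Sum>i<n. (\<Sum>b\<in>carrier L. \<epsilon> i b * (\<phi>s ! j) b) * \<phi> i a)" by (rule expand)
        qed
      qed
      finally show ?thesis using \<xi>g \<eta>g by simp
    qed
  qed
  ultimately show ?thesis by simp
qed

end
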